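(* Let $m,n\in\mathbb{N}$ with $m\ge 2$ and let $G$ be a finite abelian group with $G\cong C_m\oplus C_{mn}$. (1) Let $\{e_1,e_2\}$ be a basis of $G$ with $\operatorname{ord} e_2=mn$, and let $\{g_1,g_2\}$ be a generating set of $G$ with $\operatorname{ord} g_2=mn$. The following sequences over $G$ have length $\eta(G)-1$ and no short zero-sum subsequence: (1a) $e_1^{m-1}\, e_2^{sm-1}\,(-xe_1+e_2)^{(n+1-s)m-1}$, where $x$ is an integer with $\gcd\{x,m\}=1$ and $s\in[1,n]$; (1b) $g_1^{m-1}\, g_2^{mn-1}\,(-g_1+g_2)^{m-1}$. Moreover, if $C_m^2$ has Property C, then each sequence $S$ over $G$ with $|S|=\eta(G)-1$ and no short zero-sum subsequence is of the form (1a) for some basis $\{e_1,e_2\}$ of $G$ with $\operatorname{ord} e_2=mn$ and some $x,s$ as in (1a), or of the form (1b) for some generating set $\{g_1,g_2\}$ of $G$ with $\operatorname{ord} g_2=mn$. (2) Let $\{e_1,e_2\}$ be a basis of $G$ with $\operatorname{ord} e_2=mn$, and let $\{g_1,g_2\}$ be a generating set of $G$ with $\operatorname{ord} g_2=mn$. The following sequences over $G$ have length $\mathsf{s}(G)-1$ and no zero-sum subsequence of length $\exp(G)$: (2a) $g^{tm-1}\,(e_1+g)^{(n+1-t)m-1}\,(e_2+g)^{sm-1}\,(-xe_1+e_2+g)^{(n+1-s)m-1}$, where $x$ is an integer with $\gcd\{x,m\}=1$, $s,t\in[1,n]$, and $g\in G$; (2b) $g^{mn-1}\,(g_1+g)^{m-1}\,(g_2+g)^{mn-1}\,(-g_1+g_2+g)^{m-1}$,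 where $g\in G$. Moreover, if $C_m^2$ has Property D, then each sequence $S$ over $G$ with $|S|=\mathsf{s}(G)-1$ and no zero-sum subsequence of length $\exp(G)$ is of the form (2a) for some basis $\{e_1,e_2\}$ of $G$ with $\operatorname{ord} e_2=mn$ and some $x,s,t,g$ as in (2a), or of the form (2b) for some generating set $\{g_1,g_2\}$ of $G$ with $\operatorname{ord} g_2=mn$ and some $g\in G$.
   Context: $\mathbb{N}$ denotes the positive integers; for integers $a,b$, $[a,b]=\{z\in\mathbb{Z}: a\le z\le b\}$. $C_k$ is a cyclic group of order $k$, $C_m^2=C_m\oplus C_m$, and groups are written additively. $\exp(G)$ is the exponent of $G$. Elements $e_1,\dots,e_r\in G\setminus\{0\}$ are independent if $\sum_i m_ie_i=0$ with $m_i\in\mathbb{Z}$ implies $m_ie_i=0$ for each $i$. A subset of $G$ is a basis if it generates $G$ and its elements are independent. A sequence over $G$ is an element of the multiplicatively written free abelian monoid $\mathcal{F}(G)$ over $G$, i.e. a finite multiset $S=\prod_{g\in G}g^{v_g(S)}$ with multiplicities $v_g(S)\in\mathbb{N}_0$; here $g^k$ means $g$ repeated $k$ times, products denote multiset union, and $T^k$ is the $k$-fold product of the sequence $T$ with itself. The length is $|S|=\sum_g v_g(S)$ and the sum is $\sigma(S)=\sum_g v_g(S)g\in G$. A subsequence of $S$ is a divisor of $S$ in $\mathcal{F}(G)$ (a sub-multiset). A sequence is zero-sum if its sum is $0$. A sequence over $G$ is short if its length lies in $[1,\exp(G)]$. $\eta(G)$ is the smallest $\ell\in\mathbb{N}$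 such that each sequence over $G$ of length at least $\ell$ has a short zero-sum subsequence. $\mathsf{s}(G)$ is the smallest $\ell\in\mathbb{N}$ such that each sequence over $G$ of length at least $\ell$ has a zero-sum subsequence of length exactly $\exp(G)$. The group $H=C_m^2$ has Property C if each sequence over $H$ of length $\eta(H)-1$ with no short zero-sum subsequence equals $T^{\exp(H)-1}$ for some sequence $T$ over $H$. The group $H=C_m^2$ has Property D if each sequence over $H$ of length $\mathsf{s}(H)-1$ with no zero-sum subsequence of length $\exp(H)$ equals $T^{\exp(H)-1}$ for some sequence $T$ over $H$. *)

theory Defs
  imports
    "HOL-Algebra.Elementary_Groups"
    "HOL-Algebra.Multiplicative_Group"
    "HOL-Library.Multiset"
begin

text \<open>
  Groups are HOL-Algebra groups, hence written multiplicatively: the additive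
  \<open>g + h\<close>, \<open>k g\<close> and \<open>0\<close> become \<open>g \<otimes> h\<close>, \<open>g [^] k\<close> and \<open>\<one>\<close>.
  Sequences over \<open>G\<close> are multisets of elements of \<open>carrier G\<close>; the product of sequences
  is multiset union \<open>+\<close>, divisors are sub-multisets \<open>\<subseteq>#\<close>, the sequence \<open>g\<^sup>k\<close> is
  \<^term>\<open>replicate_mset k g\<close>, and the sequence \<open>T\<^sup>k\<close> is \<^term>\<open>repeat_mset k T\<close>.
\<close>

definition group_exp :: "('a, 'b) monoid_scheme \<Rightarrow> nat" where
  "group_exp G = (LEAST k. k > 0 \<and> (\<forall>x \<in> carrier G. x [^]\<^bsub>G\<^esub> k = \<one>\<^bsub>G\<^esub>))"

definition independent_in :: "('a, 'b) monoid_scheme \<Rightarrow> 'a set \<Rightarrow> bool" where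
  "independent_in G A \<longleftrightarrow>
     finite A \<and> A \<subseteq> carrier G - {\<one>\<^bsub>G\<^esub>} \<and>
     (\<forall>k :: 'a \<Rightarrow> int.
        finprod G (\<lambda>e. e [^]\<^bsub>G\<^esub> k e) A = \<one>\<^bsub>G\<^esub> \<longrightarrow> (\<forall>e \<in> A. e [^]\<^bsub>G\<^esub> k e = \<one>\<^bsub>G\<^esub>))"

definition generating_set :: "('a, 'b) monoid_scheme \<Rightarrow> 'a set \<Rightarrow> bool" where
  "generating_set G A \<longleftrightarrow> A \<subseteq> carrier G \<and> generate G A = carrier G"

definition basis_of :: "('a, 'b) monoid_scheme \<Rightarrow> 'a set \<Rightarrow> bool" where
  "basis_of G A \<longleftrightarrow> generating_set G A \<and> independent_in G A"

definition seq_over :: "('a, 'b) monoid_scheme \<Rightarrow> 'a multiset \<Rightarrow> bool" where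
  "seq_over G S \<longleftrightarrow> set_mset S \<subseteq> carrier G"

definition seq_sum :: "('a, 'b) monoid_scheme \<Rightarrow> 'a multiset \<Rightarrow> 'a" where
  "seq_sum G S = finprod G (\<lambda>g. g [^]\<^bsub>G\<^esub> count S g) (set_mset S)"

definition zero_sum :: "('a, 'b) monoid_scheme \<Rightarrow> 'a multiset \<Rightarrow> bool" where
  "zero_sum G S \<longleftrightarrow> seq_sum G S = \<one>\<^bsub>G\<^esub>"

definition has_short_zero_sum :: "('a, 'b) monoid_scheme \<Rightarrow> 'a multiset \<Rightarrow> bool" where
  "has_short_zero_sum G S \<longleftrightarrow> (\<exists>T. T \<subseteq># S \<and> size T \<in> {1..group_exp G} \<and> zero_sum G T)"

definition has_exp_zero_sum :: "('a, 'b) monoid_scheme \<Rightarrow> 'a multiset \<Rightarrow> bool" where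
  "has_exp_zero_sum G S \<longleftrightarrow> (\<exists>T. T \<subseteq># S \<and> size T = group_exp G \<and> zero_sum G T)"

definition eta_const :: "('a, 'b) monoid_scheme \<Rightarrow> nat" where
  "eta_const G =
     (LEAST l. l \<ge> 1 \<and> (\<forall>S. seq_over G S \<and> size S \<ge> l \<longrightarrow> has_short_zero_sum G S))"

definition s_const :: "('a, 'b) monoid_scheme \<Rightarrow> nat" where
  "s_const G =
     (LEAST l. l \<ge> 1 \<and> (\<forall>S. seq_over G S \<and> size S \<ge> l \<longrightarrow> has_exp_zero_sum G S))"

definition property_C :: "('a, 'b) monoid_scheme \<Rightarrow> bool" where
  "property_C H \<longleftrightarrow>
     (\<forall>S. seq_over H S \<and> size S = eta_const H - 1 \<and> \<not> has_short_zero_sum H S \<longrightarrow>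
        (\<exists>T. seq_over H T \<and> S = repeat_mset (group_exp H - 1) T))"

definition property_D :: "('a, 'b) monoid_scheme \<Rightarrow> bool" where
  "property_D H \<longleftrightarrow>
     (\<forall>S. seq_over H S \<and> size S = s_const H - 1 \<and> \<not> has_exp_zero_sum H S \<longrightarrow>
        (\<exists>T. seq_over H T \<and> S = repeat_mset (group_exp H - 1) T))"

definition seq_1a ::
  "('a, 'b) monoid_scheme \<Rightarrow> nat \<Rightarrow> nat \<Rightarrow> 'a \<Rightarrow> 'a \<Rightarrow> int \<Rightarrow> nat \<Rightarrow> 'a multiset" where
  "seq_1a G m n e1 e2 x s =
     replicate_mset (m - 1) e1 + replicate_mset (s * m - 1) e2 +
     replicate_mset ((n + 1 - s) * m - 1) (e1 [^]\<^bsub>G\<^esub> (- x) \<otimes>\<^bsub>G\<^esub> e2)"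

definition seq_1b ::
  "('a, 'b) monoid_scheme \<Rightarrow> nat \<Rightarrow> nat \<Rightarrow> 'a \<Rightarrow> 'a \<Rightarrow> 'a multiset" where
  "seq_1b G m n g1 g2 =
     replicate_mset (m - 1) g1 + replicate_mset (m * n - 1) g2 +
     replicate_mset (m - 1) (inv\<^bsub>G\<^esub> g1 \<otimes>\<^bsub>G\<^esub> g2)"

definition seq_2a ::
  "('a, 'b) monoid_scheme \<Rightarrow> nat \<Rightarrow> nat \<Rightarrow> 'a \<Rightarrow> 'a \<Rightarrow> int \<Rightarrow> nat \<Rightarrow> nat \<Rightarrow> 'a \<Rightarrow> 'a multiset" where
  "seq_2a G m n e1 e2 x s t g =
     replicate_mset (t * m - 1) g +
     replicate_mset ((n + 1 - t) * m - 1) (e1 \<otimes>\<^bsub>G\<^esub> g) +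
     replicate_mset (s * m - 1) (e2 \<otimes>\<^bsub>G\<^esub> g) +
     replicate_mset ((n + 1 - s) * m - 1) (e1 [^]\<^bsub>G\<^esub> (- x) \<otimes>\<^bsub>G\<^esub> e2 \<otimes>\<^bsub>G\<^esub> g)"

definition seq_2b ::
  "('a, 'b) monoid_scheme \<Rightarrow> nat \<Rightarrow> nat \<Rightarrow> 'a \<Rightarrow> 'a \<Rightarrow> 'a \<Rightarrow> 'a multiset" where
  "seq_2b G m n g1 g2 g =
     replicate_mset (m * n - 1) g +
     replicate_mset (m - 1) (g1 \<otimes>\<^bsub>G\<^esub> g) +
     replicate_mset (m * n - 1) (g2 \<otimes>\<^bsub>G\<^esub> g) +
     replicate_mset (m - 1) (inv\<^bsub>G\<^esub> g1 \<otimes>\<^bsub>G\<^esub> g2 \<otimes>\<^bsub>G\<^esub> g)"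

end

theory Submission
  imports Defs "HOL-Number_Theory.Residues" "HOL-Library.Product_Plus"
begin

text \<open>The obstacle is a fibre of length only m - 1: it carries no block, so exchanging
  elements inside a packing says nothing about it. It is reached by the mixed blocks, which may have
  length up to 2 m - 1. Their sum is still forced, because any other sum could be completed by few
  enough ordinary blocks.

  The two shapes of part (1) come from one dichotomy. Suppose the relation x f1 - f2 + f3 is known
  modulo N and f2 carries blocks. If x \<ge> 2, some multiple k x passes m exactly once; comparing
  that mixed block with k copies of the relation leaves m f1 in N, so f1 has order m and the pair
  f1, f2 is a basis, as in (1a). If x = 1, no multiple k x with k < m wraps and the order of f1
  stays open. Either a second long fibre supplies a vector of order m, or the only long fibre has
  length m n - 1, and then a mere generating pair remains: this is (1b).

  Representatives in Z^2 are used throughout because one type then serves G, C_m^2 and every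
  quotient in the induction over primes, and because a coordinate divided by m is an honest integer
  standing for an element of C_n.\<close>

text \<open>
  Write \<open>G\<close> as \<open>\<int>\<^sup>2 / N\<close> with \<open>N = m \<int> \<oplus> m n \<int>\<close> and put \<open>M = m \<int>\<^sup>2\<close>, so that
  \<open>\<int>\<^sup>2 / M\<close> is \<open>C\<^sub>m\<^sup>2\<close> and \<open>M / N\<close> is cyclic of order \<open>n\<close>. A block is a subsequence that is zero-sum
  modulo \<open>M\<close> of length at most \<open>m\<close> (for \<open>\<eta>\<close>), respectively of length \<open>m\<close> (for \<open>s\<close>). Packing
  disjoint blocks and applying the Erdos-Ginzburg-Ziv theorem or the Davenport constant of \<open>C\<^sub>n\<close> to their
  sums yields \<open>\<eta>\<close> and \<open>s\<close>, starting from the case of a prime (Reiher's theorem), which is proved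
  by a difference calculus modulo \<open>p\<close>.

  An extremal sequence has no packing with one more block; Property C (or D) then forces it to consist of
  three (or four) fibres over \<open>M\<close>, of lengths \<open>s\<^sub>j m - 1\<close>. The sequence of block sums in \<open>M / N\<close> is
  extremal for \<open>C\<^sub>n\<close>, so it is known by the inverse theorems for cyclic groups: all block sums are equal
  (take at most two values), and exchanging elements shows that a fibre carrying two blocks is constant modulo \<open>N\<close>.

  Modulo \<open>M\<close> the three fibres \<open>f\<^sub>1, f\<^sub>2, f\<^sub>3\<close> satisfy \<open>x f\<^sub>1 - f\<^sub>2 + f\<^sub>3 = 0\<close> for some \<open>x\<close> coprime to \<open>m\<close>,
  which rests on an inequality for sums of fractional parts. The blocks
  \<open>f\<^sub>1^(k x mod m) f\<^sub>2^(m - k) f\<^sub>3^k\<close> must all have the common block sum, and comparing them for different \<open>k\<close>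
  leaves only the listed forms. Part (2) reduces to part (1) by translation when some fibre has
  length \<open>m n - 1\<close>, and otherwise is settled by the same comparison of blocks.
\<close>

section \<open>Packings of disjoint blocks\<close>

lemma obtain_submset_of_size:
  assumes "k \<le> size X"
  obtains Y where "Y \<subseteq># X" "size Y = k"
proof -
  obtain xs where xs: "mset xs = X" by (metis ex_mset)
  have "mset (take k xs) \<subseteq># X"
    by (metis append_take_drop_id mset_append mset_subset_eq_add_left xs)
  moreover have "size (mset (take k xs)) = k"
    using assms xs by (metis length_take min.absorb2 size_mset)
  ultimately show thesis using that by blast
qed

lemma submset_image_msetE:
  assumes "U \<subseteq># image_mset f X"
  obtains Y where "Y \<subseteq># X" "image_mset f Y = U"
proof -
  obtain W where W: "image_mset f X = U + W" using assms by (metis subset_mset.add_diff_inverse)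
  then obtain Y Z where "X = Y + Z" "image_mset f Y = U"
    by (metis image_mset_eq_plusD)
  then have "Y \<subseteq># X" by simp
  then show thesis using \<open>image_mset f Y = U\<close> by (rule that)
qed

text \<open>Disjointness is expressed by requiring the multiset union of the chosen blocks to lie
  inside \<open>S\<close>. The family is itself a multiset because equal blocks may be used
  repeatedly.\<close>

definition packing :: "('v multiset \<Rightarrow> bool) \<Rightarrow> nat \<Rightarrow> 'v multiset \<Rightarrow> bool" where
  "packing P k S \<longleftrightarrow> (\<exists>F. size F = k \<and> (\<forall>B\<in>#F. P B) \<and> \<Sum>\<^sub># F \<subseteq># S)"

lemma packing_0 [simp]: "packing P 0 S"
  unfolding packing_def by (rule exI[of _ "{#}"]) auto

lemma packing_SucI:
  assumes "B \<subseteq># S" "P B" "packing P k (S - B)"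
  shows "packing P (Suc k) S"
proof -
  obtain F where F: "size F = k" "\<forall>B\<in>#F. P B" "\<Sum>\<^sub># F \<subseteq># S - B"
    using assms(3) unfolding packing_def by blast
  have "B + \<Sum>\<^sub># F \<subseteq># S"

    using mset_subset_eq_mono_add[OF subset_mset.order_refl[of B] F(3)] assms(1) by simp
  then show ?thesis unfolding packing_def
    using F assms(2) by (intro exI[of _ "add_mset B F"]) auto
qed

lemma packing_mono:
  assumes "packing P k S" "S \<subseteq># S'"
  shows "packing P k S'"
proof -
  obtain F where "size F = k" "\<forall>B\<in>#F. P B" "\<Sum>\<^sub># F \<subseteq># S"
    using assms(1) unfolding packing_def by blast
  with assms(2) show ?thesis unfolding packing_def
    by (intro exI[of _ F] conjI) (assumption | rule subset_mset.order_trans)+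
qed

text \<open>Greedy removal: before each choice at least \<open>l\<close> elements remain, since
  every earlier block cost at most \<open>e\<close>. The bound is size l + e (k - 1), with
  \<open>e\<close> moved to the left to avoid truncated subtraction at \<open>k = 0\<close>.\<close>

lemma packing_exists:
  assumes ex: "\<And>X. size X \<ge> l \<Longrightarrow> \<exists>B. B \<subseteq># X \<and> P B"
    and le: "\<And>B. P B \<Longrightarrow> size B \<le> e"
    and sz: "size X + e \<ge> l + e * k"
  shows "packing P k X"
  using sz
proof (induction k arbitrary: X)
  case (Suc k)
  then have "size X \<ge> l" by auto
  then obtain B where B: "B \<subseteq># X" "P B" using ex by blast
  have "size (X - B) + e \<ge> l + e * k"
    using Suc.prems le[OF B(2)] B(1) size_Diff_submset[of B X] size_mset_mono[of B X] by simp
  from Suc.IH[OF this] B show ?case by (intro packing_SucI)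
qed simp

section \<open>Lifting zero-sums of block sums through an intermediate subgroup\<close>

lemma size_sum_mset_const:
  fixes F :: "'v multiset multiset"
  assumes "\<forall>B\<in>#F. size B = e"
  shows "size (\<Sum>\<^sub># F) = e * size F"
  using assms by (induction F) (auto simp: algebra_simps)

lemma size_sum_mset_le:
  fixes F :: "'v multiset multiset"
  assumes "\<forall>B\<in>#F. size B \<le> e"
  shows "size (\<Sum>\<^sub># F) \<le> e * size F"
  using assms by (induction F) (auto simp: algebra_simps)

lemma sum_mset_sum_mset:
  fixes F :: "'v::comm_monoid_add multiset multiset"
  shows "\<Sum>\<^sub># (\<Sum>\<^sub># F) = \<Sum>\<^sub># (image_mset sum_mset F)"
  by (induction F) auto

lemma sum_mset_mono_submset: "F \<subseteq># F' \<Longrightarrow> \<Sum>\<^sub># F \<subseteq># \<Sum>\<^sub># (F' :: 'a multiset multiset)"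
  by (auto simp: subset_mset.le_iff_add)

text \<open>Additivity is relative to a set because the maps in use, division of a coordinate by
  \<open>m\<close>, are additive only on multiples of \<open>m\<close>.\<close>

definition add_on :: "'v::comm_monoid_add set \<Rightarrow> ('v \<Rightarrow> 'w::comm_monoid_add) \<Rightarrow> bool" where
  "add_on M b \<longleftrightarrow> 0 \<in> M \<and> b 0 = 0 \<and> (\<forall>x\<in>M. \<forall>y\<in>M. x + y \<in> M \<and> b (x + y) = b x + b y)"

lemma add_on_sum_mset:
  assumes "add_on M b" "set_mset X \<subseteq> M"
  shows "\<Sum>\<^sub># X \<in> M \<and> b (\<Sum>\<^sub># X) = \<Sum>\<^sub># (image_mset b X)"
  using assms by (induction X) (auto simp: add_on_def)

text \<open>The blocks of a packing, mapped to the quotient of the intermediate subgroup, form a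
  sequence over that quotient; a zero-sum subsequence of it lifts back.\<close>

lemma packing_lift:
  fixes b :: "'v::comm_monoid_add \<Rightarrow> 'w::comm_monoid_add"
  assumes b: "add_on M b" and N: "\<And>x. x \<in> M \<Longrightarrow> b x \<in> N' \<Longrightarrow> x \<in> N"
    and F: "\<forall>B\<in>#F. \<Sum>\<^sub># B \<in> M" "\<Sum>\<^sub># F \<subseteq># S"
    and U: "U \<subseteq># image_mset (\<lambda>B. b (\<Sum>\<^sub># B)) F" "\<Sum>\<^sub># U \<in> N'"
  obtains F' where "F' \<subseteq># F" "size F' = size U" "\<Sum>\<^sub># F' \<subseteq># S" "\<Sum>\<^sub># (\<Sum>\<^sub># F') \<in> N"
proof -
  obtain F' where F': "F' \<subseteq># F" "image_mset (\<lambda>B. b (\<Sum>\<^sub># B)) F' = U"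
    using U(1) by (rule submset_image_msetE)
  have sub: "set_mset (image_mset sum_mset F') \<subseteq> M"
    using F(1) F'(1) mset_subset_eqD by fastforce
  have "b (\<Sum>\<^sub># (\<Sum>\<^sub># F')) = \<Sum>\<^sub># U" "\<Sum>\<^sub># (\<Sum>\<^sub># F') \<in> M"
    unfolding sum_mset_sum_mset using add_on_sum_mset[OF b sub] F'(2)
    by (auto simp: multiset.map_comp comp_def)
  then have "\<Sum>\<^sub># (\<Sum>\<^sub># F') \<in> N" using N U(2) by simp
  moreover have "size F' = size U" using F'(2) by auto
  moreover have "\<Sum>\<^sub># F' \<subseteq># S"
    using sum_mset_mono_submset[OF F'(1)] F(2) by (rule subset_mset.order_trans)
  ultimately show thesis using that F'(1) by blast
qed

text \<open>Being zero is membership in \<open>N\<close>: these are sequences over the quotient by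
  \<open>N\<close>, written with representatives.\<close>

definition zs_len :: "'v::comm_monoid_add set \<Rightarrow> nat \<Rightarrow> 'v multiset \<Rightarrow> bool" where
  "zs_len N e T \<longleftrightarrow> size T = e \<and> \<Sum>\<^sub># T \<in> N"

definition zs_short :: "'v::comm_monoid_add set \<Rightarrow> nat \<Rightarrow> 'v multiset \<Rightarrow> bool" where
  "zs_short N e T \<longleftrightarrow> size T \<in> {1..e} \<and> \<Sum>\<^sub># T \<in> N"

definition forces :: "('v multiset \<Rightarrow> bool) \<Rightarrow> nat \<Rightarrow> bool" where
  "forces P l \<longleftrightarrow> (\<forall>S. size S \<ge> l \<longrightarrow> (\<exists>T. T \<subseteq># S \<and> P T))"

lemma forcesD: "forces P l \<Longrightarrow> size S \<ge> l \<Longrightarrow> \<exists>T. T \<subseteq># S \<and> P T"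
  by (auto simp: forces_def)

lemma lift_zs_len:
  fixes b :: "'v::comm_monoid_add \<Rightarrow> 'w::comm_monoid_add"
  assumes b: "add_on M b" and N: "\<And>x. x \<in> M \<Longrightarrow> b x \<in> N' \<Longrightarrow> x \<in> N"
    and F: "\<forall>B\<in>#F. zs_len M e B" "\<Sum>\<^sub># F \<subseteq># S"
    and U: "U \<subseteq># image_mset (\<lambda>B. b (\<Sum>\<^sub># B)) F" "zs_len N' e' U"
  shows "\<exists>T. T \<subseteq># S \<and> zs_len N (e * e') T"
proof -
  obtain F' where F': "F' \<subseteq># F" "size F' = size U" "\<Sum>\<^sub># F' \<subseteq># S" "\<Sum>\<^sub># (\<Sum>\<^sub># F') \<in> N"
    by (rule packing_lift[OF b N _ F(2) U(1)]) (use F(1) U(2) in \<open>auto simp: zs_len_def\<close>)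
  have "size (\<Sum>\<^sub># F') = e * e'"
    using size_sum_mset_const[of F' e] F(1) F' U(2) by (auto simp: zs_len_def dest: mset_subset_eqD)
  then show ?thesis using F' by (auto simp: zs_len_def)
qed

lemma lift_zs_short:
  fixes b :: "'v::comm_monoid_add \<Rightarrow> 'w::comm_monoid_add"
  assumes b: "add_on M b" and N: "\<And>x. x \<in> M \<Longrightarrow> b x \<in> N' \<Longrightarrow> x \<in> N"
    and F: "\<forall>B\<in>#F. zs_short M e B" "\<Sum>\<^sub># F \<subseteq># S"
    and U: "U \<subseteq># image_mset (\<lambda>B. b (\<Sum>\<^sub># B)) F" "zs_short N' e' U"
  shows "\<exists>T. T \<subseteq># S \<and> zs_short N (e * e') T"
proof -
  obtain F' where F': "F' \<subseteq># F" "size F' = size U" "\<Sum>\<^sub># F' \<subseteq># S" "\<Sum>\<^sub># (\<Sum>\<^sub># F') \<in> N"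
    by (rule packing_lift[OF b N _ F(2) U(1)]) (use F(1) U(2) in \<open>auto simp: zs_short_def\<close>)
  have blk: "\<forall>B\<in>#F'. size B \<in> {1..e}"
    using F(1) F'(1) by (auto simp: zs_short_def dest: mset_subset_eqD)
  have "size (\<Sum>\<^sub># F') \<le> e * size F'" using size_sum_mset_le[of F' e] blk by auto
  also have "\<dots> \<le> e * e'" using F'(2) U(2) by (auto simp: zs_short_def)
  finally have "size (\<Sum>\<^sub># F') \<le> e * e'" .
  moreover have "size (\<Sum>\<^sub># F') \<ge> 1"
  proof -
    have "F' \<noteq> {#}" using F'(2) U(2) by (auto simp: zs_short_def)
    then obtain B where B: "B \<in># F'" by (rule multiset_nonemptyE)
    then have "B \<subseteq># \<Sum>\<^sub># F'"
      using sum_mset_mono_submset[of "{#B#}" F'] by simp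
    then show ?thesis
      using blk B size_mset_mono[of B "\<Sum>\<^sub># F'"] by (auto intro: le_trans)
  qed
  ultimately show ?thesis using F' by (auto simp: zs_short_def)
qed

text \<open>The multiplicative step of the upper bounds: pack \<open>l'\<close> blocks, then choose
  \<open>e'\<close> of them whose sums add up to zero in the next quotient. For
  \<open>l = 2 * e - 1\<close> and \<open>l' = 2 * e' - 1\<close> it returns exactly 2 e e' - 1, so
  sharp prime bounds stay sharp for products.\<close>

lemma forces_zs_len_mult:
  fixes b :: "'v::comm_monoid_add \<Rightarrow> 'w::comm_monoid_add"
  assumes b: "add_on M b" and N: "\<And>x. x \<in> M \<Longrightarrow> b x \<in> N' \<Longrightarrow> x \<in> N"
    and 1: "forces (zs_len M e) l" and 2: "forces (zs_len N' e') l'" and l: "L + e \<ge> l + e * l'"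
  shows "forces (zs_len N (e * e')) L"
  unfolding forces_def
proof (intro allI impI)
  fix S :: "'v multiset" assume S: "size S \<ge> L"
  have "packing (zs_len M e) l' S"
    by (rule packing_exists[where l=l and e=e]) (use forcesD[OF 1] S l in \<open>auto simp: zs_len_def\<close>)
  then obtain F where F: "size F = l'" "\<forall>B\<in>#F. zs_len M e B" "\<Sum>\<^sub># F \<subseteq># S"
    unfolding packing_def by blast
  obtain U where U: "U \<subseteq># image_mset (\<lambda>B. b (\<Sum>\<^sub># B)) F" "zs_len N' e' U"
    using forcesD[OF 2, of "image_mset (\<lambda>B. b (\<Sum>\<^sub># B)) F"] F(1) by auto
  show "\<exists>T. T \<subseteq># S \<and> zs_len N (e * e') T" by (rule lift_zs_len[OF b N F(2,3) U])
qed

lemma forces_zs_short_mult: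
  fixes b :: "'v::comm_monoid_add \<Rightarrow> 'w::comm_monoid_add"
  assumes b: "add_on M b" and N: "\<And>x. x \<in> M \<Longrightarrow> b x \<in> N' \<Longrightarrow> x \<in> N"
    and 1: "forces (zs_short M e) l" and 2: "forces (zs_short N' e') l'" and l: "L + e \<ge> l + e * l'"
  shows "forces (zs_short N (e * e')) L"
  unfolding forces_def
proof (intro allI impI)
  fix S :: "'v multiset" assume S: "size S \<ge> L"
  have "packing (zs_short M e) l' S"
    by (rule packing_exists[where l=l and e=e]) (use forcesD[OF 1] S l in \<open>auto simp: zs_short_def\<close>)
  then obtain F where F: "size F = l'" "\<forall>B\<in>#F. zs_short M e B" "\<Sum>\<^sub># F \<subseteq># S"
    unfolding packing_def by blast
  obtain U where U: "U \<subseteq># image_mset (\<lambda>B. b (\<Sum>\<^sub># B)) F" "zs_short N' e' U"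
    using forcesD[OF 2, of "image_mset (\<lambda>B. b (\<Sum>\<^sub># B)) F"] F(1) by auto
  show "\<exists>T. T \<subseteq># S \<and> zs_short N (e * e') T" by (rule lift_zs_short[OF b N F(2,3) U])
qed

lemma packing_add:
  assumes "packing P a X" "packing P b Y"
  shows "packing P (a + b) (X + Y)"
proof -
  obtain F where F: "size F = a" "\<forall>B\<in>#F. P B" "\<Sum>\<^sub># F \<subseteq># X"
    using assms(1) unfolding packing_def by blast
  obtain F' where F': "size F' = b" "\<forall>B\<in>#F'. P B" "\<Sum>\<^sub># F' \<subseteq># Y"
    using assms(2) unfolding packing_def by blast
  show ?thesis unfolding packing_def
    using F F' mset_subset_eq_mono_add[OF F(3) F'(3)] by (intro exI[of _ "F + F'"]) auto
qed

lemma packing_1I: "B \<subseteq># X \<Longrightarrow> P B \<Longrightarrow> packing P (Suc 0) X"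
  by (rule packing_SucI[of B]) auto

section \<open>Classes of a sequence with a maximal packing\<close>

lemma count_image_filter: "count (image_mset h X) f = size (filter_mset (\<lambda>x. h x = f) X)"
  by (induction X) auto

lemma image_mset_const_on: "(\<And>x. x \<in># X \<Longrightarrow> h x = f) \<Longrightarrow> image_mset h X = replicate_mset (size X) f"
  by (induction X) auto

lemma submset_add_mset_cases:
  assumes "B \<subseteq># add_mset g R"
  obtains "B \<subseteq># R" | C where "C \<subseteq># R" "B = add_mset g C"
proof (cases "g \<in># B")
  case True
  then obtain C where C: "B = add_mset g C" by (metis insert_DiffM)
  with assms have "C \<subseteq># R" by auto
  then show thesis using that(2) C by blast
next
  case False
  then have "B \<subseteq># R" using assms
    by (metis add_mset_remove_trivial diff_single_trivial subset_eq_diff_conv add_mset_add_single)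
  then show thesis by (rule that(1))
qed

text \<open>\<open>P\<close> is a notion of block (a zero-sum sequence of length \<open>m\<close>, or of length at
  most \<open>m\<close>, modulo a subgroup with coset map \<open>h\<close>); \<open>r * (m - 1)\<close> is the maximal length of a
  sequence without a block, and \<open>inverse\<close> is the property C or D.\<close>

locale block_system =
  fixes P :: "'v multiset \<Rightarrow> bool" and h :: "'v \<Rightarrow> 'c" and r m :: nat
  assumes m: "m \<ge> 2"
    and size_le: "\<And>B. P B \<Longrightarrow> size B \<le> m"
    and const: "\<And>X f. size X = m \<Longrightarrow> \<forall>x\<in>#X. h x = f \<Longrightarrow> P X"
    and cancel: "\<And>g B f. P (add_mset g B) \<Longrightarrow> size B = m - 1 \<Longrightarrow> \<forall>x\<in>#B. h x = f \<Longrightarrow> h g = f"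
    and ex: "forces P (r * (m - 1) + 1)"
    and inverse: "\<And>X. size X = r * (m - 1) \<Longrightarrow> \<nexists>B. B \<subseteq># X \<and> P B \<Longrightarrow>
      \<exists>T. image_mset h X = repeat_mset (m - 1) T"
begin

lemma fibre_block:
  assumes "count (image_mset h X) f \<ge> m"
  obtains B where "B \<subseteq># X" "P B" "image_mset h B = replicate_mset m f"
proof -
  obtain B where B: "B \<subseteq># filter_mset (\<lambda>x. h x = f) X" "size B = m"
    using assms obtain_submset_of_size unfolding count_image_filter by blast
  have f: "\<forall>x\<in>#B. h x = f" using B(1) by (auto dest: mset_subset_eqD)
  have "B \<subseteq># X" using B(1) multiset_filter_subset subset_mset.order_trans by blast
  moreover have "P B" using B(2) f by (rule const)
  moreover have "image_mset h B = replicate_mset m f"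
    using image_mset_const_on[of B h f] f B(2) by simp
  ultimately show thesis by (rule that)
qed

lemma two_fibres:
  assumes "count (image_mset h X) f \<ge> m" "count (image_mset h X) f' \<ge> m" "f \<noteq> f'"
  shows "packing P 2 X"
proof -
  obtain B where B: "B \<subseteq># X" "P B" "image_mset h B = replicate_mset m f"
    using assms(1) by (rule fibre_block)
  have "image_mset h (X - B) = image_mset h X - replicate_mset m f"
    using B by (simp add: image_mset_Diff)
  then have "count (image_mset h (X - B)) f' \<ge> m" using assms by simp
  then obtain B' where "B' \<subseteq># X - B" "P B'" by (rule fibre_block)
  then show ?thesis using B by (auto simp: numeral_2_eq_2 intro!: packing_SucI[of B] packing_1I)
qed

text \<open>A class occurring twice in \<open>T\<close> would occur 2 (m - 1) \<ge> m times in
  \<open>R\<close> and contain a constant block. Hence \<open>T\<close> is a set, and comparing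
  sizes gives it \<open>r\<close> elements.\<close>

lemma blockfree_structure:
  assumes "size R = r * (m - 1)" "\<nexists>B. B \<subseteq># R \<and> P B"
  obtains F where "finite F" "card F = r" "image_mset h R = repeat_mset (m - 1) (mset_set F)"
proof -
  obtain T where T: "image_mset h R = repeat_mset (m - 1) T" using inverse assms by blast
  have "count T f \<le> 1" for f
  proof (rule ccontr)
    assume "\<not> count T f \<le> 1"
    then have "(m - 1) * count T f \<ge> (m - 1) * 2" by (intro mult_le_mono2) auto
    then have "(m - 1) * count T f \<ge> m" using m by linarith
    then have "count (image_mset h R) f \<ge> m" using T by simp
    then show False using assms(2) by (metis fibre_block)
  qed
  then have "count T f = count (mset_set (set_mset T)) f" for f
    by (metis One_nat_def count_eq_zero_iff count_mset_set(1) count_mset_set(3) finite_set_mset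
        le_Suc_eq le_zero_eq)
  then have T': "T = mset_set (set_mset T)" by (simp add: multiset_eq_iff)
  have "size R = size T * (m - 1)" using arg_cong[OF T, of size] by (simp add: mult.commute)
  then have "r * (m - 1) = size T * (m - 1)" by (rule trans[OF sym[OF assms(1)]])
  moreover have "m - 1 \<noteq> 0" using m by simp
  ultimately have "size T = r" by (metis mult_right_cancel)
  then have "card (set_mset T) = r" by (metis T' size_mset_set)
  then show thesis using that[of "set_mset T"] T T' by auto
qed

text \<open>If an element \<open>g\<close> of \<open>B\<close> had its class outside \<open>F\<close>, exchanging \<open>B\<close> for a block through
  \<open>g\<close> inside \<open>R + {g}\<close> would show that \<open>B\<close> meets two classes of \<open>F\<close>; together with \<open>R\<close> these
  two classes carry two disjoint blocks.\<close>

lemma block_class: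
  assumes np: "\<not> packing P 2 (R + B)" and B: "P B" "size B = m"
    and F: "finite F" "card F = r" "image_mset h R = repeat_mset (m - 1) (mset_set F)"
  obtains f where "f \<in> F" "image_mset h B = replicate_mset m f"
proof -
  have sR: "size R = r * (m - 1)" using arg_cong[OF F(3), of size] F(1,2)
    by (simp add: size_repeat_mset)
  have nb: "\<nexists>C. C \<subseteq># Y \<and> P C" if "Y + D \<subseteq># R + B" "P D" for Y D
  proof
    assume "\<exists>C. C \<subseteq># Y \<and> P C"
    then obtain C where C: "C \<subseteq># Y" "P C" by blast
    have "packing P 2 (Y + D)"
      using packing_add[OF packing_1I[where P=P, OF C] packing_1I[of D D P]] that by (simp add: numeral_2_eq_2)
    then show False using np packing_mono that(1) by blast
  qed
  have cR: "count (image_mset h R) f = (if f \<in> F then m - 1 else 0)" for f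
    using F by simp
  have hR: "h x \<in> F" if "x \<in># R" for x
  proof -
    have "h x \<in># image_mset h R" using that by simp
    then have "count (image_mset h R) (h x) \<noteq> 0" by (simp only: count_eq_zero_iff) simp
    then show ?thesis using cR by metis
  qed
  have inF: "h g \<in> F" if g: "g \<in># B" for g
  proof (rule ccontr)
    assume nF: "h g \<notin> F"
    obtain D where D: "B = add_mset g D" using g by (metis insert_DiffM)
    have sD: "size D = m - 1" using D B(2) by simp
    obtain B' where B': "B' \<subseteq># add_mset g R" "P B'" using forcesD[OF ex, of "add_mset g R"] sR by auto
    have "\<not> B' \<subseteq># R" using nb[of R B] B B'(2) by auto
    then obtain C where C: "C \<subseteq># R" "B' = add_mset g C"
      using submset_add_mset_cases[OF B'(1)] by blast
    obtain R' where R': "R = C + R'" using C(1) by (metis subset_mset.add_diff_inverse)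
    define Y where "Y = R' + D"
    have XY: "Y + B' = R + B" unfolding Y_def C(2) D R' by simp
    have nbY: "\<nexists>C. C \<subseteq># Y \<and> P C" using nb[of Y B'] XY B'(2) by auto
    \<comment> \<open>\<open>Y\<close> is free of blocks and \<open>B'\<close> is a block, so their
      sizes are at most r (m - 1) and m; the total forces equality in both.\<close>
    have "size Y + size B' = r * (m - 1) + m" using arg_cong[OF XY, of size] sR B(2) by simp
    moreover have "size Y < r * (m - 1) + 1" using forcesD[OF ex, of Y] nbY by (meson not_le)
    ultimately have sY: "size Y = r * (m - 1)" and sB': "size B' = m" using size_le[OF B'(2)] by auto
    have sC: "size C = m - 1" using sB' C(2) by simp
    have notall: "\<not> (\<forall>x\<in>#C. h x = f)" if "f \<in> F" for f
      using cancel[of g C f] B'(2) C(2) sC that nF by auto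
    obtain F' where F': "finite F'" "card F' = r" "image_mset h Y = repeat_mset (m - 1) (mset_set F')"
      using sY nbY by (rule blockfree_structure)
    have hY: "image_mset h Y = image_mset h R - image_mset h C + image_mset h D"
      unfolding Y_def R' by simp
    \<comment> \<open>The m - 1 elements of \<open>C\<close> do not all lie in one class of
      \<open>F\<close>, so they exhaust no class, and every class of \<open>F\<close> survives in
      \<open>Y\<close>. Equal cardinalities then give F' = F.\<close>
    have "F \<subseteq> F'"
    proof
      fix f assume f: "f \<in> F"
      have "count (image_mset h C) f \<noteq> m - 1"
      proof
        assume "count (image_mset h C) f = m - 1"
        then have "filter_mset (\<lambda>x. h x = f) C = C" unfolding count_image_filter
          using sC by (metis mset_subset_size multiset_filter_subset order_less_irrefl subset_mset.le_neq_trans)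
        then have "set_mset (filter_mset (\<lambda>x. h x = f) C) = set_mset C" by simp
        then have "\<forall>x\<in>#C. h x = f" by auto
        then show False using notall f by blast
      qed
      moreover have "count (image_mset h C) f \<le> m - 1" unfolding count_image_filter
        using sC by (metis size_filter_mset_lesseq)
      ultimately have "count (image_mset h Y) f > 0" unfolding hY using f cR[of f] by simp
      then show "f \<in> F'" unfolding F'(3) using F'(1) by (auto split: if_splits)
    qed
    then have "F' = F" using F(1,2) F'(1,2) by (metis card_subset_eq)
    then have "image_mset h R - image_mset h C + image_mset h D = image_mset h R"
      using hY F(3) F'(3) by simp
    moreover have "image_mset h C \<subseteq># image_mset h R" using C(1) by (rule image_mset_subseteq_mono)
    ultimately have DC: "image_mset h D = image_mset h C"
      by (metis add_diff_cancel_left' subset_mset.diff_add)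
    have "C \<noteq> {#}" using sC m by auto
    then obtain c where c: "c \<in># C" by (rule multiset_nonemptyE)
    have cF: "h c \<in> F" using c C(1) hR mset_subset_eqD by metis
    obtain c' where c': "c' \<in># C" "h c' \<noteq> h c" using notall[OF cF] by blast
    have c'F: "h c' \<in> F" using c' C(1) hR mset_subset_eqD by metis
    have two: "count (image_mset h (R + B)) f \<ge> m" if "f \<in> F" "f \<in># image_mset h C" for f
    proof -
      have "count (image_mset h D) f \<ge> 1" using that(2) DC by (metis count_greater_eq_one_iff)
      moreover have "count (image_mset h (R + B)) f \<ge> count (image_mset h R) f + count (image_mset h D) f"
        unfolding D by simp
      moreover have "count (image_mset h R) f = m - 1" using cR[of f] that(1) by simp
      ultimately show ?thesis by linarith
    qed
    have "h c \<in># image_mset h C" "h c' \<in># image_mset h C" using c c'(1) by auto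
    then have "packing P 2 (R + B)" using two_fibres[OF two two] cF c'F c'(2) by metis
    then show False using np by blast
  qed
  have "B \<noteq> {#}" using B(2) m by auto
  then obtain g where g: "g \<in># B" by (rule multiset_nonemptyE)
  have "h x = h g" if x: "x \<in># B" for x
  proof (rule ccontr)
    assume ne: "h x \<noteq> h g"
    have two: "count (image_mset h (R + B)) (h y) \<ge> m" if "y \<in># B" for y
    proof -
      have "count (image_mset h B) (h y) \<ge> 1" using that by (metis count_greater_eq_one_iff imageI set_image_mset)
      moreover have "count (image_mset h R) (h y) = m - 1" using cR[of "h y"] inF[OF that] by simp
      moreover have "count (image_mset h (R + B)) (h y) =
        count (image_mset h R) (h y) + count (image_mset h B) (h y)" by simp
      ultimately show ?thesis by linarith
    qed
    have "packing P 2 (R + B)" by (rule two_fibres[OF two[OF x] two[OF g] ne])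
    then show False using np by blast
  qed
  then have "image_mset h B = replicate_mset m (h g)"
    using image_mset_const_on[of B h "h g"] B(2) by simp
  then show thesis using inF[OF g] by (intro that)
qed

lemma packing_of_multiples:
  assumes "\<And>f. m dvd count (image_mset h Z) f" "size Z = k * m"
  shows "packing P k Z"
  using assms
proof (induction k arbitrary: Z)
  case (Suc k)
  have "Z \<noteq> {#}" using Suc.prems(2) m by auto
  then obtain z where z: "z \<in># Z" by (rule multiset_nonemptyE)
  then have "count (image_mset h Z) (h z) > 0" by (metis count_greater_zero_iff imageI set_image_mset)
  then have "count (image_mset h Z) (h z) \<ge> m" using Suc.prems(1) by (meson dvd_imp_le)
  then obtain B where B: "B \<subseteq># Z" "P B" "image_mset h B = replicate_mset m (h z)" by (rule fibre_block)
  have dv: "m dvd count (image_mset h (Z - B)) f" for f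
    using B Suc.prems(1)[of f] by (auto simp: image_mset_Diff)
  have "size (Z - B) = k * m"
  proof -
    have "size B = m" using arg_cong[OF B(3), of size] by simp
    then show ?thesis using size_Diff_submset[OF B(1)] Suc.prems(2) by simp
  qed
  from packing_SucI[OF B(1,2) Suc.IH[OF dv this]] show ?case .
qed simp

text \<open>Induction on \<open>k\<close>, removing one block \<open>B\<close>. In the rest all
  class sizes are -1 modulo m, so it contains a sequence \<open>R\<close> with m - 1 elements of
  each class whose complement splits into \<open>k\<close> constant blocks. Therefore
  \<open>R + B\<close> cannot hold two disjoint blocks, and \<open>block_class\<close> puts
  \<open>B\<close> into a single existing class.\<close>

theorem class_structure:
  assumes "size S = r * (m - 1) + k * m" "\<not> packing P (Suc k) S"
  shows "\<exists>F. finite F \<and> card F = r \<and> set_mset (image_mset h S) = F \<and>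
    (\<forall>f\<in>F. m dvd count (image_mset h S) f + 1)"
  using assms
proof (induction k arbitrary: S)
  case 0
  have "\<nexists>B. B \<subseteq># S \<and> P B" using 0(2) packing_1I by blast
  then obtain F where F: "finite F" "card F = r" "image_mset h S = repeat_mset (m - 1) (mset_set F)"
    using 0(1) blockfree_structure[of S] by auto
  have "set_mset (image_mset h S) = F" using F(1) m
    by (auto simp: F(3) set_eq_iff simp del: set_image_mset simp: count_mset_set' simp flip: count_greater_zero_iff split: if_splits)
  moreover have "\<forall>f\<in>F. m dvd count (image_mset h S) f + 1" unfolding F(3) using F(1) m by auto
  ultimately show ?case using F by blast
next
  case (Suc k)
  obtain B where B: "B \<subseteq># S" "P B" using forcesD[OF ex, of S] Suc.prems m by auto
  define S' where "S' = S - B"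
  have S: "S = S' + B" unfolding S'_def using B(1) by simp
  have np: "\<not> packing P (Suc k) S'"
    using Suc.prems(2) packing_SucI[of B S P "Suc k"] B unfolding S'_def by blast
  \<comment> \<open>A shorter block would leave enough elements for \<open>packing_exists\<close> to
    find k + 1 further blocks.\<close>
  have "size B = m"
  proof (rule ccontr)
    assume "size B \<noteq> m"
    then have "size B < m" using size_le[OF B(2)] by simp
    then have "size S' + m \<ge> (r * (m - 1) + 1) + m * (Suc k)"
      using arg_cong[OF S, of size] Suc.prems(1) by (simp add: algebra_simps)
    then have "packing P (Suc k) S'"
      by (rule packing_exists[where P=P, rotated 2]) (use forcesD[OF ex] size_le in auto)
    then show False using np by blast
  qed
  have sS': "size S' = r * (m - 1) + k * m" using arg_cong[OF S, of size] Suc.prems(1) \<open>size B = m\<close> by simp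
  obtain F where F: "finite F" "card F = r" "set_mset (image_mset h S') = F"
    "\<forall>f\<in>F. m dvd count (image_mset h S') f + 1"
    using Suc.IH[OF sS' np] by blast
  have c: "count (image_mset h S') f \<ge> m - 1" if "f \<in> F" for f
  proof -
    have "m \<le> count (image_mset h S') f + 1" using F(4) that by (intro dvd_imp_le) auto
    then show ?thesis by simp
  qed
  have "repeat_mset (m - 1) (mset_set F) \<subseteq># image_mset h S'"
    using c F(1) by (auto simp: subseteq_mset_def count_mset_set')
  then obtain R where R: "R \<subseteq># S'" "image_mset h R = repeat_mset (m - 1) (mset_set F)"
    by (rule submset_image_msetE)
  have sR: "size R = r * (m - 1)" using arg_cong[OF R(2), of size] F(1,2)
    by (simp add: size_repeat_mset)
  have "packing P k (S' - R)"
  proof (rule packing_of_multiples)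
    fix f
    show "m dvd count (image_mset h (S' - R)) f"
    proof (cases "f \<in> F")
      case True
      have "count (image_mset h (S' - R)) f = (count (image_mset h S') f + 1) - m"
        using R m True F(1) by (simp add: image_mset_Diff)
      then show ?thesis using F(4) True m by (auto simp: dvd_diff_nat)
    next
      case False
      then have "count (image_mset h S') f = 0" using F(3) by (metis count_inI)
      then show ?thesis using R by (simp add: image_mset_Diff)
    qed
    show "size (S' - R) = k * m" using R(1) sR sS' by (simp add: size_Diff_submset)
  qed
  then have "packing P (k + 2) S" if "packing P 2 (R + B)"
  proof -
    have "packing P (k + 2) ((S' - R) + (R + B))" using packing_add \<open>packing P k (S' - R)\<close> that by blast
    moreover have "(S' - R) + (R + B) = S" unfolding S using R(1) by (simp add: add.assoc[symmetric])
    ultimately show ?thesis by simp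
  qed
  then have "\<not> packing P 2 (R + B)" using Suc.prems(2) by auto
  then obtain f where f: "f \<in> F" "image_mset h B = replicate_mset m f"
    using B(2) \<open>size B = m\<close> F(1,2) R(2) by (rule block_class)
  have hS: "image_mset h S = image_mset h S' + replicate_mset m f" unfolding S using f by simp
  have "set_mset (image_mset h S) = F" unfolding hS using F(3) f(1) by auto
  moreover have "\<forall>f'\<in>F. m dvd count (image_mset h S) f' + 1"
  proof
    fix f' assume "f' \<in> F"
    then have "m dvd count (image_mset h S') f' + 1" using F(4) by blast
    then have "m dvd (count (image_mset h S') f' + 1) + (if f' = f then m else 0)"
      by (rule dvd_add) simp
    moreover have "count (image_mset h S) f' = count (image_mset h S') f' + (if f' = f then m else 0)"
      unfolding hS by simp
    ultimately show "m dvd count (image_mset h S) f' + 1" by (metis add.assoc add.commute)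
  qed
  ultimately show ?case using F(1,2) by blast
qed

end

section \<open>The prime case\<close>

text \<open>\<open>vanish p n f\<close>: all \<open>n\<close>-fold differences of \<open>f\<close> vanish modulo \<open>p\<close>; this plays the role of
  ``\<open>f\<close> is a polynomial of degree less than \<open>n\<close> modulo \<open>p\<close>''.\<close>

primrec vanish :: "int \<Rightarrow> nat \<Rightarrow> ('v::ab_group_add \<Rightarrow> int) \<Rightarrow> bool" where
  "vanish p 0 f \<longleftrightarrow> (\<forall>x. p dvd f x)"
| "vanish p (Suc n) f \<longleftrightarrow> (\<forall>v. vanish p n (\<lambda>x. f x - f (x + v)))"

lemma vanish_trivial: "\<forall>x. p dvd f x \<Longrightarrow> vanish p n f"
  by (induction n arbitrary: f) (auto intro!: dvd_diff)

lemma vanish_diff: "vanish p n f \<Longrightarrow> vanish p n g \<Longrightarrow> vanish p n (\<lambda>x. f x - g x)"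
proof (induction n arbitrary: f g)
  case (Suc n)
  have "vanish p n (\<lambda>x. (f x - f (x + v)) - (g x - g (x + v)))" for v
    using Suc by simp
  then show ?case by (simp add: algebra_simps)
qed (simp add: dvd_diff)

lemma vanish_add: "vanish p n f \<Longrightarrow> vanish p n g \<Longrightarrow> vanish p n (\<lambda>x. f x + g x)"
proof (induction n arbitrary: f g)
  case (Suc n)
  have "vanish p n (\<lambda>x. (f x - f (x + v)) + (g x - g (x + v)))" for v
    using Suc by simp
  then show ?case by (simp add: algebra_simps)
qed (simp add: dvd_add)

lemma vanish_Suc_mono: "vanish p n f \<Longrightarrow> vanish p (Suc n) f"
proof (induction n arbitrary: f)
  case 0
  then show ?case by (auto intro!: dvd_diff)
next
  case (Suc n)
  then show ?case by (metis vanish.simps(2))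
qed

lemma vanish_mono:
  assumes "vanish p n f" "n \<le> n'"
  shows "vanish p n' f"
  using assms(2,1) by (induction rule: dec_induct) (auto intro: vanish_Suc_mono simp del: vanish.simps)

text \<open>Leibniz rule D(f g) = (D f) g + f (D g) - (D f) (D g), by induction on the total order.
  \<open>Suc a\<close> stands for degree at most \<open>a\<close>, so that degrees add.\<close>

lemma vanish_mult:
  fixes f g :: "'v::ab_group_add \<Rightarrow> int"
  assumes "vanish p (Suc a) f" "vanish p (Suc b) g"
  shows "vanish p (Suc (a + b)) (\<lambda>x. f x * g x)"
  using assms
proof (induction "a + b" arbitrary: a b f g rule: less_induct)
  case less
  \<comment> \<open>Order 0 means vanishing identically modulo \<open>p\<close>; the induction
    hypothesis, stated for successors, does not reach this case.\<close>
  have sub: "vanish p (a' + b') (\<lambda>x. f x * g x)"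
    if "vanish p a' f" "vanish p (Suc b') g" "a' \<le> a" "b' \<le> b" "a' + b' \<le> a + b" for a' b' and f g :: "'v \<Rightarrow> int"
  proof (cases a')
    case 0
    then show ?thesis using that(1) by (auto intro!: vanish_trivial dvd_mult2)
  next
    case (Suc a'')
    have "vanish p (Suc (a'' + b')) (\<lambda>x. f x * g x)"
      by (rule less.hyps) (use that Suc in \<open>simp_all del: vanish.simps\<close>)
    then show ?thesis using Suc by simp
  qed
  have sub': "vanish p (a' + b') (\<lambda>x. f x * g x)"
    if "vanish p (Suc a') f" "vanish p b' g" "a' \<le> a" "b' \<le> b" for a' b' and f g :: "'v \<Rightarrow> int"
  proof (cases b')
    case 0
    then show ?thesis using that(2) by (auto intro!: vanish_trivial dvd_mult)
  next
    case (Suc b'')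
    have "vanish p (Suc (a' + b'')) (\<lambda>x. f x * g x)"
      by (rule less.hyps) (use that Suc in \<open>simp_all del: vanish.simps\<close>)
    then show ?thesis using Suc by simp
  qed
  show ?case unfolding vanish.simps(2)[of p "a + b"]
  proof
    fix v
    have df: "vanish p a (\<lambda>x. f x - f (x + v))" and dg: "vanish p b (\<lambda>x. g x - g (x + v))"
      using less.prems by auto
    have 1: "vanish p (a + b) (\<lambda>x. (f x - f (x + v)) * g x)" using sub df less.prems(2) by blast
    have 2: "vanish p (a + b) (\<lambda>x. f x * (g x - g (x + v)))" using sub' less.prems(1) dg by blast
    have 3: "vanish p (a + b) (\<lambda>x. (f x - f (x + v)) * (g x - g (x + v)))"
      using sub[OF df vanish_Suc_mono[OF dg]] by simp
    have "vanish p (a + b) (\<lambda>x. ((f x - f (x + v)) * g x + f x * (g x - g (x + v))) -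
      (f x - f (x + v)) * (g x - g (x + v)))"
      by (intro vanish_diff vanish_add 1 2 3)
    then show "vanish p (a + b) (\<lambda>x. f x * g x - f (x + v) * g (x + v))"
      by (simp add: algebra_simps)
  qed
qed

lemma vanish_const: "vanish p (Suc 0) (\<lambda>x. c)"
  by simp

lemma vanish_additive:
  assumes "\<And>x y. L (x + y) = L x + L y"
  shows "vanish p (Suc (Suc 0)) L"
  using assms by (simp add: algebra_simps)

lemma vanish_power:
  assumes "\<And>x y. L (x + y) = L x + L y"
  shows "vanish p (Suc k) (\<lambda>x. L x ^ k)"
proof (induction k)
  case (Suc k)
  have "vanish p (Suc (Suc 0 + k)) (\<lambda>x. L x * L x ^ k)"
    by (rule vanish_mult[OF vanish_additive Suc]) (rule assms)
  then show ?case by simp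
qed simp

text \<open>Expanding the product over i in \<open>I\<close> of the operators 1 - (shift by
  \<open>v i\<close>) gives this alternating sum, so it is a \<open>card I\<close>-fold difference
  of \<open>f\<close>.\<close>

lemma vanish_alternating_sum:
  assumes "finite I" "vanish p (card I) f"
  shows "p dvd (\<Sum>A\<in>Pow I. (-1) ^ card A * f (x + sum v A))"
  using assms
proof (induction I arbitrary: f x rule: finite_induct)
  case (insert i I)
  have inj: "inj_on (insert i) (Pow I)" using insert.hyps(2) by (auto simp: inj_on_def)
  have disj: "Pow I \<inter> insert i ` Pow I = {}" using insert.hyps(2) by auto
  have "(\<Sum>A\<in>insert i ` Pow I. (-1) ^ card A * f (x + sum v A)) =
    (\<Sum>A\<in>Pow I. - ((-1) ^ card A * f (x + sum v A + v i)))"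
    unfolding sum.reindex[OF inj] comp_def
  proof (rule sum.cong)
    fix A assume "A \<in> Pow I"
    then have "finite A" "i \<notin> A" using insert.hyps finite_subset by auto
    then show "(-1) ^ card (insert i A) * f (x + sum v (insert i A)) =
      - ((-1) ^ card A * f (x + sum v A + v i))" by (simp add: add_ac)
  qed simp
  then have eq: "(\<Sum>A\<in>Pow (insert i I). (-1) ^ card A * f (x + sum v A)) =
    (\<Sum>A\<in>Pow I. (-1) ^ card A * (f (x + sum v A) - f (x + sum v A + v i)))"
    unfolding Pow_insert using insert.hyps(1) disj
    by (simp add: sum.union_disjoint sum_negf sum_subtractf algebra_simps)
  have "vanish p (card I) (\<lambda>x. f x - f (x + v i))" using insert.prems insert.hyps by simp
  from insert.IH[OF this] show ?case unfolding eq .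
qed simp

section \<open>Olson's alternating count of zero-sums\<close>

lemma fermat_int:
  assumes "prime p" "\<not> int p dvd a"
  shows "[a ^ (p - 1) = 1] (mod int p)"
proof -
  have p0: "int p > 0" using assms(1) prime_gt_0_nat by simp
  define b where "b = nat (a mod int p)"
  have b: "int b = a mod int p" using p0 by (simp add: b_def)
  have "\<not> p dvd b" using assms(2) b by (metis dvd_mod_iff dvd_refl int_dvd_int_iff)
  then have "[b ^ (p - 1) = 1] (mod p)" using assms(1) by (rule fermat_theorem[rotated])
  then have "[int b ^ (p - 1) = 1] (mod int p)" by (metis cong_int_iff of_nat_1 of_nat_power)
  moreover have "[a ^ (p - 1) = int b ^ (p - 1)] (mod int p)" unfolding b
    by (intro cong_pow) (simp add: cong_def)
  ultimately show ?thesis using cong_trans by blast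
qed

definition ind :: "nat \<Rightarrow> int \<Rightarrow> int" where
  "ind p a = (if int p dvd a then 1 else 0)"

lemma ind_cong:
  assumes "prime p"
  shows "[1 - a ^ (p - 1) = ind p a] (mod int p)"
proof (cases "int p dvd a")
  case True
  then have "int p dvd a ^ (p - 1)" using prime_gt_1_nat[OF assms] by (intro dvd_power_le[of _ _ 1, simplified]) auto
  then show ?thesis using True unfolding ind_def by (simp add: cong_iff_dvd_diff)
next
  case False
  then show ?thesis using fermat_int[OF assms False] unfolding ind_def
    by (simp add: cong_iff_dvd_diff dvd_diff_commute)
qed

lemma vanish_cong:
  assumes "vanish p n f" "\<And>x. [f x = g x] (mod p)"
  shows "vanish p n g"
proof -
  have "vanish p n (\<lambda>x. f x - (f x - g x))"
    by (rule vanish_diff[OF assms(1) vanish_trivial]) (use assms(2) in \<open>auto simp: cong_iff_dvd_diff\<close>)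
  then show ?thesis by simp
qed

text \<open>By Fermat the indicator is 1 - L^(p - 1) modulo \<open>p\<close>, a polynomial of degree
  p - 1.\<close>

lemma vanish_ind:
  assumes "prime p" "\<And>x y. L (x + y) = L x + L y"
  shows "vanish (int p) (Suc (p - 1)) (\<lambda>x. ind p (L x))"
proof (rule vanish_cong)
  show "vanish (int p) (Suc (p - 1)) (\<lambda>x. 1 - L x ^ (p - 1))"
    by (intro vanish_diff vanish_power vanish_mono[OF vanish_const]) (use assms in auto)
  show "[1 - L x ^ (p - 1) = ind p (L x)] (mod int p)" for x using assms(1) by (rule ind_cong)
qed

text \<open>The indicator of zero in C_p + C_p has degree 2 (p - 1), so more differences than that
  annihilate it. The empty set contributes 1, hence some nonempty set must contribute too: this is
  the Davenport constant 2 p - 1.\<close>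

lemma olson2:
  fixes v :: "'i \<Rightarrow> int \<times> int"
  assumes "prime p" "finite I" "card I > 2 * (p - 1)"
  shows "int p dvd (\<Sum>A\<in>Pow I. (-1) ^ card A * (ind p (fst (sum v A)) * ind p (snd (sum v A))))"
proof -
  have "vanish (int p) (Suc ((p - 1) + (p - 1))) (\<lambda>x :: int \<times> int. ind p (fst x) * ind p (snd x))"
    by (intro vanish_mult vanish_ind) (use assms in auto)
  then have "vanish (int p) (card I) (\<lambda>x :: int \<times> int. ind p (fst x) * ind p (snd x))"
    by (rule vanish_mono) (use assms in auto)
  from vanish_alternating_sum[OF assms(2) this, of 0 v] show ?thesis by simp
qed

lemma olson3:
  fixes v :: "'i \<Rightarrow> int \<times> int \<times> int"
  assumes "prime p" "finite I" "card I > 3 * (p - 1)"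
  shows "int p dvd (\<Sum>A\<in>Pow I. (-1) ^ card A *
    (ind p (fst (sum v A)) * (ind p (fst (snd (sum v A))) * ind p (snd (snd (sum v A))))))"
proof -
  have "vanish (int p) (Suc ((p - 1) + ((p - 1) + (p - 1))))
    (\<lambda>x :: int \<times> int \<times> int. ind p (fst x) * (ind p (fst (snd x)) * ind p (snd (snd x))))"
    by (intro vanish_mult vanish_ind) (use assms in auto)
  then have "vanish (int p) (card I)
    (\<lambda>x :: int \<times> int \<times> int. ind p (fst x) * (ind p (fst (snd x)) * ind p (snd (snd x))))"
    by (rule vanish_mono) (use assms in auto)
  from vanish_alternating_sum[OF assms(2) this, of 0 v] show ?thesis by simp
qed

lemma nonempty_term:
  fixes f :: "'i set \<Rightarrow> int"
  assumes "finite I" "int p dvd (\<Sum>A\<in>Pow I. (-1) ^ card A * f A)" "f {} = 1" "p > 1"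
  obtains A where "A \<subseteq> I" "A \<noteq> {}" "f A \<noteq> 0"
proof -
  have "\<exists>A. A \<subseteq> I \<and> A \<noteq> {} \<and> f A \<noteq> 0"
  proof (rule ccontr)
    assume a: "\<not> ?thesis"
    have "(\<Sum>A\<in>Pow I. (-1) ^ card A * f A) = (\<Sum>A\<in>{{}}. (-1) ^ card A * f A)"
      using a assms(1) by (intro sum.mono_neutral_right) auto
    then show False using assms(2,3,4) by (simp add: zdvd1_eq)
  qed
  then show thesis using that by blast
qed

lemma obtain_indexing:
  obtains v where "X = image_mset v (mset_set {..<size X})"
proof -
  obtain xs where xs: "mset xs = X" by (metis ex_mset)
  have "X = image_mset ((!) xs) (mset_set {..<size X})"
    using xs by (metis atLeast0LessThan map_nth mset_map mset_upt size_mset atLeast_upt mset_set_set)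
  then show thesis by (rule that)
qed

lemma indexed_submset:
  assumes "X = image_mset v (mset_set I)" "finite I" "A \<subseteq> I"
  shows "image_mset v (mset_set A) \<subseteq># X" "size (image_mset v (mset_set A)) = card A"
    "\<Sum>\<^sub># (image_mset v (mset_set A)) = sum v A"
  using assms by (auto intro!: image_mset_subseteq_mono subset_imp_msubset_mset_set simp: sum_unfold_sum_mset)

lemma forcesI_eq:
  assumes "\<And>S. size S = l \<Longrightarrow> \<exists>T. T \<subseteq># S \<and> P T"
  shows "forces P l"
  unfolding forces_def
proof (intro allI impI)
  fix S :: "'a multiset" assume "size S \<ge> l"
  then obtain S' where "S' \<subseteq># S" "size S' = l" by (rule obtain_submset_of_size)
  then show "\<exists>T. T \<subseteq># S \<and> P T" using assms by (metis subset_mset.order_trans)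
qed

definition lat :: "nat \<Rightarrow> nat \<Rightarrow> (int \<times> int) set" where
  "lat m k = {v. int m dvd fst v \<and> int k dvd snd v}"

definition mult_of :: "nat \<Rightarrow> int set" where
  "mult_of n = {a. int n dvd a}"

lemma ind_eq_0 [simp]: "ind p a = 0 \<longleftrightarrow> \<not> int p dvd a" and ind_0 [simp]: "ind p 0 = 1"
  by (auto simp: ind_def)

lemma fst_sum': "fst (sum f A) = (\<Sum>a\<in>A. fst (f a))" and snd_sum': "snd (sum f A) = (\<Sum>a\<in>A. snd (f a))"
  by (induction A rule: infinite_finite_induct) auto

lemma egz_prime:
  assumes "prime p"
  shows "forces (zs_len (mult_of p) p) (2 * p - 1)"
proof (rule forcesI_eq)
  fix X :: "int multiset" assume sz: "size X = 2 * p - 1"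
  have p: "p > 1" using assms by (rule prime_gt_1_nat)
  obtain v where v: "X = image_mset v (mset_set {..<size X})" by (rule obtain_indexing)
  \<comment> \<open>The extra coordinate 1 counts the length modulo \<open>p\<close>.\<close>
  define w where "w i = (v i, 1 :: int)" for i
  have w: "fst (sum w A) = sum v A" "snd (sum w A) = int (card A)" for A
    by (simp_all add: fst_sum' snd_sum' w_def)
  obtain A where A: "A \<subseteq> {..<size X}" "A \<noteq> {}" "ind p (fst (sum w A)) * ind p (snd (sum w A)) \<noteq> 0"
    by (rule nonempty_term[OF _ olson2[OF assms, of "{..<size X}" w]]) (use sz p in auto)
  have "card A \<le> 2 * p - 1" "card A > 0"
    using A(1,2) sz by (metis card_lessThan card_mono finite_lessThan) (use A in \<open>auto simp: card_gt_0_iff finite_subset\<close>)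
  moreover have "p dvd card A" using A(3) w by (simp add: int_dvd_int_iff)
  then obtain c where c: "card A = p * c" by (rule dvdE)
  ultimately have "0 < c" "p * c \<le> 2 * p - 1" using p by (auto intro: gr0I)
  then have "0 < c" "p * c < p * 2" using p by linarith+
  then have "c = 1" by auto
  then show "\<exists>T. T \<subseteq># X \<and> zs_len (mult_of p) p T"
    using indexed_submset[OF v _ A(1)] A(3) w c
    by (intro exI[of _ "image_mset v (mset_set A)"]) (auto simp: zs_len_def mult_of_def)
qed

text \<open>With the length as third coordinate, Olson's argument yields a zero-sum of length p or 2
  p. In the second case 2 p - 1 of its elements contain a zero-sum \<open>B\<close>, and
  \<open>B\<close> or its complement has length at most p.\<close>

lemma eta_prime:
  assumes "prime p"
  shows "forces (zs_short (lat p p) p) (3 * p - 2)"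
proof (rule forcesI_eq)
  fix X :: "(int \<times> int) multiset" assume sz: "size X = 3 * p - 2"
  have p: "p > 1" using assms by (rule prime_gt_1_nat)
  obtain v where v: "X = image_mset v (mset_set {..<size X})" by (rule obtain_indexing)
  define w where "w i = (fst (v i), snd (v i), 1 :: int)" for i
  have w: "fst (sum w A) = fst (sum v A)" "fst (snd (sum w A)) = snd (sum v A)"
    "snd (snd (sum w A)) = int (card A)" for A
    by (simp_all add: fst_sum' snd_sum' w_def)
  obtain A where A: "A \<subseteq> {..<size X}" "A \<noteq> {}"
    "ind p (fst (sum w A)) * (ind p (fst (snd (sum w A))) * ind p (snd (snd (sum w A)))) \<noteq> 0"
    by (rule nonempty_term[OF _ olson3[OF assms, of "{..<size X}" w]]) (use sz p in auto)
  have fin: "finite A" using A(1) finite_subset by blast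
  have zs: "sum v A \<in> lat p p" using A(3) w by (simp add: lat_def)
  have cA: "card A \<le> 3 * p - 2" "card A > 0"
    using A(1,2) sz by (metis card_lessThan card_mono finite_lessThan) (use A fin in \<open>auto simp: card_gt_0_iff\<close>)
  have "\<exists>B\<subseteq>A. card B \<in> {1..p} \<and> sum v B \<in> lat p p"
  proof (cases "card A \<le> p")
    case True
    then show ?thesis using cA zs by auto
  next
    case False
    have "p dvd card A" using A(3) w by (simp add: int_dvd_int_iff)
    then obtain c where c: "card A = p * c" by (rule dvdE)
    then have "p * 1 < p * c" "p * c < p * 3" using cA False p by linarith+
    then have "c = 2" by auto
    \<comment> \<open>Setting \<open>a\<close> aside keeps \<open>B\<close> proper, so that the
      complement is nonempty.\<close>
    obtain a where a: "a \<in> A" using A(2) by blast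
    obtain B where B: "B \<subseteq> A - {a}" "B \<noteq> {}" "ind p (fst (sum v B)) * ind p (snd (sum v B)) \<noteq> 0"
      by (rule nonempty_term[OF _ olson2[OF assms, of "A - {a}" v]]) (use c \<open>c = 2\<close> p a fin in auto)
    have zB: "sum v B \<in> lat p p" using B(3) by (simp add: lat_def)
    have cB: "card B > 0" using B fin by (metis card_gt_0_iff finite_Diff finite_subset)
    show ?thesis
    proof (cases "card B \<le> p")
      case True
      then show ?thesis using B(1) cB zB by auto
    next
      case False
      have fB: "finite B" "B \<subseteq> A" using B(1) fin finite_subset by auto
      have "sum v (A - B) = sum v A - sum v B" using fB fin by (simp add: sum_diff)
      then have "sum v (A - B) \<in> lat p p" using zs zB by (auto simp: lat_def)
      moreover have "card (A - B) = 2 * p - card B" using fB c \<open>c = 2\<close> by (simp add: card_Diff_subset)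
      moreover have "card (A - B) > 0" using B(1) a fin by (auto simp: card_gt_0_iff)
      ultimately show ?thesis using False by (intro exI[of _ "A - B"]) auto
    qed
  qed
  then obtain B where B: "B \<subseteq> A" "card B \<in> {1..p}" "sum v B \<in> lat p p" by blast
  then show "\<exists>T. T \<subseteq># X \<and> zs_short (lat p p) p T"
    using indexed_submset[OF v _ order_trans[OF B(1) A(1)]]
    by (intro exI[of _ "image_mset v (mset_set B)"]) (auto simp: zs_short_def)
qed

section \<open>Counting zero-sum index sets: Kemnitz's conjecture for odd primes\<close>

definition zsub :: "nat \<Rightarrow> (nat \<Rightarrow> int \<times> int) \<Rightarrow> nat set \<Rightarrow> nat \<Rightarrow> nat set set" where
  "zsub p v I k = {A. A \<subseteq> I \<and> card A = k \<and> sum v A \<in> lat p p}"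

text \<open>Index sets are counted rather than submultisets: the congruences need equal terms at
  different positions to be distinguished.\<close>

abbreviation nz :: "nat \<Rightarrow> (nat \<Rightarrow> int \<times> int) \<Rightarrow> nat set \<Rightarrow> nat \<Rightarrow> int" where
  "nz p v I k \<equiv> int (card (zsub p v I k))"

lemma finite_zsub [simp]: "finite I \<Longrightarrow> finite (zsub p v I k)"
  by (rule finite_subset[of _ "Pow I"]) (auto simp: zsub_def)

lemma nz_0 [simp]: "finite I \<Longrightarrow> nz p v I 0 = 1"
proof -
  assume "finite I"
  then have "zsub p v I 0 = {{}}" by (auto simp: zsub_def lat_def card_eq_0_iff dest: finite_subset)
  then show ?thesis by simp
qed

lemma nz_large: "finite I \<Longrightarrow> card I < k \<Longrightarrow> nz p v I k = 0"
proof -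
  assume "finite I" "card I < k"
  then have "zsub p v I k = {}" by (auto simp: zsub_def dest: card_mono)
  then show ?thesis by simp
qed

lemma lat_diff: "x \<in> lat m k \<Longrightarrow> y \<in> lat m k \<Longrightarrow> x - y \<in> lat m k"
  and lat_add: "x \<in> lat m k \<Longrightarrow> y \<in> lat m k \<Longrightarrow> x + y \<in> lat m k"
  by (auto simp: lat_def)

lemma alternating_nz:
  assumes "prime p" "finite I" "card I > 3 * (p - 1)"
  shows "int p dvd (\<Sum>k\<le>card I. (-1) ^ k * (ind p (int k) * nz p v I k))"
proof -
  define w where "w i = (fst (v i), snd (v i), 1 :: int)" for i
  have w: "fst (sum w A) = fst (sum v A)" "fst (snd (sum w A)) = snd (sum v A)"
    "snd (snd (sum w A)) = int (card A)" for A
    by (simp_all add: fst_sum' snd_sum' w_def)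
  let ?f = "\<lambda>A. (-1) ^ card A * (ind p (fst (sum v A)) * (ind p (snd (sum v A)) * ind p (int (card A))))"
  have "int p dvd (\<Sum>A\<in>Pow I. ?f A)" using olson3[OF assms, of w] unfolding w .
  also have "(\<Sum>A\<in>Pow I. ?f A) = (\<Sum>k\<le>card I. \<Sum>A\<in>{A \<in> Pow I. card A = k}. ?f A)"
    using assms(2) by (intro sum.group[symmetric]) (auto intro: card_mono)
  also have "\<dots> = (\<Sum>k\<le>card I. (-1) ^ k * (ind p (int k) * nz p v I k))"
  proof (rule sum.cong)
    fix k
    have "(\<Sum>A\<in>{A \<in> Pow I. card A = k}. ?f A) = (\<Sum>A\<in>zsub p v I k. (-1) ^ k * ind p (int k))"
      using assms(2) by (intro sum.mono_neutral_cong_right) (auto simp: zsub_def lat_def ind_def)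
    then show "(\<Sum>A\<in>{A \<in> Pow I. card A = k}. ?f A) = (-1) ^ k * (ind p (int k) * nz p v I k)"
      by simp
  qed simp
  finally show ?thesis .
qed

context
  fixes p :: nat
  assumes p: "prime p" "odd p"
begin

lemma p3: "p \<ge> 3"
  using prime_gt_1_nat[OF p(1)] p(2) by (cases "p = 2") auto

text \<open>With fewer than 4 p indices only the lengths 0, p, 2 p, 3 p survive in
  \<open>alternating_nz\<close>; their signs alternate because \<open>p\<close> is odd.\<close>

lemma nz_relation:
  assumes "finite I" "3 * p - 3 < card I" "card I < 4 * p"
  shows "int p dvd 1 - nz p v I p + nz p v I (2 * p) - nz p v I (3 * p)"
proof -
  let ?g = "\<lambda>k. (-1) ^ k * (ind p (int k) * nz p v I k)"
  have "int p dvd (\<Sum>k\<le>card I. ?g k)" using assms p(1) by (intro alternating_nz) auto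
  also have "(\<Sum>k\<le>card I. ?g k) = (\<Sum>k<4 * p. ?g k)"
    using assms by (intro sum.mono_neutral_left) (auto simp: nz_large)
  also have "\<dots> = (\<Sum>k\<in>{0, p, 2 * p, 3 * p}. ?g k)"
  proof (intro sum.mono_neutral_right ballI)
    fix k assume k: "k \<in> {..<4 * p} - {0, p, 2 * p, 3 * p}"
    have "\<not> p dvd k"
    proof
      assume "p dvd k"
      then obtain c where c: "k = p * c" by (rule dvdE)
      then have "c < 4" using k by auto
      then have "c = 0 \<or> c = 1 \<or> c = 2 \<or> c = 3" by auto
      then show False using c k by auto
    qed
    then show "?g k = 0" by (simp add: int_dvd_int_iff)
  qed (use p3 in auto)
  also have "\<dots> = 1 - nz p v I p + nz p v I (2 * p) - nz p v I (3 * p)"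
    using p3 p(2) assms(1) by (simp add: ind_def)
  finally show ?thesis .
qed

lemma zsub_insert_zero:
  assumes "finite I" "i \<notin> I"
  shows "nz p (v(i := 0)) (insert i I) (Suc k) = nz p v I (Suc k) + nz p v I k"
proof -
  define w where "w = v(i := 0)"
  have s: "sum w A = sum v A" if "A \<subseteq> I" for A
  proof (rule sum.cong)
    fix x assume "x \<in> A"
    then have "x \<noteq> i" using assms(2) that by blast
    then show "w x = v x" by (simp add: w_def)
  qed simp
  have s': "sum w (insert i A) = sum v A" if "A \<subseteq> I" for A
  proof -
    have "sum w (insert i A) = w i + sum w A"
      using assms that by (intro sum.insert) (auto intro: finite_subset)
    then show ?thesis unfolding s[OF that] by (simp add: w_def)
  qed
  have "zsub p w (insert i I) (Suc k) = zsub p v I (Suc k) \<union> insert i ` zsub p v I k"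
  proof (rule subset_antisym; rule subsetI)
    fix A assume A: "A \<in> zsub p w (insert i I) (Suc k)"
    then have fin: "finite A" using assms(1) by (auto simp: zsub_def intro: finite_subset)
    show "A \<in> zsub p v I (Suc k) \<union> insert i ` zsub p v I k"
    proof (cases "i \<in> A")
      case True
      then have eq: "A = insert i (A - {i})" by auto
      have "A - {i} \<subseteq> I" using A by (auto simp: zsub_def)
      then have "A - {i} \<in> zsub p v I k"
        using A fin True s'[of "A - {i}"] by (auto simp: zsub_def insert_absorb)
      then show ?thesis using eq by blast
    next
      case False
      then have "A \<subseteq> I" using A by (auto simp: zsub_def)
      then show ?thesis using A s[of A] by (auto simp: zsub_def)
    qed
  next
    fix A assume "A \<in> zsub p v I (Suc k) \<union> insert i ` zsub p v I k"
    then show "A \<in> zsub p w (insert i I) (Suc k)"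
      using s s' assms by (auto simp: zsub_def card_insert_if intro: finite_subset)
         (subst card_insert_disjoint; auto intro: finite_subset)
  qed
  moreover have "zsub p v I (Suc k) \<inter> insert i ` zsub p v I k = {}" using assms(2) by (auto simp: zsub_def)
  moreover have "inj_on (insert i) (zsub p v I k)" using assms(2)
    by (auto simp: zsub_def inj_on_def)
  ultimately show ?thesis using assms(1) by (simp add: card_Un_disjoint card_image w_def)
qed

text \<open>Appending a zero vector makes \<open>nz_relation\<close> available already for 3 p - 3
  indices. A zero-sum through the new index is an old one that is shorter by one, whence the paired
  terms.\<close>

lemma nz_relation':
  assumes "finite I" "3 * p - 3 \<le> card I" "card I < 4 * p - 1"
  shows "int p dvd 1 - (nz p v I p + nz p v I (p - 1)) + (nz p v I (2 * p) + nz p v I (2 * p - 1))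
    - (nz p v I (3 * p) + nz p v I (3 * p - 1))"
proof -
  obtain i where i: "i \<notin> I" using assms(1) ex_new_if_finite infinite_UNIV_nat by blast
  have "int p dvd 1 - nz p (v(i := 0)) (insert i I) p + nz p (v(i := 0)) (insert i I) (2 * p)
    - nz p (v(i := 0)) (insert i I) (3 * p)"
    using assms i by (intro nz_relation) auto
  moreover have "nz p (v(i := 0)) (insert i I) k = nz p v I k + nz p v I (k - 1)" if "k > 0" for k
    using zsub_insert_zero[OF assms(1) i, of v "k - 1"] that by simp
  ultimately show ?thesis using p3 by simp
qed

text \<open>In Vandermonde's sum all terms but the two extreme ones are divisible by
  \<open>p\<close>. Iterated, this is the case of Lucas' theorem that evaluates the weights in the
  averaging below.\<close>

lemma choose_p_add: "[int ((a + p) choose p) = int (a choose p) + 1] (mod int p)"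
proof -
  have "(\<Sum>k\<le>p. (a choose k) * (p choose (p - k))) = (a + p) choose p" by (rule vandermonde)
  moreover have "(\<Sum>k\<le>p. (a choose k) * (p choose (p - k))) =
    (\<Sum>k\<in>{0, p}. (a choose k) * (p choose (p - k))) +
    (\<Sum>k\<in>{..p} - {0, p}. (a choose k) * (p choose (p - k)))"
    by (subst sum.subset_diff[of "{0, p}"]) auto
  moreover have "p dvd (\<Sum>k\<in>{..p} - {0, p}. (a choose k) * (p choose (p - k)))"
    using p(1) by (intro dvd_sum dvd_mult dvd_choose_prime) auto
  moreover then obtain c where "(\<Sum>k\<in>{..p} - {0, p}. (a choose k) * (p choose (p - k))) = p * c" by (rule dvdE)
  ultimately have "(a + p) choose p = 1 + (a choose p) + p * c"
    using p3 by simp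
  then have "int ((a + p) choose p) = int (a choose p) + 1 + int p * int c" by simp
  then show ?thesis by (simp add: cong_def)
qed

lemma choose_p: "r < p \<Longrightarrow> [int ((q * p + r) choose p) = int q] (mod int p)"
proof (induction q)
  case (Suc q)
  have "[int ((q * p + r + p) choose p) = int ((q * p + r) choose p) + 1] (mod int p)" by (rule choose_p_add)
  also have "[int ((q * p + r) choose p) + 1 = int q + 1] (mod int p)" using Suc by (intro cong_add) auto
  finally show ?case by (simp add: add_ac)
qed (simp add: binomial_eq_0)

lemma choose_p': "n = q * p + r \<Longrightarrow> r < p \<Longrightarrow> [int (n choose p) = int q] (mod int p)"
  using choose_p by blast

text \<open>Double counting: a zero-sum set of size \<open>k\<close> lies in (4 p - 3 - k choose 3 p
  - 3 - k) of the sets \<open>J\<close>, and this binomial is symmetric to the one stated.\<close>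

lemma nz_average:
  assumes "finite X" "card X = 4 * p - 3" "k \<le> 3 * p - 3"
  shows "(\<Sum>J\<in>{J. J \<subseteq> X \<and> card J = 3 * p - 3}. nz p v J k) = int ((4 * p - 3 - k) choose p) * nz p v X k"
proof -
  let ?J = "{J. J \<subseteq> X \<and> card J = 3 * p - 3}"
  have finJ: "finite ?J" using assms(1) by auto
  have "(\<Sum>J\<in>?J. card (zsub p v J k)) = (\<Sum>J\<in>?J. card {A \<in> zsub p v X k. A \<subseteq> J})"
    by (intro sum.cong arg_cong[of _ _ card]) (auto simp: zsub_def)
  also have "\<dots> = (\<Sum>J\<in>?J. \<Sum>A\<in>zsub p v X k. if A \<subseteq> J then 1 else 0)"
    using assms(1) by (intro sum.cong) (simp_all add: sum.If_cases Int_def)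
  also have "\<dots> = (\<Sum>A\<in>zsub p v X k. \<Sum>J\<in>?J. if A \<subseteq> J then 1 else 0)" by (rule sum.swap)
  also have "\<dots> = (\<Sum>A\<in>zsub p v X k. card {J \<in> ?J. A \<subseteq> J})"
    using finJ by (intro sum.cong) (simp_all add: sum.If_cases Int_def)
  also have "\<dots> = (\<Sum>A\<in>zsub p v X k. (4 * p - 3 - k) choose p)"
  proof (rule sum.cong)
    fix A assume A: "A \<in> zsub p v X k"
    then have fin: "finite A" "A \<subseteq> X" "card A = k" using assms(1) by (auto simp: zsub_def intro: finite_subset)
    have "bij_betw (\<lambda>J. J - A) {J \<in> ?J. A \<subseteq> J} {B. B \<subseteq> X - A \<and> card B = 3 * p - 3 - k}"
      by (rule bij_betw_byWitness[of _ "\<lambda>B. B \<union> A"])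
        (use fin assms in \<open>auto simp: card_Diff_subset card_Un_disjoint finite_subset Int_Diff disjoint_iff
          intro!: card_Un_disjoint[THEN trans]\<close>)
    then have "card {J \<in> ?J. A \<subseteq> J} = card (X - A) choose (3 * p - 3 - k)"
      using assms(1) by (simp add: bij_betw_same_card n_subsets)
    also have "\<dots> = (4 * p - 3 - k) choose (3 * p - 3 - k)" using fin assms by (simp add: card_Diff_subset)
    also have "\<dots> = (4 * p - 3 - k) choose p"
      using p3 assms(3) by (subst binomial_symmetric) (auto intro: arg_cong2[of _ _ _ _ binomial])
    finally show "card {J \<in> ?J. A \<subseteq> J} = (4 * p - 3 - k) choose p" .
  qed simp
  finally show ?thesis by (simp flip: of_nat_sum)
qed

text \<open>Sum of \<open>nz_relation'\<close> over all subsets of size 3 p - 3. Modulo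
  \<open>p\<close> the binomial weights are 3, 2, 2, 1, 1, the quotients of their upper entries by
  \<open>p\<close>.\<close>

lemma nz_relation_average:
  assumes "finite X" "card X = 4 * p - 3"
  shows "int p dvd 3 - 2 * nz p v X p - 2 * nz p v X (p - 1) + nz p v X (2 * p) + nz p v X (2 * p - 1)"
proof -
  let ?J = "{J. J \<subseteq> X \<and> card J = 3 * p - 3}"
  have large: "nz p v J (3 * p) = 0" "nz p v J (3 * p - 1) = 0" if "J \<in> ?J" for J
    using that p3 by (intro nz_large finite_subset[OF _ assms(1)]; auto)+
  have "int p dvd (\<Sum>J\<in>?J. nz p v J 0 - (nz p v J p + nz p v J (p - 1)) + (nz p v J (2 * p) + nz p v J (2 * p - 1)))"
  proof (rule dvd_sum)
    fix J assume J: "J \<in> ?J"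
    then have "finite J" using assms(1) by (auto intro: finite_subset)
    then show "int p dvd nz p v J 0 - (nz p v J p + nz p v J (p - 1)) + (nz p v J (2 * p) + nz p v J (2 * p - 1))"
      using nz_relation'[of J v] J large[OF J] p3 by simp
  qed
  also have "(\<Sum>J\<in>?J. nz p v J 0 - (nz p v J p + nz p v J (p - 1)) + (nz p v J (2 * p) + nz p v J (2 * p - 1))) =
    (\<Sum>J\<in>?J. nz p v J 0) - ((\<Sum>J\<in>?J. nz p v J p) + (\<Sum>J\<in>?J. nz p v J (p - 1)))
      + ((\<Sum>J\<in>?J. nz p v J (2 * p)) + (\<Sum>J\<in>?J. nz p v J (2 * p - 1)))"
    by (simp only: sum.distrib sum_subtractf)
  also have "\<dots> = int ((4 * p - 3) choose p) - (int ((4 * p - 3 - p) choose p) * nz p v X p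
      + int ((4 * p - 3 - (p - 1)) choose p) * nz p v X (p - 1))
      + (int ((4 * p - 3 - 2 * p) choose p) * nz p v X (2 * p)
      + int ((4 * p - 3 - (2 * p - 1)) choose p) * nz p v X (2 * p - 1))" (is "_ = ?rhs")
    using assms p3 by (simp add: nz_average del: binomial_eq_0_iff)
  finally have 1: "int p dvd ?rhs" .
  have c: "[int ((4 * p - 3) choose p) = 3] (mod int p)" "[int ((4 * p - 3 - p) choose p) = 2] (mod int p)"
    "[int ((4 * p - 3 - (p - 1)) choose p) = 2] (mod int p)" "[int ((4 * p - 3 - 2 * p) choose p) = 1] (mod int p)"
    "[int ((4 * p - 3 - (2 * p - 1)) choose p) = 1] (mod int p)"
    by (rule choose_p'[of _ 3 "p - 3", simplified] choose_p'[of _ 2 "p - 3", simplified]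
      choose_p'[of _ 2 "p - 2", simplified] choose_p'[of _ 1 "p - 3", simplified]
      choose_p'[of _ 1 "p - 2", simplified]; use p3 in simp)+
  have "[?rhs = 3 - (2 * nz p v X p + 2 * nz p v X (p - 1)) + (1 * nz p v X (2 * p) + 1 * nz p v X (2 * p - 1))] (mod int p)"
    by (intro cong_add cong_diff cong_mult c cong_refl)
  then have "int p dvd 3 - (2 * nz p v X p + 2 * nz p v X (p - 1)) + (1 * nz p v X (2 * p) + 1 * nz p v X (2 * p - 1))"
    using 1 cong_dvd_iff by blast
  then show ?thesis by (simp add: algebra_simps)
qed

text \<open>Both sides count, modulo \<open>p\<close> and up to sign, the pairs of disjoint zero-sum subsequences of
  lengths \<open>p - 1\<close> and \<open>2 * p\<close>.\<close>

lemma nz_complement: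
  assumes "finite X" "card X = 4 * p - 3" "zsub p v X p = {}"
  shows "int p dvd nz p v X (p - 1) - nz p v X (3 * p - 1)"
proof -
  have sub0: "zsub p v J p = {}" if "J \<subseteq> X" for J using assms(3) that by (auto simp: zsub_def)
  \<comment> \<open>Without zero-sums of length p, the number of those of length 2 p inside 3 p - 2
    or 3 p - 1 indices is -1 modulo \<open>p\<close>. This evaluates both inner sums of the double
    count.\<close>
  have rel: "int p dvd 1 + nz p v J (2 * p)" if "J \<subseteq> X" "3 * p - 3 < card J" "card J < 3 * p" for J
    using nz_relation[of J v] sub0[OF that(1)] that assms(1) finite_subset[OF that(1)]
    by (simp add: nz_large)
  let ?S1 = "SIGMA A:zsub p v X (p - 1). zsub p v (X - A) (2 * p)"
  let ?S2 = "SIGMA D:zsub p v X (3 * p - 1). zsub p v D (2 * p)"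
  have fin: "finite A" if "A \<in> zsub p v X k" for A k
    using that assms(1) by (auto simp: zsub_def intro: finite_subset)
  have "bij_betw (\<lambda>(A, C). (A \<union> C, C)) ?S1 ?S2"
  proof (rule bij_betw_byWitness[of _ "\<lambda>(D, C). (D - C, C)"])
    show "\<forall>a\<in>?S1. (\<lambda>(D, C). (D - C, C)) ((\<lambda>(A, C). (A \<union> C, C)) a) = a" by (auto simp: zsub_def)
    show "\<forall>a\<in>?S2. (\<lambda>(A, C). (A \<union> C, C)) ((\<lambda>(D, C). (D - C, C)) a) = a" by (auto simp: zsub_def)
    show "(\<lambda>(A, C). (A \<union> C, C)) ` ?S1 \<subseteq> ?S2"
    proof clarify
      fix A C assume A: "A \<in> zsub p v X (p - 1)" and C: "C \<in> zsub p v (X - A) (2 * p)"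
      have f: "finite A" "finite C" "A \<inter> C = {}" using fin[OF A] C assms(1)
        by (auto simp: zsub_def intro: finite_subset)
      have "A \<union> C \<in> zsub p v X (3 * p - 1)"
        using A C f p3 by (auto simp: zsub_def card_Un_disjoint sum.union_disjoint lat_add)
      moreover have "C \<in> zsub p v (A \<union> C) (2 * p)" using C by (auto simp: zsub_def)
      ultimately show "A \<union> C \<in> zsub p v X (3 * p - 1) \<and> C \<in> zsub p v (A \<union> C) (2 * p)" by blast
    qed
    show "(\<lambda>(D, C). (D - C, C)) ` ?S2 \<subseteq> ?S1"
    proof clarify
      fix D C assume D: "D \<in> zsub p v X (3 * p - 1)" and C: "C \<in> zsub p v D (2 * p)"
      have f: "finite D" "finite C" "C \<subseteq> D" using fin[OF D] C by (auto simp: zsub_def intro: finite_subset)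
      have "D - C \<in> zsub p v X (p - 1)"
        using D C f p3 by (auto simp: zsub_def card_Diff_subset sum_diff lat_diff)
      moreover have "C \<in> zsub p v (X - (D - C)) (2 * p)" using C D by (auto simp: zsub_def)
      ultimately show "D - C \<in> zsub p v X (p - 1) \<and> C \<in> zsub p v (X - (D - C)) (2 * p)" by blast
    qed
  qed
  then have "card ?S1 = card ?S2" by (rule bij_betw_same_card)
  then have eq: "(\<Sum>A\<in>zsub p v X (p - 1). nz p v (X - A) (2 * p)) = (\<Sum>D\<in>zsub p v X (3 * p - 1). nz p v D (2 * p))"
    using assms(1) fin by (simp add: card_SigmaI flip: of_nat_sum)
  have "int p dvd (\<Sum>A\<in>zsub p v X (p - 1). 1 + nz p v (X - A) (2 * p))"
  proof (intro dvd_sum rel)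
    fix A assume A: "A \<in> zsub p v X (p - 1)"
    then have "card (X - A) = 3 * p - 2" using assms(1,2) fin[OF A] p3 by (auto simp: zsub_def card_Diff_subset)
    then show "X - A \<subseteq> X" "3 * p - 3 < card (X - A)" "card (X - A) < 3 * p" using p3 by auto
  qed
  then have 1: "int p dvd nz p v X (p - 1) + (\<Sum>A\<in>zsub p v X (p - 1). nz p v (X - A) (2 * p))"
    by (simp add: sum.distrib)
  have "int p dvd (\<Sum>D\<in>zsub p v X (3 * p - 1). 1 + nz p v D (2 * p))"
    using p3 by (intro dvd_sum rel) (auto simp: zsub_def)
  then have 2: "int p dvd nz p v X (3 * p - 1) + (\<Sum>D\<in>zsub p v X (3 * p - 1). nz p v D (2 * p))"
    by (simp add: sum.distrib)
  from dvd_diff[OF 1 2] show ?thesis unfolding eq by simp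
qed

text \<open>Without zero-sums of length p, the relation for all of \<open>X\<close>, the averaged
  relation and \<open>nz_complement\<close> combine so that all counts cancel and p divides
  2.\<close>

lemma kemnitz_index:
  assumes "finite X" "card X = 4 * p - 3"
  shows "zsub p v X p \<noteq> {}"
proof
  assume none: "zsub p v X p = {}"
  \<comment> \<open>A zero-sum of length 3 p, even after deleting one element, contains one of
    length 2 p; the complement of the latter in the former has length p.\<close>
  have "zsub p v X (3 * p) = {}"
  proof (rule ccontr)
    assume "zsub p v X (3 * p) \<noteq> {}"
    then obtain D where D: "D \<subseteq> X" "card D = 3 * p" "sum v D \<in> lat p p" by (auto simp: zsub_def)
    have fD: "finite D" using D(1) assms(1) finite_subset by blast
    have "D \<noteq> {}" using D(2) p3 by auto
    then obtain d where d: "d \<in> D" by blast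
    have "zsub p v (D - {d}) p = {}" using none D(1) by (auto simp: zsub_def)
    then have "int p dvd 1 + nz p v (D - {d}) (2 * p)"
      using nz_relation[of "D - {d}" v] fD d D(2) p3 by (simp add: nz_large)
    then have "nz p v (D - {d}) (2 * p) \<noteq> 0" using p3 by (intro notI) (simp add: zdvd1_eq)
    then obtain C where C: "C \<in> zsub p v (D - {d}) (2 * p)" by (metis card.empty equals0I of_nat_0)
    have "C \<subseteq> D" "finite C" using C fD by (auto simp: zsub_def intro: finite_subset)
    then have "D - C \<in> zsub p v X p"
      using C D fD by (auto simp: zsub_def card_Diff_subset sum_diff lat_diff)
    then show False using none by blast
  qed
  then have "int p dvd 1 - nz p v X (p - 1) + (nz p v X (2 * p) + nz p v X (2 * p - 1)) - nz p v X (3 * p - 1)"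
    using nz_relation'[of X v] none assms p3 by simp
  moreover have "int p dvd nz p v X (p - 1) - nz p v X (3 * p - 1)" using assms none by (rule nz_complement)
  moreover have "int p dvd 3 - 2 * nz p v X (p - 1) + nz p v X (2 * p) + nz p v X (2 * p - 1)"
    using nz_relation_average[OF assms, of v] none by simp
  ultimately have "int p dvd ((3 - 2 * nz p v X (p - 1) + nz p v X (2 * p) + nz p v X (2 * p - 1))
    - (1 - nz p v X (p - 1) + (nz p v X (2 * p) + nz p v X (2 * p - 1)) - nz p v X (3 * p - 1)))
    + (nz p v X (p - 1) - nz p v X (3 * p - 1))"
    by (metis dvd_add dvd_diff)
  then have "int p dvd 2" by (simp add: algebra_simps)
  then show False using p3 zdvd_imp_le by fastforce
qed

end

lemma kemnitz_2: "forces (zs_len (lat 2 2) 2) 5"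
proof (rule forcesI_eq)
  fix X :: "(int \<times> int) multiset" assume sz: "size X = 5"
  obtain v where v: "X = image_mset v (mset_set {..<size X})" by (rule obtain_indexing)
  let ?c = "\<lambda>i. (fst (v i) mod 2, snd (v i) mod 2)"
  have "?c ` {..<5} \<subseteq> {0, 1} \<times> {0, 1}" by auto
  then have "card (?c ` {..<5 :: nat}) \<le> card ({0, 1 :: int} \<times> {0, 1 :: int})" by (intro card_mono) auto
  then have "card (?c ` {..<5 :: nat}) < card {..<5 :: nat}" by simp
  then have "\<not> inj_on ?c {..<5}" by (rule pigeonhole)
  then obtain i j where ij: "i < 5" "j < 5" "i \<noteq> j" "?c i = ?c j" by (auto simp: inj_on_def)
  have "v i + v j \<in> lat 2 2" using ij(4) by (auto simp: lat_def)
  moreover have "{i, j} \<subseteq> {..<size X}" using ij sz by auto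
  ultimately show "\<exists>T. T \<subseteq># X \<and> zs_len (lat 2 2) 2 T"
    using indexed_submset[OF v, of "{i, j}"] ij(3)
    by (intro exI[of _ "image_mset v (mset_set {i, j})"]) (simp add: zs_len_def)
qed

lemma kemnitz_prime:
  assumes "prime p"
  shows "forces (zs_len (lat p p) p) (4 * p - 3)"
proof (cases "odd p")
  case True
  show ?thesis
  proof (rule forcesI_eq)
    fix X :: "(int \<times> int) multiset" assume sz: "size X = 4 * p - 3"
    obtain v where v: "X = image_mset v (mset_set {..<size X})" by (rule obtain_indexing)
    obtain A where A: "A \<in> zsub p v {..<size X} p"
      using kemnitz_index[OF assms True, of "{..<size X}" v] sz by auto
    then show "\<exists>T. T \<subseteq># X \<and> zs_len (lat p p) p T"
      using indexed_submset[OF v, of A]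
      by (intro exI[of _ "image_mset v (mset_set A)"]) (auto simp: zs_len_def zsub_def)
  qed
next
  case False
  then have "p = 2" using assms primes_dvd_imp_eq two_is_prime_nat by blast
  then show ?thesis using kemnitz_2 by simp
qed

section \<open>Upper bounds for the constants\<close>

lemma add_on_lat:
  assumes "m > 0"
  shows "add_on (lat m m) (\<lambda>v. (fst v div int m, snd v div int m))"
  unfolding add_on_def by (auto simp: lat_def div_plus_div_distrib_dvd_left zero_prod_def)

lemma add_on_lat_snd: "add_on (lat m m) (\<lambda>v. snd v div int m)"
  unfolding add_on_def by (auto simp: lat_def div_plus_div_distrib_dvd_left)

lemma add_on_mult_of: "add_on (mult_of m) (\<lambda>v. v div int m)"
  unfolding add_on_def by (auto simp: mult_of_def div_plus_div_distrib_dvd_left)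

lemma dvd_mult_div_iff:
  assumes "m > 0" "int m dvd a"
  shows "int (m * n) dvd a \<longleftrightarrow> int n dvd a div int m"
  using assms by (metis dvd_mult_div_cancel int_ops(7) mult_dvd_mono of_nat_0_less_iff dvd_refl
      dvd_mult_cancel1 dvd_times_left_cancel_iff less_irrefl)

lemma lat_mult_iff: "m > 0 \<Longrightarrow> x \<in> lat m m \<Longrightarrow>
    x \<in> lat (m * m') (m * m') \<longleftrightarrow> (fst x div int m, snd x div int m) \<in> lat m' m'"
  using dvd_mult_div_iff[of m "fst x" m'] dvd_mult_div_iff[of m "snd x" m'] by (simp add: lat_def)

lemma lat_snd_iff: "m > 0 \<Longrightarrow> x \<in> lat m m \<Longrightarrow> x \<in> lat m (m * n) \<longleftrightarrow> snd x div int m \<in> mult_of n"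
  using dvd_mult_div_iff[of m "snd x" n] by (simp add: lat_def mult_of_def)

lemma mult_of_iff: "m > 0 \<Longrightarrow> x \<in> mult_of m \<Longrightarrow> x \<in> mult_of (m * n) \<longleftrightarrow> x div int m \<in> mult_of n"
  using dvd_mult_div_iff[of m x n] by (simp add: mult_of_def)

lemma nat_mult_induct [consumes 1, case_names 1 mult]:
  assumes "n > 0" "P 1" "\<And>p m. prime p \<Longrightarrow> m > 0 \<Longrightarrow> P m \<Longrightarrow> P (p * m)"
  shows "P (n :: nat)"
  using assms(1)
proof (induction n rule: less_induct)
  case (less n)
  show ?case
  proof (cases "n = 1")
    case False
    then obtain p where p: "prime p" "p dvd n" using prime_factor_nat by blast
    then obtain m where m: "n = p * m" by (auto elim: dvdE)
    have "m < n" "m > 0" using m less.prems prime_gt_1_nat[OF p(1)] by auto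
    then show ?thesis using less.IH assms(3) p(1) m by blast
  qed (use assms(2) in simp)
qed

theorem egz: "n > 0 \<Longrightarrow> forces (zs_len (mult_of n) n) (2 * n - 1)"
proof (induction n rule: nat_mult_induct)
  case 1
  show ?case
  proof (rule forcesI_eq)
    fix S :: "int multiset" assume "size S = 2 * 1 - 1"
    then show "\<exists>T. T \<subseteq># S \<and> zs_len (mult_of 1) 1 T" by (intro exI[of _ S]) (auto simp: zs_len_def mult_of_def)
  qed
next
  case (mult p m)
  have "p > 1" using mult(1) by (rule prime_gt_1_nat)
  show ?case
  proof (rule forces_zs_len_mult[OF add_on_mult_of _ egz_prime[OF mult(1)] mult(3)])
    show "x \<in> mult_of p \<Longrightarrow> x div int p \<in> mult_of m \<Longrightarrow> x \<in> mult_of (p * m)" for x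
      using mult_of_iff[of p x m] \<open>p > 1\<close> by simp
    show "2 * p - 1 + p * (2 * m - 1) \<le> 2 * (p * m) - 1 + p"
      using \<open>p > 1\<close> mult(2) by (cases m) (auto simp: algebra_simps)
  qed
qed

theorem eta_square: "n > 0 \<Longrightarrow> forces (zs_short (lat n n) n) (3 * n - 2)"
proof (induction n rule: nat_mult_induct)
  case 1
  show ?case
  proof (rule forcesI_eq)
    fix S :: "(int \<times> int) multiset" assume "size S = 3 * 1 - 2"
    then show "\<exists>T. T \<subseteq># S \<and> zs_short (lat 1 1) 1 T" by (intro exI[of _ S]) (auto simp: zs_short_def lat_def)
  qed
next
  case (mult p m)
  have p: "p > 1" using mult(1) by (rule prime_gt_1_nat)
  show ?case
  proof (rule forces_zs_short_mult[OF add_on_lat _ eta_prime[OF mult(1)] mult(3)])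
    show "x \<in> lat p p \<Longrightarrow> (fst x div int p, snd x div int p) \<in> lat m m \<Longrightarrow> x \<in> lat (p * m) (p * m)" for x
      using lat_mult_iff[of p x m] p by simp
    show "3 * p - 2 + p * (3 * m - 2) \<le> 3 * (p * m) - 2 + p"
      using p mult(2) by (cases m) (auto simp: algebra_simps)
  qed (use p in simp)
qed

theorem kemnitz: "n > 0 \<Longrightarrow> forces (zs_len (lat n n) n) (4 * n - 3)"
proof (induction n rule: nat_mult_induct)
  case 1
  show ?case
  proof (rule forcesI_eq)
    fix S :: "(int \<times> int) multiset" assume "size S = 4 * 1 - 3"
    then show "\<exists>T. T \<subseteq># S \<and> zs_len (lat 1 1) 1 T" by (intro exI[of _ S]) (auto simp: zs_len_def lat_def)
  qed
next
  case (mult p m)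
  have p: "p > 1" using mult(1) by (rule prime_gt_1_nat)
  show ?case
  proof (rule forces_zs_len_mult[OF add_on_lat _ kemnitz_prime[OF mult(1)] mult(3)])
    show "x \<in> lat p p \<Longrightarrow> (fst x div int p, snd x div int p) \<in> lat m m \<Longrightarrow> x \<in> lat (p * m) (p * m)" for x
      using lat_mult_iff[of p x m] p by simp
    show "4 * p - 3 + p * (4 * m - 3) \<le> 4 * (p * m) - 3 + p"
      using p mult(2) by (cases m) (auto simp: algebra_simps)
  qed (use p in simp)
qed

lemma prefix_sum_zero:
  fixes xs :: "int list"
  assumes "i < j" "j \<le> length xs" "sum_list (take i xs) mod int n = sum_list (take j xs) mod int n"
  shows "\<exists>T. T \<subseteq># mset xs \<and> T \<noteq> {#} \<and> \<Sum>\<^sub># T \<in> mult_of n"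
proof -
  define ys where "ys = drop i (take j xs)"
  have tk: "take j xs = take i xs @ ys" unfolding ys_def using assms(1)
    by (metis append_take_drop_id less_imp_le min.absorb1 take_take)
  have "mset xs = mset (take i xs) + mset ys + mset (drop j xs)"
    using tk by (metis append_take_drop_id mset_append)
  then have "mset ys \<subseteq># mset xs" by simp
  moreover have "mset ys \<noteq> {#}" using assms(1,2) by (simp add: ys_def)
  moreover have "sum_list (take j xs) - sum_list (take i xs) = sum_list ys" using tk by simp
  then have "int n dvd sum_list ys" using assms(3) by (metis mod_eq_dvd_iff)
  ultimately show ?thesis by (auto simp: mult_of_def sum_mset_sum_list)
qed

text \<open>The n + 1 partial sums, the empty one included, fall into n residue classes.\<close>

lemma eta_cyclic: "n > 0 \<Longrightarrow> forces (zs_short (mult_of n) n) n"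
proof (rule forcesI_eq)
  fix S :: "int multiset" assume n: "n > 0" "size S = n"
  obtain xs where xs: "mset xs = S" by (metis ex_mset)
  then have l: "length xs = n" using n by auto
  let ?f = "\<lambda>i. sum_list (take i xs) mod int n"
  have "?f ` {..n} \<subseteq> {0..<int n}" using n by auto
  then have "card (?f ` {..n}) \<le> card {0..<int n}" by (intro card_mono) auto
  then have "card (?f ` {..n}) < card {..n}" by simp
  then have "\<not> inj_on ?f {..n}" by (rule pigeonhole)
  then obtain i j where "i < j" "j \<le> n" "?f i = ?f j"
    unfolding inj_on_def by (metis atMost_iff linorder_neqE_nat)
  then obtain T where "T \<subseteq># S" "T \<noteq> {#}" "\<Sum>\<^sub># T \<in> mult_of n"
    using prefix_sum_zero[of i j xs n] l xs by auto
  then show "\<exists>T. T \<subseteq># S \<and> zs_short (mult_of n) n T"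
    using n size_mset_mono[of T S] by (intro exI[of _ T]) (auto simp: zs_short_def Suc_le_eq nonempty_has_size)
qed

text \<open>Blocks come from C_m^2 and their sums from C_n: the bound is (3 m - 2) + m (n -
  1).\<close>

theorem eta_rank2:
  assumes "m > 0" "n > 0"
  shows "forces (zs_short (lat m (m * n)) (m * n)) (m * n + 2 * m - 2)"
proof (rule forces_zs_short_mult[OF add_on_lat_snd _ eta_square[OF assms(1)] eta_cyclic[OF assms(2)]])
  show "x \<in> lat m m \<Longrightarrow> snd x div int m \<in> mult_of n \<Longrightarrow> x \<in> lat m (m * n)" for x
    using lat_snd_iff[of m x n] assms by simp
  show "3 * m - 2 + m * n \<le> m * n + 2 * m - 2 + m" using assms by simp
qed

theorem s_rank2:
  assumes "m > 0" "n > 0"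
  shows "forces (zs_len (lat m (m * n)) (m * n)) (2 * (m * n) + 2 * m - 3)"
proof (rule forces_zs_len_mult[OF add_on_lat_snd _ kemnitz[OF assms(1)] egz[OF assms(2)]])
  show "x \<in> lat m m \<Longrightarrow> snd x div int m \<in> mult_of n \<Longrightarrow> x \<in> lat m (m * n)" for x
    using lat_snd_iff[of m x n] assms by simp
  show "4 * m - 3 + m * (2 * n - 1) \<le> 2 * (m * n) + 2 * m - 3 + m"
    using assms by (cases n; cases m) (auto simp: algebra_simps)
qed

section \<open>Exchanging elements in an extremal sequence\<close>

context block_system
begin

text \<open>Each block is stored together with its class, so that the multiset of classes of the
  chosen blocks can be prescribed exactly.\<close>

lemma fibre_selection:
  assumes "\<And>f. m * count T f \<le> count (image_mset h Z) f"
  shows "\<exists>FF. image_mset fst FF = T \<and> (\<forall>(f, B)\<in>#FF. size B = m \<and> (\<forall>x\<in>#B. h x = f)) \<and>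
    \<Sum>\<^sub># (image_mset snd FF) \<subseteq># Z"
  using assms
proof (induction T arbitrary: Z)
  case empty
  then show ?case by (intro exI[of _ "{#}"]) auto
next
  case (add f T)
  have "m \<le> count (image_mset h Z) f" using add.prems[of f] by simp
  then obtain B where B: "B \<subseteq># filter_mset (\<lambda>x. h x = f) Z" "size B = m"
    unfolding count_image_filter by (rule obtain_submset_of_size)
  have f: "\<forall>x\<in>#B. h x = f" using B(1) by (auto dest: mset_subset_eqD)
  have BZ: "B \<subseteq># Z" using B(1) multiset_filter_subset subset_mset.order_trans by blast
  have hB: "image_mset h B = replicate_mset m f" using image_mset_const_on[of B h f] f B(2) by simp
  have "m * count T f' \<le> count (image_mset h (Z - B)) f'" for f'
    using add.prems[of f'] BZ hB by (auto simp: image_mset_Diff split: if_splits)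
  from add.IH[OF this] obtain FF where FF: "image_mset fst FF = T"
    "\<forall>(f, B)\<in>#FF. size B = m \<and> (\<forall>x\<in>#B. h x = f)" "\<Sum>\<^sub># (image_mset snd FF) \<subseteq># Z - B" by blast
  have "B + \<Sum>\<^sub># (image_mset snd FF) \<subseteq># Z"
    using mset_subset_eq_mono_add[OF subset_mset.order_refl[of B] FF(3)] BZ by simp
  then show ?case using FF f B(2) by (intro exI[of _ "add_mset (f, B) FF"]) auto
qed

end

text \<open>An extremal sequence after \<open>class_structure\<close>, treated once for all three
  inverse theorems. \<open>b\<close> turns membership in \<open>N\<close> into divisibility by
  \<open>q\<close>; \<open>good\<close> is extremality over C_q of the \<open>k\<close> block sums
  (\<open>zsfree\<close> or \<open>egzfree\<close>); \<open>good_cancel\<close> says that all but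
  one term of an extremal sequence determine the last modulo \<open>q\<close>.\<close>

locale fibred = block_system P h r m
  for P :: "'v::ab_group_add multiset \<Rightarrow> bool" and h :: "'v \<Rightarrow> 'c" and r m :: nat +
  fixes M N :: "'v set" and b :: "'v \<Rightarrow> int" and q k :: nat and S :: "'v multiset" and F :: "'c set"
    and good :: "int multiset \<Rightarrow> bool"
  assumes M_minus: "\<And>x y. x \<in> M \<Longrightarrow> y \<in> M \<Longrightarrow> x - y \<in> M"
    and b: "add_on M b"
    and N: "\<And>x. x \<in> M \<Longrightarrow> x \<in> N \<longleftrightarrow> int q dvd b x"
    and h: "\<And>x y. h x = h y \<longleftrightarrow> x - y \<in> M"
    and P_sum: "\<And>B. P B \<Longrightarrow> \<Sum>\<^sub># B \<in> M"
    and F: "finite F" "card F = r" "set_mset (image_mset h S) = F"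
      "\<And>f. f \<in> F \<Longrightarrow> m dvd count (image_mset h S) f + 1"
    and size_S: "size S = r * (m - 1) + k * m"
    and good_packing: "\<And>FF. size FF = k \<Longrightarrow> \<forall>B\<in>#FF. P B \<Longrightarrow> \<Sum>\<^sub># FF \<subseteq># S \<Longrightarrow>
      good (image_mset (\<lambda>B. b (\<Sum>\<^sub># B)) FF)"
    and good_cancel: "\<And>c c' U. good (add_mset c U) \<Longrightarrow> good (add_mset c' U) \<Longrightarrow> int q dvd c - c'"
begin

definition s :: "'c \<Rightarrow> nat" where
  "s f = (count (image_mset h S) f + 1) div m"

lemma count_s: "f \<in> F \<Longrightarrow> count (image_mset h S) f = s f * m - 1" and s_pos: "f \<in> F \<Longrightarrow> s f \<ge> 1"
proof -
  assume "f \<in> F"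
  then have eq: "s f * m = count (image_mset h S) f + 1" using F(4) by (simp add: s_def)
  then show "count (image_mset h S) f = s f * m - 1" by simp
  show "s f \<ge> 1" using eq by (cases "s f") auto
qed

text \<open>A fibre of length \<open>s f * m - 1\<close> supports \<open>s f - 1\<close> constant
  blocks, with m - 1 elements to spare; over all fibres this accounts for exactly \<open>k\<close>
  blocks.\<close>

definition blocks :: "'c multiset" where
  "blocks = (\<Sum>f\<in>F. replicate_mset (s f - 1) f)"

lemma count_blocks: "count blocks f = (if f \<in> F then s f - 1 else 0)"
proof -
  have "count blocks f = (\<Sum>f'\<in>F. if f' = f then s f - 1 else 0)"
    unfolding blocks_def count_sum by (intro sum.cong) auto
  then show ?thesis using F(1) by simp
qed

lemma size_blocks: "size blocks = k" "(\<Sum>f\<in>F. s f) = r + k"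
proof -
  have "size S = (\<Sum>f\<in>F. count (image_mset h S) f)"
    using F(3) by (metis size_image_mset size_multiset_overloaded_eq)
  then have "size S + r = (\<Sum>f\<in>F. count (image_mset h S) f + 1)"
    unfolding sum.distrib using F(2) by simp
  also have "\<dots> = (\<Sum>f\<in>F. s f * m)"
    using F(4) by (intro sum.cong) (simp_all add: s_def)
  also have "\<dots> = (\<Sum>f\<in>F. s f) * m" by (simp add: sum_distrib_right)
  finally have "(\<Sum>f\<in>F. s f) * m = r * (m - 1) + r + k * m" using size_S by simp
  also have "\<dots> = (r + k) * m" using m by (cases m) (auto simp: algebra_simps)
  finally show 1: "(\<Sum>f\<in>F. s f) = r + k" using m by simp
  have "size blocks = (\<Sum>f\<in>F. s f - 1)" by (simp add: blocks_def)
  also have "\<dots> = (\<Sum>f\<in>F. s f) - r"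
    using s_pos F(1,2) by (subst sum_subtractf_nat) auto
  finally show "size blocks = k" using 1 by simp
qed

lemma b_diff:
  assumes "x \<in> M" "y \<in> M"
  shows "b (x - y) = b x - b y"
proof -
  have "b ((x - y) + y) = b (x - y) + b y" using b M_minus[OF assms] assms(2) unfolding add_on_def by blast
  then show ?thesis by simp
qed

lemma M0: "0 \<in> M" and M_add: "x \<in> M \<Longrightarrow> y \<in> M \<Longrightarrow> x + y \<in> M"
  using b unfolding add_on_def by auto

lemma N_M_iff: "x \<in> M \<Longrightarrow> y \<in> M \<Longrightarrow> x - y \<in> N \<longleftrightarrow> int q dvd b x - b y"
  using N M_minus b_diff by simp

lemma lifts_agree:
  assumes xy: "{#x, y#} \<subseteq># S" "h x = h y" and sf: "s (h x) \<ge> 2"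
  shows "x - y \<in> N"
proof -
  define f where "f = h x"
  have fF: "f \<in> F" using xy(1) F(3) mset_subset_eqD[of "{#x, y#}" S x] by (auto simp: f_def)
  obtain S1 where S1: "S = {#x, y#} + S1" using xy(1) by (metis subset_mset.add_diff_inverse)
  have cf: "count (image_mset h S1) f = s f * m - 3"
    using count_s[OF fF] S1 xy(2) by (simp add: f_def)
  have "s f * m \<ge> 2 * m" using sf f_def by simp
  then have "count (image_mset h S1) f \<ge> m - 1" using cf m by linarith
  then obtain C where C: "C \<subseteq># filter_mset (\<lambda>x. h x = f) S1" "size C = m - 1"
    unfolding count_image_filter by (rule obtain_submset_of_size)
  have hC: "\<forall>x\<in>#C. h x = f" using C(1) by (auto dest: mset_subset_eqD)
  have CS: "C \<subseteq># S1" using C(1) multiset_filter_subset subset_mset.order_trans by blast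
  then obtain Z where Z: "S1 = C + Z" by (metis subset_mset.add_diff_inverse)
  have iC: "image_mset h C = replicate_mset (m - 1) f" using image_mset_const_on[of C h f] hC C(2) by simp
  have cS: "image_mset h S = replicate_mset (m + 1) f + image_mset h Z"
  proof -
    have "image_mset h S = {#f, f#} + (replicate_mset (m - 1) f + image_mset h Z)"
      using S1 Z iC xy(2) f_def by simp
    then show ?thesis using m by (simp add: multiset_eq_iff)
  qed
  \<comment> \<open>After removal of \<open>x\<close>, \<open>y\<close> and \<open>C\<close> the
    class \<open>f\<close> retains (s f - 1) m - 2 \<ge> (s f - 2) m elements, enough for the other
    blocks of a standard packing.\<close>
  have "m * count (blocks - {#f#}) f' \<le> count (image_mset h Z) f'" for f'
  proof (cases "f' = f")
    case True
    have "count (image_mset h Z) f = s f * m - 1 - (m + 1)" using count_s[OF fF] cS by simp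
    moreover have "m * count (blocks - {#f#}) f = m * (s f - 2)" using fF by (simp add: count_blocks numeral_2_eq_2)
    ultimately show ?thesis using True sf m by (simp add: f_def algebra_simps diff_mult_distrib2 numeral_2_eq_2)
  next
    case False
    then have "count (image_mset h Z) f' = count (image_mset h S) f'" using cS by simp
    then show ?thesis using False count_s[of f'] m
      by (cases "f' \<in> F") (auto simp: count_blocks algebra_simps diff_mult_distrib2)
  qed
  from fibre_selection[OF this] obtain FF where FF: "image_mset fst FF = blocks - {#f#}"
    "\<forall>(f, B)\<in>#FF. size B = m \<and> (\<forall>x\<in>#B. h x = f)" "\<Sum>\<^sub># (image_mset snd FF) \<subseteq># Z" by blast
  have "f \<in># blocks" using fF sf by (simp add: count_blocks f_def flip: count_greater_zero_iff)
  then have "size (blocks - {#f#}) = k - 1" "k \<ge> 1" using size_blocks(1)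
    by (auto simp: size_Diff_singleton Suc_le_eq nonempty_has_size[symmetric])
  then have sFF: "Suc (size FF) = k" using arg_cong[OF FF(1), of size] by simp
  have PFF: "\<forall>B\<in>#image_mset snd FF. P B"
  proof
    fix B assume "B \<in># image_mset snd FF"
    then obtain f' where "(f', B) \<in># FF" by auto
    then have "size B = m" "\<forall>x\<in>#B. h x = f'" using FF(2) by auto
    then show "P B" by (rule const)
  qed
  have gd: "P (add_mset z C)" "good (add_mset (b (\<Sum>\<^sub># (add_mset z C))) (image_mset (\<lambda>B. b (\<Sum>\<^sub># B)) (image_mset snd FF)))"
    if "z = x \<or> z = y" for z
  proof -
    have "h z = f" using that xy(2) f_def by auto
    then show Pz: "P (add_mset z C)" using hC C(2) m by (intro const[of _ f]) auto
    have "add_mset z C + \<Sum>\<^sub># (image_mset snd FF) \<subseteq># S"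
    proof -
      have "{#z#} \<subseteq># {#x, y#}" using that by auto
      then have "{#z#} + (C + \<Sum>\<^sub># (image_mset snd FF)) \<subseteq># {#x, y#} + (C + Z)"
        using FF(3) by (intro mset_subset_eq_mono_add) auto
      then show ?thesis using S1 Z by simp
    qed
    then show "good (add_mset (b (\<Sum>\<^sub># (add_mset z C))) (image_mset (\<lambda>B. b (\<Sum>\<^sub># B)) (image_mset snd FF)))"
      using good_packing[of "add_mset (add_mset z C) (image_mset snd FF)"] sFF PFF Pz by simp
  qed
  \<comment> \<open>The two packings differ in one element, so their sequences of block sums differ
    in one term.\<close>
  have "int q dvd b (\<Sum>\<^sub># (add_mset x C)) - b (\<Sum>\<^sub># (add_mset y C))"
    by (rule good_cancel[OF gd(2)[of x] gd(2)[of y]]) simp_all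
  then have "\<Sum>\<^sub># (add_mset x C) - \<Sum>\<^sub># (add_mset y C) \<in> N"
    using N_M_iff[OF P_sum[OF gd(1)[of x]] P_sum[OF gd(1)[of y]]] by simp
  then show ?thesis by simp
qed

lemma N_add:
  assumes "N \<subseteq> M" "x \<in> N" "y \<in> N"
  shows "x + y \<in> N"
proof -
  have xy: "x \<in> M" "y \<in> M" using assms by auto
  then have "b (x + y) = b x + b y" using b unfolding add_on_def by blast
  then show ?thesis using N[OF xy(1)] N[OF xy(2)] N[OF M_add[OF xy]] assms(2,3) by simp
qed

lemma sum_mset_diff_N:
  assumes "N \<subseteq> M" "\<forall>x\<in>#B. x - g \<in> N"
  shows "\<Sum>\<^sub># B - \<Sum>\<^sub># (replicate_mset (size B) g) \<in> N"
  using assms(2)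
proof (induction B)
  case empty
  have "0 \<in> N" using N[OF M0] b by (simp add: add_on_def)
  then show ?case by simp
next
  case (add x B)
  have "(x - g) + (\<Sum>\<^sub># B - \<Sum>\<^sub># (replicate_mset (size B) g)) \<in> N"
    using add by (intro N_add assms(1)) auto
  then show ?case by (simp add: algebra_simps)
qed

lemma lifts_agree':
  assumes "x \<in># S" "y \<in># S" "h x = h y" "s (h x) \<ge> 2"
  shows "x - y \<in> N"
proof (cases "x = y")
  case True
  then show ?thesis using N[OF M0] b by (simp add: add_on_def)
next
  case False
  then have "y \<in># S - {#x#}" using assms(2) by (simp add: in_diff_count)
  then have "{#x, y#} \<subseteq># S" using assms(1) by (simp add: insert_subset_eq_iff)
  then show ?thesis using assms(3,4) by (rule lifts_agree)
qed

definition weight :: "('c \<Rightarrow> 'v) \<Rightarrow> 'c \<Rightarrow> int" where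
  "weight g f = b (\<Sum>\<^sub># (replicate_mset m (g f)))"

lemma block_sum_in_M:
  assumes "h y = f"
  shows "\<Sum>\<^sub># (replicate_mset m y) \<in> M"
  using assms by (intro P_sum const[of _ f]) auto

text \<open>Only classes with \<open>s f \<ge> 2\<close> occur among the blocks, and there
  \<open>lifts_agree'\<close> makes the block sum modulo \<open>q\<close> independent of the chosen
  elements. Extremality thus becomes a statement about the weights alone.\<close>

lemma good_standard_packing:
  assumes NM: "N \<subseteq> M" and g: "\<And>f. f \<in> F \<Longrightarrow> g f \<in># S \<and> h (g f) = f"
  obtains U where "good U" "image_mset (\<lambda>x. x mod int q) U = image_mset (\<lambda>f. weight g f mod int q) blocks"
proof -
  have "m * count blocks f \<le> count (image_mset h S) f" for f
    using count_s[of f] m by (cases "f \<in> F") (auto simp: count_blocks algebra_simps diff_mult_distrib2)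
  from fibre_selection[OF this] obtain FF where FF: "image_mset fst FF = blocks"
    "\<forall>(f, B)\<in>#FF. size B = m \<and> (\<forall>x\<in>#B. h x = f)" "\<Sum>\<^sub># (image_mset snd FF) \<subseteq># S" by blast
  have FFb: "P B \<and> [b (\<Sum>\<^sub># B) = weight g f] (mod int q)" if fB: "(f, B) \<in># FF" for f B
  proof -
    have B: "size B = m" "\<forall>x\<in>#B. h x = f" using FF(2) fB by auto
    have "f \<in># image_mset fst FF" using fB by force
    then have "count blocks f > 0" unfolding FF(1) by simp
    then have f: "f \<in> F" "s f \<ge> 2" unfolding count_blocks by (auto split: if_splits)
    have "B \<in># image_mset snd FF" using fB by force
    then have "B \<subseteq># S" using FF(3) sum_mset_mono_submset[of "{#B#}" "image_mset snd FF"]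
      by (auto intro: subset_mset.order_trans)
    then have "\<forall>x\<in>#B. x - g f \<in> N"
      using lifts_agree'[of _ "g f"] B(2) g[OF f(1)] f(2) by (auto dest: mset_subset_eqD)
    from sum_mset_diff_N[OF NM this]
    have d: "\<Sum>\<^sub># B - \<Sum>\<^sub># (replicate_mset m (g f)) \<in> N" using B(1) by simp
    have P: "P B" by (rule const[OF B])
    have "int q dvd b (\<Sum>\<^sub># B) - b (\<Sum>\<^sub># (replicate_mset m (g f)))"
      using N_M_iff[OF P_sum[OF P] block_sum_in_M[of "g f" f]] g[OF f(1)] d by simp
    then show ?thesis using P by (simp add: weight_def cong_iff_dvd_diff)
  qed
  have "good (image_mset (\<lambda>B. b (\<Sum>\<^sub># B)) (image_mset snd FF))"
  proof (rule good_packing)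
    show "size (image_mset snd FF) = k" using arg_cong[OF FF(1), of size] size_blocks(1) by simp
    show "\<forall>B\<in>#image_mset snd FF. P B" using FFb by auto
  qed (rule FF(3))
  moreover have "image_mset (\<lambda>x. x mod int q) (image_mset (\<lambda>B. b (\<Sum>\<^sub># B)) (image_mset snd FF)) =
    image_mset (\<lambda>f. weight g f mod int q) blocks"
    unfolding FF(1)[symmetric] multiset.map_comp comp_def
    using FFb by (intro image_mset_cong) (auto simp: cong_def)
  ultimately show thesis by (rule that)
qed

lemma partition_fibres: "S = (\<Sum>f\<in>F. filter_mset (\<lambda>x. h x = f) S)"
proof (rule multiset_eqI)
  fix a
  have "count (\<Sum>f\<in>F. filter_mset (\<lambda>x. h x = f) S) a = (\<Sum>f\<in>F. if f = h a then count S a else 0)"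
    unfolding count_sum by (intro sum.cong) auto
  also have "\<dots> = (if h a \<in> F then count S a else 0)" using F(1) by simp
  also have "\<dots> = count S a" using F(3) by (auto simp: not_in_iff)
  finally show "count S a = count (\<Sum>f\<in>F. filter_mset (\<lambda>x. h x = f) S) a" by simp
qed

lemma size_fibre: "f \<in> F \<Longrightarrow> size (filter_mset (\<lambda>x. h x = f) S) = s f * m - 1"
  using count_s by (simp add: count_image_filter)

text \<open>A block meeting every class less than \<open>m\<close> times leaves a standard packing intact.\<close>

lemma packing_of_sparse_block:
  assumes T: "T \<subseteq># S" "P T" and sparse: "\<And>f. count (image_mset h T) f < m"
  shows "packing P (Suc k) S"
proof -
  have "m * count blocks f \<le> count (image_mset h (S - T)) f" for f
  proof (cases "f \<in> F")
    case True
    have "count (image_mset h (S - T)) f = s f * m - 1 - count (image_mset h T) f"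
      using T(1) count_s[OF True] by (simp add: image_mset_Diff)
    moreover have "m * (s f - 1) + m = s f * m" using s_pos[OF True] by (cases "s f") auto
    ultimately show ?thesis using sparse[of f] True by (simp add: count_blocks)
  qed (simp add: count_blocks)
  from fibre_selection[OF this] obtain FF where FF: "image_mset fst FF = blocks"
    "\<forall>(f, B)\<in>#FF. size B = m \<and> (\<forall>x\<in>#B. h x = f)" "\<Sum>\<^sub># (image_mset snd FF) \<subseteq># S - T" by blast
  have "\<forall>B\<in>#image_mset snd FF. P B"
  proof
    fix B assume "B \<in># image_mset snd FF"
    then obtain f' where "(f', B) \<in># FF" by auto
    then have "size B = m" "\<forall>x\<in>#B. h x = f'" using FF(2) by auto
    then show "P B" by (rule const)
  qed
  moreover have "size (image_mset snd FF) = k" using arg_cong[OF FF(1), of size] size_blocks(1) by simp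
  ultimately have "packing P k (S - T)" unfolding packing_def using FF(3) by blast
  with T show ?thesis by (rule packing_SucI)
qed

end

section \<open>Inverse theorems for cyclic groups\<close>

definition zsfree :: "nat \<Rightarrow> int multiset \<Rightarrow> bool" where
  "zsfree n X \<longleftrightarrow> size X = n - 1 \<and> (\<forall>T. T \<subseteq># X \<longrightarrow> T \<noteq> {#} \<longrightarrow> \<Sum>\<^sub># T \<notin> mult_of n)"

definition egzfree :: "nat \<Rightarrow> int multiset \<Rightarrow> bool" where
  "egzfree n X \<longleftrightarrow> size X = 2 * n - 2 \<and> \<not> (\<exists>T. T \<subseteq># X \<and> zs_len (mult_of n) n T)"

lemma sum_mset_const_cong:
  assumes "\<forall>x\<in>#B. x mod int n = v mod int n"
  shows "[\<Sum>\<^sub># B = int (size B) * v] (mod int n)"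
  using assms
proof (induction B)
  case (add x B)
  have "[x + \<Sum>\<^sub># B = v + int (size B) * v] (mod int n)"
    using add by (intro cong_add) (auto simp: cong_def)
  then show ?case by (simp add: algebra_simps)
qed simp

text \<open>Suppose x and g are incongruent and order the sequence as x, g, and the rest. Its n
  partial sums are distinct, hence represent every residue, in particular that of g. But g can be
  neither the empty sum, nor x, nor a longer sum, from which g itself could be cancelled to leave a
  zero-sum.\<close>

lemma zsfree_constant:
  assumes n: "n \<ge> 2" and X: "zsfree n X"
  obtains g where "coprime g (int n)" "\<forall>x\<in>#X. x mod int n = g mod int n"
proof -
  have sz: "size X = n - 1" and free: "\<And>T. T \<subseteq># X \<Longrightarrow> T \<noteq> {#} \<Longrightarrow> \<not> int n dvd \<Sum>\<^sub># T"
    using X unfolding zsfree_def mult_of_def by auto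
  have "X \<noteq> {#}" using sz n by auto
  then obtain g where g: "g \<in># X" by (rule multiset_nonemptyE)
  have const: "x mod int n = g mod int n" if x: "x \<in># X" for x
  proof (rule ccontr)
    assume ne: "x mod int n \<noteq> g mod int n"
    then have "x \<noteq> g" by auto
    obtain Y0 where Y0: "X = add_mset g Y0" using g by (metis insert_DiffM)
    then have "x \<in># Y0" using x \<open>x \<noteq> g\<close> by auto
    then obtain Y where "Y0 = add_mset x Y" by (metis insert_DiffM)
    then have Y: "X = {#x, g#} + Y" using Y0 by simp
    obtain ys where ys: "mset ys = Y" by (metis ex_mset)
    define xs where "xs = x # g # ys"
    have xs: "mset xs = X" "length xs = n - 1" using Y ys sz by (auto simp: xs_def)
    let ?f = "\<lambda>i. sum_list (take i xs) mod int n"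
    have inj: "inj_on ?f {..<n}"
    proof (rule inj_onI, rule ccontr)
      fix i j assume ij: "i \<in> {..<n}" "j \<in> {..<n}" "?f i = ?f j" "i \<noteq> j"
      have "\<exists>T. T \<subseteq># mset xs \<and> T \<noteq> {#} \<and> \<Sum>\<^sub># T \<in> mult_of n"
      proof (cases "i < j")
        case True
        then show ?thesis using ij xs(2) by (intro prefix_sum_zero[of i j]) auto
      next
        case False
        then show ?thesis using ij xs(2) by (intro prefix_sum_zero[of j i]) auto
      qed
      then show False using free xs(1) by (auto simp: mult_of_def)
    qed
    have "?f ` {..<n} \<subseteq> {0..<int n}" using n by auto
    moreover have "card (?f ` {..<n}) = card {0..<int n}" using inj by (simp add: card_image)
    ultimately have "?f ` {..<n} = {0..<int n}" by (intro card_subset_eq) auto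
    moreover have "g mod int n \<in> {0..<int n}" using n by simp
    ultimately have "g mod int n \<in> ?f ` {..<n}" by (simp only:)
    then obtain i where "g mod int n = ?f i" "i \<in> {..<n}" by (rule imageE)
    then have i: "i < n" "?f i = g mod int n" by simp_all
    consider "i = 0" | "i = 1" | j where "i = Suc (Suc j)" by (metis One_nat_def not0_implies_Suc)
    then show False
    proof cases
      case 1
      then have "int n dvd \<Sum>\<^sub># {#g#}" using i by auto
      then show False using free[of "{#g#}"] g by auto
    next
      case 2
      then show False using i ne by (simp add: xs_def)
    next
      case 3
      have "\<Sum>\<^sub># (mset (x # take j ys)) = sum_list (take i xs) - g"
        unfolding sum_mset_sum_list by (simp add: xs_def 3)
      then have "int n dvd \<Sum>\<^sub># (mset (x # take j ys))" using i(2) by (metis mod_eq_dvd_iff)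
      moreover have "mset (take j ys) \<subseteq># mset ys"
        by (metis append_take_drop_id mset_append mset_subset_eq_add_left)
      then have "mset (x # take j ys) \<subseteq># X" 
        using Y ys subset_mset.order_trans[OF _ mset_subset_eq_add_left[of Y "{#g#}"]] by simp
      ultimately show False using free by force
    qed
  qed
  \<comment> \<open>Otherwise n div d terms, with d the gcd, form a zero-sum, and n div d is at most
    n - 1.\<close>
  have "coprime g (int n)"
  proof (rule ccontr)
    assume "\<not> coprime g (int n)"
    define d where "d = nat (gcd g (int n))"
    have d: "int d = gcd g (int n)" by (simp add: d_def)
    have "d \<noteq> 1" using \<open>\<not> coprime g (int n)\<close> d coprime_iff_gcd_eq_1 by (metis of_nat_1)
    moreover have "d > 0" using n d by (simp add: d_def)
    ultimately have "d \<ge> 2" by simp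
    have "int d dvd int n" unfolding d by simp
    then have dn: "d dvd n" by (simp only: int_dvd_int_iff)
    have "n div d \<le> n div 2" using \<open>d \<ge> 2\<close> by (simp add: div_le_mono2)
    also have "\<dots> \<le> n - 1" using n by simp
    finally have "n div d \<le> size X" using sz by simp
    then obtain T where T: "T \<subseteq># X" "size T = n div d" by (rule obtain_submset_of_size)
    have "\<forall>x\<in>#T. x mod int n = g mod int n" using const T(1) by (auto dest: mset_subset_eqD)
    then have "[\<Sum>\<^sub># T = int (n div d) * g] (mod int n)" using sum_mset_const_cong T(2) by metis
    moreover have "int n dvd int (n div d) * g"
    proof -
      have "int d dvd g" unfolding d by simp
      then obtain c where c: "g = int d * c" by (rule dvdE)
      have "int (n div d) * g = int (n div d * d) * c" by (simp add: c)
      also have "n div d * d = n" using dn by simp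
      finally show ?thesis by simp
    qed
    ultimately have "int n dvd \<Sum>\<^sub># T" by (simp add: cong_dvd_iff)
    moreover have "n div d > 0" using dn \<open>d > 0\<close> n by (simp add: dvd_imp_le div_greater_zero_iff)
    then have "T \<noteq> {#}" using T(2) by auto
    ultimately show False using free T(1) by blast
  qed
  then show thesis using that const by blast
qed

text \<open>For n \<ge> 3 the common part \<open>U\<close> is nonempty and fixes the constant
  residue; for n = 2 both terms are odd.\<close>

lemma zsfree_cancel:
  assumes "n \<ge> 2" "zsfree n (add_mset c U)" "zsfree n (add_mset c' U)"
  shows "int n dvd c - c'"
proof (cases "U = {#}")
  case True
  then have "1 = n - 1" using assms(2) by (simp add: zsfree_def)
  then have "n = 2" using assms(1) by linarith
  moreover have "odd c" "odd c'"
    using assms(2,3)[unfolded zsfree_def] \<open>n = 2\<close> True by (auto simp: mult_of_def)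
  ultimately show ?thesis by simp
next
  case False
  then obtain u where u: "u \<in># U" by (rule multiset_nonemptyE)
  obtain g where "\<forall>x\<in>#add_mset c U. x mod int n = g mod int n" using zsfree_constant assms by metis
  moreover obtain g' where "\<forall>x\<in>#add_mset c' U. x mod int n = g' mod int n" using zsfree_constant assms by metis
  ultimately have "c mod int n = c' mod int n" using u by (metis insert_iff set_mset_add_mset_insert)
  then show ?thesis by (simp add: mod_eq_dvd_iff)
qed

lemma egzfree_count:
  assumes "egzfree n X" "n > 0"
  shows "count (image_mset (\<lambda>x. x mod int n) X) v < n"
proof (rule ccontr)
  assume "\<not> ?thesis"
  then have "size (filter_mset (\<lambda>x. x mod int n = v) X) \<ge> n" by (simp add: count_image_filter)
  then obtain T where T: "T \<subseteq># filter_mset (\<lambda>x. x mod int n = v) X" "size T = n"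
    by (rule obtain_submset_of_size)
  have "\<forall>x\<in>#T. x mod int n = v" using T(1) by (auto dest: mset_subset_eqD)
  then have "\<forall>x\<in>#T. x mod int n = v mod int n" by (metis mod_mod_trivial)
  then have "[\<Sum>\<^sub># T = int n * v] (mod int n)" using sum_mset_const_cong T(2) by metis
  then have "int n dvd \<Sum>\<^sub># T" by (simp add: cong_dvd_iff)
  moreover have "T \<subseteq># X" using T(1) multiset_filter_subset subset_mset.order_trans by blast
  ultimately show False using assms(1) T(2) by (auto simp: egzfree_def zs_len_def mult_of_def)
qed

definition inverse_egz :: "nat \<Rightarrow> bool" where
  "inverse_egz n \<longleftrightarrow> (\<forall>X. egzfree n X \<longrightarrow> (\<exists>T. image_mset (\<lambda>x. x mod int n) X = repeat_mset (n - 1) T))"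

lemma inverse_egz_count:
  assumes "inverse_egz n" "egzfree n X" "n \<ge> 2"
  shows "count (image_mset (\<lambda>x. x mod int n) X) v \<in> {0, n - 1}"
proof -
  obtain T where T: "image_mset (\<lambda>x. x mod int n) X = repeat_mset (n - 1) T"
    using assms unfolding inverse_egz_def by blast
  have "count T v \<le> 1"
  proof (rule ccontr)
    assume "\<not> ?thesis"
    then have "(n - 1) * 2 \<le> (n - 1) * count T v" by (intro mult_le_mono2) simp
    then have "(n - 1) * count T v \<ge> n" using assms(3) by linarith
    then show False using egzfree_count[OF assms(2), of v] assms(3) T by simp
  qed
  then have "count T v = 0 \<or> count T v = 1" by auto
  then show ?thesis unfolding T by auto
qed

text \<open>For n \<ge> 3 all multiplicities are 0 or n - 1, and replacing one term by an
  incongruent one would turn n - 1 into n - 2. For n = 2 parity decides.\<close>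

lemma egzfree_cancel:
  assumes inv: "inverse_egz n" and n: "n \<ge> 2"
    and c: "egzfree n (add_mset c U)" and c': "egzfree n (add_mset c' U)"
  shows "int n dvd c - c'"
proof (cases "n = 2")
  case True
  have sU: "size U = 1" using c True by (simp add: egzfree_def)
  have "odd (\<Sum>\<^sub># (add_mset z U))" if "egzfree n (add_mset z U)" for z
  proof -
    have "\<not> zs_len (mult_of n) n (add_mset z U)" using that unfolding egzfree_def by blast
    then show ?thesis using sU True by (simp add: zs_len_def mult_of_def)
  qed
  from this[OF c] this[OF c'] show ?thesis using True by simp
next
  case False
  show ?thesis
  proof (rule ccontr)
    assume "\<not> ?thesis"
    then have ne: "c mod int n \<noteq> c' mod int n" by (simp add: mod_eq_dvd_iff)
    have "count (image_mset (\<lambda>x. x mod int n) (add_mset c U)) (c mod int n) = n - 1"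
      using inverse_egz_count[OF inv c n, of "c mod int n"] by auto
    moreover have "count (image_mset (\<lambda>x. x mod int n) (add_mset c' U)) (c mod int n) \<in> {0, n - 1}"
      by (rule inverse_egz_count[OF inv c' n])
    ultimately show False using ne False n by auto
  qed
qed

text \<open>If one class is repeated \<open>n - 1\<close> times, translate it to \<open>0\<close>; the remaining \<open>n - 1\<close> elements
  are then zero-sum free.\<close>

lemma inverse_egz_of_count:
  assumes n: "n \<ge> 2" and X: "egzfree n X"
    and cnt: "count (image_mset (\<lambda>x. x mod int n) X) (a mod int n) = n - 1"
  shows "\<exists>T. image_mset (\<lambda>x. x mod int n) X = repeat_mset (n - 1) T"
proof -
  let ?P = "\<lambda>x. x mod int n = a mod int n"
  define A where "A = filter_mset ?P X"
  define Y where "Y = filter_mset (\<lambda>x. \<not> ?P x) X"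
  have XAY: "X = A + Y" unfolding A_def Y_def by (rule multiset_partition)
  have sA: "size A = n - 1" using cnt by (simp add: A_def count_image_filter)
  have "size X = 2 * n - 2" using X by (simp add: egzfree_def)
  then have sY: "size Y = n - 1" using XAY sA n by simp
  have cA: "\<forall>x\<in>#A. ?P x" by (simp add: A_def)
  have "zsfree n (image_mset (\<lambda>y. y - a) Y)"
    unfolding zsfree_def
  proof (intro conjI allI impI notI)
    show "size (image_mset (\<lambda>y. y - a) Y) = n - 1" using sY by simp
    fix T assume T: "T \<subseteq># image_mset (\<lambda>y. y - a) Y" "T \<noteq> {#}" "\<Sum>\<^sub># T \<in> mult_of n"
    obtain T' where T': "T' \<subseteq># Y" "image_mset (\<lambda>y. y - a) T' = T" using T(1) by (rule submset_image_msetE)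
    have "T' \<noteq> {#}" using T' T(2) by auto
    then have t: "size T' \<ge> 1" "size T' \<le> n - 1"
      using size_mset_mono[OF T'(1)] sY by (auto simp: Suc_le_eq nonempty_has_size)
    then have "n - size T' \<le> size A" using sA by simp
    then obtain A' where A': "A' \<subseteq># A" "size A' = n - size T'" by (rule obtain_submset_of_size)
    have "\<forall>x\<in>#A'. ?P x" using cA A'(1) by (auto dest: mset_subset_eqD)
    then have 1: "[\<Sum>\<^sub># A' = int (size A') * a] (mod int n)" by (rule sum_mset_const_cong)
    have "\<Sum>\<^sub># (image_mset (\<lambda>y. y - a) T') = \<Sum>\<^sub># T' - int (size T') * a"
      by (induction T') (auto simp: algebra_simps)
    then have "[\<Sum>\<^sub># T' = int (size T') * a] (mod int n)"
      using T(3) T'(2) by (simp add: mult_of_def cong_iff_dvd_diff)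
    then have "[\<Sum>\<^sub># (A' + T') = int (size A') * a + int (size T') * a] (mod int n)"
      using 1 by (simp add: cong_add)
    also have "int (size A') * a + int (size T') * a = int n * a"
      using A'(2) t n by (simp add: of_nat_diff algebra_simps)
    finally have "int n dvd \<Sum>\<^sub># (A' + T')" by (simp add: cong_dvd_iff)
    moreover have "A' + T' \<subseteq># X" unfolding XAY using A'(1) T'(1) by (rule mset_subset_eq_mono_add)
    moreover have "size (A' + T') = n" using A'(2) t n by simp
    ultimately show False using X unfolding egzfree_def zs_len_def mult_of_def by blast
  qed
  then obtain g where g: "\<forall>x\<in>#image_mset (\<lambda>y. y - a) Y. x mod int n = g mod int n"
    using zsfree_constant[OF n] by metis
  have "x mod int n = (g + a) mod int n" if "x \<in># Y" for x
  proof -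
    have "(x - a) mod int n = g mod int n" using g that by simp
    then have "[(x - a) + a = g + a] (mod int n)" by (intro cong_add) (auto simp: cong_def)
    then show ?thesis by (simp add: cong_def)
  qed
  then have "image_mset (\<lambda>x. x mod int n) Y = replicate_mset (n - 1) ((g + a) mod int n)"
    using image_mset_const_on[of Y _ "(g + a) mod int n"] sY by simp
  moreover have "image_mset (\<lambda>x. x mod int n) A = replicate_mset (n - 1) (a mod int n)"
    using image_mset_const_on[of A _ "a mod int n"] cA sA by simp
  ultimately have "image_mset (\<lambda>x. x mod int n) X = repeat_mset (n - 1) {#a mod int n, (g + a) mod int n#}"
    unfolding XAY by (simp add: multiset_eq_iff)
  then show ?thesis by blast
qed

section \<open>The inverse Erdos-Ginzburg-Ziv theorem for primes\<close>

lemma residue_eq: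
  "a \<in> {0..<n} \<Longrightarrow> b \<in> {0..<n} \<Longrightarrow> a mod n = b mod n \<Longrightarrow> a = (b :: int)"
  by simp

text \<open>Cauchy-Davenport for a two-element set: if the union is no larger than \<open>B\<close>,
  the two translates coincide, so \<open>B\<close> is invariant under y - x, which generates the
  integers modulo \<open>p\<close>, and \<open>B\<close> is everything.\<close>

lemma shift_union_card:
  fixes B :: "int set"
  assumes p: "prime p" and B: "B \<subseteq> {0..<int p}" "B \<noteq> {}" and d: "\<not> int p dvd y - x"
  shows "card ((\<lambda>b. (b + x) mod int p) ` B \<union> (\<lambda>b. (b + y) mod int p) ` B) \<ge> min p (card B + 1)"
proof (rule ccontr)
  assume "\<not> ?thesis"
  then have small: "card ((\<lambda>b. (b + x) mod int p) ` B \<union> (\<lambda>b. (b + y) mod int p) ` B) < min p (card B + 1)"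
    by (simp only: not_le)
  have p0: "int p > 0" using prime_gt_0_nat[OF p] by simp
  have fin: "finite B" using B(1) finite_subset by blast
  have inj: "inj_on (\<lambda>b. (b + z) mod int p) B" for z
  proof (rule inj_onI)
    fix a b assume ab: "a \<in> B" "b \<in> B" "(a + z) mod int p = (b + z) mod int p"
    then have "[a = b] (mod int p)" by (metis cong_add_rcancel cong_def)
    then show "a = b" using ab B(1) unfolding cong_def by (intro residue_eq[of a "int p" b]) auto
  qed
  have cB: "card ((\<lambda>b. (b + z) mod int p) ` B) = card B" for z using inj by (rule card_image)
  let ?f = "\<lambda>z. (\<lambda>b. (b + z) mod int p) ` B"
  have sub: "?f z = ?f x \<union> ?f y" if z: "z = x \<or> z = y" for z
  proof (rule card_subset_eq)
    show "finite (?f x \<union> ?f y)" using fin by simp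
    show s: "?f z \<subseteq> ?f x \<union> ?f y" using z by blast
    have "card (?f z) \<le> card (?f x \<union> ?f y)" using fin by (intro card_mono s) simp
    moreover have "card (?f x \<union> ?f y) < card B + 1" using small by linarith
    ultimately show "card (?f z) = card (?f x \<union> ?f y)" using cB[of z] by linarith
  qed
  have eq: "?f x = ?f y" using sub[of x] sub[of y] by simp
  have step: "(b + (y - x)) mod int p \<in> B" if "b \<in> B" for b
  proof -
    have "(b + y) mod int p \<in> (\<lambda>b. (b + x) mod int p) ` B" using eq that by blast
    then obtain b' where b': "b' \<in> B" "(b + y) mod int p = (b' + x) mod int p" by blast
    then have "[b + y = b' + x] (mod int p)" by (simp add: cong_def)
    then have "[b + (y - x) = b'] (mod int p)" by (simp add: cong_iff_dvd_diff algebra_simps)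
    then show ?thesis using b'(1) B(1) by (auto simp: cong_def)
  qed
  obtain b0 where b0: "b0 \<in> B" using B(2) by blast
  have steps: "(b0 + int j * (y - x)) mod int p \<in> B" for j :: nat
  proof (induction j)
    case 0
    then show ?case using b0 B(1) by auto
  next
    case (Suc j)
    have "((b0 + int j * (y - x)) mod int p + (y - x)) mod int p \<in> B" using step Suc by blast
    moreover have "((b0 + int j * (y - x)) mod int p + (y - x)) mod int p =
      (b0 + int (Suc j) * (y - x)) mod int p"
      by (simp only: mod_add_left_eq) (simp add: algebra_simps)
    ultimately show ?case by (simp only:)
  qed
  have "coprime (y - x) (int p)" using d p by (metis coprime_commute prime_imp_coprime prime_nat_int_transfer)
  then obtain e where e: "[(y - x) * e = 1] (mod int p)" by (metis cong_solve_coprime_int)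
  have "c \<in> B" if c: "c \<in> {0..<int p}" for c
  proof -
    define j where "j = nat ((e * (c - b0)) mod int p)"
    have j: "int j = (e * (c - b0)) mod int p" using p0 by (simp add: j_def)
    have "[int j * (y - x) = (e * (c - b0)) * (y - x)] (mod int p)"
      unfolding j by (intro cong_mult) (auto simp: cong_def)
    also have "[(e * (c - b0)) * (y - x) = 1 * (c - b0)] (mod int p)"
      using cong_mult[OF e cong_refl[of "c - b0"]] by (simp add: mult_ac)
    finally have "[b0 + int j * (y - x) = b0 + (c - b0)] (mod int p)" by (intro cong_add) auto
    then have "(b0 + int j * (y - x)) mod int p = c" using c by (simp add: cong_def)
    then show ?thesis using steps[of j] by simp
  qed
  then have "B = {0..<int p}" using B(1) by auto
  then have "card B = p" by simp
  moreover have "card B \<le> card ((\<lambda>b. (b + x) mod int p) ` B \<union> (\<lambda>b. (b + y) mod int p) ` B)"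
    using cB[of x] fin by (metis Un_upper1 card_mono finite_UnI finite_imageI)
  ultimately show False using small by simp
qed

definition shifted_sums :: "nat \<Rightarrow> int set \<Rightarrow> nat \<Rightarrow> int multiset \<Rightarrow> int set" where
  "shifted_sums p B j X = {(b + \<Sum>\<^sub># T) mod int p |b T. b \<in> B \<and> T \<subseteq># X \<and> size T = j}"

lemma finite_shifted_sums: "p > 0 \<Longrightarrow> finite (shifted_sums p B j X)"
  by (rule finite_subset[of _ "{0..<int p}"]) (auto simp: shifted_sums_def)

text \<open>Pairing the elements of \<open>X\<close> into \<open>k\<close> pairs of distinct elements and two singletons,
  every pair enlarges the set of sums.\<close>

lemma card_shifted_sums:
  assumes p: "prime p" and X: "set_mset X \<subseteq> {0..<int p}" "size X = 2 * k + 2" "\<And>x. count X x \<le> k + 2"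
    and B: "B \<subseteq> {0..<int p}" "B \<noteq> {}"
  shows "card (shifted_sums p B (k + 2) X) \<ge> min p (card B + k)"
  using X B
proof (induction k arbitrary: X B)
  case 0
  have "inj_on (\<lambda>b. (b + \<Sum>\<^sub># X) mod int p) B"
  proof (rule inj_onI)
    fix a b assume ab: "a \<in> B" "b \<in> B" "(a + \<Sum>\<^sub># X) mod int p = (b + \<Sum>\<^sub># X) mod int p"
    then have "[a = b] (mod int p)" by (metis cong_add_rcancel cong_def)
    then show "a = b" using ab 0(4) unfolding cong_def by (intro residue_eq[of a "int p" b]) auto
  qed
  then have "card ((\<lambda>b. (b + \<Sum>\<^sub># X) mod int p) ` B) = card B" by (rule card_image)
  moreover have "(\<lambda>b. (b + \<Sum>\<^sub># X) mod int p) ` B \<subseteq> shifted_sums p B (0 + 2) X"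
    using 0(2) by (auto simp: shifted_sums_def)
  ultimately show ?case using finite_shifted_sums prime_gt_0_nat[OF p] by (metis add_0_right card_mono min.coboundedI2)
next
  case (Suc k)
  have ne: "X \<noteq> {#}" using Suc.prems(2) by auto
  \<comment> \<open>The removed pair contains a most frequent element: if another element kept
    multiplicity k + 3, so would this one, and 2 (k + 3) exceeds the size 2 k + 4.\<close>
  have "\<exists>x\<in>#X. \<forall>y\<in>#X. count X y \<le> count X x"
  proof -
    have "Max (count X ` set_mset X) \<in> count X ` set_mset X" using ne by (intro Max_in) auto
    then obtain x where "x \<in># X" "count X x = Max (count X ` set_mset X)" by auto
    then show ?thesis by (intro bexI[of _ x]) auto
  qed
  then obtain x where x: "x \<in># X" "\<And>y. y \<in># X \<Longrightarrow> count X y \<le> count X x" by blast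
  have "\<exists>y\<in>#X. y \<noteq> x"
  proof (rule ccontr)
    assume "\<not> ?thesis"
    then have "X = replicate_mset (size X) x" using image_mset_const_on[of X "\<lambda>x. x" x] by auto
    then have "count X x = size X" by (metis count_replicate_mset)
    then show False using Suc.prems(2) Suc.prems(3)[of x] by simp
  qed
  then obtain y where y: "y \<in># X" "y \<noteq> x" by blast
  obtain X' where "X = add_mset x X'" using x(1) by (metis insert_DiffM)
  moreover then have "y \<in># X'" using y by auto
  then obtain N where "X' = add_mset y N" by (metis insert_DiffM)
  ultimately have XN: "X = {#x, y#} + N" by simp
  have cN: "count N z \<le> k + 2" for z
  proof (cases "z = x \<or> z = y")
    case True
    then have "count {#x, y#} z \<ge> 1" by auto
    moreover have "count X z = count {#x, y#} z + count N z" unfolding XN by (rule count_union)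
    ultimately show ?thesis using Suc.prems(3)[of z] by linarith
  next
    case False
    show ?thesis
    proof (rule ccontr)
      assume a: "\<not> count N z \<le> k + 2"
      then have cz: "count X z \<ge> k + 3" using XN False by simp
      then have "z \<in># X" by (metis add_is_0 count_inI le_zero_eq zero_neq_numeral)
      then have cx: "count X x \<ge> k + 3" using x(2) cz by fastforce
      have "replicate_mset (k + 3) x + replicate_mset (k + 3) z \<subseteq># X"
        using cz cx False by (auto simp: subseteq_mset_def)
      then have "(k + 3) + (k + 3) \<le> size X" using size_mset_mono by fastforce
      then show False using Suc.prems(2) by simp
    qed
  qed
  define B' where "B' = (\<lambda>b. (b + x) mod int p) ` B \<union> (\<lambda>b. (b + y) mod int p) ` B"
  have xy: "x \<in> {0..<int p}" "y \<in> {0..<int p}" using x(1) y(1) Suc.prems(1) by auto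
  have "\<not> int p dvd y - x"
  proof
    assume "int p dvd y - x"
    then have "y mod int p = x mod int p" by (simp add: mod_eq_dvd_iff)
    then show False using xy y(2) by simp
  qed
  then have cB: "card B' \<ge> min p (card B + 1)"
    unfolding B'_def by (rule shift_union_card[OF p Suc.prems(4,5)])
  have p0: "int p > 0" using prime_gt_0_nat[OF p] by simp
  have "card (shifted_sums p B' (k + 2) N) \<ge> min p (card B' + k)"
  proof (rule Suc.IH[OF _ _ cN])
    show "set_mset N \<subseteq> {0..<int p}" "size N = 2 * k + 2" using XN Suc.prems(1,2) by auto
    show "B' \<subseteq> {0..<int p}" "B' \<noteq> {}" using p0 Suc.prems(5) by (auto simp: B'_def)
  qed
  moreover have "shifted_sums p B' (k + 2) N \<subseteq> shifted_sums p B (Suc k + 2) X"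
  proof
    fix c assume "c \<in> shifted_sums p B' (k + 2) N"
    then obtain b' T where T: "c = (b' + \<Sum>\<^sub># T) mod int p" "b' \<in> B'" "T \<subseteq># N" "size T = k + 2"
      unfolding shifted_sums_def by blast
    obtain b z where b: "b \<in> B" "z = x \<or> z = y" "b' = (b + z) mod int p" using T(2) unfolding B'_def by blast
    have "c = (b + \<Sum>\<^sub># (add_mset z T)) mod int p" using T(1) b(3) by (simp add: mod_simps add.assoc)
    moreover have "{#z#} + T \<subseteq># {#x, y#} + N" using T(3) b(2) by (intro mset_subset_eq_mono_add) auto
    ultimately show "c \<in> shifted_sums p B (Suc k + 2) X"
      unfolding shifted_sums_def XN using T(4) b(1) by (intro CollectI exI[of _ b] exI[of _ "add_mset z T"]) simp
  qed
  then have "card (shifted_sums p B' (k + 2) N) \<le> card (shifted_sums p B (Suc k + 2) X)"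
    using finite_shifted_sums p0 by (intro card_mono) auto
  ultimately show ?case using cB by linarith
qed

lemma size_le_sum_count:
  assumes "set_mset X \<subseteq> K" "finite K"
  shows "size X = (\<Sum>c\<in>K. count X c)"
  using assms unfolding size_multiset_overloaded_eq
  by (intro sum.mono_neutral_left) (auto simp: not_in_iff)

text \<open>A class \<open>u\<close> of multiplicity at least two and two further classes \<open>v\<close>, \<open>w\<close> with
  \<open>v + w \<noteq> 2 u\<close> give the two disjoint pairs \<open>{u, v}\<close>, \<open>{u, w}\<close> with four distinct sums.\<close>

lemma prime_no_small_counts:
  assumes p: "prime p" and X: "set_mset X \<subseteq> {0..<int p}" "size X = 2 * p - 2" "\<And>x. count X x \<le> p - 2"
  shows "\<exists>T. T \<subseteq># X \<and> zs_len (mult_of p) p T"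
proof -
  have p2: "p \<ge> 2" using prime_gt_1_nat[OF p] by simp
  have few: "\<not> set_mset X \<subseteq> {a, b}" for a b
  proof
    assume "set_mset X \<subseteq> {a, b}"
    then have "size X = (\<Sum>c\<in>{a, b}. count X c)" by (intro size_le_sum_count) auto
    also have "\<dots> \<le> (\<Sum>c\<in>{a, b}. p - 2)" by (intro sum_mono X(3))
    also have "\<dots> \<le> 2 * (p - 2)" by (cases "a = b") auto
    finally show False using X(2) p2 by linarith
  qed
  have "size X \<le> (\<Sum>c\<in>{0..<int p}. p - 2)"
    using size_le_sum_count[OF X(1)] by (simp only: finite_atLeastLessThan_int) (intro sum_mono X(3))
  then have "2 * p - 2 \<le> p * (p - 2)" using X(2) by simp
  then have p4: "p \<ge> 4"
  proof -
    have "p \<noteq> 2" "p \<noteq> 3" using \<open>2 * p - 2 \<le> p * (p - 2)\<close> by auto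
    then show ?thesis using p2 by simp
  qed
  have mod_eqD: "a = b" if "int p dvd a - b" "a \<in># X" "b \<in># X" for a b
  proof -
    have "a mod int p = b mod int p" using that(1) by (simp add: mod_eq_dvd_iff)
    then show ?thesis using that(2,3) X(1) by (intro residue_eq[of a "int p" b]) auto
  qed
  have key: "\<exists>T. T \<subseteq># X \<and> zs_len (mult_of p) p T"
    if u: "count X u \<ge> 2" and v: "v \<in># X" "v \<noteq> u" and w: "w \<in># X" "w \<noteq> u" and vw: "v \<noteq> w"
      and ne: "\<not> int p dvd v + w - 2 * u" for u v w
  proof -
    have uX: "u \<in># X" using u by (metis count_inI not_numeral_le_zero)
    have "{#u, u, v, w#} \<subseteq># X"
    proof (rule mset_subset_eqI)
      fix a
      have "count X v \<ge> 1" "count X w \<ge> 1" using v w by auto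
      then show "count {#u, u, v, w#} a \<le> count X a" using u v(2) w(2) vw by auto
    qed
    then obtain N where N: "X = {#u, u, v, w#} + N" by (metis subset_mset.add_diff_inverse)
    define B where "B = {(u + u) mod int p, (u + v) mod int p, (u + w) mod int p, (v + w) mod int p}"
    have n1: "\<not> int p dvd v - u" "\<not> int p dvd w - u" "\<not> int p dvd v - w"
      using mod_eqD uX v w vw by metis+
    have "card B = 4"
    proof -
      have "(u + u) mod int p \<noteq> (u + v) mod int p" "(u + u) mod int p \<noteq> (u + w) mod int p"
        "(u + u) mod int p \<noteq> (v + w) mod int p" "(u + v) mod int p \<noteq> (u + w) mod int p"
        "(u + v) mod int p \<noteq> (v + w) mod int p" "(u + w) mod int p \<noteq> (v + w) mod int p"
        using n1 ne unfolding mod_eq_dvd_iff by (simp_all add: algebra_simps dvd_diff_commute)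
      then show ?thesis by (simp add: B_def)
    qed
    \<comment> \<open>The sums in \<open>B\<close> use two elements each, and k + 2 = p - 2 more
      come from \<open>N\<close>. Four initial residues enlarged k times give 4 + k = p, that is,
      all residues including 0.\<close>
    obtain k where k: "p = k + 4" using p4 by (metis add.commute le_Suc_ex)
    have "card (shifted_sums p B (k + 2) N) \<ge> min p (card B + k)"
    proof (rule card_shifted_sums[OF p])
      show "set_mset N \<subseteq> {0..<int p}" "size N = 2 * k + 2" using N X(1,2) k by auto
      show "count N x \<le> k + 2" for x
      proof -
        have "count N x \<le> count X x" unfolding N count_union by (rule le_add2)
        then show ?thesis using X(3)[of x] k by simp
      qed
      show "B \<subseteq> {0..<int p}" "B \<noteq> {}" using p2 by (auto simp: B_def)
    qed
    then have "card (shifted_sums p B (k + 2) N) \<ge> card {0..<int p}" using \<open>card B = 4\<close> k by simp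
    moreover have "shifted_sums p B (k + 2) N \<subseteq> {0..<int p}" using p2 by (auto simp: shifted_sums_def)
    ultimately have "shifted_sums p B (k + 2) N = {0..<int p}"
      by (metis card_seteq finite_atLeastLessThan_int)
    then have "0 \<in> shifted_sums p B (k + 2) N" using p2 by simp
    then obtain c T where "0 = (c + \<Sum>\<^sub># T) mod int p" "c \<in> B" "T \<subseteq># N" "size T = k + 2"
      unfolding shifted_sums_def by blast
    then have T: "c \<in> B" "(c + \<Sum>\<^sub># T) mod int p = 0" "T \<subseteq># N" "size T = k + 2" by simp_all
    obtain D where D: "D \<subseteq># {#u, u, v, w#}" "size D = 2" "c = \<Sum>\<^sub># D mod int p"
    proof -
      have "{#u, u#} \<subseteq># {#u, u, v, w#}" "{#u, v#} \<subseteq># {#u, u, v, w#}" "{#u, w#} \<subseteq># {#u, u, v, w#}"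
        "{#v, w#} \<subseteq># {#u, u, v, w#}" by (auto simp: subseteq_mset_def)
      then show thesis using T(1) that[of "{#u, u#}"] that[of "{#u, v#}"] that[of "{#u, w#}"] that[of "{#v, w#}"]
        unfolding B_def by fastforce
    qed
    have "int p dvd \<Sum>\<^sub># (D + T)" using T(2) D(3) by (simp add: mod_simps mod_eq_0_iff_dvd)
    moreover have "D + T \<subseteq># X" unfolding N using D(1) T(3) by (rule mset_subset_eq_mono_add)
    ultimately show ?thesis using D(2) T(4) k
      by (intro exI[of _ "D + T"]) (auto simp: zs_len_def mult_of_def)
  qed
  have "\<exists>x. count X x \<ge> 2"
  proof (rule ccontr)
    assume "\<not> ?thesis"
    then have "count X x \<le> 1" for x
      by (metis Suc_1 not_less_eq_eq)
    then have "(\<Sum>c\<in>{0..<int p}. count X c) \<le> (\<Sum>c\<in>{0..<int p}. 1)" by (intro sum_mono)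
    then show False using size_le_sum_count[OF X(1)] X(2) p4 by simp
  qed
  then obtain x where x: "count X x \<ge> 2" by blast
  have xX: "x \<in># X" using x by (metis count_inI not_numeral_le_zero)
  obtain y where y: "y \<in># X" "y \<noteq> x" using few[of x x] by blast
  obtain z where z: "z \<in># X" "z \<noteq> x" "z \<noteq> y" using few[of x y] by blast
  show ?thesis
  proof (cases "int p dvd y + z - 2 * x")
    case False
    then show ?thesis using key[OF x y z(1,2)] z(3) by auto
  next
    case True
    show ?thesis
    proof (cases "\<exists>w. w \<in># X \<and> w \<notin> {x, y, z}")
      case True
      then obtain w where w: "w \<in># X" "w \<noteq> x" "w \<noteq> y" "w \<noteq> z" by auto
      have "\<not> int p dvd y + w - 2 * x"
      proof
        assume "int p dvd y + w - 2 * x"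
        then have "int p dvd (y + z - 2 * x) - (y + w - 2 * x)"
          using \<open>int p dvd y + z - 2 * x\<close> by (rule dvd_diff[rotated])
        then show False using mod_eqD[of z w] z(1) w by (simp add: algebra_simps)
      qed
      then show ?thesis using key[OF x y w(1,2)] w(3) by auto
    next
      case False
      \<comment> \<open>Only three classes occur. Then y or z is repeated as well, and letting it
        play the part of u changes y + z - 2 x by 3 (x - y) or 3 (x - z), which is nonzero modulo
        \<open>p\<close> because p > 3.\<close>
      then have "size X = (\<Sum>c\<in>{x, y, z}. count X c)" by (intro size_le_sum_count) auto
      then have "count X x + (count X y + count X z) = 2 * p - 2" using y(2) z(2,3) X(2) by auto
      then have "count X y + count X z \<ge> p" using X(3)[of x] p4 by linarith
      then have "count X y \<ge> 2 \<or> count X z \<ge> 2" using p4 by linarith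
      moreover have "\<not> int p dvd 3 * (x - y)" "\<not> int p dvd 3 * (x - z)"
      proof -
        have "\<not> p dvd 3" using p4 by (auto dest: dvd_imp_le)
        then have n3: "\<not> int p dvd 3" by (metis int_dvd_int_iff of_nat_numeral)
        show "\<not> int p dvd 3 * (x - y)" "\<not> int p dvd 3 * (x - z)"
          using n3 p mod_eqD xX y z by (metis prime_dvd_mult_iff prime_nat_int_transfer)+
      qed
      moreover have "x + z - 2 * y = (y + z - 2 * x) + 3 * (x - y)" "x + y - 2 * z = (y + z - 2 * x) + 3 * (x - z)"
        by simp_all
      ultimately show ?thesis
        using key[of y x z] key[of z x y] xX y z True by (metis dvd_add_right_iff)
    qed
  qed
qed

lemma inverse_egz_prime:
  assumes p: "prime p"
  shows "inverse_egz p"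
  unfolding inverse_egz_def
proof (intro allI impI)
  fix X assume X: "egzfree p X"
  have p2: "p \<ge> 2" using prime_gt_1_nat[OF p] by simp
  let ?X = "image_mset (\<lambda>x. x mod int p) X"
  have "\<exists>x. count ?X x > p - 2"
  proof (rule ccontr)
    assume "\<not> ?thesis"
    then have small: "\<And>x. count ?X x \<le> p - 2" by (meson not_le)
    have "set_mset ?X \<subseteq> {0..<int p}" using p2 by auto
    moreover have "size ?X = 2 * p - 2" using X by (simp add: egzfree_def)
    ultimately obtain T where T: "T \<subseteq># ?X" "zs_len (mult_of p) p T"
      using prime_no_small_counts[OF p _ _ small] by blast
    obtain T' where T': "T' \<subseteq># X" "image_mset (\<lambda>x. x mod int p) T' = T" using T(1) by (rule submset_image_msetE)
    have "[\<Sum>\<^sub># (image_mset (\<lambda>x. x mod int p) T') = \<Sum>\<^sub># T'] (mod int p)"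
    proof (induction T')
      case (add x T')
      have "[x mod int p + \<Sum>\<^sub># (image_mset (\<lambda>x. x mod int p) T') = x + \<Sum>\<^sub># T'] (mod int p)"
        by (intro cong_add add.IH) (simp add: cong_def)
      then show ?case by simp
    qed simp
    then have "int p dvd \<Sum>\<^sub># T'" using T(2) T'(2) by (simp add: zs_len_def mult_of_def cong_dvd_iff)
    moreover have "size T' = p" using T(2) T'(2) by (auto simp: zs_len_def)
    ultimately show False using X T'(1) unfolding egzfree_def zs_len_def mult_of_def by blast
  qed
  then obtain a where a: "count ?X a > p - 2" by blast
  then have "count ?X a = p - 1" using egzfree_count[OF X, of a] p2 by simp
  moreover have "a mod int p = a"
  proof -
    have "a \<in># ?X" using a by (metis count_inI not_less_zero)
    then show ?thesis by auto
  qed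
  ultimately show "\<exists>T. ?X = repeat_mset (p - 1) T" using inverse_egz_of_count[OF p2 X, of a] by simp
qed

section \<open>From prime to composite moduli\<close>

lemma egzfree_packing:
  assumes b: "add_on M b" and N: "\<And>x. x \<in> M \<Longrightarrow> b x \<in> mult_of q \<Longrightarrow> x \<in> N"
    and F: "size FF = 2 * q - 2" "\<forall>B\<in>#FF. zs_len M m B" "\<Sum>\<^sub># FF \<subseteq># S"
    and no: "\<nexists>T. T \<subseteq># S \<and> zs_len N (m * q) T"
  shows "egzfree q (image_mset (\<lambda>B. b (\<Sum>\<^sub># B)) FF)"
  using lift_zs_len[OF b N F(2,3)] no F(1) unfolding egzfree_def by auto

lemma not_packing_len:
  assumes b: "add_on M b" and N: "\<And>x. x \<in> M \<Longrightarrow> b x \<in> mult_of q \<Longrightarrow> x \<in> N" and q: "q > 0"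
    and no: "\<nexists>T. T \<subseteq># S \<and> zs_len N (m * q) T"
  shows "\<not> packing (zs_len M m) (Suc (2 * q - 2)) S"
proof
  assume "packing (zs_len M m) (Suc (2 * q - 2)) S"
  then obtain FF where FF: "size FF = Suc (2 * q - 2)" "\<forall>B\<in>#FF. zs_len M m B" "\<Sum>\<^sub># FF \<subseteq># S"
    unfolding packing_def by blast
  obtain U where "U \<subseteq># image_mset (\<lambda>B. b (\<Sum>\<^sub># B)) FF" "zs_len (mult_of q) q U"
    using forcesD[OF egz[OF q], of "image_mset (\<lambda>B. b (\<Sum>\<^sub># B)) FF"] FF(1) q by fastforce
  from lift_zs_len[OF b N FF(2,3) this] no show False by blast
qed

text \<open>The block machinery with M = p Z and N = p q Z. There are two fibres with s1 + s2 = 2 q,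
  and the block sums, extremal over C_q, take two values q - 1 times each. So s1 = s2 = q \<ge> 2,
  and both fibres are constant modulo p q.\<close>

lemma inverse_egz_mult:
  assumes p: "p \<ge> 2" "inverse_egz p" and qq: "q \<ge> 2" "inverse_egz q"
  shows "inverse_egz (p * q)"
  unfolding inverse_egz_def
proof (intro allI impI)
  fix X assume X: "egzfree (p * q) X"
  let ?h = "\<lambda>x. x mod int p"
  interpret block_system "zs_len (mult_of p) p" ?h 2 p
  proof
    show "size X = p \<Longrightarrow> \<forall>x\<in>#X. ?h x = f \<Longrightarrow> zs_len (mult_of p) p X" for X f
    proof -
      assume X: "size X = p" "\<forall>x\<in>#X. ?h x = f"
      then have "\<forall>x\<in>#X. x mod int p = f mod int p" by auto
      then have "[\<Sum>\<^sub># X = int p * f] (mod int p)" using sum_mset_const_cong X(1) by metis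
      then show ?thesis using X(1) by (simp add: zs_len_def mult_of_def cong_dvd_iff)
    qed
    show "?h g = f" if a: "zs_len (mult_of p) p (add_mset g B)" "size B = p - 1" "\<forall>x\<in>#B. ?h x = f" for g B f
    proof -
      have "B \<noteq> {#}" using a(2) p(1) by auto
      then have f: "f mod int p = f" using a(3) by (metis mod_mod_trivial multiset_nonemptyE)
      then have "\<forall>x\<in>#B. x mod int p = f mod int p" using a(3) by auto
      then have "[\<Sum>\<^sub># B = int (p - 1) * f] (mod int p)" using sum_mset_const_cong a(2) by metis
      then have "[g + \<Sum>\<^sub># B = g + int (p - 1) * f] (mod int p)" by (intro cong_add) auto
      moreover have "int p dvd g + \<Sum>\<^sub># B" using a(1) by (simp add: zs_len_def mult_of_def)
      ultimately have "int p dvd g + int (p - 1) * f" using cong_dvd_iff by blast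
      moreover have "g + int (p - 1) * f = (g - f) + int p * f" using p(1) by (simp add: of_nat_diff algebra_simps)
      ultimately have "int p dvd g - f" by (metis dvd_add_left_iff dvd_triv_left)
      then show ?thesis using f by (metis mod_eq_dvd_iff)
    qed
    have "2 * (p - 1) + 1 = 2 * p - 1" using p(1) by simp
    then show "forces (zs_len (mult_of p) p) (2 * (p - 1) + 1)" using egz[of p] p(1) by simp
    show "\<exists>T. image_mset ?h X = repeat_mset (p - 1) T"
      if "size X = 2 * (p - 1)" "\<nexists>B. B \<subseteq># X \<and> zs_len (mult_of p) p B" for X
      using p(2) that unfolding inverse_egz_def egzfree_def by (simp add: diff_mult_distrib2)
  qed (use p(1) in \<open>auto simp: zs_len_def\<close>)
  have b: "add_on (mult_of p) (\<lambda>v. v div int p)" by (rule add_on_mult_of)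
  have N: "x \<in> mult_of p \<Longrightarrow> x div int p \<in> mult_of q \<Longrightarrow> x \<in> mult_of (p * q)" for x
    using mult_of_iff[of p x q] p(1) by simp
  have no: "\<nexists>T. T \<subseteq># X \<and> zs_len (mult_of (p * q)) (p * q) T" using X by (simp add: egzfree_def)
  have szX: "size X = 2 * (p - 1) + (2 * q - 2) * p"
    using X p(1) qq(1) by (cases p; cases q) (auto simp: egzfree_def algebra_simps)
  have np: "\<not> packing (zs_len (mult_of p) p) (Suc (2 * q - 2)) X"
    by (rule not_packing_len[OF b N _ no]) (use qq in auto)
  obtain F where F: "finite F" "card F = 2" "set_mset (image_mset ?h X) = F"
    "\<forall>f\<in>F. p dvd count (image_mset ?h X) f + 1"
    using class_structure[OF szX np] by blast
  interpret fibred "zs_len (mult_of p) p" ?h 2 p "mult_of p" "mult_of (p * q)" "\<lambda>v. v div int p" q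
    "2 * q - 2" X F "egzfree q"
  proof
    show "x \<in> mult_of p \<Longrightarrow> x \<in> mult_of (p * q) \<longleftrightarrow> int q dvd x div int p" for x
      using mult_of_iff[of p x q] p(1) by (simp add: mult_of_def)
    show "egzfree q (image_mset (\<lambda>B. \<Sum>\<^sub># B div int p) FF)"
      if "size FF = 2 * q - 2" "\<forall>B\<in>#FF. zs_len (mult_of p) p B" "\<Sum>\<^sub># FF \<subseteq># X" for FF
      by (rule egzfree_packing[OF b N that no])
    show "egzfree q (add_mset c U) \<Longrightarrow> egzfree q (add_mset c' U) \<Longrightarrow> int q dvd c - c'" for c c' U
      by (rule egzfree_cancel[OF qq(2,1)])
    show "?h x = ?h y \<longleftrightarrow> x - y \<in> mult_of p" for x y by (simp add: mod_eq_dvd_iff mult_of_def)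
  qed (use b F szX in \<open>auto simp: mult_of_def zs_len_def\<close>)
  obtain f1 f2 where f: "F = {f1, f2}" "f1 \<noteq> f2" using F(2) by (metis card_2_iff)
  have ssum: "s f1 + s f2 = 2 * q" using size_blocks(2) f qq(1) by simp
  define g where "g f = (SOME x. x \<in># X \<and> ?h x = f)" for f
  have g: "g f \<in># X \<and> ?h (g f) = f" if "f \<in> F" for f
  proof -
    have "f \<in> ?h ` set_mset X" using that F(3) by simp
    then have "\<exists>x. x \<in># X \<and> ?h x = f" by auto
    then show ?thesis unfolding g_def by (rule someI_ex)
  qed
  have NM: "mult_of (p * q) \<subseteq> mult_of p" by (auto simp: mult_of_def dest: dvd_mult_left)
  obtain U where U: "egzfree q U"
    "image_mset (\<lambda>x. x mod int q) U = image_mset (\<lambda>f. weight g f mod int q) blocks"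
    using good_standard_packing[of g] NM g by metis
  let ?c = "\<lambda>v. count (image_mset (\<lambda>x. x mod int q) U) v"
  have blocks: "blocks = replicate_mset (s f1 - 1) f1 + replicate_mset (s f2 - 1) f2"
    unfolding blocks_def using f by simp
  have c: "?c v = (if weight g f1 mod int q = v then s f1 - 1 else 0) +
    (if weight g f2 mod int q = v then s f2 - 1 else 0)" for v
    unfolding U(2) blocks by simp
  have c01: "?c v \<in> {0, q - 1}" for v by (rule inverse_egz_count[OF qq(2) U(1) qq(1)])
  have sp: "s f1 \<ge> 1" "s f2 \<ge> 1" using s_pos f by auto
  \<comment> \<open>Equal weights would give one value the multiplicity 2 q - 2.\<close>
  have "weight g f1 mod int q \<noteq> weight g f2 mod int q"
  proof
    assume "weight g f1 mod int q = weight g f2 mod int q"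
    then have "?c (weight g f1 mod int q) = 2 * q - 2" using c[of "weight g f1 mod int q"] ssum sp by simp
    then show False using c01[of "weight g f1 mod int q"] qq(1) by auto
  qed
  then have "s f1 - 1 \<in> {0, q - 1}" "s f2 - 1 \<in> {0, q - 1}"
    using c01[of "weight g f1 mod int q"] c01[of "weight g f2 mod int q"]
      c[of "weight g f1 mod int q"] c[of "weight g f2 mod int q"] by auto
  then have sq: "s f1 = q" "s f2 = q" using ssum sp qq(1) by auto
  have fib: "image_mset (\<lambda>x. x mod int (p * q)) (filter_mset (\<lambda>x. ?h x = f') X) =
    replicate_mset (p * q - 1) (g f' mod int (p * q))" if f': "f' \<in> F" "s f' = q" for f'
  proof -
    have "x mod int (p * q) = g f' mod int (p * q)" if "x \<in># filter_mset (\<lambda>x. ?h x = f') X" for x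
    proof -
      have "x - g f' \<in> mult_of (p * q)"
        using that g[OF f'(1)] f' qq(1) by (intro lifts_agree') auto
      then show ?thesis by (simp add: mult_of_def mod_eq_dvd_iff)
    qed
    moreover have "size (filter_mset (\<lambda>x. ?h x = f') X) = p * q - 1"
      using size_fibre[OF f'(1)] f'(2) by (simp add: mult.commute)
    ultimately show ?thesis
      using image_mset_const_on[of "filter_mset (\<lambda>x. ?h x = f') X" "\<lambda>x. x mod int (p * q)"] by metis
  qed
  have "X = filter_mset (\<lambda>x. ?h x = f1) X + filter_mset (\<lambda>x. ?h x = f2) X"
    using partition_fibres f by simp
  then have "image_mset (\<lambda>x. x mod int (p * q)) X =
    image_mset (\<lambda>x. x mod int (p * q)) (filter_mset (\<lambda>x. ?h x = f1) X) +
    image_mset (\<lambda>x. x mod int (p * q)) (filter_mset (\<lambda>x. ?h x = f2) X)" by (metis image_mset_union)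
  also have "\<dots> = repeat_mset (p * q - 1) {#g f1 mod int (p * q), g f2 mod int (p * q)#}"
    using fib f sq by (simp add: multiset_eq_iff)
  finally show "\<exists>T. image_mset (\<lambda>x. x mod int (p * q)) X = repeat_mset (p * q - 1) T" by blast
qed

theorem inverse_egz:
  assumes "n > 0"
  shows "inverse_egz n"
  using assms
proof (induction n rule: nat_mult_induct)
  case 1
  then show ?case unfolding inverse_egz_def egzfree_def by auto
next
  case (mult p m)
  show ?case
  proof (cases "m = 1")
    case True
    then show ?thesis using inverse_egz_prime mult(1) by simp
  next
    case False
    then show ?thesis using inverse_egz_mult[of p m] inverse_egz_prime[OF mult(1)] mult prime_ge_2_nat by auto
  qed
qed

section \<open>Three floor functions\<close>

lemma le_div_iff:
  fixes m :: int
  assumes "m > 0"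
  shows "t \<le> a div m \<longleftrightarrow> t * m \<le> a"
proof
  assume "t \<le> a div m"
  then have "t * m \<le> (a div m) * m" using assms by (intro mult_right_mono) auto
  also have "\<dots> \<le> a" using assms by (metis div_mult_mod_eq le_add_same_cancel1 pos_mod_sign)
  finally show "t * m \<le> a" .
next
  assume "t * m \<le> a"
  then have "t * m div m \<le> a div m" using assms by (intro zdiv_mono1) auto
  then show "t \<le> a div m" using assms by simp
qed

lemma ceiling_exists:
  fixes x y :: int
  assumes "x > 0"
  obtains k where "(k - 1) * x < y" "y \<le> k * x"
proof -
  define k where "k = - ((- y) div x)"
  have "(- y) div x * x \<le> - y" using le_div_iff[OF assms, of "(- y) div x" "- y"] by simp
  then have "y \<le> k * x" by (simp add: k_def)
  moreover have "\<not> (- y) div x + 1 \<le> (- y) div x" by simp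
  then have "\<not> ((- y) div x + 1) * x \<le> - y" unfolding le_div_iff[OF assms] .
  then have "(k - 1) * x < y" by (simp add: k_def algebra_simps)
  ultimately show thesis using that by blast
qed

text \<open>The floors of \<open>k b / m\<close>, \<open>k c / m\<close>, \<open>k d / m\<close> jump at times that partition an interval. With
  \<open>e = m - b\<close> the jumps for \<open>e\<close> are those for \<open>c\<close> and \<open>d\<close>; the gap between the two jumps for
  \<open>c\<close> around the first jump for \<open>d\<close> would be too long.\<close>

lemma three_floors_sorted:
  fixes b c d m :: int
  assumes sum: "b + c + d = m + 1" and ord: "b \<ge> c" "c \<ge> d" "d \<ge> 2"
    and nd: "\<And>k. k \<in> {1..m - 1} \<Longrightarrow> \<not> m dvd k * b"
    and fl: "\<And>k. k \<in> {1..m - 1} \<Longrightarrow> k * b div m + k * c div m + k * d div m = k - 1"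
  shows False
proof -
  have m: "m \<ge> 5" using sum ord by linarith
  have m0: "m > 0" using m by simp
  \<comment> \<open>At k = 2 the floors must add up to 1, so the largest of the three numbers
    exceeds m / 2.\<close>
  have b2: "2 * b > m"
  proof (rule ccontr)
    assume "\<not> 2 * b > m"
    moreover have "2 * b \<noteq> m" using nd[of 2] m by auto
    ultimately have "2 * b < m" "2 * c < m" "2 * d < m" using ord by linarith+
    then have "2 * b div m = 0" "2 * c div m = 0" "2 * d div m = 0" using ord by auto
    then show False using fl[of 2] m by simp
  qed
  define e where "e = m - b"
  have e: "e = c + d - 1" "2 * e < m" "e \<ge> 3" "c \<le> e" using sum b2 ord unfolding e_def by auto
  have E: "k * e div m = k * c div m + k * d div m" if k: "k \<in> {1..m - 1}" for k
  proof -
    have "k * e = k * m - k * b" by (simp add: e_def algebra_simps)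
    then have "\<not> m dvd k * e" using nd[OF k] by (metis dvd_diff_right_iff dvd_triv_right)
    have "k * b = - (k * e) + k * m" by (simp add: e_def algebra_simps)
    then have "k * b div m = (- (k * e) + k * m) div m" by (simp only:)
    also have "\<dots> = k + (- (k * e)) div m" using m0 by (subst div_mult_self1) auto
    also have "(- (k * e)) div m = - (k * e div m) - 1"
      using \<open>\<not> m dvd k * e\<close> m0 by (simp add: zdiv_zminus1_eq_if dvd_eq_mod_eq_0)
    finally show ?thesis using fl[OF k] by simp
  qed
  \<comment> \<open>\<open>r\<close> is the time of the first jump for c. Since d \<le> c, nothing
    jumps earlier for d, hence nothing for e either.\<close>
  obtain r where r: "(r - 1) * c < m" "m \<le> r * c" using ceiling_exists[of c m] ord by auto
  have "r * c \<le> r * e" "r > 0"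
  proof -
    show "r > 0" using r(2) m0 ord by (metis less_le_trans linorder_not_less mult_nonpos_nonneg zero_le_numeral order_trans)
    then show "r * c \<le> r * e" using e(4) by simp
  qed
  then have "r * e > 2 * e" using r(2) e(2) by linarith
  then have r3: "r \<ge> 3" using e(3) by (simp add: mult_less_cancel_right)
  have rm: "r \<le> m - 1"
  proof (rule ccontr)
    assume "\<not> r \<le> m - 1"
    then have "(m - 1) * 2 \<le> (r - 1) * c" using ord m by (intro mult_mono) auto
    then have "(m - 1) * 2 < m" using r(1) by (rule le_less_trans)
    then show False using m by simp
  qed
  have re: "(r - 1) * e < m"
  proof -
    have "(r - 1) * d \<le> (r - 1) * c" using ord r3 by (intro mult_left_mono) auto
    then have "(r - 1) * d < m" using r(1) by linarith
    moreover have "(r - 1) * c \<ge> 0" "(r - 1) * d \<ge> 0" using r3 ord by auto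
    ultimately have "(r - 1) * e div m = 0" using E[of "r - 1"] r3 rm r(1) by simp
    moreover have "\<not> 1 \<le> (r - 1) * e div m" using calculation by simp
    ultimately show ?thesis unfolding le_div_iff[OF m0] by simp
  qed
  \<comment> \<open>\<open>k0\<close> is the first jump for d; \<open>j\<close> below counts the
    jumps for c before it.\<close>
  obtain k0 where k0: "(k0 - 1) * d < m" "m \<le> k0 * d" using ceiling_exists[of d m] ord by auto
  have k0m: "k0 \<le> m - 1"
  proof (rule ccontr)
    assume "\<not> k0 \<le> m - 1"
    then have "(m - 1) * 2 \<le> (k0 - 1) * d" using ord m by (intro mult_mono) auto
    then have "(m - 1) * 2 < m" using k0(1) by (rule le_less_trans)
    then show False using m by simp
  qed
  have k02: "k0 \<ge> 2"
  proof (rule ccontr)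
    assume "\<not> k0 \<ge> 2"
    then have "k0 * d \<le> 1 * d" using ord by (intro mult_right_mono) auto
    then show False using k0(2) ord sum by linarith
  qed
  define j where "j = (k0 - 1) * c div m"
  have d0: "k * d div m = 0" if "0 \<le> k" "k \<le> k0 - 1" for k
  proof -
    have "k * d \<le> (k0 - 1) * d" using that ord by (intro mult_right_mono) auto
    then have "k * d < m" using k0(1) by (rule le_less_trans)
    moreover have "0 \<le> k * d" using that ord by simp
    ultimately show ?thesis by (rule div_pos_pos_trivial[rotated])
  qed
  have d1: "k0 * d div m \<ge> 1" using k0(2) le_div_iff[OF m0, of 1] by simp
  \<comment> \<open>As e < m, the floor for e rises by at most one per step, so c does not jump at
    \<open>k0\<close> together with d.\<close>
  have "k0 * e div m \<le> (k0 - 1) * e div m + 1"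
  proof -
    have "k0 * e \<le> (k0 - 1) * e + m" using e by (simp add: algebra_simps)
    then have "k0 * e div m \<le> ((k0 - 1) * e + m) div m" using m0 by (intro zdiv_mono1) auto
    then show ?thesis using m0 by simp
  qed
  then have "k0 * c div m + k0 * d div m \<le> (k0 - 1) * c div m + 1"
    using E[of k0] E[of "k0 - 1"] d0[of "k0 - 1"] k02 k0m by simp
  moreover have "(k0 - 1) * c div m \<le> k0 * c div m"
    using m0 ord by (intro zdiv_mono1) (auto simp: algebra_simps)
  ultimately have jk0: "k0 * c div m = j" using d1 unfolding j_def by linarith
  have "k0 * d \<le> k0 * c" using ord k02 by simp
  then have j1: "j \<ge> 1" using k0(2) le_div_iff[OF m0, of 1 "k0 * c"] jk0 by simp
  \<comment> \<open>This keeps the next jump for c, at \<open>k1\<close> below, in the range up to m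
    - 1 where the hypothesis speaks.\<close>
  have jc: "j \<le> c - 2"
  proof (rule ccontr)
    assume "\<not> j \<le> c - 2"
    then have "(c - 1) * m \<le> (k0 - 1) * c" using le_div_iff[OF m0, of "c - 1" "(k0 - 1) * c"] j_def by simp
    then have 1: "(m - k0 + 1) * c \<le> m" by (simp add: algebra_simps)
    have "m * 2 \<le> m * d" using ord m0 by (intro mult_left_mono) auto
    then have "(m - k0 + 1) * d > m" using k0(1) by (simp add: algebra_simps)
    moreover have "(m - k0 + 1) * d \<le> (m - k0 + 1) * c" using ord k0m by (intro mult_left_mono) auto
    ultimately show False using 1 by linarith
  qed
  \<comment> \<open>\<open>kp\<close> and \<open>k1\<close> are the jumps number j and j + 1 for c;
    \<open>k0\<close> lies strictly between them.\<close>
  obtain kp where kp: "(kp - 1) * c < j * m" "j * m \<le> kp * c" using ceiling_exists[of c "j * m"] ord by auto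
  obtain k1 where k1: "(k1 - 1) * c < (j + 1) * m" "(j + 1) * m \<le> k1 * c"
    using ceiling_exists[of c "(j + 1) * m"] ord by auto
  have kp1: "kp \<ge> 1"
  proof (rule ccontr)
    assume "\<not> kp \<ge> 1"
    then have "kp * c \<le> 0" using ord by (intro mult_nonpos_nonneg) auto
    moreover have "j * m > 0" using j1 m0 by simp
    ultimately show False using kp(2) by linarith
  qed
  have "kp \<le> k0 - 1"
  proof (rule ccontr)
    assume "\<not> kp \<le> k0 - 1"
    then have "(k0 - 1) * c \<le> (kp - 1) * c" using ord by (intro mult_right_mono) auto
    moreover have "j * m \<le> (k0 - 1) * c" using le_div_iff[OF m0, of j "(k0 - 1) * c"] j_def by simp
    ultimately show False using kp(1) by linarith
  qed
  have k1k0: "k1 > k0"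
  proof (rule ccontr)
    assume "\<not> k1 > k0"
    then have "k1 * c \<le> k0 * c" using ord by (intro mult_right_mono) auto
    then have "(j + 1) * m \<le> k0 * c" using k1(2) by linarith
    then show False using le_div_iff[OF m0, of "j + 1" "k0 * c"] jk0 by simp
  qed
  have k1m: "k1 \<le> m - 1"
  proof (rule ccontr)
    assume "\<not> k1 \<le> m - 1"
    then have "(m - 1) * c \<le> (k1 - 1) * c" using ord by (intro mult_right_mono) auto
    moreover have "(j + 1) * m \<le> (c - 1) * m" using jc m0 by (intro mult_right_mono) auto
    moreover have "c \<le> m" using e m by linarith
    ultimately show False using k1(1) by (simp add: algebra_simps)
  qed
  have "(j + 2) * m \<le> k1 * e"
  proof -
    have "k1 * c div m \<ge> j + 1" using k1(2) le_div_iff[OF m0] by simp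
    moreover have "k0 * d \<le> k1 * d" using k1k0 ord by (intro mult_right_mono) auto
    then have "k1 * d div m \<ge> 1" using k0(2) le_div_iff[OF m0, of 1 "k1 * d"] by simp
    ultimately have "k1 * e div m \<ge> j + 2" using E[of k1] k1k0 k02 k1m by simp
    then show ?thesis using le_div_iff[OF m0] by simp
  qed
  moreover have "(kp - 1) * e < j * m"
  proof (cases "kp = 1")
    case True
    then show ?thesis using j1 m0 by simp
  next
    case False
    have "\<not> j \<le> (kp - 1) * c div m" using kp(1) le_div_iff[OF m0] by simp
    then have "\<not> j \<le> (kp - 1) * e div m"
      using E[of "kp - 1"] d0[of "kp - 1"] kp1 False \<open>kp \<le> k0 - 1\<close> k0m by simp
    then show ?thesis using le_div_iff[OF m0] by simp
  qed
  \<comment> \<open>From \<open>kp - 1\<close> to \<open>k1\<close> the multiples of e pass the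
    levels j, j + 1 and j + 2, which takes more than 2 m / e steps. But k1 - kp is at most r, and (r
    - 1) e < m.\<close>
  ultimately have big: "(k1 - kp + 1) * e > 2 * m" by (simp add: algebra_simps)
  have "(k1 - kp - 1) * c < m" using k1(1) kp(2) by (simp add: algebra_simps)
  then have "(k1 - kp - 1) * c < r * c" using r(2) by linarith
  then have "k1 - kp - 1 < r" using ord by (simp add: mult_less_cancel_right)
  then have "(k1 - kp + 1) * e \<le> (r + 1) * e" using e by (intro mult_right_mono) auto
  then have "2 * ((r - 1) * e) < (r + 1) * e" using re big by linarith
  then have "(2 * (r - 1)) * e < (r + 1) * e" by (simp only: mult.assoc)
  then have "2 * (r - 1) < r + 1" using e(3) by (simp only: mult_less_cancel_right)
  then show False using r3 by simp
qed

lemma three_floors: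
  fixes b c d m :: int
  assumes sum: "b + c + d = m + 1" and pos: "b \<ge> 1" "c \<ge> 1" "d \<ge> 1"
    and nd: "\<And>k. k \<in> {1..m - 1} \<Longrightarrow> \<not> m dvd k * b" "\<And>k. k \<in> {1..m - 1} \<Longrightarrow> \<not> m dvd k * c"
      "\<And>k. k \<in> {1..m - 1} \<Longrightarrow> \<not> m dvd k * d"
    and fl: "\<And>k. k \<in> {1..m - 1} \<Longrightarrow> k * b div m + k * c div m + k * d div m = k - 1"
  shows "b = 1 \<or> c = 1 \<or> d = 1"
proof (rule ccontr)
  assume "\<not> ?thesis"
  then have ge: "b \<ge> 2" "c \<ge> 2" "d \<ge> 2" using pos by auto
  consider "b \<ge> c \<and> c \<ge> d" | "b \<ge> d \<and> d \<ge> c" | "c \<ge> b \<and> b \<ge> d" | "c \<ge> d \<and> d \<ge> b" | "d \<ge> b \<and> b \<ge> c" | "d \<ge> c \<and> c \<ge> b"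
    by linarith
  then show False
  proof cases
    case 1 then show ?thesis using three_floors_sorted[of b c d m] assms ge by auto
  next
    case 2 then show ?thesis using three_floors_sorted[of b d c m] assms ge by (auto simp: add_ac)
  next
    case 3 then show ?thesis using three_floors_sorted[of c b d m] assms ge by (auto simp: add_ac)
  next
    case 4 then show ?thesis using three_floors_sorted[of c d b m] assms ge by (auto simp: add_ac)
  next
    case 5 then show ?thesis using three_floors_sorted[of d b c m] assms ge by (auto simp: add_ac)
  next
    case 6 then show ?thesis using three_floors_sorted[of d c b m] assms ge by (auto simp: add_ac)
  qed
qed

text \<open>Put b = m - u, c = m - v, d = u + v + 1 - m. That k + (k u mod m) + (k v mod m) has
  quotient 1 by m turns into the floor identity of \<open>three_floors\<close>, and the three
  conclusions are b = 1, c = 1 and d = 1.\<close>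

theorem trivial_residue_pair:
  fixes u v m :: int
  assumes m: "m \<ge> 2" and uv: "u \<in> {1..m - 1}" "v \<in> {1..m - 1}"
    and nd: "\<And>k. k \<in> {1..m - 1} \<Longrightarrow> \<not> m dvd k * u" "\<And>k. k \<in> {1..m - 1} \<Longrightarrow> \<not> m dvd k * v"
    and age: "\<And>k. k \<in> {1..m - 1} \<Longrightarrow> m < k + k * u mod m + k * v mod m \<and> k + k * u mod m + k * v mod m < 2 * m"
  shows "u = m - 1 \<or> v = m - 1 \<or> u + v = m"
proof -
  have m0: "m > 0" using m by simp
  define d where "d = u + v + 1 - m"
  have "u mod m = u" "v mod m = v" using uv by auto
  then have d1: "d \<ge> 1" using age[of 1] m unfolding d_def by simp
  have "m - u = 1 \<or> m - v = 1 \<or> d = 1"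
  proof (rule three_floors)
    show "m - u + (m - v) + d = m + 1" by (simp add: d_def)
    show "1 \<le> m - u" "1 \<le> m - v" "1 \<le> d" using uv d1 by auto
    fix k assume k: "k \<in> {1..m - 1}"
    have kd: "k * d = k + k * u mod m + k * v mod m + m * (k * u div m + k * v div m - k)"
      using mult_div_mod_eq[of m "k * u"] mult_div_mod_eq[of m "k * v"] by (simp add: d_def algebra_simps)
    show "\<not> m dvd k * (m - u)"
    proof
      assume "m dvd k * (m - u)"
      then have "m dvd m * k - k * (m - u)" by (rule dvd_diff[rotated]) simp
      moreover have "m * k - k * (m - u) = k * u" by (simp add: algebra_simps)
      ultimately show False using nd(1)[OF k] by simp
    qed
    show "\<not> m dvd k * (m - v)"
    proof
      assume "m dvd k * (m - v)"
      then have "m dvd m * k - k * (m - v)" by (rule dvd_diff[rotated]) simp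
      moreover have "m * k - k * (m - v) = k * v" by (simp add: algebra_simps)
      ultimately show False using nd(2)[OF k] by simp
    qed
    define s where "s = k + k * u mod m + k * v mod m"
    have s: "m < s" "s < 2 * m" using age[OF k] unfolding s_def by auto
    have sd: "s div m = 1" by (rule int_div_pos_eq[of _ _ _ "s - m"]) (use s in auto)
    show "\<not> m dvd k * d"
    proof
      assume "m dvd k * d"
      then have "m dvd s" unfolding kd s_def[symmetric] by (simp add: dvd_add_left_iff)
      then obtain t where t: "s = m * t" by (rule dvdE)
      then have "1 < t" "t < 2" using s m0 by (metis mult.commute mult.right_neutral mult_less_cancel_left_pos)+
      then show False by simp
    qed
    have neg: "k * (m - x) div m = k - 1 - k * x div m" if "\<not> m dvd k * x" for x
    proof -
      have "k * (m - x) = - (k * x) + k * m" by (simp add: algebra_simps)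
      then have "k * (m - x) div m = (- (k * x) + k * m) div m" by (simp only:)
      also have "\<dots> = (- (k * x)) div m + k" using m0 by (subst div_mult_self1) auto
      also have "(- (k * x)) div m = - (k * x div m) - 1"
        using that m0 by (simp add: zdiv_zminus1_eq_if dvd_eq_mod_eq_0)
      finally show ?thesis by simp
    qed
    have "k * d div m = s div m + (k * u div m + k * v div m - k)"
      unfolding kd s_def[symmetric] using m0 by simp
    then show "k * (m - u) div m + k * (m - v) div m + k * d div m = k - 1"
      using neg[OF nd(1)[OF k]] neg[OF nd(2)[OF k]] sd by simp
  qed
  then show ?thesis unfolding d_def by auto
qed

section \<open>Sequences over the square of a cyclic group\<close>

definition sm :: "int \<Rightarrow> int \<times> int \<Rightarrow> int \<times> int" where
  "sm k v = (k * fst v, k * snd v)"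

lemma sm_simps: "sm (a + b) v = sm a v + sm b v" "sm (a - b) v = sm a v - sm b v" "sm (- a) v = - sm a v"
    "sm a (v + w) = sm a v + sm a w" "sm a (v - w) = sm a v - sm a w" "sm a (- v) = - sm a v"
    "sm 0 v = 0" "sm 1 v = v" "sm a (sm b v) = sm (a * b) v" "sm a 0 = 0"
  by (auto simp: sm_def prod_eq_iff algebra_simps)

lemma lat_sm: "x \<in> lat m k \<Longrightarrow> sm a x \<in> lat m k"
  by (auto simp: lat_def sm_def)

lemma lat_uminus: "- x \<in> lat m k \<longleftrightarrow> x \<in> lat m k"
  by (auto simp: lat_def)

lemma lat_0 [simp]: "0 \<in> lat m k"
  by (auto simp: lat_def)

lemma sm_in_lat: "int m dvd a \<Longrightarrow> sm a v \<in> lat m m"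
  by (auto simp: lat_def sm_def)

lemma lat_add_left_iff: "y \<in> lat m k \<Longrightarrow> x + y \<in> lat m k \<longleftrightarrow> x \<in> lat m k"
  by (metis add_diff_cancel_right' lat_add lat_diff)

lemma comb_cong:
  assumes "int m dvd a - a'" "int m dvd b - b'" "int m dvd c - c'"
  shows "sm a f1 + sm b f2 + sm c f3 \<in> lat m m \<longleftrightarrow> sm a' f1 + sm b' f2 + sm c' f3 \<in> lat m m"
proof -
  have "sm (a - a') f1 + sm (b - b') f2 + sm (c - c') f3 \<in> lat m m"
    using assms by (intro lat_add sm_in_lat)
  moreover have "sm a f1 + sm b f2 + sm c f3 = (sm a' f1 + sm b' f2 + sm c' f3) +
      (sm (a - a') f1 + sm (b - b') f2 + sm (c - c') f3)"
    by (simp add: sm_simps algebra_simps)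
  ultimately show ?thesis by (metis lat_add_left_iff)
qed

text \<open>No short zero-sum in \<open>f1^(m-1) f2^(m-1) f3^(m-1)\<close> over \<open>C_m + C_m\<close>.\<close>

definition shortfree3 :: "nat \<Rightarrow> int \<times> int \<Rightarrow> int \<times> int \<Rightarrow> int \<times> int \<Rightarrow> bool" where
  "shortfree3 m f1 f2 f3 \<longleftrightarrow> (\<forall>a b c :: int. a \<in> {0..int m - 1} \<longrightarrow> b \<in> {0..int m - 1} \<longrightarrow> c \<in> {0..int m - 1} \<longrightarrow>
     a + b + c \<in> {1..int m} \<longrightarrow> sm a f1 + sm b f2 + sm c f3 \<notin> lat m m)"

lemma shortfree3_perm:
  assumes "shortfree3 m f1 f2 f3"
  shows "shortfree3 m f2 f1 f3" "shortfree3 m f1 f3 f2"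
proof -
  have H: "sm a f1 + sm b f2 + sm c f3 \<notin> lat m m"
    if "a \<in> {0..int m - 1}" "b \<in> {0..int m - 1}" "c \<in> {0..int m - 1}" "a + b + c \<in> {1..int m}" for a b c
    using assms that unfolding shortfree3_def by blast
  show "shortfree3 m f2 f1 f3" unfolding shortfree3_def
  proof (intro allI impI)
    fix a b c assume "a \<in> {0..int m - 1}" "b \<in> {0..int m - 1}" "c \<in> {0..int m - 1}" "a + b + c \<in> {1..int m}"
    then show "sm a f2 + sm b f1 + sm c f3 \<notin> lat m m" using H[of b a c] by (simp add: add_ac)
  qed
  show "shortfree3 m f1 f3 f2" unfolding shortfree3_def
  proof (intro allI impI)
    fix a b c assume "a \<in> {0..int m - 1}" "b \<in> {0..int m - 1}" "c \<in> {0..int m - 1}" "a + b + c \<in> {1..int m}"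
    then show "sm a f1 + sm b f3 + sm c f2 \<notin> lat m m" using H[of a c b] by (simp add: add_ac)
  qed
qed

text \<open>Reduce b and c to residues b' and c'. If they are not both zero, either b' + c' \<le> m
  or the complements m - b', m - c' have sum below m, and one of the two is a forbidden short
  zero-sum. By symmetry any two of the three vectors are independent modulo m.\<close>

lemma shortfree3_zero_coord:
  assumes m: "m \<ge> 2" and H: "shortfree3 m f1 f2 f3" and rel: "sm a f1 + sm b f2 + sm c f3 \<in> lat m m"
    and a: "int m dvd a"
  shows "int m dvd b \<and> int m dvd c"
proof (rule ccontr)
  assume n: "\<not> ?thesis"
  define b' c' where "b' = b mod int m" and "c' = c mod int m"
  have r: "b' \<in> {0..int m - 1}" "c' \<in> {0..int m - 1}" using m by (auto simp: b'_def c'_def)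
  have n': "\<not> (b' = 0 \<and> c' = 0)" using n by (auto simp: b'_def c'_def dvd_eq_mod_eq_0)
  have d: "int m dvd b - b'" "int m dvd c - c'" by (auto simp: b'_def c'_def minus_mod_eq_mult_div)
  have rel': "sm 0 f1 + sm b' f2 + sm c' f3 \<in> lat m m"
  proof -
    have "int m dvd a - 0" using a by simp
    from comb_cong[OF this d] rel show ?thesis by blast
  qed
  show False
  proof (cases "b' + c' \<le> int m")
    case True
    then show False using H[unfolded shortfree3_def, rule_format, of 0 b' c'] rel' r n' m by auto
  next
    case False
    have "sm 0 f1 + sm (int m - b') f2 + sm (int m - c') f3 \<in> lat m m"
    proof -
      have "sm (int m) f2 + sm (int m) f3 - (sm 0 f1 + sm b' f2 + sm c' f3) \<in> lat m m"
        by (rule lat_diff[OF _ rel']) (intro lat_add sm_in_lat; simp)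
      then show ?thesis by (simp add: sm_simps algebra_simps)
    qed
    then show False
      using H[unfolded shortfree3_def, rule_format, of 0 "int m - b'" "int m - c'"] r False m by auto
  qed
qed

lemma shortfree3_zero_coord':
  assumes "m \<ge> 2" "shortfree3 m f1 f2 f3" "sm a f1 + sm b f2 + sm c f3 \<in> lat m m"
  shows "int m dvd b \<Longrightarrow> int m dvd a \<and> int m dvd c" "int m dvd c \<Longrightarrow> int m dvd a \<and> int m dvd b"
proof -
  show "int m dvd b \<Longrightarrow> int m dvd a \<and> int m dvd c"
    using shortfree3_zero_coord[OF assms(1) shortfree3_perm(1)[OF assms(2)], of b a c] assms(3)
    by (simp add: add_ac)
  show "int m dvd c \<Longrightarrow> int m dvd a \<and> int m dvd b"
    using shortfree3_zero_coord[OF assms(1) shortfree3_perm(1)[OF shortfree3_perm(2)[OF assms(2)]], of c a b] assms(3)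
    by (simp add: add_ac)
qed

text \<open>By \<open>shortfree3_zero_coord\<close> the m^2 combinations of \<open>f2\<close> and
  \<open>f3\<close> are distinct modulo m, so they exhaust C_m^2 and one of them represents
  -f1.\<close>

lemma shortfree3_generate:
  assumes m: "m \<ge> 2" and H: "shortfree3 m f1 f2 f3"
  obtains u v where "u \<in> {0..int m - 1}" "v \<in> {0..int m - 1}" "sm 1 f1 + sm u f2 + sm v f3 \<in> lat m m"
proof -
  let ?I = "{0..int m - 1} \<times> {0..int m - 1}"
  let ?\<phi> = "\<lambda>(b, c). (fst (sm b f2 + sm c f3) mod int m, snd (sm b f2 + sm c f3) mod int m)"
  have sub: "?\<phi> ` ?I \<subseteq> ?I" using m by auto
  have inj: "inj_on ?\<phi> ?I"
  proof (rule inj_onI, clarify)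
    fix b c b' c' assume r: "b \<in> {0..int m - 1}" "c \<in> {0..int m - 1}" "b' \<in> {0..int m - 1}" "c' \<in> {0..int m - 1}"
      and e: "fst (sm b f2 + sm c f3) mod int m = fst (sm b' f2 + sm c' f3) mod int m"
        "snd (sm b f2 + sm c f3) mod int m = snd (sm b' f2 + sm c' f3) mod int m"
    have "(sm b f2 + sm c f3) - (sm b' f2 + sm c' f3) \<in> lat m m"
      using e by (simp add: lat_def mod_eq_dvd_iff)
    then have "sm 0 f1 + sm (b - b') f2 + sm (c - c') f3 \<in> lat m m" by (simp add: sm_simps algebra_simps)
    then have "int m dvd b - b'" "int m dvd c - c'" using shortfree3_zero_coord[OF m H] by auto
    then have "b mod int m = b' mod int m" "c mod int m = c' mod int m" by (auto simp: mod_eq_dvd_iff)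
    then show "b = b' \<and> c = c'" using r by auto
  qed
  have "?\<phi> ` ?I = ?I" by (rule endo_inj_surj[OF _ sub inj]) simp
  moreover have "(- fst f1 mod int m, - snd f1 mod int m) \<in> ?I" using m by auto
  ultimately have "(- fst f1 mod int m, - snd f1 mod int m) \<in> ?\<phi> ` ?I" by (simp only:)
  then obtain z where z: "(- fst f1 mod int m, - snd f1 mod int m) = ?\<phi> z" "z \<in> ?I" by (rule imageE)
  obtain b c where "z = (b, c)" by (cases z)
  with z have bc: "b \<in> {0..int m - 1}" "c \<in> {0..int m - 1}"
    "- fst f1 mod int m = fst (sm b f2 + sm c f3) mod int m"
    "- snd f1 mod int m = snd (sm b f2 + sm c f3) mod int m" by auto
  have "- f1 - (sm b f2 + sm c f3) \<in> lat m m"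
    using bc(3,4) by (simp add: lat_def mod_eq_dvd_iff)
  then have "- (- f1 - (sm b f2 + sm c f3)) \<in> lat m m" by (simp only: lat_uminus)
  then have "sm 1 f1 + sm b f2 + sm c f3 \<in> lat m m"
    by (simp add: sm_simps algebra_simps)
  with bc show thesis using that by blast
qed

lemma coprime_of_multiples:
  assumes m: "m \<ge> 2" and nd: "\<And>k. k \<in> {1..int m - 1} \<Longrightarrow> \<not> int m dvd k * x"
  shows "coprime x (int m)"
proof (rule ccontr)
  assume "\<not> coprime x (int m)"
  define d where "d = gcd x (int m)"
  have d: "d dvd x" "d dvd int m" "d > 0" "d \<noteq> 1"
    using \<open>\<not> coprime x (int m)\<close> m by (auto simp: d_def coprime_iff_gcd_eq_1)
  obtain k where k: "int m = d * k" using d(2) by (rule dvdE)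
  obtain y where y: "x = d * y" using d(1) by (rule dvdE)
  have "d \<ge> 2" using d by simp
  have "k > 0" using k m d(3) by (metis nat_0_less_mult_iff of_nat_0_less_iff zero_less_mult_pos not_numeral_le_zero gr0I)
  have "2 * k \<le> d * k" using \<open>k > 0\<close> \<open>d \<ge> 2\<close> by (intro mult_right_mono) auto
  then have "k \<in> {1..int m - 1}" using \<open>k > 0\<close> k by auto
  moreover have "int m dvd k * x" by (simp add: k y)
  ultimately show False using nd by blast
qed

text \<open>Write f1 + u f2 + v f3 = 0 modulo m. By \<open>trivial_residue_pair\<close> u = -1, v =
  -1 or u + v = 0; a permutation brings each case into the stated shape, in the last one after
  dividing by u.\<close>

theorem shortfree3_structure:
  assumes m: "m \<ge> 2" and H: "shortfree3 m f1 f2 f3"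
  obtains p1 p2 p3 x where "{#p1, p2, p3#} = {#f1, f2, f3#}" "x \<in> {1..int m - 1}" "coprime x (int m)"
    "sm x p1 - p2 + p3 \<in> lat m m"
proof -
  obtain u v where uv: "u \<in> {0..int m - 1}" "v \<in> {0..int m - 1}" "sm 1 f1 + sm u f2 + sm v f3 \<in> lat m m"
    using m H by (rule shortfree3_generate)
  have rel: "sm k f1 + sm (k * u) f2 + sm (k * v) f3 \<in> lat m m" for k
    using lat_sm[OF uv(3), of k] by (simp add: sm_simps)
  have nd: "\<not> int m dvd k * u" "\<not> int m dvd k * v" if k: "k \<in> {1..int m - 1}" for k
  proof -
    have nk: "\<not> int m dvd k" using k by (auto dest: zdvd_imp_le)
    show "\<not> int m dvd k * u" using shortfree3_zero_coord'(1)[OF m H rel[of k]] nk by blast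
    show "\<not> int m dvd k * v" using shortfree3_zero_coord'(2)[OF m H rel[of k]] nk by blast
  qed
  have uv1: "u \<in> {1..int m - 1}" "v \<in> {1..int m - 1}"
    using nd[of 1] uv(1,2) m by (cases "u = 0"; cases "v = 0"; auto)+
  \<comment> \<open>Neither the reduced relation (k, b, c) nor its complement (m - k, m - b, m - c)
    is short; this gives the lower and the upper bound.\<close>
  have age: "int m < k + k * u mod int m + k * v mod int m \<and> k + k * u mod int m + k * v mod int m < 2 * int m"
    if k: "k \<in> {1..int m - 1}" for k
  proof -
    define b c where "b = k * u mod int m" and "c = k * v mod int m"
    have r: "b \<in> {0..int m - 1}" "c \<in> {0..int m - 1}" "b \<noteq> 0" "c \<noteq> 0"
      using m nd[OF k] by (auto simp: b_def c_def dvd_eq_mod_eq_0)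
    have d: "int m dvd k * u - b" "int m dvd k * v - c" by (auto simp: b_def c_def minus_mod_eq_mult_div)
    have rel': "sm k f1 + sm b f2 + sm c f3 \<in> lat m m"
    proof -
      have "int m dvd k - k" by simp
      from comb_cong[OF this d] rel[of k] show ?thesis by blast
    qed
    then have 1: "\<not> k + b + c \<le> int m"
      using H[unfolded shortfree3_def, rule_format, of k b c] r k by auto
    have "sm (int m) f1 + sm (int m) f2 + sm (int m) f3 - (sm k f1 + sm b f2 + sm c f3) \<in> lat m m"
      by (rule lat_diff[OF _ rel']) (intro lat_add sm_in_lat; simp)
    then have "sm (int m - k) f1 + sm (int m - b) f2 + sm (int m - c) f3 \<in> lat m m"
      by (simp add: sm_simps algebra_simps)
    then have "\<not> (int m - k) + (int m - b) + (int m - c) \<le> int m"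
      using H[unfolded shortfree3_def, rule_format, of "int m - k" "int m - b" "int m - c"] r k by auto
    then show ?thesis using 1 unfolding b_def c_def by linarith
  qed
  have cu: "coprime u (int m)" and cv: "coprime v (int m)"
    using coprime_of_multiples[OF m] nd by auto
  have "u = int m - 1 \<or> v = int m - 1 \<or> u + v = int m"
    by (rule trivial_residue_pair) (use m uv1 nd age in auto)
  then consider "u = int m - 1" | "v = int m - 1" | "u + v = int m" by blast
  then show thesis
  proof cases
    case 1
    have eq: "sm v f3 - f2 + f1 = (sm 1 f1 + sm u f2 + sm v f3) - sm (int m) f2"
      by (simp add: 1 sm_simps algebra_simps)
    have "sm v f3 - f2 + f1 \<in> lat m m" unfolding eq by (intro lat_diff uv(3) sm_in_lat) simp
    then show thesis using that[of f3 f2 f1 v] uv1 cv by (simp add: add_mset_commute)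
  next
    case 2
    have eq: "sm u f2 - f3 + f1 = (sm 1 f1 + sm u f2 + sm v f3) - sm (int m) f3"
      by (simp add: 2 sm_simps algebra_simps)
    have "sm u f2 - f3 + f1 \<in> lat m m" unfolding eq by (intro lat_diff uv(3) sm_in_lat) simp
    then show thesis using that[of f2 f3 f1 u] uv1 cu by (simp add: add_mset_commute)
  next
    case 3
    obtain y where y: "[u * y = 1] (mod int m)" using cu by (metis cong_solve_coprime_int)
    define x where "x = y mod int m"
    have ux: "[u * x = 1] (mod int m)" using y by (simp add: x_def cong_def mod_simps)
    have cx: "coprime x (int m)" using ux by (metis cong_solve_coprime_int coprime_iff_invertible_int mult.commute)
    have x0: "x \<in> {0..int m - 1}" using m by (simp add: x_def)
    have "x \<noteq> 0"
    proof
      assume "x = 0"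
      then show False using ux m by (simp add: cong_def)
    qed
    then have x1: "x \<in> {1..int m - 1}" using x0 by auto
    have d: "int m dvd 1 - u * x" using ux by (metis cong_iff_dvd_diff cong_sym)
    have v: "v = int m - u" using 3 by simp
    have "sm x f1 - f3 + f2 = sm x (sm 1 f1 + sm u f2 + sm v f3) - sm (int m) (sm x f3)
        + sm (1 - u * x) (f2 - f3)"
      by (simp add: v sm_simps algebra_simps)
    also have "\<dots> \<in> lat m m" by (intro lat_add[OF lat_diff[OF lat_sm[OF uv(3)] sm_in_lat] sm_in_lat]) (use d in auto)
    finally show thesis using that[of f1 f3 f2 x] x1 cx by (simp add: add_mset_commute)
  qed
qed

section \<open>The inverse theorem for short zero-sums\<close>

definition res :: "nat \<Rightarrow> int \<times> int \<Rightarrow> int \<times> int" where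
  "res m v = (fst v mod int m, snd v mod int m)"

lemma res_eq_iff: "res m x = res m y \<longleftrightarrow> x - y \<in> lat m m"
  by (simp add: res_def lat_def mod_eq_dvd_iff)

text \<open>Property C of C_m^2 for representatives; \<open>3 * (m - 1)\<close> is the value of eta
  minus one, as \<open>4 * (m - 1)\<close> is for s in the next definition.\<close>

definition lattice_C :: "nat \<Rightarrow> bool" where
  "lattice_C m \<longleftrightarrow> (\<forall>X. size X = 3 * (m - 1) \<longrightarrow> (\<nexists>B. B \<subseteq># X \<and> zs_short (lat m m) m B) \<longrightarrow>
    (\<exists>T. image_mset (res m) X = repeat_mset (m - 1) T))"

definition lattice_D :: "nat \<Rightarrow> bool" where
  "lattice_D m \<longleftrightarrow> (\<forall>X. size X = 4 * (m - 1) \<longrightarrow> (\<nexists>B. B \<subseteq># X \<and> zs_len (lat m m) m B) \<longrightarrow>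
    (\<exists>T. image_mset (res m) X = repeat_mset (m - 1) T))"

lemma sum_mset_replicate: "\<Sum>\<^sub># (replicate_mset k g) = sm (int k) g"
  by (induction k) (simp_all add: sm_simps)

lemma sum_mset_near:
  assumes "\<forall>x\<in>#B. x - g \<in> lat a b"
  shows "\<Sum>\<^sub># B - sm (int (size B)) g \<in> lat a b"
  using assms
proof (induction B)
  case (add x B)
  have "(x - g) + (\<Sum>\<^sub># B - sm (int (size B)) g) \<in> lat a b" using add by (intro lat_add) auto
  then show ?case by (simp add: sm_simps algebra_simps)
qed (simp add: sm_simps)

lemma lat_near: "x - y \<in> lat a b \<Longrightarrow> x \<in> lat a b \<longleftrightarrow> y \<in> lat a b"
  by (metis diff_add_cancel lat_add_left_iff add.commute)

lemma const_block:
  assumes "size X = m" "\<forall>x\<in>#X. res m x = f"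
  shows "\<Sum>\<^sub># X \<in> lat m m"
proof (cases "X = {#}")
  case False
  then obtain g where "g \<in># X" by (rule multiset_nonemptyE)
  then have "\<forall>x\<in>#X. x - g \<in> lat m m" using assms(2) by (simp flip: res_eq_iff)
  from sum_mset_near[OF this] show ?thesis using lat_near sm_in_lat assms(1) by (metis dvd_refl)
qed simp

lemma cancel_block:
  assumes m: "m \<ge> 2" and s: "\<Sum>\<^sub># (add_mset g B) \<in> lat m m" "size B = m - 1" "\<forall>x\<in>#B. res m x = f"
  shows "res m g = f"
proof -
  have "B \<noteq> {#}" using m s(2) by auto
  then obtain y where y: "y \<in># B" by (rule multiset_nonemptyE)
  then have "\<forall>x\<in>#B. x - y \<in> lat m m" using s(3) by (simp flip: res_eq_iff)
  from sum_mset_near[OF this] have "\<Sum>\<^sub># B - sm (int (m - 1)) y \<in> lat m m" using s(2) by simp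
  then have "\<Sum>\<^sub># (add_mset g B) - (\<Sum>\<^sub># B - sm (int (m - 1)) y) - sm (int m) y \<in> lat m m"
    by (intro lat_diff[OF lat_diff[OF s(1)] sm_in_lat]) auto
  then have "g - y \<in> lat m m" using m by (simp add: sm_simps of_nat_diff algebra_simps)
  then show ?thesis using s(3) y by (metis res_eq_iff)
qed

lemma block_system_C:
  assumes m: "m \<ge> 2" and C: "lattice_C m"
  shows "block_system (zs_short (lat m m) m) (res m) 3 m"
proof
  have "3 * (m - 1) + 1 = 3 * m - 2" using m by simp
  then show "forces (zs_short (lat m m) m) (3 * (m - 1) + 1)" using eta_square[of m] m by simp
  show "\<exists>T. image_mset (res m) X = repeat_mset (m - 1) T"
    if "size X = 3 * (m - 1)" "\<nexists>B. B \<subseteq># X \<and> zs_short (lat m m) m B" for X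
    using C that unfolding lattice_C_def by blast
  show "zs_short (lat m m) m X" if "size X = m" "\<forall>x\<in>#X. res m x = f" for X f
    using const_block[OF that] that(1) m by (simp add: zs_short_def)
  show "res m g = f" if "zs_short (lat m m) m (add_mset g B)" "size B = m - 1" "\<forall>x\<in>#B. res m x = f" for g B f
    by (rule cancel_block[OF m _ that(2,3)]) (use that(1) in \<open>simp add: zs_short_def\<close>)
qed (use m in \<open>auto simp: zs_short_def\<close>)

lemma block_system_D:
  assumes m: "m \<ge> 2" and D: "lattice_D m"
  shows "block_system (zs_len (lat m m) m) (res m) 4 m"
proof
  have "4 * (m - 1) + 1 = 4 * m - 3" using m by simp
  then show "forces (zs_len (lat m m) m) (4 * (m - 1) + 1)" using kemnitz[of m] m by simp
  show "\<exists>T. image_mset (res m) X = repeat_mset (m - 1) T"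
    if "size X = 4 * (m - 1)" "\<nexists>B. B \<subseteq># X \<and> zs_len (lat m m) m B" for X
    using D that unfolding lattice_D_def by blast
  show "zs_len (lat m m) m X" if "size X = m" "\<forall>x\<in>#X. res m x = f" for X f
    using const_block[OF that] that(1) by (simp add: zs_len_def)
  show "res m g = f" if "zs_len (lat m m) m (add_mset g B)" "size B = m - 1" "\<forall>x\<in>#B. res m x = f" for g B f
    by (rule cancel_block[OF m _ that(2,3)]) (use that(1) in \<open>simp add: zs_len_def\<close>)
qed (use m in \<open>auto simp: zs_len_def\<close>)

lemma lat_mult_subset: "lat m (m * n) \<subseteq> lat m m"
  by (auto simp: lat_def dest: dvd_mult_left)

lemma lat_snd_iff_dvd: "m > 0 \<Longrightarrow> x \<in> lat m m \<Longrightarrow> x \<in> lat m (m * n) \<longleftrightarrow> int n dvd snd x div int m"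
  using lat_snd_iff[of m x n] by (simp add: mult_of_def)

lemma shortfree3_mset:
  assumes p: "{#p1, p2, p3#} = {#f1, f2, f3#}" and sf: "shortfree3 m f1 f2 f3"
  shows "shortfree3 m p1 p2 p3"
proof -
  note perm = shortfree3_perm[OF sf] shortfree3_perm[OF shortfree3_perm(1)[OF sf]]
    shortfree3_perm[OF shortfree3_perm(2)[OF sf]]
    shortfree3_perm(2)[OF shortfree3_perm(1)[OF shortfree3_perm(2)[OF sf]]]
  consider "p1 = f1 \<and> {#p2, p3#} = {#f2, f3#}" | "p1 = f2 \<and> {#p2, p3#} = {#f1, f3#}"
    | "p1 = f3 \<and> {#p2, p3#} = {#f1, f2#}"
  proof -
    have "p1 \<in># {#f1, f2, f3#}" using p by (metis union_single_eq_member)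
    then consider "p1 = f1" | "p1 = f2" | "p1 = f3" by auto
    then show thesis
    proof cases
      case 1 then show thesis using that(1) p by simp
    next
      case 2 then show thesis using that(2) p by (simp add: add_mset_commute)
    next
      case 3 then show thesis using that(3) p by (simp add: add_mset_commute)
    qed
  qed
  then show ?thesis using sf perm by cases (auto simp: add_eq_conv_ex add_mset_eq_single)
qed

text \<open>The three fibres of a maximal sequence without short zero-sum, normalised by
  \<open>shortfree3_structure\<close>; \<open>(0, m * t)\<close> represents the common sum of the blocks.\<close>

definition config_C :: "nat \<Rightarrow> nat \<Rightarrow> (int \<times> int) multiset \<Rightarrow> int \<times> int \<Rightarrow> int \<times> int \<Rightarrow> int \<times> int \<Rightarrow>
    (int \<times> int) multiset \<Rightarrow> (int \<times> int) multiset \<Rightarrow> (int \<times> int) multiset \<Rightarrow> nat \<Rightarrow> nat \<Rightarrow> nat \<Rightarrow> int \<Rightarrow> int \<Rightarrow> bool" where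
  "config_C m n S g1 g2 g3 A1 A2 A3 s1 s2 s3 x t \<longleftrightarrow>
    S = A1 + A2 + A3 \<and> size A1 = s1 * m - 1 \<and> size A2 = s2 * m - 1 \<and> size A3 = s3 * m - 1 \<and>
    s1 \<ge> 1 \<and> s2 \<ge> 1 \<and> s3 \<ge> 1 \<and> s1 + s2 + s3 = n + 2 \<and>
    g1 \<in># A1 \<and> g2 \<in># A2 \<and> g3 \<in># A3 \<and>
    (\<forall>y\<in>#A1. y - g1 \<in> lat m m) \<and> (\<forall>y\<in>#A2. y - g2 \<in> lat m m) \<and> (\<forall>y\<in>#A3. y - g3 \<in> lat m m) \<and>
    (s1 \<ge> 2 \<longrightarrow> (\<forall>y\<in>#A1. y - g1 \<in> lat m (m * n)) \<and> sm (int m) g1 - (0, int m * t) \<in> lat m (m * n)) \<and>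
    (s2 \<ge> 2 \<longrightarrow> (\<forall>y\<in>#A2. y - g2 \<in> lat m (m * n)) \<and> sm (int m) g2 - (0, int m * t) \<in> lat m (m * n)) \<and>
    (s3 \<ge> 2 \<longrightarrow> (\<forall>y\<in>#A3. y - g3 \<in> lat m (m * n)) \<and> sm (int m) g3 - (0, int m * t) \<in> lat m (m * n)) \<and>
    x \<in> {1..int m - 1} \<and> coprime x (int m) \<and> sm x g1 - g2 + g3 \<in> lat m m \<and> shortfree3 m g1 g2 g3 \<and>
    coprime t (int n)"

text \<open>Subtracting the relation from m g1 exchanges the roles of g2 and g3 and replaces x by m
  - x.\<close>

lemma config_C_swap:
  assumes "config_C m n S g1 g2 g3 A1 A2 A3 s1 s2 s3 x t"
  shows "config_C m n S g1 g3 g2 A1 A3 A2 s1 s3 s2 (int m - x) t"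
proof -
  have c: "coprime x (int m)" "sm x g1 - g2 + g3 \<in> lat m m"
    using assms unfolding config_C_def by blast+
  have "gcd (int m - x) (int m) = gcd x (int m)" by (metis gcd.commute gcd_diff1 gcd_diff2)
  then have "coprime (int m - x) (int m)" using c(1) by (simp add: coprime_iff_gcd_eq_1)
  moreover have "sm (int m - x) g1 - g3 + g2 \<in> lat m m"
  proof -
    have "sm (int m) g1 - (sm x g1 - g2 + g3) \<in> lat m m" by (rule lat_diff[OF sm_in_lat c(2)]) simp
    then show ?thesis by (simp add: sm_simps algebra_simps)
  qed
  ultimately show ?thesis using assms shortfree3_perm(2) unfolding config_C_def
    by (auto simp: add_ac)
qed

text \<open>A packing of n blocks would yield a short zero-sum. So n - 1 is the maximum, the n - 1
  block sums form a zero-sum free sequence over C_n, and by \<open>zsfree_constant\<close> they all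
  equal one generator t.\<close>

theorem config_C_exists:
  assumes m: "m \<ge> 2" and n: "n \<ge> 1" and C: "lattice_C m"
    and sz: "size S = m * n + 2 * m - 3"
    and no: "\<nexists>T. T \<subseteq># S \<and> zs_short (lat m (m * n)) (m * n) T"
  shows "\<exists>g1 g2 g3 A1 A2 A3 s1 s2 s3 x t. config_C m n S g1 g2 g3 A1 A2 A3 s1 s2 s3 x t"
proof -
  let ?P = "zs_short (lat m m) m" and ?b = "\<lambda>v :: int \<times> int. snd v div int m"
  interpret block_system ?P "res m" 3 m by (rule block_system_C[OF m C])
  have b: "add_on (lat m m) ?b" by (rule add_on_lat_snd)
  have N: "x \<in> lat m m \<Longrightarrow> ?b x \<in> mult_of n \<Longrightarrow> x \<in> lat m (m * n)" for x
    using lat_snd_iff[of m x n] m by simp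
  have zsf: "\<nexists>U. U \<subseteq># image_mset (\<lambda>B. ?b (\<Sum>\<^sub># B)) FF \<and> zs_short (mult_of n) n U"
    if "\<forall>B\<in>#FF. ?P B" "\<Sum>\<^sub># FF \<subseteq># S" for FF
    using lift_zs_short[OF b N that] no by blast
  have np: "\<not> packing ?P (Suc (n - 1)) S"
  proof
    assume "packing ?P (Suc (n - 1)) S"
    then obtain FF where FF: "size FF = Suc (n - 1)" "\<forall>B\<in>#FF. ?P B" "\<Sum>\<^sub># FF \<subseteq># S"
      unfolding packing_def by blast
    have "\<exists>U. U \<subseteq># image_mset (\<lambda>B. ?b (\<Sum>\<^sub># B)) FF \<and> zs_short (mult_of n) n U"
      using forcesD[OF eta_cyclic[of n], of "image_mset (\<lambda>B. ?b (\<Sum>\<^sub># B)) FF"] FF(1) n by simp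
    then show False using zsf FF(2,3) by blast
  qed
  have szS: "size S = 3 * (m - 1) + (n - 1) * m"
    using sz m n by (cases m; cases n) (auto simp: algebra_simps)
  obtain F where F: "finite F" "card F = 3" "set_mset (image_mset (res m) S) = F"
    "\<forall>f\<in>F. m dvd count (image_mset (res m) S) f + 1"
    using class_structure[OF szS np] by blast
  interpret fibred ?P "res m" 3 m "lat m m" "lat m (m * n)" ?b n "n - 1" S F "zsfree n"
  proof
    show "x \<in> lat m m \<Longrightarrow> x \<in> lat m (m * n) \<longleftrightarrow> int n dvd ?b x" for x
      using lat_snd_iff_dvd m by simp
    show "zsfree n (image_mset (\<lambda>B. ?b (\<Sum>\<^sub># B)) FF)"
      if "size FF = n - 1" "\<forall>B\<in>#FF. ?P B" "\<Sum>\<^sub># FF \<subseteq># S" for FF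
      unfolding zsfree_def
    proof (intro conjI allI impI notI)
      show "size (image_mset (\<lambda>B. ?b (\<Sum>\<^sub># B)) FF) = n - 1" using that(1) by simp
      fix T assume T: "T \<subseteq># image_mset (\<lambda>B. ?b (\<Sum>\<^sub># B)) FF" "T \<noteq> {#}" "\<Sum>\<^sub># T \<in> mult_of n"
      have "size T \<le> n - 1" using size_mset_mono[OF T(1)] that(1) by simp
      moreover have "size T \<ge> 1" using T(2) by (simp add: Suc_le_eq nonempty_has_size)
      ultimately have "zs_short (mult_of n) n T" using T(3) by (simp add: zs_short_def)
      then show False using zsf[OF that(2,3)] T(1) by blast
    qed
    show "int n dvd c - c'" if "zsfree n (add_mset c U)" "zsfree n (add_mset c' U)" for c c' U
      using zsfree_cancel[OF _ that] n by (cases "n = 1") auto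
    show "res m x = res m y \<longleftrightarrow> x - y \<in> lat m m" for x y by (rule res_eq_iff)
  qed (use b F szS in \<open>auto simp: lat_diff zs_short_def\<close>)
  define g where "g f = (SOME x. x \<in># S \<and> res m x = f)" for f
  have g: "g f \<in># S \<and> res m (g f) = f" if "f \<in> F" for f
  proof -
    have "f \<in> res m ` set_mset S" using that F(3) by simp
    then have "\<exists>x. x \<in># S \<and> res m x = f" by auto
    then show ?thesis unfolding g_def by (rule someI_ex)
  qed
  obtain f1 f2 f3 where f: "F = {f1, f2, f3}" "f1 \<noteq> f2" "f1 \<noteq> f3" "f2 \<noteq> f3"
    using F(2) by (auto simp: card_3_iff)
  let ?A = "\<lambda>f. filter_mset (\<lambda>x. res m x = f) S"
  have sA: "size (?A f) = s f * m - 1" "size (?A f) \<ge> m - 1" if "f \<in> F" for f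
    using size_fibre[OF that] s_pos[OF that] by (cases "s f"; simp)+
  \<comment> \<open>A short zero-sum with fewer than m terms in each class leaves a standard packing
    intact and would be the n-th block.\<close>
  have sf3: "shortfree3 m (g f1) (g f2) (g f3)"
    unfolding shortfree3_def
  proof (intro allI impI notI)
    fix a1 a2 a3 :: int
    assume a: "a1 \<in> {0..int m - 1}" "a2 \<in> {0..int m - 1}" "a3 \<in> {0..int m - 1}" "a1 + a2 + a3 \<in> {1..int m}"
      and z: "sm a1 (g f1) + sm a2 (g f2) + sm a3 (g f3) \<in> lat m m"
    have ex: "\<exists>T. T \<subseteq># ?A f' \<and> size T = nat a" if "f' \<in> F" "a \<in> {0..int m - 1}" for f' a
    proof -
      have "nat a \<le> size (?A f')" using sA(2)[OF that(1)] that(2) by auto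
      then show ?thesis by (metis obtain_submset_of_size)
    qed
    obtain T1 where T1: "T1 \<subseteq># ?A f1" "size T1 = nat a1" using ex[of f1 a1] f a by auto
    obtain T2 where T2: "T2 \<subseteq># ?A f2" "size T2 = nat a2" using ex[of f2 a2] f a by auto
    obtain T3 where T3: "T3 \<subseteq># ?A f3" "size T3 = nat a3" using ex[of f3 a3] f a by auto
    have S3: "S = ?A f1 + ?A f2 + ?A f3" using partition_fibres f by (simp add: add.assoc)
    have TS: "T1 + T2 + T3 \<subseteq># S"
      by (subst S3) (intro mset_subset_eq_mono_add T1(1) T2(1) T3(1))
    have near: "\<Sum>\<^sub># T - sm a (g f') \<in> lat m m" "image_mset (res m) T = replicate_mset (nat a) f'"
      if "T \<subseteq># ?A f'" "size T = nat a" "f' \<in> F" "a \<ge> 0" for T a f'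
    proof -
      have r: "\<forall>x\<in>#T. res m x = f'" using that(1) by (auto dest: mset_subset_eqD)
      then have "\<forall>x\<in>#T. x - g f' \<in> lat m m" using g[OF that(3)] by (simp flip: res_eq_iff)
      from sum_mset_near[OF this] show "\<Sum>\<^sub># T - sm a (g f') \<in> lat m m" using that by simp
      show "image_mset (res m) T = replicate_mset (nat a) f'" using image_mset_const_on[of T "res m" f'] r that(2) by simp
    qed
    have ff: "f1 \<in> F" "f2 \<in> F" "f3 \<in> F" using f by auto
    have aa: "a1 \<ge> 0" "a2 \<ge> 0" "a3 \<ge> 0" using a by auto
    have "(\<Sum>\<^sub># T1 - sm a1 (g f1)) + (\<Sum>\<^sub># T2 - sm a2 (g f2)) + (\<Sum>\<^sub># T3 - sm a3 (g f3)) \<in> lat m m"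
      by (intro lat_add near(1) T1 T2 T3 ff aa)
    then have "(\<Sum>\<^sub># T1 + \<Sum>\<^sub># T2 + \<Sum>\<^sub># T3) - (sm a1 (g f1) + sm a2 (g f2) + sm a3 (g f3)) \<in> lat m m"
      by (simp add: algebra_simps)
    then have "\<Sum>\<^sub># (T1 + T2 + T3) \<in> lat m m" using z lat_near by fastforce
    then have "?P (T1 + T2 + T3)" using T1(2) T2(2) T3(2) a by (auto simp: zs_short_def)
    moreover have "count (image_mset (res m) (T1 + T2 + T3)) f' < m" for f'
      using near(2)[OF T1 ff(1) aa(1)] near(2)[OF T2 ff(2) aa(2)] near(2)[OF T3 ff(3) aa(3)] a f m by auto
    ultimately have "packing ?P (Suc (n - 1)) S" using TS packing_of_sparse_block by blast
    then show False using np by blast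
  qed
  obtain p1 p2 p3 x where p: "{#p1, p2, p3#} = {#g f1, g f2, g f3#}" "x \<in> {1..int m - 1}" "coprime x (int m)"
    "sm x p1 - p2 + p3 \<in> lat m m"
    using m sf3 by (rule shortfree3_structure)
  have sfp: "shortfree3 m p1 p2 p3" by (rule shortfree3_mset[OF p(1) sf3])
  have setF: "{res m p1, res m p2, res m p3} = F"
  proof -
    have "image_mset (res m) {#p1, p2, p3#} = {#f1, f2, f3#}" unfolding p(1) using g f by simp
    from arg_cong[OF this, of set_mset] show ?thesis using f by auto
  qed
  have card3: "card {res m p1, res m p2, res m p3} = 3" using setF F(2) by simp
  then have dist: "res m p1 \<noteq> res m p2" "res m p1 \<noteq> res m p3" "res m p2 \<noteq> res m p3"
    by (auto simp: card_insert_if split: if_splits)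
  have pS: "p1 \<in># S" "p2 \<in># S" "p3 \<in># S"
  proof -
    have "{p1, p2, p3} = {g f1, g f2, g f3}" using arg_cong[OF p(1), of set_mset] by simp
    moreover have "{g f1, g f2, g f3} \<subseteq> set_mset S" using g f by auto
    ultimately have "{p1, p2, p3} \<subseteq> set_mset S" by (simp only:)
    then show "p1 \<in># S" "p2 \<in># S" "p3 \<in># S" by auto
  qed
  define G where "G f = (if f = res m p1 then p1 else if f = res m p2 then p2 else p3)" for f
  have G: "G (res m p1) = p1" "G (res m p2) = p2" "G (res m p3) = p3" using dist by (auto simp: G_def)
  have GF: "G f \<in># S \<and> res m (G f) = f" if "f \<in> F" for f
    using that G pS unfolding setF[symmetric] by auto
  obtain U where U: "zsfree n U" "image_mset (\<lambda>x. x mod int n) U = image_mset (\<lambda>f. weight G f mod int n) blocks"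
    using good_standard_packing[of G] lat_mult_subset GF by metis
  \<comment> \<open>For n = 1 there are no block sums, and every t is coprime to 1.\<close>
  obtain t where t: "coprime t (int n)" "\<forall>x\<in>#U. x mod int n = t mod int n"
  proof (cases "n = 1")
    case True
    then show thesis using that[of 1] U by (auto simp: zsfree_def)
  next
    case False
    then show thesis using zsfree_constant[of n U] U(1) n that by auto
  qed
  have lifted: "(\<forall>y\<in>#?A f. y - G f \<in> lat m (m * n)) \<and> sm (int m) (G f) - (0, int m * t) \<in> lat m (m * n)"
    if fF: "f \<in> F" "s f \<ge> 2" for f
  proof
    show "\<forall>y\<in>#?A f. y - G f \<in> lat m (m * n)"
      using lifts_agree'[of _ "G f"] GF[OF fF(1)] fF by auto
    have "f \<in># blocks" using fF by (simp add: count_blocks flip: count_greater_zero_iff)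
    then have "weight G f mod int n \<in># image_mset (\<lambda>x. x mod int n) U" unfolding U(2) by simp
    then have "weight G f mod int n = t mod int n" using t(2) by auto
    then have w: "int n dvd snd (sm (int m) (G f)) div int m - t"
      by (simp add: weight_def sum_mset_replicate mod_eq_dvd_iff)
    have 1: "sm (int m) (G f) - (0, int m * t) \<in> lat m m" by (simp add: lat_def sm_def)
    have "snd (sm (int m) (G f) - (0, int m * t)) div int m = snd (sm (int m) (G f)) div int m - t"
      using m by (simp add: sm_def flip: right_diff_distrib)
    then show "sm (int m) (G f) - (0, int m * t) \<in> lat m (m * n)"
      using lat_snd_iff_dvd[OF _ 1, of n] w m by simp
  qed
  have nearA: "\<forall>y\<in>#?A f. y - G f \<in> lat m m" if "f \<in> F" for f
    using GF[OF that] by (auto simp flip: res_eq_iff)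
  have pF: "res m p1 \<in> F" "res m p2 \<in> F" "res m p3 \<in> F" using setF by auto
  have "config_C m n S p1 p2 p3 (?A (res m p1)) (?A (res m p2)) (?A (res m p3))
     (s (res m p1)) (s (res m p2)) (s (res m p3)) x t"
    unfolding config_C_def
  proof (intro conjI)
    show "S = ?A (res m p1) + ?A (res m p2) + ?A (res m p3)"
      using partition_fibres dist unfolding setF[symmetric] by (simp add: add.assoc)
    have "s (res m p1) + s (res m p2) + s (res m p3) = 3 + (n - 1)"
      using size_blocks(2) dist unfolding setF[symmetric] by simp
    then show "s (res m p1) + s (res m p2) + s (res m p3) = n + 2" using n by simp
  qed (use sA(1)[OF pF(1)] sA(1)[OF pF(2)] sA(1)[OF pF(3)] s_pos[OF pF(1)] s_pos[OF pF(2)] s_pos[OF pF(3)] pS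
      nearA[OF pF(1)] nearA[OF pF(2)] nearA[OF pF(3)]
      lifted[OF pF(1)] lifted[OF pF(2)] lifted[OF pF(3)] p sfp t(1) in \<open>simp_all only: G, auto\<close>)
  then show ?thesis by blast
qed

section \<open>From a configuration to the forms (1a) and (1b)\<close>

definition near :: "nat \<Rightarrow> nat \<Rightarrow> int \<times> int \<Rightarrow> nat \<Rightarrow> (int \<times> int) multiset \<Rightarrow> bool" where
  "near m k g l A \<longleftrightarrow> size A = l \<and> (\<forall>y\<in>#A. y - g \<in> lat m k)"

text \<open>In the quotient by \<open>lat m k\<close> this says that \<open>g1\<close>, \<open>g2\<close> generate and \<open>g2\<close> has order \<open>k\<close>.\<close>

definition rank2_pair :: "nat \<Rightarrow> nat \<Rightarrow> int \<times> int \<Rightarrow> int \<times> int \<Rightarrow> bool" where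
  "rank2_pair m k g1 g2 \<longleftrightarrow> (\<forall>i j. sm i g1 + sm j g2 \<in> lat m k \<longrightarrow> int m dvd i) \<and>
     (\<forall>j. sm j g2 \<in> lat m k \<longrightarrow> int k dvd j)"

text \<open>The condition on \<open>sm (int m) e1\<close> is what turns the generating pair of
  \<open>rank2_pair\<close> into a basis; it is absent from \<open>form_1b\<close>.\<close>

definition form_1a :: "nat \<Rightarrow> nat \<Rightarrow> (int \<times> int) multiset \<Rightarrow> bool" where
  "form_1a m n S \<longleftrightarrow> (\<exists>e1 e2 x s A1 A2 A3. S = A1 + A2 + A3 \<and> s \<in> {1..n} \<and> coprime x (int m) \<and>
     rank2_pair m (m * n) e1 e2 \<and> sm (int m) e1 \<in> lat m (m * n) \<and> near m (m * n) e1 (m - 1) A1 \<and>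
     near m (m * n) e2 (s * m - 1) A2 \<and> near m (m * n) (sm (- x) e1 + e2) ((n + 1 - s) * m - 1) A3)"

definition form_1b :: "nat \<Rightarrow> nat \<Rightarrow> (int \<times> int) multiset \<Rightarrow> bool" where
  "form_1b m n S \<longleftrightarrow> (\<exists>g1 g2 A1 A2 A3. S = A1 + A2 + A3 \<and> rank2_pair m (m * n) g1 g2 \<and>
     near m (m * n) g1 (m - 1) A1 \<and> near m (m * n) g2 (m * n - 1) A2 \<and> near m (m * n) (- g1 + g2) (m - 1) A3)"

lemma near_shift: "near m k g l A \<Longrightarrow> g - g' \<in> lat m k \<Longrightarrow> near m k g' l A"
  unfolding near_def by (metis diff_add_cancel lat_add add_diff_eq)

lemma unit_multiple:
  assumes "coprime t (int n)" "n \<ge> 1"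
  obtains r where "r < n" "int n dvd c + int r * t"
proof -
  obtain y where y: "[t * y = 1] (mod int n)" using assms(1) by (metis cong_solve_coprime_int)
  define r where "r = nat ((- c * y) mod int n)"
  have r: "int r = (- c * y) mod int n" using assms(2) by (simp add: r_def)
  have "[int r * t = (- c * y) * t] (mod int n)" unfolding r by (intro cong_mult) (auto simp: cong_def)
  also have "[(- c * y) * t = - c * 1] (mod int n)"
    using cong_mult[OF cong_refl[of "- c"] y] by (simp add: mult_ac)
  finally have "int n dvd c + int r * t" by (simp add: cong_iff_dvd_diff add.commute)
  moreover have "int r < int n" unfolding r using assms(2) by simp
  then have "r < n" by simp
  ultimately show thesis using that by blast
qed

lemma near_sum:
  assumes "near m k g l A"
  shows "\<Sum>\<^sub># A - sm (int l) g \<in> lat m k"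
  using assms sum_mset_near unfolding near_def by blast

lemma near_sub: "near m k g l A \<Longrightarrow> B \<subseteq># A \<Longrightarrow> near m k g (size B) B"
  unfolding near_def by (auto dest: mset_subset_eqD)

text \<open>\<open>Y\<close> takes at most m - 1 of the s m - 1 elements, so (s - 1) m remain and
  there is room for r < s blocks. For s = 1 only r = 0 occurs, hence the lifting information is
  asked for s \<ge> 2.\<close>

lemma fibre_blocks:
  assumes A: "size A = s * m - 1" "r < s"
    and lift: "s \<ge> 2 \<Longrightarrow> (\<forall>y\<in>#A. y - g \<in> lat m k) \<and> sm (int m) g - H \<in> lat m k"
    and Y: "Y \<subseteq># A" "size Y \<le> m - 1" and m: "m > 0"
  obtains Z where "Z \<subseteq># A - Y" "size Z = r * m" "\<Sum>\<^sub># Z - sm (int r) H \<in> lat m k"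
proof (cases "r = 0")
  case True
  then show thesis using that[of "{#}"] by (simp add: sm_simps)
next
  case False
  then have s2: "s \<ge> 2" using A(2) by simp
  have "(r + 1) * m \<le> s * m" using A(2) by (intro mult_right_mono) auto
  then have "r * m \<le> size (A - Y)" using A(1) Y m by (simp add: size_Diff_submset)
  then obtain Z where Z: "Z \<subseteq># A - Y" "size Z = r * m" by (rule obtain_submset_of_size)
  have "Z \<subseteq># A" using Z(1) by (metis diff_subset_eq_self subset_mset.order_trans)
  then have "near m k g (r * m) Z" using lift[OF s2] Z(2) by (auto simp: near_def dest: mset_subset_eqD)
  from near_sum[OF this] have 1: "\<Sum>\<^sub># Z - sm (int (r * m)) g \<in> lat m k" .
  have "(\<Sum>\<^sub># Z - sm (int (r * m)) g) + sm (int r) (sm (int m) g - H) \<in> lat m k"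
    by (intro lat_add 1 lat_sm) (use lift[OF s2] in blast)
  then have "\<Sum>\<^sub># Z - sm (int r) H \<in> lat m k" by (simp add: sm_simps)
  then show thesis using that Z by blast
qed

lemma sub_diff_union:
  assumes "Y \<subseteq># A" "Z \<subseteq># A - Y"
  shows "Y + Z \<subseteq># A"
  using mset_subset_eq_mono_add[OF subset_mset.order_refl[of Y] assms(2)] assms(1) by simp

text \<open>A zero-sum modulo \<open>lat m m\<close> of length between \<open>m + 1\<close> and \<open>2 m - 1\<close> has the same sum as the
  blocks, since any other sum could be completed to a short zero-sum by at most \<open>n - 2\<close> blocks.\<close>

lemma config_C_special:
  assumes m: "m \<ge> 2" and n: "n \<ge> 1" and cfg: "config_C m n S g1 g2 g3 A1 A2 A3 s1 s2 s3 x t"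
    and no: "\<nexists>T. T \<subseteq># S \<and> zs_short (lat m (m * n)) (m * n) T"
    and Y: "Y1 \<subseteq># A1" "Y2 \<subseteq># A2" "Y3 \<subseteq># A3" "size Y1 \<le> m - 1" "size Y2 \<le> m - 1" "size Y3 \<le> m - 1"
    and szY: "size Y1 + size Y2 + size Y3 \<in> {1..2 * m - 1}"
    and zero: "\<Sum>\<^sub># (Y1 + Y2 + Y3) \<in> lat m m"
  shows "\<Sum>\<^sub># (Y1 + Y2 + Y3) - (0, int m * t) \<in> lat m (m * n)"
proof -
  define H where "H = (0 :: int, int m * t)"
  have ct: "coprime t (int n)" using cfg by (simp add: config_C_def)
  define c where "c = snd (\<Sum>\<^sub># (Y1 + Y2 + Y3)) div int m"
  obtain r where r: "r < n" "int n dvd c + int r * t" using ct n by (rule unit_multiple)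
  have dvdm: "int m dvd fst (\<Sum>\<^sub># (Y1 + Y2 + Y3))" "snd (\<Sum>\<^sub># (Y1 + Y2 + Y3)) = int m * c"
    using zero by (auto simp: lat_def c_def)
  have inN: "\<Sum>\<^sub># (Y1 + Y2 + Y3) + sm i H \<in> lat m (m * n) \<longleftrightarrow> int n dvd c + i * t" for i
  proof -
    have "snd (\<Sum>\<^sub># (Y1 + Y2 + Y3) + sm i H) = int m * (c + i * t)"
      using dvdm(2) by (simp add: H_def sm_def algebra_simps)
    moreover have "fst (\<Sum>\<^sub># (Y1 + Y2 + Y3) + sm i H) = fst (\<Sum>\<^sub># (Y1 + Y2 + Y3))" by (simp add: H_def sm_def)
    ultimately show ?thesis using dvdm(1) m unfolding lat_def by simp
  qed
  have "r = n - 1"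
  proof (rule ccontr)
    assume "r \<noteq> n - 1"
    then have rn: "r + 2 \<le> n" using r(1) by simp
    \<comment> \<open>The r blocks are taken greedily from the three fibres, whose capacities s1 -
      1, s2 - 1, s3 - 1 add up to n - 1.\<close>
    define r1 r2 r3 where "r1 = min r (s1 - 1)" and "r2 = min (r - r1) (s2 - 1)" and "r3 = r - r1 - r2"
    have s: "s1 \<ge> 1" "s2 \<ge> 1" "s3 \<ge> 1" "s1 + s2 + s3 = n + 2" using cfg by (auto simp: config_C_def)
    have rr: "r1 + r2 + r3 = r" "r1 < s1" "r2 < s2" "r3 < s3"
      using s r(1) unfolding r1_def r2_def r3_def by (auto simp: min_def)
    obtain Z1 where Z1: "Z1 \<subseteq># A1 - Y1" "size Z1 = r1 * m" "\<Sum>\<^sub># Z1 - sm (int r1) H \<in> lat m (m * n)"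
      by (rule fibre_blocks[of A1 s1 m r1 g1 "m * n" H Y1]) (use cfg Y rr m in \<open>auto simp: config_C_def H_def\<close>)
    obtain Z2 where Z2: "Z2 \<subseteq># A2 - Y2" "size Z2 = r2 * m" "\<Sum>\<^sub># Z2 - sm (int r2) H \<in> lat m (m * n)"
      by (rule fibre_blocks[of A2 s2 m r2 g2 "m * n" H Y2]) (use cfg Y rr m in \<open>auto simp: config_C_def H_def\<close>)
    obtain Z3 where Z3: "Z3 \<subseteq># A3 - Y3" "size Z3 = r3 * m" "\<Sum>\<^sub># Z3 - sm (int r3) H \<in> lat m (m * n)"
      by (rule fibre_blocks[of A3 s3 m r3 g3 "m * n" H Y3]) (use cfg Y rr m in \<open>auto simp: config_C_def H_def\<close>)
    define T where "T = (Y1 + Z1) + (Y2 + Z2) + (Y3 + Z3)"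
    have "T \<subseteq># A1 + A2 + A3" unfolding T_def
      by (intro mset_subset_eq_mono_add sub_diff_union Y Z1 Z2 Z3)
    then have "T \<subseteq># S" using cfg by (simp add: config_C_def)
    have sT: "size T = size Y1 + size Y2 + size Y3 + r * m"
      using Z1(2) Z2(2) Z3(2) unfolding T_def rr(1)[symmetric] by (simp add: algebra_simps)
    have "(r + 2) * m \<le> n * m" using rn by (intro mult_right_mono) auto
    then have "size T \<in> {1..m * n}" using sT szY m by (auto simp: algebra_simps)
    moreover have "\<Sum>\<^sub># T \<in> lat m (m * n)"
    proof -
      have z: "\<Sum>\<^sub># (Y1 + Y2 + Y3) + sm (int r) H \<in> lat m (m * n)" using inN r(2) by blast
      have "(\<Sum>\<^sub># Z1 - sm (int r1) H) + (\<Sum>\<^sub># Z2 - sm (int r2) H) + (\<Sum>\<^sub># Z3 - sm (int r3) H)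
        + (\<Sum>\<^sub># (Y1 + Y2 + Y3) + sm (int r) H) \<in> lat m (m * n)"
        by (rule lat_add[OF lat_add[OF lat_add[OF Z1(3) Z2(3)] Z3(3)] z])
      moreover have "int r = int r1 + int r2 + int r3" using rr(1) by simp
      ultimately show ?thesis unfolding T_def by (simp add: sm_simps algebra_simps)
    qed
    ultimately have "zs_short (lat m (m * n)) (m * n) T" by (simp add: zs_short_def)
    then show False using no \<open>T \<subseteq># S\<close> by blast
  qed
  then have "int r = int n - 1" using n by (simp add: of_nat_diff)
  then have "int n dvd c + (int n - 1) * t" using r(2) by simp
  moreover have "c + (int n - 1) * t = (c + (- 1) * t) + int n * t" by (simp add: algebra_simps)
  ultimately have "int n dvd c + (- 1) * t" by (metis dvd_add_left_iff dvd_triv_left)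
  then have "\<Sum>\<^sub># (Y1 + Y2 + Y3) + sm (- 1) H \<in> lat m (m * n)" using inN by blast
  then show ?thesis by (simp add: sm_def H_def diff_conv_add_uminus del: add_uminus_conv_diff)
qed

lemma lat_to_mm: "v \<in> lat m (m * n) \<Longrightarrow> v \<in> lat m m"
  using lat_mult_subset by blast

lemma near_pair:
  assumes "\<And>y z. {#y, z#} \<subseteq># A \<Longrightarrow> y - z \<in> lat m k" "g \<in># A"
  shows "near m k g (size A) A"
  unfolding near_def
proof (intro conjI ballI refl)
  fix y assume y: "y \<in># A"
  show "y - g \<in> lat m k"
  proof (cases "y = g")
    case False
    then have "g \<in># A - {#y#}" using assms(2) by (simp add: in_diff_count)
    then have "{#y, g#} \<subseteq># A" using y by (simp add: insert_subset_eq_iff)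
    then show ?thesis by (rule assms(1))
  qed simp
qed

lemma special_zero:
  assumes rel: "sm x g1 - g2 + g3 \<in> lat m m" and k: "k \<in> {1..m - 1}"
    and Y: "near m m g1 (nat ((int k * x) mod int m)) Y1" "near m m g2 (m - k) Y2" "near m m g3 k Y3"
    and m: "m \<ge> 2"
  shows "\<Sum>\<^sub># (Y1 + Y2 + Y3) \<in> lat m m"
proof -
  define a where "a = (int k * x) mod int m"
  have a: "int (nat a) = a" using m by (simp add: a_def)
  have d: "int m dvd a - int k * x" by (simp add: a_def mod_eq_dvd_iff[symmetric])
  have "(\<Sum>\<^sub># Y1 - sm a g1) + (\<Sum>\<^sub># Y2 - sm (int (m - k)) g2) + (\<Sum>\<^sub># Y3 - sm (int k) g3)
    + sm (int k) (sm x g1 - g2 + g3) + sm (int m) g2 + sm (a - int k * x) g1 \<in> lat m m"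
    by (intro lat_add lat_sm[OF rel] sm_in_lat d near_sum[OF Y(2)] near_sum[OF Y(3)])
      (use near_sum[OF Y(1)] a in \<open>simp_all add: a_def\<close>)
  moreover have "int (m - k) = int m - int k" using k by (auto simp: of_nat_diff)
  ultimately show ?thesis by (simp add: sm_simps algebra_simps)
qed

text \<open>For each fibre some k puts exactly one of its elements into the mixed block: the inverse
  of x for g1, k = m - 1 for g2, k = 1 for g3. Exchanging that element cannot change the prescribed
  sum, so even a fibre of length m - 1 is constant modulo N.\<close>

theorem config_C_lifted:
  assumes m: "m \<ge> 2" and n: "n \<ge> 1" and cfg: "config_C m n S g1 g2 g3 A1 A2 A3 s1 s2 s3 x t"
    and no: "\<nexists>T. T \<subseteq># S \<and> zs_short (lat m (m * n)) (m * n) T"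
  shows "near m (m * n) g1 (s1 * m - 1) A1" "near m (m * n) g2 (s2 * m - 1) A2" "near m (m * n) g3 (s3 * m - 1) A3"
    "\<And>k. k \<in> {1..m - 1} \<Longrightarrow>
      sm ((int k * x) mod int m) g1 + sm (int m - int k) g2 + sm (int k) g3 - (0, int m * t) \<in> lat m (m * n)"
proof -
  define H where "H = (0 :: int, int m * t)"
  have sz: "size A1 = s1 * m - 1" "size A2 = s2 * m - 1" "size A3 = s3 * m - 1"
    and s: "s1 \<ge> 1" "s2 \<ge> 1" "s3 \<ge> 1"
    and gA: "g1 \<in># A1" "g2 \<in># A2" "g3 \<in># A3"
    and nr: "\<forall>y\<in>#A1. y - g1 \<in> lat m m" "\<forall>y\<in>#A2. y - g2 \<in> lat m m" "\<forall>y\<in>#A3. y - g3 \<in> lat m m"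
    and x: "x \<in> {1..int m - 1}" "coprime x (int m)" and rel: "sm x g1 - g2 + g3 \<in> lat m m"
    and lift: "s1 \<ge> 2 \<Longrightarrow> \<forall>y\<in>#A1. y - g1 \<in> lat m (m * n)"
      "s2 \<ge> 2 \<Longrightarrow> \<forall>y\<in>#A2. y - g2 \<in> lat m (m * n)" "s3 \<ge> 2 \<Longrightarrow> \<forall>y\<in>#A3. y - g3 \<in> lat m (m * n)"
    using cfg unfolding config_C_def by blast+
  have szge: "size A \<ge> m - 1" if "size A = s * m - 1" "s \<ge> 1" for A :: "(int \<times> int) multiset" and s
  proof -
    have "m \<le> s * m" using that(2) by (cases s) auto
    then show ?thesis using that(1) by linarith
  qed
  have big: "size A1 \<ge> m - 1" "size A2 \<ge> m - 1" "size A3 \<ge> m - 1" using szge sz s by blast+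
  define a where "a k = nat ((int k * x) mod int m)" for k
  have ak: "a k \<in> {1..m - 1}" if "k \<in> {1..m - 1}" for k
  proof -
    have "\<not> int m dvd int k * x"
    proof
      assume "int m dvd int k * x"
      then have "int m dvd int k" using x(2) by (metis coprime_commute coprime_dvd_mult_left_iff)
      then have "m dvd k" by (simp only: int_dvd_int_iff)
      then have "m \<le> k" using that by (intro dvd_imp_le) auto
      then show False using that m by simp
    qed
    then have "(int k * x) mod int m \<noteq> 0" by (simp add: dvd_eq_mod_eq_0)
    moreover have "0 \<le> (int k * x) mod int m" "(int k * x) mod int m < int m" using m by auto
    moreover from this have "int (a k) = (int k * x) mod int m" unfolding a_def by simp
    ultimately have "0 < int (a k)" "int (a k) < int m" by linarith+
    then show ?thesis by auto
  qed
  have special: "\<Sum>\<^sub># (Y1 + Y2 + Y3) - H \<in> lat m (m * n)"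
    if k: "k \<in> {1..m - 1}" and Y: "Y1 \<subseteq># A1" "Y2 \<subseteq># A2" "Y3 \<subseteq># A3" "size Y1 = a k" "size Y2 = m - k" "size Y3 = k"
    for k Y1 Y2 Y3
  proof -
    have "\<Sum>\<^sub># (Y1 + Y2 + Y3) \<in> lat m m"
      by (rule special_zero[OF rel k _ _ _ m])
        (use Y nr in \<open>auto simp: near_def a_def dest: mset_subset_eqD\<close>)
    then show ?thesis unfolding H_def
      by (intro config_C_special[OF m n cfg no Y(1-3)]) (use Y k ak[OF k] in auto)
  qed
  have ex: "\<exists>Y. Y \<subseteq># A \<and> size Y = l" if "l \<le> m - 1" "size A \<ge> m - 1" for A :: "(int \<times> int) multiset" and l
    using that by (metis obtain_submset_of_size le_trans)
  show n1: "near m (m * n) g1 (s1 * m - 1) A1"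
  proof -
    obtain y where y: "[x * y = 1] (mod int m)" using x(2) by (metis cong_solve_coprime_int)
    define k where "k = nat (y mod int m)"
    have ik: "int k = y mod int m" using m by (simp add: k_def)
    have "[int k * x = y * x] (mod int m)" unfolding ik by (intro cong_mult) (auto simp: cong_def)
    also have "[y * x = 1] (mod int m)" using y by (simp add: mult.commute)
    finally have kx: "(int k * x) mod int m = 1" using m by (simp add: cong_def)
    have "k \<noteq> 0"
    proof
      assume "k = 0"
      then show False using kx by simp
    qed
    moreover have "int k < int m" unfolding ik using m by simp
    ultimately have k: "k \<in> {1..m - 1}" by auto
    have "near m (m * n) g1 (size A1) A1"
    proof (rule near_pair[OF _ gA(1)])
      fix y z assume yz: "{#y, z#} \<subseteq># A1"
      obtain Y2 where Y2: "Y2 \<subseteq># A2" "size Y2 = m - k" using ex[OF diff_le_mono2[of 1 k m] big(2)] k by auto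
      obtain Y3 where Y3: "Y3 \<subseteq># A3" "size Y3 = k" using ex[of k A3] big k by auto
      have "a k = 1" using kx by (simp add: a_def)
      have "{#y#} \<subseteq># A1" "{#z#} \<subseteq># A1" using mset_subset_eqD[OF yz] by auto
      then have "(\<Sum>\<^sub># ({#y#} + Y2 + Y3) - H) - (\<Sum>\<^sub># ({#z#} + Y2 + Y3) - H) \<in> lat m (m * n)"
        by (intro lat_diff special[OF k]) (use Y2 Y3 \<open>a k = 1\<close> in auto)
      then show "y - z \<in> lat m (m * n)" by simp
    qed
    then show ?thesis using sz by simp
  qed
  show n2: "near m (m * n) g2 (s2 * m - 1) A2"
  proof -
    have k: "m - 1 \<in> {1..m - 1}" using m by simp
    have "near m (m * n) g2 (size A2) A2"
    proof (rule near_pair[OF _ gA(2)])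
      fix y z assume yz: "{#y, z#} \<subseteq># A2"
      obtain Y1 where Y1: "Y1 \<subseteq># A1" "size Y1 = a (m - 1)" using ex[of "a (m - 1)" A1] big ak[OF k] by auto
      obtain Y3 where Y3: "Y3 \<subseteq># A3" "size Y3 = m - 1" using ex[of "m - 1" A3] big by auto
      have "{#y#} \<subseteq># A2" "{#z#} \<subseteq># A2" using mset_subset_eqD[OF yz] by auto
      then have "(\<Sum>\<^sub># (Y1 + {#y#} + Y3) - H) - (\<Sum>\<^sub># (Y1 + {#z#} + Y3) - H) \<in> lat m (m * n)"
        by (intro lat_diff special[OF k]) (use Y1 Y3 m in auto)
      then show "y - z \<in> lat m (m * n)" by simp
    qed
    then show ?thesis using sz by simp
  qed
  show n3: "near m (m * n) g3 (s3 * m - 1) A3"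
  proof -
    have k: "1 \<in> {1..m - 1}" using m by simp
    have "near m (m * n) g3 (size A3) A3"
    proof (rule near_pair[OF _ gA(3)])
      fix y z assume yz: "{#y, z#} \<subseteq># A3"
      obtain Y1 where Y1: "Y1 \<subseteq># A1" "size Y1 = a 1" using ex[of "a 1" A1] big ak[OF k] by auto
      obtain Y2 where Y2: "Y2 \<subseteq># A2" "size Y2 = m - 1" using ex[of "m - 1" A2] big by auto
      have "{#y#} \<subseteq># A3" "{#z#} \<subseteq># A3" using mset_subset_eqD[OF yz] by auto
      then have "(\<Sum>\<^sub># (Y1 + Y2 + {#y#}) - H) - (\<Sum>\<^sub># (Y1 + Y2 + {#z#}) - H) \<in> lat m (m * n)"
        by (intro lat_diff special[OF k]) (use Y1 Y2 in auto)
      then show "y - z \<in> lat m (m * n)" by simp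
    qed
    then show ?thesis using sz by simp
  qed
  fix k assume k: "k \<in> {1..m - 1}"
  obtain Y1 where Y1: "Y1 \<subseteq># A1" "size Y1 = a k" using ex[of "a k" A1] big ak[OF k] by auto
  obtain Y2 where Y2: "Y2 \<subseteq># A2" "size Y2 = m - k" using ex[OF diff_le_mono2[of 1 k m] big(2)] k by auto
  obtain Y3 where Y3: "Y3 \<subseteq># A3" "size Y3 = k" using ex[of k A3] big k by auto
  have "(\<Sum>\<^sub># (Y1 + Y2 + Y3) - H) - (\<Sum>\<^sub># Y1 - sm (int (a k)) g1) - (\<Sum>\<^sub># Y2 - sm (int (m - k)) g2)
      - (\<Sum>\<^sub># Y3 - sm (int k) g3) \<in> lat m (m * n)"
    using lat_diff[OF lat_diff[OF lat_diff[OF special[OF k Y1(1) Y2(1) Y3(1) Y1(2) Y2(2) Y3(2)]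
      near_sum[OF near_sub[OF n1 Y1(1)]]] near_sum[OF near_sub[OF n2 Y2(1)]]] near_sum[OF near_sub[OF n3 Y3(1)]]]
    unfolding Y1(2) Y2(2) Y3(2) .
  moreover have "int (a k) = (int k * x) mod int m" using m by (simp add: a_def)
  moreover have "int (m - k) = int m - int k" using k by (auto simp: of_nat_diff)
  ultimately show "sm ((int k * x) mod int m) g1 + sm (int m - int k) g2 + sm (int k) g3 - (0, int m * t) \<in> lat m (m * n)"
    unfolding H_def[symmetric] by (simp add: algebra_simps)
qed

lemma lat_eqI: "v \<in> lat m k \<Longrightarrow> w = v \<Longrightarrow> w \<in> lat m k"
  by simp

lemma H_multiple:
  assumes "m > 0" "coprime t (int n)" "sm j (0, int m * t) \<in> lat m (m * n)"
  shows "int n dvd j"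
proof -
  have "int m * int n dvd int m * (j * t)" using assms(3) by (simp add: lat_def sm_def mult_ac)
  then have "int n dvd j * t" using assms(1) by simp
  then show ?thesis using assms(2) by (metis coprime_commute coprime_dvd_mult_left_iff)
qed

text \<open>Modulo M the two vectors are independent, and m g2 agrees with
  \<open>(0, int m * t)\<close>, which has order n since t is coprime to n; so g2 has order m
  n.\<close>

lemma rank2_pairI:
  assumes m: "m > 0" and t: "coprime t (int n)"
    and ind: "\<And>i j. sm i g1 + sm j g2 \<in> lat m m \<Longrightarrow> int m dvd i \<and> int m dvd j"
    and g2: "sm (int m) g2 - (0, int m * t) \<in> lat m (m * n)"
  shows "rank2_pair m (m * n) g1 g2"
  unfolding rank2_pair_def
proof (intro conjI allI impI)
  show "int m dvd i" if "sm i g1 + sm j g2 \<in> lat m (m * n)" for i j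
    using ind lat_to_mm[OF that] by blast
  fix j assume j: "sm j g2 \<in> lat m (m * n)"
  then have "sm 0 g1 + sm j g2 \<in> lat m m" using lat_to_mm by (simp add: sm_simps)
  then have "int m dvd j" using ind by blast
  then obtain i where i: "j = int m * i" by (rule dvdE)
  have "sm j g2 - sm i (sm (int m) g2 - (0, int m * t)) \<in> lat m (m * n)" by (intro lat_diff j lat_sm g2)
  then have "sm i (0, int m * t) \<in> lat m (m * n)" by (simp add: i sm_simps mult.commute)
  then have "int n dvd i" using H_multiple m t by blast
  then show "int (m * n) dvd j" by (simp add: i)
qed

text \<open>k = m div x + 1 gives the first multiple of x beyond m; x \<ge> 2 together with
  coprimality keeps k within m - 1. The excess over m is what later isolates m times a
  vector.\<close>

lemma wrapping_multiple:
  assumes x: "x \<in> {2..int m - 1}" "coprime x (int m)"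
  obtains k where "k \<in> {1..m - 1}" "(int k * x) mod int m = int k * x - int m"
    "int k * x - int m > 0"
proof -
  define d where "d = int m div x"
  have x0: "x > 0" using x by simp
  have dm: "d * x + int m mod x = int m" by (simp add: d_def)
  have "int m mod x \<noteq> 0"
  proof
    assume "int m mod x = 0"
    then have "x dvd int m" by (simp add: dvd_eq_mod_eq_0)
    then have "x dvd 1" using x(2) by (metis coprime_common_divisor dvd_refl)
    then show False using x(1) by (auto simp: zdvd1_eq)
  qed
  moreover have "0 \<le> int m mod x" "int m mod x < x" using x0 by auto
  ultimately have r: "0 < int m mod x" "int m mod x < x" by auto
  have d1: "d \<ge> 1" unfolding d_def using x by (simp add: le_div_iff)
  have "d * 2 \<le> d * x" using d1 x by (intro mult_left_mono) auto
  then have "d * 2 < int m" using dm r by linarith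
  then have dle: "d + 1 \<le> int m - 1"
  proof (cases "d = 1")
    case True
    then show ?thesis using x by simp
  next
    case False
    then show ?thesis using \<open>d * 2 < int m\<close> d1 by linarith
  qed
  define k where "k = nat (d + 1)"
  have k: "int k = d + 1" using d1 by (simp add: k_def)
  have "int k * x = int m + (x - int m mod x)" using dm by (simp add: k algebra_simps)
  moreover have "(int m + (x - int m mod x)) mod int m = x - int m mod x"
    using r x by (simp add: mod_pos_pos_trivial)
  ultimately have "(int k * x) mod int m = int k * x - int m" by simp
  moreover have "k \<in> {1..m - 1}" using k d1 dle by auto
  moreover have "int k * x - int m > 0" using \<open>int k * x = int m + (x - int m mod x)\<close> r by simp
  ultimately show thesis using that by blast
qed

text \<open>\<open>ord\<close> is a normalisation attained by exchanging g2 and g3. Where possible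
  the relation x g1 - g2 + g3 is first lifted from M to N; comparing m g1, m g2, m g3 with the block
  sum \<open>H\<close> then tells which vector can serve as the basis element of order m.\<close>

theorem config_C_form_ordered:
  assumes m: "m \<ge> 2" and n: "n \<ge> 1" and cfg: "config_C m n S g1 g2 g3 A1 A2 A3 s1 s2 s3 x t"
    and no: "\<nexists>T. T \<subseteq># S \<and> zs_short (lat m (m * n)) (m * n) T"
    and ord: "s2 \<ge> 2 \<or> s2 = 1 \<and> s3 = 1 \<and> (n = 1 \<or> 2 * x \<le> int m)"
  shows "form_1a m n S \<or> form_1b m n S"
proof -
  let ?N = "lat m (m * n)"
  define H where "H = (0 :: int, int m * t)"
  note lifted = config_C_lifted[OF m n cfg no, folded H_def]
  have S: "S = A1 + A2 + A3" and s: "s1 \<ge> 1" "s2 \<ge> 1" "s3 \<ge> 1" "s1 + s2 + s3 = n + 2"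
    and x: "x \<in> {1..int m - 1}" "coprime x (int m)" and rel: "sm x g1 - g2 + g3 \<in> lat m m"
    and sf: "shortfree3 m g1 g2 g3" and t: "coprime t (int n)"
    and K: "s1 \<ge> 2 \<Longrightarrow> sm (int m) g1 - H \<in> ?N" "s2 \<ge> 2 \<Longrightarrow> sm (int m) g2 - H \<in> ?N"
      "s3 \<ge> 2 \<Longrightarrow> sm (int m) g3 - H \<in> ?N"
    using cfg unfolding config_C_def H_def by blast+
  have m0: "m > 0" using m by simp
  have ind12: "int m dvd i \<and> int m dvd j" if "sm i g1 + sm j g2 \<in> lat m m" for i j
    using shortfree3_zero_coord'(2)[OF m sf, of i j 0] that by (simp add: sm_simps)
  have ind13: "int m dvd i \<and> int m dvd j" if "sm i g1 + sm j g3 \<in> lat m m" for i j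
    using shortfree3_zero_coord'(1)[OF m sf, of i 0 j] that by (simp add: sm_simps)
  have ind23: "int m dvd i \<and> int m dvd j" if "sm i g2 + sm j g3 \<in> lat m m" for i j
    using shortfree3_zero_coord[OF m sf, of 0 i j] that by (simp add: sm_simps)
  have nH: "H \<notin> ?N" if "n \<ge> 2"
  proof
    assume "H \<in> ?N"
    then have "int n dvd 1" using H_multiple[OF m0 t, of 1] by (simp add: sm_simps H_def)
    then show False using that by (simp add: zdvd1_eq)
  qed
  have E: "sm ((int k * x) mod int m) g1 + sm (int m - int k) g2 + sm (int k) g3 - H \<in> ?N" if "k \<in> {1..m - 1}" for k
    using lifted(4)[OF that] .
  have E1: "sm x g1 + sm (int m - 1) g2 + g3 - H \<in> ?N" 
  proof -
    have "1 \<in> {1..m - 1}" using m by simp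
    from E[OF this] show ?thesis using x by (simp add: sm_simps)
  qed
  have D_of_K2: "sm x g1 - g2 + g3 \<in> ?N" if "sm (int m) g2 - H \<in> ?N"
    by (rule lat_eqI[OF lat_diff[OF E1 that]]) (simp add: sm_simps algebra_simps)
  \<comment> \<open>Compare k copies of the lifted relation with the mixed block for k: the
    coefficients of g1 differ by exactly m and everything else cancels.\<close>
  have mg1: "sm (int m) g1 \<in> ?N" if K2: "sm (int m) g2 - H \<in> ?N" and x2: "x \<ge> 2"
  proof -
    obtain k where k: "k \<in> {1..m - 1}" "(int k * x) mod int m = int k * x - int m"
      by (rule wrapping_multiple[of x m]) (use x x2 in auto)
    have "sm (int k) (sm x g1 - g2 + g3) + (sm (int m) g2 - H)
      - (sm (int k * x - int m) g1 + sm (int m - int k) g2 + sm (int k) g3 - H) \<in> ?N"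
      by (rule lat_diff[OF lat_add[OF lat_sm[OF D_of_K2[OF K2]] K2] E[OF k(1), unfolded k(2)]])
    then show ?thesis by (rule lat_eqI) (simp add: sm_simps algebra_simps)
  qed
  \<comment> \<open>A fibre with \<open>s1 \<ge> 2\<close> has m g1 = H modulo N, and H is nonzero
    there.\<close>
  have mg1_s1: "s1 = 1" if "sm (int m) g1 \<in> ?N" "n \<ge> 2"
  proof (rule ccontr)
    assume "s1 \<noteq> 1"
    then have "sm (int m) g1 - H \<in> ?N" using K(1) s by simp
    then have "sm (int m) g1 - (sm (int m) g1 - H) \<in> ?N" by (rule lat_diff[OF that(1)])
    then show False using nH[OF that(2)] by simp
  qed
  have case_a: "form_1a m n S" if K2: "sm (int m) g2 - H \<in> ?N" and g1: "sm (int m) g1 \<in> ?N" and s1: "s1 = 1"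
  proof -
    have "rank2_pair m (m * n) g1 g2" by (rule rank2_pairI[OF m0 t ind12]) (use K2 H_def in auto)
    moreover have "near m (m * n) (sm (- x) g1 + g2) ((n + 1 - s2) * m - 1) A3"
    proof -
      have "n + 1 - s2 = s3" using s s1 by simp
      moreover have "g3 - (sm (- x) g1 + g2) \<in> ?N"
        by (rule lat_eqI[OF D_of_K2[OF K2]]) (simp add: sm_simps algebra_simps)
      ultimately show ?thesis using near_shift[OF lifted(3)] by simp
    qed
    moreover have "s2 \<in> {1..n}" using s s1 by auto
    ultimately show ?thesis unfolding form_1a_def
      using S x(2) g1 lifted(1,2) s1 by (intro exI[of _ g1] exI[of _ g2] exI[of _ x] exI[of _ s2] exI[of _ A1]
          exI[of _ A2] exI[of _ A3]) simp
  qed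
  show ?thesis
  proof (cases "s2 \<ge> 2")
    case True
    then have n2: "n \<ge> 2" using s by simp
    note K2 = K(2)[OF True]
    note D = D_of_K2[OF K2]
    show ?thesis
    proof (cases "x \<ge> 2")
      case True
      then show ?thesis using case_a[OF K2] mg1[OF K2] mg1_s1 n2 by blast
    next
      case False
      \<comment> \<open>For x = 1 no multiple k x exceeds m, so the mixed blocks do not determine m
        g1; only a second long fibre can supply a vector of order m.\<close>
      then have x1: "x = 1" using x by simp
      show ?thesis
      proof (cases "s3 \<ge> 2")
        case True
        have "sm (int m) (sm x g1 - g2 + g3) + (sm (int m) g2 - H) - (sm (int m) g3 - H) \<in> ?N"
          by (intro lat_diff[OF lat_add[OF lat_sm[OF D] K2] K(3)[OF True]])
        then have "sm (int m) g1 \<in> ?N" by (rule lat_eqI) (simp add: x1 sm_simps algebra_simps)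
        then show ?thesis using case_a[OF K2] mg1_s1 n2 by blast
      next
        case False
        then have s3: "s3 = 1" using s by simp
        show ?thesis
        proof (cases "s1 \<ge> 2")
          case True
          have "sm (int m) (sm x g1 - g2 + g3) - (sm (int m) g1 - H) + (sm (int m) g2 - H) \<in> ?N"
            by (intro lat_add[OF lat_diff[OF lat_sm[OF D] K(1)[OF True]] K2])
          then have mg3: "sm (int m) g3 \<in> ?N" by (rule lat_eqI) (simp add: x1 sm_simps algebra_simps)
          have "rank2_pair m (m * n) g3 g2"
          proof (rule rank2_pairI[OF m0 t])
            show "int m dvd i \<and> int m dvd j" if "sm i g3 + sm j g2 \<in> lat m m" for i j
              using ind23[of j i] that by (simp add: add.commute)
          qed (use K2 H_def in auto)
          moreover have "near m (m * n) (sm (- 1) g3 + g2) ((n + 1 - s2) * m - 1) A1"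
          proof -
            have "n + 1 - s2 = s1" using s s3 by simp
            moreover have "g1 - (sm (- 1) g3 + g2) \<in> ?N"
              by (rule lat_eqI[OF D]) (simp add: x1 sm_simps algebra_simps)
            ultimately show ?thesis using near_shift[OF lifted(1)] by simp
          qed
          moreover have "s2 \<in> {1..n}" using s s3 by auto
          moreover have "S = A3 + A2 + A1" using S by (simp add: add_ac)
          ultimately show ?thesis unfolding form_1a_def
            using mg3 lifted(2,3) s3 by (intro disjI1 exI[of _ g3] exI[of _ g2] exI[of _ 1] exI[of _ s2]
                exI[of _ A3] exI[of _ A2] exI[of _ A1]) simp
        next
          case False
          \<comment> \<open>Only the fibre of g2 is long: s2 = n, the order of g1 stays open, and
            the form is (1b).\<close>
          then have s1: "s1 = 1" using s by simp
          have "rank2_pair m (m * n) g1 g2" by (rule rank2_pairI[OF m0 t ind12]) (use K2 H_def in auto)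
          moreover have "near m (m * n) (- g1 + g2) (m - 1) A3"
          proof -
            have "g3 - (- g1 + g2) \<in> ?N"
              by (rule lat_eqI[OF D]) (simp add: x1 sm_simps algebra_simps)
            then show ?thesis using near_shift[OF lifted(3)] s3 by simp
          qed
          moreover have "s2 = n" using s s1 s3 by simp
          ultimately show ?thesis unfolding form_1b_def
            using S lifted(1,2) s1 by (intro disjI2 exI[of _ g1] exI[of _ g2] exI[of _ A1] exI[of _ A2] exI[of _ A3])
              (simp add: mult.commute)
        qed
      qed
    qed
  next
    case False
    then have s23: "s2 = 1" "s3 = 1" and nx: "n = 1 \<or> 2 * x \<le> int m" using ord by auto
    then have s1: "s1 = n" using s by simp
    show ?thesis
    proof (cases "n = 1")
      case True
      have "rank2_pair m (m * n) g1 g2" unfolding rank2_pair_def True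
      proof (intro conjI allI impI)
        show "int m dvd i" if "sm i g1 + sm j g2 \<in> lat m (m * 1)" for i j using ind12 that by simp
        show "int (m * 1) dvd j" if "sm j g2 \<in> lat m (m * 1)" for j
          using ind12[of 0 j] that by (simp add: sm_simps)
      qed
      moreover have "near m (m * n) (sm (- x) g1 + g2) (m - 1) A3"
      proof -
        have "sm x g1 - g2 + g3 \<in> ?N" using rel True by simp
        then have "g3 - (sm (- x) g1 + g2) \<in> ?N"
          by (rule lat_eqI) (simp add: sm_simps algebra_simps)
        then show ?thesis using near_shift[OF lifted(3)] s23 by simp
      qed
      moreover have "sm (int m) g1 \<in> ?N" using True by (simp add: sm_in_lat)
      ultimately show ?thesis unfolding form_1a_def
        using S x(2) lifted(1,2) s1 s23 True by (intro disjI1 exI[of _ g1] exI[of _ g2] exI[of _ x] exI[of _ 1]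
            exI[of _ A1] exI[of _ A2] exI[of _ A3]) simp
    next
      case False
      then have n2: "n \<ge> 2" and xm: "2 * x \<le> int m" using n nx by auto
      have K1: "sm (int m) g1 - H \<in> ?N" using K(1) s1 n2 by simp
      show ?thesis
      \<comment> \<open>For m = 2 the only mixed block is g1 + g2 + g3. Its sum equals 2 g1 modulo
        N, which already gives g3 = -g2 + g1.\<close>
      proof (cases "m = 2")
        case True
        then have x1: "x = 1" using x by simp
        have "rank2_pair m (m * n) g2 g1"
        proof (rule rank2_pairI[OF m0 t])
          show "int m dvd i \<and> int m dvd j" if "sm i g2 + sm j g1 \<in> lat m m" for i j
            using ind12[of j i] that by (simp add: add.commute)
        qed (use K1 H_def in auto)
        moreover have "near m (m * n) (- g2 + g1) (m - 1) A3"
        proof -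
          have "g3 - (- g2 + g1) \<in> ?N"
            by (rule lat_eqI[OF lat_diff[OF E1 K1]])
              (simp add: x1 True sm_def prod_eq_iff)
          then show ?thesis using near_shift[OF lifted(3)] s23 by simp
        qed
        moreover have "S = A2 + A1 + A3" using S by (simp add: add_ac)
        ultimately show ?thesis unfolding form_1b_def
          using lifted(1,2) s1 s23 by (intro disjI2 exI[of _ g2] exI[of _ g1] exI[of _ A2] exI[of _ A1] exI[of _ A3])
            (simp add: mult.commute)
      next
        case False
        then have m3: "m \<ge> 3" using m by simp
        have "2 * x \<noteq> int m"
        proof
          assume eq: "2 * x = int m"
          then have "x dvd int m" by (metis dvd_triv_right)
          then have "x dvd 1" using x(2) by (metis coprime_common_divisor dvd_refl)
          then have "x = 1" using x by (auto simp: zdvd1_eq)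
          then show False using eq m3 by simp
        qed
        then have x2: "(2 * x) mod int m = 2 * x" using xm x by simp
        \<comment> \<open>With 2 x < m neither k = 1 nor k = 2 wraps, so the difference of these two
          mixed blocks is the relation itself.\<close>
        have E2: "sm (2 * x) g1 + sm (int m - 2) g2 + sm 2 g3 - H \<in> ?N" using E[of 2] m3 x2 by simp
        have D: "sm x g1 - g2 + g3 \<in> ?N"
          by (rule lat_eqI[OF lat_diff[OF E2 E1]])
            (simp add: sm_def prod_eq_iff algebra_simps)
        have K2: "sm (int m) g2 - H \<in> ?N"
          by (rule lat_eqI[OF lat_diff[OF E1 D]]) (simp add: sm_simps algebra_simps)
        have x1: "x = 1"
        proof (rule ccontr)
          assume "x \<noteq> 1"
          then have "sm (int m) g1 \<in> ?N" using mg1[OF K2] x by simp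
          then show False using mg1_s1 n2 s1 by simp
        qed
        have "sm (int m) (sm x g1 - g2 + g3) - (sm (int m) g1 - H) + (sm (int m) g2 - H) \<in> ?N"
          by (intro lat_add[OF lat_diff[OF lat_sm[OF D] K1] K2])
        then have mg3: "sm (int m) g3 \<in> ?N" by (rule lat_eqI) (simp add: x1 sm_simps algebra_simps)
        have "rank2_pair m (m * n) g3 g1"
        proof (rule rank2_pairI[OF m0 t])
          show "int m dvd i \<and> int m dvd j" if "sm i g3 + sm j g1 \<in> lat m m" for i j
            using ind13[of j i] that by (simp add: add.commute)
        qed (use K1 H_def in auto)
        \<comment> \<open>Here g2 = g3 + g1 takes the part of -x e1 + e2 with x = -1.\<close>
        moreover have "near m (m * n) (sm (- (- 1)) g3 + g1) ((n + 1 - n) * m - 1) A2"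
        proof -
          have "- (sm x g1 - g2 + g3) \<in> ?N" using D by (simp only: lat_uminus)
          then have "g2 - (sm (- (- 1)) g3 + g1) \<in> ?N"
            by (rule lat_eqI) (simp add: x1 sm_simps algebra_simps)
          then show ?thesis using near_shift[OF lifted(2)] s23 by simp
        qed
        moreover have "S = A3 + A1 + A2" using S by (simp add: add_ac)
        ultimately show ?thesis unfolding form_1a_def
          using lifted(1,3) s1 s23 mg3 n by (intro disjI1 exI[of _ g3] exI[of _ g1] exI[of _ "- 1"] exI[of _ n]
              exI[of _ A3] exI[of _ A1] exI[of _ A2]) simp
      qed
    qed
  qed
qed

text \<open>One of x and m - x is at most m / 2, so the normalisation holds after exchanging g2 and
  g3 if necessary.\<close>

theorem inverse_eta:
  assumes m: "m \<ge> 2" and n: "n \<ge> 1" and C: "lattice_C m"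
    and sz: "size S = m * n + 2 * m - 3"
    and no: "\<nexists>T. T \<subseteq># S \<and> zs_short (lat m (m * n)) (m * n) T"
  shows "form_1a m n S \<or> form_1b m n S"
proof -
  obtain g1 g2 g3 A1 A2 A3 s1 s2 s3 x t where cfg: "config_C m n S g1 g2 g3 A1 A2 A3 s1 s2 s3 x t"
    using config_C_exists[OF assms] by blast
  note swap = config_C_swap[OF cfg]
  have s: "s1 \<ge> 1" "s2 \<ge> 1" "s3 \<ge> 1" using cfg by (auto simp: config_C_def)
  consider "s2 \<ge> 2 \<or> s2 = 1 \<and> s3 = 1 \<and> (n = 1 \<or> 2 * x \<le> int m)"
    | "s3 \<ge> 2 \<or> s3 = 1 \<and> s2 = 1 \<and> (n = 1 \<or> 2 * (int m - x) \<le> int m)" using s by fastforce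
  then show ?thesis
  proof cases
    case 1
    then show ?thesis by (rule config_C_form_ordered[OF m n cfg no])
  next
    case 2
    then show ?thesis by (rule config_C_form_ordered[OF m n swap no])
  qed
qed

section \<open>The inverse theorem for zero-sums of length the exponent\<close>

definition form_2a :: "nat \<Rightarrow> nat \<Rightarrow> (int \<times> int) multiset \<Rightarrow> bool" where
  "form_2a m n S \<longleftrightarrow> (\<exists>g e1 e2 x s t A0 A1 A2 A3. S = A0 + A1 + A2 + A3 \<and> s \<in> {1..n} \<and> t \<in> {1..n} \<and>
     coprime x (int m) \<and> rank2_pair m (m * n) e1 e2 \<and> sm (int m) e1 \<in> lat m (m * n) \<and>
     near m (m * n) g (t * m - 1) A0 \<and> near m (m * n) (e1 + g) ((n + 1 - t) * m - 1) A1 \<and>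
     near m (m * n) (e2 + g) (s * m - 1) A2 \<and> near m (m * n) (sm (- x) e1 + e2 + g) ((n + 1 - s) * m - 1) A3)"

definition form_2b :: "nat \<Rightarrow> nat \<Rightarrow> (int \<times> int) multiset \<Rightarrow> bool" where
  "form_2b m n S \<longleftrightarrow> (\<exists>g g1 g2 A0 A1 A2 A3. S = A0 + A1 + A2 + A3 \<and> rank2_pair m (m * n) g1 g2 \<and>
     near m (m * n) g (m * n - 1) A0 \<and> near m (m * n) (g1 + g) (m - 1) A1 \<and>
     near m (m * n) (g2 + g) (m * n - 1) A2 \<and> near m (m * n) (- g1 + g2 + g) (m - 1) A3)"

lemma form_2aI:
  assumes "S = A0 + A1 + A2 + A3" "s \<in> {1..n}" "t \<in> {1..n}" "coprime x (int m)"
    "rank2_pair m (m * n) e1 e2" "sm (int m) e1 \<in> lat m (m * n)"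
    "near m (m * n) g (t * m - 1) A0" "near m (m * n) (e1 + g) ((n + 1 - t) * m - 1) A1"
    "near m (m * n) (e2 + g) (s * m - 1) A2" "near m (m * n) (sm (- x) e1 + e2 + g) ((n + 1 - s) * m - 1) A3"
  shows "form_2a m n S"
  unfolding form_2a_def
  by (rule exI[of _ g], rule exI[of _ e1], rule exI[of _ e2], rule exI[of _ x], rule exI[of _ s], rule exI[of _ t],
    rule exI[of _ A0], rule exI[of _ A1], rule exI[of _ A2], rule exI[of _ A3]) (intro conjI assms)

lemma submset_plusE:
  assumes "T \<subseteq># A + B"
  obtains T1 T2 where "T1 \<subseteq># A" "T2 \<subseteq># B" "T = T1 + T2"
proof -
  have "T - A \<subseteq># B" using assms by (simp add: subset_eq_diff_conv add.commute)
  moreover have "T = (T \<inter># A) + (T - A)" by (rule multiset_eqI) (simp add: min_def)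
  moreover have "T \<inter># A \<subseteq># A" by simp
  ultimately show thesis using that by blast
qed

text \<open>Extend the sequence by m - 1 zeros. A zero-sum of length m must use an original term, so
  it restricts to a short zero-sum; Property D therefore applies, and one member of the resulting
  \<open>T\<close> is the class of zero, which can be removed.\<close>

lemma lattice_D_imp_C:
  assumes m: "m \<ge> 2" and D: "lattice_D m"
  shows "lattice_C m"
  unfolding lattice_C_def
proof (intro allI impI)
  fix X assume X: "size X = 3 * (m - 1)" "\<nexists>B. B \<subseteq># X \<and> zs_short (lat m m) m B"
  let ?Y = "X + replicate_mset (m - 1) 0"
  have "\<nexists>B. B \<subseteq># ?Y \<and> zs_len (lat m m) m B"
  proof
    assume "\<exists>B. B \<subseteq># ?Y \<and> zs_len (lat m m) m B"
    then obtain B where B: "B \<subseteq># ?Y" "size B = m" "\<Sum>\<^sub># B \<in> lat m m" by (auto simp: zs_len_def)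
    obtain B1 B2 where BB: "B1 \<subseteq># X" "B2 \<subseteq># replicate_mset (m - 1) 0" "B = B1 + B2"
      using B(1) by (rule submset_plusE)
    have "size B2 \<le> m - 1" using size_mset_mono[OF BB(2)] by simp
    have "\<forall>x\<in>#B2. x = 0" using mset_subset_eqD[OF BB(2)] by (metis in_replicate_mset)
    then have "\<Sum>\<^sub># B2 = 0" by (induction B2) auto
    then have "\<Sum>\<^sub># B1 \<in> lat m m" using B(3) BB(3) by simp
    moreover have "size B1 \<in> {1..m}" using B(2) BB(3) \<open>size B2 \<le> m - 1\<close> m by auto
    ultimately show False using X(2) BB(1) by (auto simp: zs_short_def)
  qed
  moreover have "size ?Y = 4 * (m - 1)" using X(1) by simp
  ultimately obtain T where T: "image_mset (res m) ?Y = repeat_mset (m - 1) T"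
    using D unfolding lattice_D_def by blast
  have "res m 0 \<in># T"
  proof (rule ccontr)
    assume "res m 0 \<notin># T"
    then have "count (image_mset (res m) ?Y) (res m 0) = 0" unfolding T by (simp add: not_in_iff)
    then show False using m by simp
  qed
  then obtain T' where T': "T = add_mset (res m 0) T'" by (metis insert_DiffM)
  have "image_mset (res m) X + replicate_mset (m - 1) (res m 0) =
      repeat_mset (m - 1) T' + replicate_mset (m - 1) (res m 0)"
    using T unfolding T' by (simp add: multiset_eq_iff)
  then show "\<exists>T. image_mset (res m) X = repeat_mset (m - 1) T" by auto
qed

lemma sum_mset_translate:
  "\<Sum>\<^sub># (image_mset (\<lambda>v. v - g) T) = \<Sum>\<^sub># T - sm (int (size T)) g"
  by (induction T) (auto simp: sm_simps algebra_simps)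

lemma near_translate: "near m k h l (image_mset (\<lambda>v. v - g) A) \<longleftrightarrow> near m k (h + g) l A"
  by (auto simp: near_def diff_diff_eq2 diff_diff_eq add.commute)

lemma lat_multiple_exp: "sm (int (m * n)) v \<in> lat m (m * n)"
  by (simp add: lat_def sm_def)

text \<open>Translated by -g the full fibre becomes m n - 1 zeros, which pad any short zero-sum of
  the rest to length m n. So the rest is extremal for eta; in form (2a) the full fibre has t =
  n.\<close>

theorem inverse_s_full_fibre:
  assumes m: "m \<ge> 2" and n: "n \<ge> 1" and D: "lattice_D m"
    and no: "\<nexists>T. T \<subseteq># S \<and> zs_len (lat m (m * n)) (m * n) T"
    and S: "S = A0 + S'" "near m (m * n) g (m * n - 1) A0" "size S' = m * n + 2 * m - 3"
  shows "form_2a m n S \<or> form_2b m n S"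
proof -
  let ?N = "lat m (m * n)" and ?tr = "image_mset (\<lambda>v. v - g)"
  have mn: "m * n \<ge> 1" using m n by (cases m; cases n) auto
  have "\<nexists>T. T \<subseteq># ?tr S' \<and> zs_short ?N (m * n) T"
  proof
    assume "\<exists>T. T \<subseteq># ?tr S' \<and> zs_short ?N (m * n) T"
    then obtain T where T: "T \<subseteq># ?tr S'" "size T \<in> {1..m * n}" "\<Sum>\<^sub># T \<in> ?N" by (auto simp: zs_short_def)
    obtain T' where T': "T' \<subseteq># S'" "?tr T' = T" using T(1) by (rule submset_image_msetE)
    have sT: "size T' = size T" using T'(2) by auto
    have "m * n - size T \<le> size A0" using S(2) T(2) by (auto simp: near_def)
    then obtain B where B: "B \<subseteq># A0" "size B = m * n - size T" by (rule obtain_submset_of_size)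
    have 1: "\<Sum>\<^sub># B - sm (int (m * n - size T)) g \<in> ?N" using near_sum[OF near_sub[OF S(2) B(1)]] B(2) by simp
    have 2: "\<Sum>\<^sub># T' - sm (int (size T)) g \<in> ?N"
      using T(3) sum_mset_translate[of g T'] unfolding T'(2) sT by (simp only:)
    have "int (m * n) = int (m * n - size T) + int (size T)" using T(2) by (simp flip: of_nat_add)
    then have "(\<Sum>\<^sub># B - sm (int (m * n - size T)) g) + (\<Sum>\<^sub># T' - sm (int (size T)) g) + sm (int (m * n)) g =
        \<Sum>\<^sub># (B + T')" by (simp add: sm_simps(1) algebra_simps)
    moreover have "(\<Sum>\<^sub># B - sm (int (m * n - size T)) g) + (\<Sum>\<^sub># T' - sm (int (size T)) g) + sm (int (m * n)) g \<in> ?N"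
      by (rule lat_add[OF lat_add[OF 1 2] lat_multiple_exp])
    ultimately have "\<Sum>\<^sub># (B + T') \<in> ?N" by (simp only:)
    moreover have "B + T' \<subseteq># S" unfolding S(1) by (rule mset_subset_eq_mono_add[OF B(1) T'(1)])
    moreover have "size (B + T') = m * n" using B(2) sT T(2) by simp
    ultimately show False using no unfolding zs_len_def by blast
  qed
  moreover have "size (?tr S') = m * n + 2 * m - 3" using S(3) by simp
  ultimately consider "form_1a m n (?tr S')" | "form_1b m n (?tr S')"
    using inverse_eta[OF m n lattice_D_imp_C[OF m D]] by blast
  then show ?thesis
  proof cases
    case 1
    then obtain e1 e2 x s A1 A2 A3 where A: "?tr S' = A1 + A2 + A3" "s \<in> {1..n}" "coprime x (int m)"
      "rank2_pair m (m * n) e1 e2" "sm (int m) e1 \<in> ?N" "near m (m * n) e1 (m - 1) A1"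
      "near m (m * n) e2 (s * m - 1) A2" "near m (m * n) (sm (- x) e1 + e2) ((n + 1 - s) * m - 1) A3"
      unfolding form_1a_def by blast
    obtain B12 B3 where B: "S' = B12 + B3" "?tr B12 = A1 + A2" "?tr B3 = A3" using A(1) by (metis image_mset_eq_plusD)
    obtain B1 B2 where B': "B12 = B1 + B2" "?tr B1 = A1" "?tr B2 = A2" using B(2) by (metis image_mset_eq_plusD)
    have nr: "near m (m * n) (e1 + g) (m - 1) B1" "near m (m * n) (e2 + g) (s * m - 1) B2"
      "near m (m * n) (sm (- x) e1 + e2 + g) ((n + 1 - s) * m - 1) B3"
      using A(6,7,8) unfolding B'(2,3)[symmetric] B(3)[symmetric] near_translate .
    have "form_2a m n S" unfolding form_2a_def
      by (rule exI[of _ g], rule exI[of _ e1], rule exI[of _ e2], rule exI[of _ x], rule exI[of _ s], rule exI[of _ n],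
        rule exI[of _ A0], rule exI[of _ B1], rule exI[of _ B2], rule exI[of _ B3])
        (use A nr S(1,2) B B' n in \<open>simp add: add_ac mult.commute[of n m]\<close>)
    then show ?thesis ..
  next
    case 2
    then obtain g1 g2 A1 A2 A3 where A: "?tr S' = A1 + A2 + A3"
      "rank2_pair m (m * n) g1 g2" "near m (m * n) g1 (m - 1) A1"
      "near m (m * n) g2 (m * n - 1) A2" "near m (m * n) (- g1 + g2) (m - 1) A3"
      unfolding form_1b_def by blast
    obtain B12 B3 where B: "S' = B12 + B3" "?tr B12 = A1 + A2" "?tr B3 = A3" using A(1) by (metis image_mset_eq_plusD)
    obtain B1 B2 where B': "B12 = B1 + B2" "?tr B1 = A1" "?tr B2 = A2" using B(2) by (metis image_mset_eq_plusD)
    have nr: "near m (m * n) (g1 + g) (m - 1) B1" "near m (m * n) (g2 + g) (m * n - 1) B2"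
      "near m (m * n) (- g1 + g2 + g) (m - 1) B3"
      using A(3,4,5) unfolding B'(2,3)[symmetric] B(3)[symmetric] near_translate .
    have "form_2b m n S" unfolding form_2b_def
      by (rule exI[of _ g], rule exI[of _ g1], rule exI[of _ g2],
        rule exI[of _ A0], rule exI[of _ B1], rule exI[of _ B2], rule exI[of _ B3])
        (use A nr S(1,2) B B' in \<open>simp add: add_ac\<close>)
    then show ?thesis ..
  qed
qed

text \<open>Four fibres of multiplicity at least two, translated by the fourth; the three indices with
  coefficient \<open>q1, q2, q3\<close> say which fibres have the same block sum as the fourth (coefficient 0).\<close>

definition config_D :: "nat \<Rightarrow> nat \<Rightarrow> (int \<times> int) multiset \<Rightarrow> int \<times> int \<Rightarrow> int \<times> int \<Rightarrow> int \<times> int \<Rightarrow> int \<times> int \<Rightarrow>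
    (int \<times> int) multiset \<Rightarrow> (int \<times> int) multiset \<Rightarrow> (int \<times> int) multiset \<Rightarrow> (int \<times> int) multiset \<Rightarrow>
    nat \<Rightarrow> nat \<Rightarrow> nat \<Rightarrow> nat \<Rightarrow> nat \<Rightarrow> nat \<Rightarrow> nat \<Rightarrow> int \<Rightarrow> int \<Rightarrow> bool" where
  "config_D m n S p1 p2 p3 g A1 A2 A3 A4 s1 s2 s3 s4 q1 q2 q3 x t \<longleftrightarrow>
    S = A1 + A2 + A3 + A4 \<and> s1 \<ge> 2 \<and> s2 \<ge> 2 \<and> s3 \<ge> 2 \<and> s4 \<ge> 2 \<and>
    near m (m * n) (p1 + g) (s1 * m - 1) A1 \<and> near m (m * n) (p2 + g) (s2 * m - 1) A2 \<and>
    near m (m * n) (p3 + g) (s3 * m - 1) A3 \<and> near m (m * n) g (s4 * m - 1) A4 \<and>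
    x \<in> {1..int m - 1} \<and> coprime x (int m) \<and> sm x p1 - p2 + p3 \<in> lat m m \<and> shortfree3 m p1 p2 p3 \<and>
    coprime t (int n) \<and>
    sm (int m) p1 - sm (int q1) (0, int m * t) \<in> lat m (m * n) \<and>
    sm (int m) p2 - sm (int q2) (0, int m * t) \<in> lat m (m * n) \<and>
    sm (int m) p3 - sm (int q3) (0, int m * t) \<in> lat m (m * n) \<and>
    ((q1 = 0 \<and> q2 = 1 \<and> q3 = 1 \<and> s1 + s4 = n + 1 \<and> s2 + s3 = n + 1) \<or>
     (q1 = 1 \<and> q2 = 0 \<and> q3 = 1 \<and> s2 + s4 = n + 1 \<and> s1 + s3 = n + 1) \<or>
     (q1 = 1 \<and> q2 = 1 \<and> q3 = 0 \<and> s3 + s4 = n + 1 \<and> s1 + s2 = n + 1))"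

lemma config_D_swap:
  assumes "config_D m n S p1 p2 p3 g A1 A2 A3 A4 s1 s2 s3 s4 q1 q2 q3 x t"
  shows "config_D m n S p1 p3 p2 g A1 A3 A2 A4 s1 s3 s2 s4 q1 q3 q2 (int m - x) t"
proof -
  have c: "coprime x (int m)" "sm x p1 - p2 + p3 \<in> lat m m"
    using assms unfolding config_D_def by blast+
  have "gcd (int m - x) (int m) = gcd x (int m)" by (metis gcd.commute gcd_diff1 gcd_diff2)
  then have "coprime (int m - x) (int m)" using c(1) by (simp add: coprime_iff_gcd_eq_1)
  moreover have "sm (int m - x) p1 - p3 + p2 \<in> lat m m"
  proof -
    have "sm (int m) p1 - (sm x p1 - p2 + p3) \<in> lat m m" by (rule lat_diff[OF sm_in_lat c(2)]) simp
    then show ?thesis by (simp add: sm_simps algebra_simps)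
  qed
  ultimately show ?thesis using assms shortfree3_perm(2) unfolding config_D_def
    by (auto simp: add_ac)
qed

lemma split_below:
  assumes "r + 2 \<le> a + b" "a \<ge> 1" "b \<ge> (1 :: nat)"
  obtains r1 r2 where "r1 < a" "r2 < b" "r1 + r2 = r"
proof -
  have "min r (a - 1) < a" "r - min r (a - 1) < b" "min r (a - 1) + (r - min r (a - 1)) = r"
    using assms by (auto simp: min_def)
  then show thesis using that by blast
qed

text \<open>At total length m n the translation contributes m n g, which lies in the lattice. So
  only the vectors \<open>p1\<close>, \<open>p2\<close>, \<open>p3\<close> matter, and the fourth
  fibre merely adjusts the length.\<close>

lemma config_D_take:
  assumes cfg: "config_D m n S p1 p2 p3 g A1 A2 A3 A4 s1 s2 s3 s4 q1 q2 q3 x t"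
    and no: "\<nexists>T. T \<subseteq># S \<and> zs_len (lat m (m * n)) (m * n) T"
    and c: "c1 < s1 * m" "c2 < s2 * m" "c3 < s3 * m" "c4 < s4 * m" "c1 + c2 + c3 + c4 = m * n"
  shows "sm (int c1) p1 + sm (int c2) p2 + sm (int c3) p3 \<notin> lat m (m * n)"
proof
  assume z: "sm (int c1) p1 + sm (int c2) p2 + sm (int c3) p3 \<in> lat m (m * n)"
  have S: "S = A1 + A2 + A3 + A4" and nr: "near m (m * n) (p1 + g) (s1 * m - 1) A1"
    "near m (m * n) (p2 + g) (s2 * m - 1) A2" "near m (m * n) (p3 + g) (s3 * m - 1) A3" "near m (m * n) g (s4 * m - 1) A4"
    using cfg unfolding config_D_def by blast+
  have ex: "\<exists>T. T \<subseteq># A \<and> size T = c \<and> \<Sum>\<^sub># T - sm (int c) h \<in> lat m (m * n)"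
    if nA: "near m (m * n) h (s * m - 1) A" and c: "c < s * m" for A h s c
  proof -
    have "c \<le> size A" using that by (auto simp: near_def)
    then obtain T where T: "T \<subseteq># A" "size T = c" by (rule obtain_submset_of_size)
    then show ?thesis using near_sum[OF near_sub[OF nA T(1)]] by auto
  qed
  obtain T1 where T1: "T1 \<subseteq># A1" "size T1 = c1" "\<Sum>\<^sub># T1 - sm (int c1) (p1 + g) \<in> lat m (m * n)"
    using ex[OF nr(1) c(1)] by blast
  obtain T2 where T2: "T2 \<subseteq># A2" "size T2 = c2" "\<Sum>\<^sub># T2 - sm (int c2) (p2 + g) \<in> lat m (m * n)"
    using ex[OF nr(2) c(2)] by blast
  obtain T3 where T3: "T3 \<subseteq># A3" "size T3 = c3" "\<Sum>\<^sub># T3 - sm (int c3) (p3 + g) \<in> lat m (m * n)"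
    using ex[OF nr(3) c(3)] by blast
  obtain T4 where T4: "T4 \<subseteq># A4" "size T4 = c4" "\<Sum>\<^sub># T4 - sm (int c4) g \<in> lat m (m * n)"
    using ex[OF nr(4) c(4)] by blast
  have "(\<Sum>\<^sub># T1 - sm (int c1) (p1 + g)) + (\<Sum>\<^sub># T2 - sm (int c2) (p2 + g)) + (\<Sum>\<^sub># T3 - sm (int c3) (p3 + g))
     + (\<Sum>\<^sub># T4 - sm (int c4) g) + (sm (int c1) p1 + sm (int c2) p2 + sm (int c3) p3) + sm (int (m * n)) g \<in> lat m (m * n)"
    by (rule lat_add[OF lat_add[OF lat_add[OF lat_add[OF lat_add[OF T1(3) T2(3)] T3(3)] T4(3)] z] lat_multiple_exp])
  moreover have "int (m * n) = int c1 + int c2 + int c3 + int c4" using c(5) by (simp flip: of_nat_add)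
  ultimately have "\<Sum>\<^sub># (T1 + T2 + T3 + T4) \<in> lat m (m * n)"
    by (simp add: sm_simps algebra_simps)
  moreover have "T1 + T2 + T3 + T4 \<subseteq># S" unfolding S by (intro mset_subset_eq_mono_add T1 T2 T3 T4)
  moreover have "size (T1 + T2 + T3 + T4) = m * n" using T1(2) T2(2) T3(2) T4(2) c(5) by simp
  ultimately show False using no unfolding zs_len_def by blast
qed

text \<open>A mixed block with m - a terms of the fourth fibre has length 2 m and leaves n - 2
  constant blocks. Each pair of fibres of equal block sum offers n - 1 of them, so for every r \<le>
  n - 2 exactly r blocks of value H can be chosen. Hence only r = n - 1 can cancel the mixed sum,
  which is therefore H.\<close>

lemma config_D_special:
  assumes m: "m \<ge> 2" and n: "n \<ge> 2" and cfg: "config_D m n S p1 p2 p3 g A1 A2 A3 A4 s1 s2 s3 s4 q1 q2 q3 x t"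
    and no: "\<nexists>T. T \<subseteq># S \<and> zs_len (lat m (m * n)) (m * n) T"
    and k: "k \<in> {1..m - 1}"
  shows "sm ((int k * x) mod int m) p1 + sm (int m - int k) p2 + sm (int k) p3 - (0, int m * t) \<in> lat m (m * n)"
proof -
  define H where "H = (0 :: int, int m * t)"
  have s: "s1 \<ge> 2" "s2 \<ge> 2" "s3 \<ge> 2" "s4 \<ge> 2"
    and x: "x \<in> {1..int m - 1}" "coprime x (int m)" and rel: "sm x p1 - p2 + p3 \<in> lat m m" and ct: "coprime t (int n)"
    and Q: "sm (int m) p1 - sm (int q1) H \<in> lat m (m * n)" "sm (int m) p2 - sm (int q2) H \<in> lat m (m * n)"
      "sm (int m) p3 - sm (int q3) H \<in> lat m (m * n)"
    and flags: "(q1 = 0 \<and> q2 = 1 \<and> q3 = 1 \<and> s1 + s4 = n + 1 \<and> s2 + s3 = n + 1) \<or>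
     (q1 = 1 \<and> q2 = 0 \<and> q3 = 1 \<and> s2 + s4 = n + 1 \<and> s1 + s3 = n + 1) \<or>
     (q1 = 1 \<and> q2 = 1 \<and> q3 = 0 \<and> s3 + s4 = n + 1 \<and> s1 + s2 = n + 1)"
    using cfg unfolding config_D_def H_def by blast+
  define a where "a = nat ((int k * x) mod int m)"
  have ia: "int a = (int k * x) mod int m" using m by (simp add: a_def)
  have am: "a < m"
  proof -
    have "int a < int m" unfolding ia using m by simp
    then show ?thesis by simp
  qed
  have a0: "a > 0"
  proof (rule ccontr)
    assume "\<not> a > 0"
    then have "int m dvd int k * x" using ia by (simp add: dvd_eq_mod_eq_0)
    then have "int m dvd int k" using x(2) by (metis coprime_commute coprime_dvd_mult_left_iff)
    then have "m dvd k" by (simp only: int_dvd_int_iff)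
    then have "m \<le> k" using k by (intro dvd_imp_le) auto
    then show False using k m by simp
  qed
  define V where "V = sm (int a) p1 + sm (int m - int k) p2 + sm (int k) p3"
  have zero: "V \<in> lat m m"
  proof -
    have "int m dvd int a - int k * x" unfolding ia by (simp add: mod_eq_dvd_iff[symmetric])
    then have "sm (int k) (sm x p1 - p2 + p3) + sm (int m) p2 + sm (int a - int k * x) p1 \<in> lat m m"
      by (intro lat_add[OF lat_add[OF lat_sm[OF rel] sm_in_lat] sm_in_lat]) simp_all
    then show ?thesis unfolding V_def by (simp add: sm_simps algebra_simps)
  qed
  define c where "c = snd V div int m"
  obtain r where r: "r < n" "int n dvd c + int r * t" using ct by (rule unit_multiple) (use n in simp)
  have dvdm: "int m dvd fst V" "snd V = int m * c"
    using zero by (auto simp: lat_def c_def)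
  have inN: "V + sm i H \<in> lat m (m * n) \<longleftrightarrow> int n dvd c + i * t" for i
  proof -
    have "snd (V + sm i H) = int m * (c + i * t)"
      using dvdm(2) by (simp add: H_def sm_def algebra_simps)
    moreover have "fst (V + sm i H) = fst V" by (simp add: H_def sm_def)
    ultimately show ?thesis using dvdm(1) m unfolding lat_def by simp
  qed
  have "r = n - 1"
  proof (rule ccontr)
    assume "r \<noteq> n - 1"
    then have rn: "r + 2 \<le> n" using r(1) by simp
    have "\<exists>r1 r2 r3 r4. r1 < s1 \<and> r2 < s2 \<and> r3 < s3 \<and> r4 < s4 \<and> r1 + r2 + r3 + r4 = n - 2 \<and>
      q1 * r1 + q2 * r2 + q3 * r3 = r"
      using flags
    proof (elim disjE)
      assume f: "q1 = 0 \<and> q2 = 1 \<and> q3 = 1 \<and> s1 + s4 = n + 1 \<and> s2 + s3 = n + 1"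
      obtain r2 r3 where "r2 < s2" "r3 < s3" "r2 + r3 = r" by (rule split_below[of r s2 s3]) (use f s rn in auto)
      moreover obtain r1 r4 where "r1 < s1" "r4 < s4" "r1 + r4 = n - 2 - r"
        by (rule split_below[of "n - 2 - r" s1 s4]) (use f s rn in auto)
      ultimately show ?thesis using f rn
        by (intro exI[of _ r1] exI[of _ r2] exI[of _ r3] exI[of _ r4]) simp
    next
      assume f: "q1 = 1 \<and> q2 = 0 \<and> q3 = 1 \<and> s2 + s4 = n + 1 \<and> s1 + s3 = n + 1"
      obtain r1 r3 where "r1 < s1" "r3 < s3" "r1 + r3 = r" by (rule split_below[of r s1 s3]) (use f s rn in auto)
      moreover obtain r2 r4 where "r2 < s2" "r4 < s4" "r2 + r4 = n - 2 - r"
        by (rule split_below[of "n - 2 - r" s2 s4]) (use f s rn in auto)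
      ultimately show ?thesis using f rn
        by (intro exI[of _ r1] exI[of _ r2] exI[of _ r3] exI[of _ r4]) simp
    next
      assume f: "q1 = 1 \<and> q2 = 1 \<and> q3 = 0 \<and> s3 + s4 = n + 1 \<and> s1 + s2 = n + 1"
      obtain r1 r2 where "r1 < s1" "r2 < s2" "r1 + r2 = r" by (rule split_below[of r s1 s2]) (use f s rn in auto)
      moreover obtain r3 r4 where "r3 < s3" "r4 < s4" "r3 + r4 = n - 2 - r"
        by (rule split_below[of "n - 2 - r" s3 s4]) (use f s rn in auto)
      ultimately show ?thesis using f rn
        by (intro exI[of _ r1] exI[of _ r2] exI[of _ r3] exI[of _ r4]) simp
    qed
    then obtain r1 r2 r3 r4 where rr: "r1 < s1" "r2 < s2" "r3 < s3" "r4 < s4" "r1 + r2 + r3 + r4 = n - 2"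
      "q1 * r1 + q2 * r2 + q3 * r3 = r" by blast
    have lt: "b + m * r < s * m" if "b < m" "r < s" for b r s
    proof -
      have "(r + 1) * m \<le> s * m" using that(2) by (intro mult_right_mono) auto
      then show ?thesis using that(1) by (simp add: algebra_simps)
    qed
    have "(a + m * r1) + ((m - k) + m * r2) + (k + m * r3) + ((m - a) + m * r4) = 2 * m + m * (r1 + r2 + r3 + r4)"
    proof -
      have "(m - k) + k = m" "(m - a) + a = m" using am k by auto
      then show ?thesis by (simp add: algebra_simps)
    qed
    also have "\<dots> = m * n" unfolding rr(5) using n by (simp add: diff_mult_distrib2 algebra_simps)
    finally have tot: "(a + m * r1) + ((m - k) + m * r2) + (k + m * r3) + ((m - a) + m * r4) = m * n" .
    have "sm (int (a + m * r1)) p1 + sm (int ((m - k) + m * r2)) p2 + sm (int (k + m * r3)) p3 \<notin> lat m (m * n)"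
      by (rule config_D_take[OF cfg no _ _ _ _ tot]; rule lt) (use am a0 k m rr in auto)
    moreover have "int ((m - k) + m * r2) = int m - int k + int m * int r2" using k by auto
    moreover have "sm (int (a + m * r1)) p1 + sm (int m - int k + int m * int r2) p2 + sm (int (k + m * r3)) p3
      = V + (sm (int r1) (sm (int m) p1) + sm (int r2) (sm (int m) p2) + sm (int r3) (sm (int m) p3))"
      unfolding V_def by (simp add: sm_simps algebra_simps)
    moreover have "V + (sm (int r1) (sm (int m) p1) + sm (int r2) (sm (int m) p2) + sm (int r3) (sm (int m) p3)) \<in> lat m (m * n)"
    proof -
      have "V + sm (int r) H \<in> lat m (m * n)" using inN r(2) by blast
      then have "(V + sm (int r) H) + sm (int r1) (sm (int m) p1 - sm (int q1) H)
        + sm (int r2) (sm (int m) p2 - sm (int q2) H) + sm (int r3) (sm (int m) p3 - sm (int q3) H) \<in> lat m (m * n)"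
        by (rule lat_add[OF lat_add[OF lat_add[OF _ lat_sm[OF Q(1)]] lat_sm[OF Q(2)]] lat_sm[OF Q(3)]])
      moreover have "int r = int q1 * int r1 + int q2 * int r2 + int q3 * int r3"
        unfolding rr(6)[symmetric] by simp
      ultimately show ?thesis by (simp add: sm_simps algebra_simps)
    qed
    ultimately show False by (simp only: simp_thms)
  qed
  then have "int r = int n - 1" using n by (simp add: of_nat_diff)
  then have "int n dvd c + (int n - 1) * t" using r(2) by simp
  moreover have "c + (int n - 1) * t = (c + (- 1) * t) + int n * t" by (simp add: algebra_simps)
  ultimately have "int n dvd c + (- 1) * t" by (metis dvd_add_left_iff dvd_triv_left)
  then have "V + sm (- 1) H \<in> lat m (m * n)" using inN by blast
  then have "V - H \<in> lat m (m * n)" by (simp add: sm_simps)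
  then show ?thesis unfolding V_def H_def ia .
qed

text \<open>If \<open>p1\<close> has block sum 0, the relation lifts to N and \<open>p1\<close> is
  the basis element of order m. If \<open>p2\<close> has block sum 0, the relation takes the value H
  instead; a wrapping multiple of m - x rules out all x but m - 1, and then \<open>p2\<close> has
  that role.\<close>

theorem config_D_form_ordered:
  assumes m: "m \<ge> 2" and n: "n \<ge> 2" and cfg: "config_D m n S p1 p2 p3 g A1 A2 A3 A4 s1 s2 s3 s4 q1 q2 q3 x t"
    and no: "\<nexists>T. T \<subseteq># S \<and> zs_len (lat m (m * n)) (m * n) T" and ord: "q3 = 1"
  shows "form_2a m n S"
proof -
  let ?N = "lat m (m * n)"
  define H where "H = (0 :: int, int m * t)"
  have S: "S = A1 + A2 + A3 + A4" and s: "s1 \<ge> 2" "s2 \<ge> 2" "s3 \<ge> 2" "s4 \<ge> 2"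
    and nr: "near m (m * n) (p1 + g) (s1 * m - 1) A1"
      "near m (m * n) (p2 + g) (s2 * m - 1) A2" "near m (m * n) (p3 + g) (s3 * m - 1) A3" "near m (m * n) g (s4 * m - 1) A4"
    and x: "x \<in> {1..int m - 1}" "coprime x (int m)"
    and sf: "shortfree3 m p1 p2 p3" and t: "coprime t (int n)"
    and Q: "sm (int m) p1 - sm (int q1) H \<in> ?N" "sm (int m) p2 - sm (int q2) H \<in> ?N"
      "sm (int m) p3 - sm (int q3) H \<in> ?N"
    and flags: "(q1 = 0 \<and> q2 = 1 \<and> q3 = 1 \<and> s1 + s4 = n + 1 \<and> s2 + s3 = n + 1) \<or>
     (q1 = 1 \<and> q2 = 0 \<and> q3 = 1 \<and> s2 + s4 = n + 1 \<and> s1 + s3 = n + 1)"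
    using cfg ord unfolding config_D_def H_def by auto
  have m0: "m > 0" using m by simp
  have ind12: "int m dvd i \<and> int m dvd j" if "sm i p1 + sm j p2 \<in> lat m m" for i j
    using shortfree3_zero_coord'(2)[OF m sf, of i j 0] that by (simp add: sm_simps)
  have E: "sm ((int k * x) mod int m) p1 + sm (int m - int k) p2 + sm (int k) p3 - H \<in> ?N" if "k \<in> {1..m - 1}" for k
    using config_D_special[OF m n cfg no that] unfolding H_def .
  have E1: "sm x p1 + sm (int m - 1) p2 + p3 - H \<in> ?N"
  proof -
    have "1 \<in> {1..m - 1}" using m by simp
    from E[OF this] show ?thesis using x by (simp add: sm_simps)
  qed
  from flags show ?thesis
  proof
    assume f: "q1 = 0 \<and> q2 = 1 \<and> q3 = 1 \<and> s1 + s4 = n + 1 \<and> s2 + s3 = n + 1"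
    have K2: "sm (int m) p2 - H \<in> ?N" and K1: "sm (int m) p1 \<in> ?N" using Q f by (auto simp: sm_simps)
    have D: "sm x p1 - p2 + p3 \<in> ?N"
      by (rule lat_eqI[OF lat_diff[OF E1 K2]]) (simp add: sm_simps algebra_simps)
    have "rank2_pair m (m * n) p1 p2" by (rule rank2_pairI[OF m0 t ind12]) (use K2 H_def in auto)
    moreover have "near m (m * n) (sm (- x) p1 + p2 + g) ((n + 1 - s2) * m - 1) A3"
    proof -
      have "n + 1 - s2 = s3" using f by auto
      moreover have "(p3 + g) - (sm (- x) p1 + p2 + g) \<in> ?N"
        by (rule lat_eqI[OF D]) (simp add: sm_simps algebra_simps)
      ultimately show ?thesis using near_shift[OF nr(3)] by simp
    qed
    moreover have s14: "n + 1 - s4 = s1" and "s2 \<in> {1..n}" "s4 \<in> {1..n}" using f s by auto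
    moreover have "S = A4 + A1 + A2 + A3" unfolding S by (simp only: add_ac)
    moreover have "near m (m * n) (p1 + g) ((n + 1 - s4) * m - 1) A1" unfolding s14 by (rule nr(1))
    ultimately show ?thesis using K1 x(2) nr(2,4) by (intro form_2aI)
  next
    assume f: "q1 = 1 \<and> q2 = 0 \<and> q3 = 1 \<and> s2 + s4 = n + 1 \<and> s1 + s3 = n + 1"
    have K1: "sm (int m) p1 - H \<in> ?N" and K2: "sm (int m) p2 \<in> ?N" using Q f by (auto simp: sm_simps)
    have D: "sm x p1 - p2 + p3 - H \<in> ?N"
      by (rule lat_eqI[OF lat_diff[OF E1 K2]]) (simp add: sm_simps algebra_simps)
    have xm: "x = int m - 1"
    proof (rule ccontr)
      assume "x \<noteq> int m - 1"
      have "gcd (int m - x) (int m) = gcd x (int m)" by (metis gcd.commute gcd_diff1 gcd_diff2)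
      then have "coprime (int m - x) (int m)" using x(2) by (simp add: coprime_iff_gcd_eq_1)
      moreover have "int m - x \<in> {2..int m - 1}" using x \<open>x \<noteq> int m - 1\<close> by auto
      ultimately obtain k where k: "k \<in> {1..m - 1}" "(int k * (int m - x)) mod int m = int k * (int m - x) - int m"
        "int k * (int m - x) - int m > 0" using wrapping_multiple by blast
      have less: "int k * (int m - x) - int m < int m" unfolding k(2)[symmetric] using m by simp
      have "(int k * x) mod int m = 2 * int m - int k * (int m - x)"
      proof -
        have "int k * x = (2 * int m - int k * (int m - x)) + (int k - 2) * int m" by (simp add: algebra_simps)
        then have "(int k * x) mod int m = (2 * int m - int k * (int m - x)) mod int m" by (metis mod_mult_self1)
        also have "\<dots> = 2 * int m - int k * (int m - x)" using k(3) less by (intro mod_pos_pos_trivial) auto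
        finally show ?thesis .
      qed
      then have Ek: "sm (2 * int m - int k * (int m - x)) p1 + sm (int m - int k) p2 + sm (int k) p3 - H \<in> ?N"
        using E[OF k(1)] by simp
      \<comment> \<open>The combination is chosen so that the coefficients of \<open>p1\<close>,
        \<open>p2\<close>, \<open>p3\<close> cancel and a single H is left.\<close>
      have "(sm (2 * int m - int k * (int m - x)) p1 + sm (int m - int k) p2 + sm (int k) p3 - H)
        - sm (int k) (sm x p1 - p2 + p3 - H) - sm (int m) p2 + sm (int k - 2) (sm (int m) p1 - H) \<in> ?N"
        by (rule lat_add[OF lat_diff[OF lat_diff[OF Ek lat_sm[OF D]] K2] lat_sm[OF K1]])
      then have "H \<in> ?N" by (rule lat_eqI) (simp add: sm_def prod_eq_iff algebra_simps)
      then have "int n dvd 1" using H_multiple[OF m0 t, of 1] by (simp add: sm_simps H_def)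
      then show False using n by (simp add: zdvd1_eq)
    qed
    have D': "(sm (int m) p1 - H) - (sm x p1 - p2 + p3 - H) \<in> ?N" by (rule lat_diff[OF K1 D])
    have "rank2_pair m (m * n) p2 p1"
    proof (rule rank2_pairI[OF m0 t])
      show "int m dvd i \<and> int m dvd j" if "sm i p2 + sm j p1 \<in> lat m m" for i j
        using ind12[of j i] that by (simp add: add.commute)
    qed (use K1 H_def in auto)
    moreover have "near m (m * n) (sm (- (- 1)) p2 + p1 + g) ((n + 1 - s1) * m - 1) A3"
    proof -
      have "n + 1 - s1 = s3" using f by auto
      moreover have "(p3 + g) - (sm (- (- 1)) p2 + p1 + g) \<in> ?N"
      proof -
        have "- ((sm (int m) p1 - H) - (sm x p1 - p2 + p3 - H)) \<in> ?N" using D' by (simp only: lat_uminus)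
        then show ?thesis by (rule lat_eqI) (simp add: xm sm_simps algebra_simps)
      qed
      ultimately show ?thesis using near_shift[OF nr(3)] by simp
    qed
    moreover have s24: "n + 1 - s4 = s2" and "s1 \<in> {1..n}" "s4 \<in> {1..n}" using f s by auto
    moreover have "S = A4 + A2 + A1 + A3" unfolding S by (simp only: add_ac)
    moreover have "near m (m * n) (p2 + g) ((n + 1 - s4) * m - 1) A2" unfolding s24 by (rule nr(2))
    moreover have "coprime (- 1) (int m)" by simp
    ultimately show ?thesis using K2 nr(1,4) by (intro form_2aI)
  qed
qed

text \<open>If d = gcd (w - v) n were at least 2, then n / d terms of class w and n - n / d of class
  v would add up to zero, and both numbers are at most n - 1.\<close>

lemma egzfree_coprime:
  assumes n: "n \<ge> 2" and U: "egzfree n U"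
    and v: "n - 1 \<le> count (image_mset (\<lambda>x. x mod int n) U) (v mod int n)"
    and w: "n - 1 \<le> count (image_mset (\<lambda>x. x mod int n) U) (w mod int n)"
    and ne: "v mod int n \<noteq> w mod int n"
  shows "coprime (w - v) (int n)"
proof (rule ccontr)
  assume nc: "\<not> coprime (w - v) (int n)"
  define d where "d = nat (gcd (w - v) (int n))"
  have d: "int d = gcd (w - v) (int n)" by (simp add: d_def)
  have "d \<noteq> 1" using nc d coprime_iff_gcd_eq_1 by (metis of_nat_1)
  moreover have "d > 0" using n d by (simp add: d_def)
  ultimately have d2: "d \<ge> 2" by simp
  have "int d dvd int n" unfolding d by simp
  then have dn: "d dvd n" by (simp only: int_dvd_int_iff)
  define r where "r = n div d"
  have rd: "r * d = n" using dn by (simp add: r_def)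
  have "r > 0" using rd n by (cases r) auto
  moreover have "r * 2 \<le> r * d" using d2 by (intro mult_left_mono) auto
  ultimately have r: "r \<ge> 1" "r \<le> n - 1" using rd by auto
  let ?R = "replicate_mset r (w mod int n) + replicate_mset (n - r) (v mod int n)"
  have "?R \<subseteq># image_mset (\<lambda>x. x mod int n) U"
  proof (rule mset_subset_eqI)
    fix a show "count ?R a \<le> count (image_mset (\<lambda>x. x mod int n) U) a"
      using v w ne r by (auto intro: order_trans)
  qed
  then obtain T where T: "T \<subseteq># U" "image_mset (\<lambda>x. x mod int n) T = ?R" by (rule submset_image_msetE)
  have sT: "size T = n" using arg_cong[OF T(2), of size] r by simp
  have "[\<Sum>\<^sub># (image_mset (\<lambda>x. x mod int n) T) = \<Sum>\<^sub># T] (mod int n)"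
  proof (induction T)
    case (add x T)
    have "[x mod int n + \<Sum>\<^sub># (image_mset (\<lambda>x. x mod int n) T) = x + \<Sum>\<^sub># T] (mod int n)"
      by (intro cong_add add.IH) (simp add: cong_def)
    then show ?case by simp
  qed simp
  then have 1: "[\<Sum>\<^sub># ?R = \<Sum>\<^sub># T] (mod int n)" unfolding T(2) .
  have sr: "\<Sum>\<^sub># (replicate_mset k a) = int k * a" for k and a :: int by (induction k) (auto simp: algebra_simps)
  have "\<Sum>\<^sub># ?R = int r * (w mod int n) + int (n - r) * (v mod int n)" by (simp add: sr)
  moreover have "[int r * (w mod int n) + int (n - r) * (v mod int n) = int r * w + int (n - r) * v] (mod int n)"
    by (intro cong_add cong_mult) (auto simp: cong_def)
  moreover have "int r * w + int (n - r) * v = int r * (w - v) + int n * v"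
    using r by (simp add: of_nat_diff algebra_simps)
  moreover have "int n dvd int r * (w - v) + int n * v"
  proof -
    have "int d dvd w - v" unfolding d by simp
    then obtain c where "w - v = int d * c" by (rule dvdE)
    then have "int r * (w - v) = int (r * d) * c" by simp
    then show ?thesis unfolding rd by simp
  qed
  ultimately have "int n dvd \<Sum>\<^sub># T" using 1 by (metis cong_dvd_iff)
  then show False using U T(1) sT unfolding egzfree_def zs_len_def mult_of_def by blast
qed

text \<open>Suppose no fibre has s = n. Every block value that occurs has multiplicity n - 1 and
  must be shared by at least two fibres, since a single one would have s - 1 = n - 1. With two
  values and four fibres, the fibres split into two pairs and all of them carry blocks.\<close>

theorem inverse_s:
  assumes m: "m \<ge> 2" and n: "n \<ge> 1" and D: "lattice_D m"
    and sz: "size S = 2 * (m * n) + 2 * m - 4"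
    and no: "\<nexists>T. T \<subseteq># S \<and> zs_len (lat m (m * n)) (m * n) T"
  shows "form_2a m n S \<or> form_2b m n S"
proof -
  let ?P = "zs_len (lat m m) m" and ?b = "\<lambda>v :: int \<times> int. snd v div int m" and ?N = "lat m (m * n)"
  interpret block_system ?P "res m" 4 m by (rule block_system_D[OF m D])
  have b: "add_on (lat m m) ?b" by (rule add_on_lat_snd)
  have N: "x \<in> lat m m \<Longrightarrow> ?b x \<in> mult_of n \<Longrightarrow> x \<in> ?N" for x
    using lat_snd_iff[of m x n] m by simp
  have np: "\<not> packing ?P (Suc (2 * n - 2)) S"
    by (rule not_packing_len[OF b N _ no]) (use n in auto)
  have szS: "size S = 4 * (m - 1) + (2 * n - 2) * m"
    using sz m n by (cases m; cases n) (auto simp: algebra_simps)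
  obtain F where F: "finite F" "card F = 4" "set_mset (image_mset (res m) S) = F"
    "\<forall>f\<in>F. m dvd count (image_mset (res m) S) f + 1"
    using class_structure[OF szS np] by blast
  interpret fibred ?P "res m" 4 m "lat m m" ?N ?b n "2 * n - 2" S F "egzfree n"
  proof
    show "x \<in> lat m m \<Longrightarrow> x \<in> ?N \<longleftrightarrow> int n dvd ?b x" for x
      using lat_snd_iff_dvd m by simp
    show "egzfree n (image_mset (\<lambda>B. ?b (\<Sum>\<^sub># B)) FF)"
      if "size FF = 2 * n - 2" "\<forall>B\<in>#FF. ?P B" "\<Sum>\<^sub># FF \<subseteq># S" for FF
      by (rule egzfree_packing[OF b N that no])
    show "int n dvd c - c'" if "egzfree n (add_mset c U)" "egzfree n (add_mset c' U)" for c c' U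
      using egzfree_cancel[OF inverse_egz _ that] n by (cases "n = 1") auto
    show "res m x = res m y \<longleftrightarrow> x - y \<in> lat m m" for x y by (rule res_eq_iff)
  qed (use b F szS in \<open>auto simp: lat_diff zs_len_def\<close>)
  define g where "g f = (SOME x. x \<in># S \<and> res m x = f)" for f
  have g: "g f \<in># S \<and> res m (g f) = f" if "f \<in> F" for f
  proof -
    have "f \<in> res m ` set_mset S" using that F(3) by simp
    then have "\<exists>x. x \<in># S \<and> res m x = f" by auto
    then show ?thesis unfolding g_def by (rule someI_ex)
  qed
  let ?A = "\<lambda>f. filter_mset (\<lambda>x. res m x = f) S"
  have sA: "size (?A f) = s f * m - 1" "size (?A f) \<ge> m - 1" if "f \<in> F" for f
    using size_fibre[OF that] s_pos[OF that] by (cases "s f"; simp)+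
  have nearA: "near m (m * n) (g f) (s f * m - 1) (?A f)" if fF: "f \<in> F" and f2: "s f \<ge> 2 \<or> n = 1" for f
    unfolding near_def
  proof (intro conjI ballI)
    show "size (?A f) = s f * m - 1" using sA(1)[OF fF] .
    fix y assume y: "y \<in># ?A f"
    show "y - g f \<in> ?N"
    proof (cases "n = 1")
      case True
      then show ?thesis using y g[OF fF] by (simp flip: res_eq_iff)
    next
      case False
      then show ?thesis using y g[OF fF] f2 by (intro lifts_agree') auto
    qed
  qed
  show ?thesis
  proof (cases "\<exists>f\<in>F. s f = n")
    case True
    then obtain f where f: "f \<in> F" "s f = n" by blast
    define S' where "S' = filter_mset (\<lambda>x. res m x \<noteq> f) S"
    have SS: "S = ?A f + S'" unfolding S'_def by (rule multiset_partition)
    have nr: "near m (m * n) (g f) (m * n - 1) (?A f)"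
    proof -
      have "n \<ge> 2 \<or> n = 1" using n by auto
      then show ?thesis using nearA[OF f(1)] f(2) by (simp add: mult.commute)
    qed
    have "size S = (m * n - 1) + size S'" using arg_cong[OF SS, of size] nr by (simp add: near_def)
    moreover have "m * n \<ge> 1" using m n by (cases m; cases n) auto
    ultimately have "size S' = m * n + 2 * m - 3" using sz m by linarith
    from inverse_s_full_fibre[OF m n D no SS nr this] show ?thesis .
  next
    case False
    \<comment> \<open>For n = 1 there are no blocks, so all four fibres have s = 1 = n.\<close>
    have n2: "n \<ge> 2"
    proof (rule ccontr)
      assume "\<not> n \<ge> 2"
      then have n1: "n = 1" using n by simp
      have "F \<noteq> {}" using F(2) by auto
      then obtain f where f: "f \<in> F" by blast
      have "s f \<noteq> 1" if "f \<in> F" for f using False that n1 by auto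
      then have "s f \<ge> 2" if "f \<in> F" for f using s_pos[OF that] that by (metis One_nat_def Suc_1 le_antisym not_less_eq_eq)
      then have "(\<Sum>f\<in>F. 2) \<le> (\<Sum>f\<in>F. s f)" by (intro sum_mono)
      then show False using size_blocks(2) F(2) n1 by simp
    qed
    obtain U where U: "egzfree n U" "image_mset (\<lambda>x. x mod int n) U = image_mset (\<lambda>f. weight g f mod int n) blocks"
      using good_standard_packing[of g] lat_mult_subset g by metis
    let ?w = "\<lambda>f. weight g f mod int n"
    let ?c = "\<lambda>v. count (image_mset (\<lambda>x. x mod int n) U) v"
    define J where "J v = {f \<in> F. s f \<ge> 2 \<and> ?w f = v}" for v
    have finJ: "finite (J v)" for v using F(1) by (simp add: J_def)
    have c: "?c v = (\<Sum>f\<in>J v. s f - 1)" for v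
    proof -
      have "?c v = (\<Sum>f\<in>F. if ?w f = v then s f - 1 else 0)"
        unfolding U(2) blocks_def using F(1)
        by (induction F rule: finite_induct) auto
      also have "\<dots> = (\<Sum>f\<in>J v. s f - 1)"
        using F(1) by (intro sum.mono_neutral_cong_right) (auto simp: J_def)
      finally show ?thesis .
    qed
    have c01: "?c v \<in> {0, n - 1}" for v
      by (rule inverse_egz_count[OF inverse_egz U(1) n2]) (use n in simp)
    have Jpos: "(\<Sum>f\<in>J v. s f - 1) = n - 1" if "f \<in> J v" for f v
    proof -
      have "s f - 1 \<le> (\<Sum>f\<in>J v. s f - 1)" using that finJ by (intro member_le_sum) auto
      moreover have "s f \<ge> 2" using that by (simp add: J_def)
      ultimately show ?thesis using c01[of v] c[of v] by auto
    qed
    have J2: "card (J v) \<ge> 2" if f: "f \<in> J v" for f v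
    proof (rule ccontr)
      assume "\<not> card (J v) \<ge> 2"
      then have "card (J v) \<le> 1" by simp
      then have "J v = {f}" using f finJ by (metis card_le_Suc0_iff_eq One_nat_def singleton_iff subsetI subset_singletonD empty_iff)
      then have "s f - 1 = n - 1" using Jpos[OF f] by simp
      moreover have "s f \<ge> 2" "f \<in> F" using f by (auto simp: J_def)
      ultimately have "s f = n" using n2 by simp
      then show False using False \<open>f \<in> F\<close> by blast
    qed
    have tot: "(\<Sum>f\<in>F. s f - 1) = 2 * n - 2" using size_blocks(1) by (simp add: blocks_def)
    have "\<exists>f\<in>F. s f \<ge> 2"
    proof (rule ccontr)
      assume a: "\<not> ?thesis"
      have "(\<Sum>f\<in>F. s f - 1) = 0"
      proof (intro sum.neutral ballI)
        fix f assume "f \<in> F"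
        then have "\<not> s f \<ge> 2" using a by blast
        then show "s f - 1 = 0" by simp
      qed
      then show False using tot n2 by simp
    qed
    then obtain f4 where f4: "f4 \<in> F" "s f4 \<ge> 2" by blast
    define v where "v = ?w f4"
    have f4J: "f4 \<in> J v" using f4 by (simp add: J_def v_def)
    have sumdiff: "(\<Sum>f\<in>F - J v. s f - 1) = n - 1"
    proof -
      have "(\<Sum>f\<in>F. s f - 1) = (\<Sum>f\<in>F - J v. s f - 1) + (\<Sum>f\<in>J v. s f - 1)"
        using F(1) by (intro sum.subset_diff) (auto simp: J_def)
      then show ?thesis using tot Jpos[OF f4J] by simp
    qed
    \<comment> \<open>One value accounts for only n - 1 of the 2 n - 2 blocks.\<close>
    have "\<exists>f\<in>F - J v. s f \<ge> 2"
    proof (rule ccontr)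
      assume a: "\<not> ?thesis"
      have "(\<Sum>f\<in>F - J v. s f - 1) = 0"
      proof (intro sum.neutral ballI)
        fix f assume "f \<in> F - J v"
        then have "\<not> s f \<ge> 2" using a by blast
        then show "s f - 1 = 0" by simp
      qed
      then show False using sumdiff n2 by simp
    qed
    then obtain f0 where f0: "f0 \<in> F" "f0 \<notin> J v" "s f0 \<ge> 2" by blast
    define w where "w = ?w f0"
    have f0J: "f0 \<in> J w" using f0 by (simp add: J_def w_def)
    have vw: "v \<noteq> w" using f0 f0J by (auto simp: J_def)
    have disj: "J v \<inter> J w = {}" using vw by (auto simp: J_def)
    have JF: "J v \<union> J w \<subseteq> F" by (auto simp: J_def)
    have "card (J v \<union> J w) = card (J v) + card (J w)" using finJ disj by (simp add: card_Un_disjoint)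
    moreover have "card (J v \<union> J w) \<le> 4" using JF F(1,2) card_mono by metis
    ultimately have cJ: "card (J v) = 2" "card (J w) = 2" "card (J v \<union> J w) = 4"
      using J2[OF f4J] J2[OF f0J] by auto
    then have JFeq: "J v \<union> J w = F" using JF F(1,2) by (intro card_subset_eq) auto
    have all2: "s f \<ge> 2" if "f \<in> F" for f using that unfolding JFeq[symmetric] by (auto simp: J_def)
    have wJ: "?w f = (if f \<in> J v then v else w)" if "f \<in> F" for f
      using that unfolding JFeq[symmetric] by (auto simp: J_def)
    obtain fa where fa: "J v = {f4, fa}" "fa \<noteq> f4"
      using cJ(1) f4J by (metis card_2_iff doubleton_eq_iff insertE singletonD)
    have sumJv: "s f4 + s fa = n + 1"
    proof -
      have "(s f4 - 1) + (s fa - 1) = n - 1" using Jpos[OF f4J] fa by simp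
      then show ?thesis using all2[OF f4(1)] all2[of fa] fa JF n2 by auto
    qed
    \<comment> \<open>After translation by the fourth fibre the two block values become 0 and H, and
      coprimality of t makes H a generator of M / N.\<close>
    define t where "t = weight g f0 - weight g f4"
    have ct: "coprime t (int n)"
      unfolding t_def
    proof (rule egzfree_coprime[OF n2 U(1)])
      show "n - 1 \<le> ?c (?w f4)" "n - 1 \<le> ?c (?w f0)"
        using c[of v] c[of w] Jpos[OF f4J] Jpos[OF f0J] by (simp_all add: v_def w_def)
      show "?w f4 \<noteq> ?w f0" using vw by (simp add: v_def w_def)
    qed
    define H where "H = (0 :: int, int m * t)"
    have Q: "sm (int m) (g f - g f4) - sm (int (if f \<in> J v then 0 else 1)) H \<in> ?N" if fF: "f \<in> F" for f
    proof -
      define q :: nat where "q = (if f \<in> J v then 0 else 1)"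
      have wf: "weight g f' = snd (sm (int m) (g f')) div int m" for f'
        by (simp add: weight_def sum_mset_replicate)
      have wf': "weight g f' = snd (g f')" for f' using m by (simp add: wf sm_def)
      have "(weight g f - weight g f4 - int q * t) mod int n = 0"
      proof (cases "f \<in> J v")
        case True
        then have "?w f = ?w f4" using wJ[OF fF] v_def by simp
        then show ?thesis using True by (simp add: q_def mod_eq_dvd_iff)
      next
        case False
        then have "?w f = ?w f0" using wJ[OF fF] w_def by simp
        then show ?thesis using False by (simp add: q_def t_def mod_eq_dvd_iff)
      qed
      then have "int n dvd snd (g f) - snd (g f4) - int q * t" by (simp add: wf' dvd_eq_mod_eq_0)
      then have "int m * int n dvd int m * (snd (g f) - snd (g f4) - int q * t)" by (rule mult_dvd_mono[OF dvd_refl])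
      then show ?thesis unfolding q_def[symmetric] by (simp add: lat_def sm_def H_def algebra_simps)
    qed
    define F3 where "F3 = F - {f4}"
    have "card F3 = 3" using F(1,2) f4(1) by (simp add: F3_def)
    then obtain f1 f2 f3 where f: "F3 = {f1, f2, f3}" "f1 \<noteq> f2" "f1 \<noteq> f3" "f2 \<noteq> f3"
      by (auto simp: card_3_iff)
    have f4n: "f4 \<notin> F3" by (simp add: F3_def)
    have F3F: "F3 \<subseteq> F" "F = insert f4 F3" using f4(1) by (auto simp: F3_def)
    have sf3: "shortfree3 m (g f1 - g f4) (g f2 - g f4) (g f3 - g f4)"
      unfolding shortfree3_def
    proof (intro allI impI notI)
      fix a1 a2 a3 :: int
      assume a: "a1 \<in> {0..int m - 1}" "a2 \<in> {0..int m - 1}" "a3 \<in> {0..int m - 1}" "a1 + a2 + a3 \<in> {1..int m}"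
        and z: "sm a1 (g f1 - g f4) + sm a2 (g f2 - g f4) + sm a3 (g f3 - g f4) \<in> lat m m"
      \<comment> \<open>Terms of the fourth fibre fill up the length: a short zero-sum of
        differences becomes a block of length m with fewer than m terms in each class.\<close>
      define a4 where "a4 = int m - (a1 + a2 + a3)"
      have a4: "a4 \<in> {0..int m - 1}" using a by (auto simp: a4_def)
      have ex: "\<exists>T. T \<subseteq># ?A f' \<and> size T = nat a" if "f' \<in> F" "a \<in> {0..int m - 1}" for f' a
      proof -
        have "nat a \<le> size (?A f')" using sA(2)[OF that(1)] that(2) by auto
        then show ?thesis by (metis obtain_submset_of_size)
      qed
      have ff: "f1 \<in> F" "f2 \<in> F" "f3 \<in> F" using f F3F by auto
      have ne4: "f1 \<noteq> f4" "f2 \<noteq> f4" "f3 \<noteq> f4" using f f4n by auto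
      obtain T1 where T1: "T1 \<subseteq># ?A f1" "size T1 = nat a1" using ex[OF ff(1) a(1)] by auto
      obtain T2 where T2: "T2 \<subseteq># ?A f2" "size T2 = nat a2" using ex[OF ff(2) a(2)] by auto
      obtain T3 where T3: "T3 \<subseteq># ?A f3" "size T3 = nat a3" using ex[OF ff(3) a(3)] by auto
      obtain T4 where T4: "T4 \<subseteq># ?A f4" "size T4 = nat a4" using ex[OF f4(1) a4] by auto
      have S4: "S = ?A f1 + ?A f2 + ?A f3 + ?A f4"
        using partition_fibres f f4n unfolding F3F(2) by (simp add: add_ac)
      have TS: "T1 + T2 + T3 + T4 \<subseteq># S"
        by (subst S4) (intro mset_subset_eq_mono_add T1(1) T2(1) T3(1) T4(1))
      have near: "\<Sum>\<^sub># T - sm a (g f') \<in> lat m m" "image_mset (res m) T = replicate_mset (nat a) f'"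
        if "T \<subseteq># ?A f'" "size T = nat a" "f' \<in> F" "a \<ge> 0" for T a f'
      proof -
        have r: "\<forall>x\<in>#T. res m x = f'" using that(1) by (auto dest: mset_subset_eqD)
        then have "\<forall>x\<in>#T. x - g f' \<in> lat m m" using g[OF that(3)] by (simp flip: res_eq_iff)
        from sum_mset_near[OF this] show "\<Sum>\<^sub># T - sm a (g f') \<in> lat m m" using that by simp
        show "image_mset (res m) T = replicate_mset (nat a) f'" using image_mset_const_on[of T "res m" f'] r that(2) by simp
      qed
      have aa: "a1 \<ge> 0" "a2 \<ge> 0" "a3 \<ge> 0" "a4 \<ge> 0" using a a4 by auto
      have "(\<Sum>\<^sub># T1 - sm a1 (g f1)) + (\<Sum>\<^sub># T2 - sm a2 (g f2)) + (\<Sum>\<^sub># T3 - sm a3 (g f3)) + (\<Sum>\<^sub># T4 - sm a4 (g f4))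
        + (sm a1 (g f1 - g f4) + sm a2 (g f2 - g f4) + sm a3 (g f3 - g f4)) + sm (int m) (g f4) \<in> lat m m"
        by (rule lat_add[OF lat_add[OF lat_add[OF lat_add[OF lat_add[OF near(1)[OF T1 ff(1) aa(1)]
          near(1)[OF T2 ff(2) aa(2)]] near(1)[OF T3 ff(3) aa(3)]] near(1)[OF T4 f4(1) aa(4)]] z] sm_in_lat[OF dvd_refl]])
      then have "\<Sum>\<^sub># (T1 + T2 + T3 + T4) \<in> lat m m"
        by (rule lat_eqI) (simp add: a4_def sm_simps algebra_simps)
      moreover have "size (T1 + T2 + T3 + T4) = m"
        using T1(2) T2(2) T3(2) T4(2) aa by (simp add: a4_def flip: nat_add_distrib)
      ultimately have "?P (T1 + T2 + T3 + T4)" by (simp add: zs_len_def)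
      moreover have "count (image_mset (res m) (T1 + T2 + T3 + T4)) f' < m" for f'
        using near(2)[OF T1 ff(1) aa(1)] near(2)[OF T2 ff(2) aa(2)] near(2)[OF T3 ff(3) aa(3)]
          near(2)[OF T4 f4(1) aa(4)] a a4 f ne4 m by auto
      ultimately have "packing ?P (Suc (2 * n - 2)) S" using TS packing_of_sparse_block by blast
      then show False using np by blast
    qed
    obtain p1 p2 p3 x where p: "{#p1, p2, p3#} = {#g f1 - g f4, g f2 - g f4, g f3 - g f4#}" "x \<in> {1..int m - 1}"
      "coprime x (int m)" "sm x p1 - p2 + p3 \<in> lat m m"
      using m sf3 by (rule shortfree3_structure)
    have sfp: "shortfree3 m p1 p2 p3" by (rule shortfree3_mset[OF p(1) sf3])
    have setF: "{res m (p1 + g f4), res m (p2 + g f4), res m (p3 + g f4)} = F3"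
    proof -
      have "image_mset (\<lambda>y. res m (y + g f4)) {#p1, p2, p3#} = {#f1, f2, f3#}" unfolding p(1) using g f F3F by simp
      from arg_cong[OF this, of set_mset] show ?thesis using f by auto
    qed
    define h1 h2 h3 where h: "h1 = res m (p1 + g f4)" "h2 = res m (p2 + g f4)" "h3 = res m (p3 + g f4)"
    have hF: "F3 = {h1, h2, h3}" using setF h by simp
    have dist: "h1 \<noteq> h2" "h1 \<noteq> h3" "h2 \<noteq> h3"
      using \<open>card F3 = 3\<close> unfolding hF by (auto simp: card_insert_if split: if_splits)
    have gp: "g h1 = p1 + g f4" "g h2 = p2 + g f4" "g h3 = p3 + g f4"
    proof -
      have gres: "g (res m (y + g f4)) = y + g f4" if "y \<in># {#p1, p2, p3#}" for y
      proof -
        have "res m (g f1) = f1" "res m (g f2) = f2" "res m (g f3) = f3" using g f F3F by blast+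
        then show ?thesis using that unfolding p(1) by auto
      qed
      show "g h1 = p1 + g f4" "g h2 = p2 + g f4" "g h3 = p3 + g f4" unfolding h by (rule gres; simp)+
    qed
    have hh: "h1 \<in> F" "h2 \<in> F" "h3 \<in> F" using hF F3F by auto
    have h4: "h1 \<noteq> f4" "h2 \<noteq> f4" "h3 \<noteq> f4" using hF f4n by auto
    define q1 q2 q3 :: nat where "q1 = (if h1 \<in> J v then 0 else 1)" and "q2 = (if h2 \<in> J v then 0 else 1)"
      and "q3 = (if h3 \<in> J v then 0 else 1)"
    have Fsum: "s h1 + s h2 + s h3 + s f4 = 2 * n + 2"
    proof -
      have "(\<Sum>f\<in>F. s f) = s f4 + (s h1 + (s h2 + s h3))" unfolding F3F(2) hF using dist h4 by simp
      then show ?thesis using size_blocks(2) n by simp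
    qed
    have "fa \<in> {h1, h2, h3}" using fa JF F3F(2) hF by auto
    then have flags: "(q1 = 0 \<and> q2 = 1 \<and> q3 = 1 \<and> s h1 + s f4 = n + 1 \<and> s h2 + s h3 = n + 1) \<or>
      (q1 = 1 \<and> q2 = 0 \<and> q3 = 1 \<and> s h2 + s f4 = n + 1 \<and> s h1 + s h3 = n + 1) \<or>
      (q1 = 1 \<and> q2 = 1 \<and> q3 = 0 \<and> s h3 + s f4 = n + 1 \<and> s h1 + s h2 = n + 1)"
      using dist h4 sumJv Fsum unfolding q1_def q2_def q3_def fa(1) by auto
    have p_eq: "p1 = g h1 - g f4" "p2 = g h2 - g f4" "p3 = g h3 - g f4" using gp by auto
    have cfg: "config_D m n S p1 p2 p3 (g f4) (?A h1) (?A h2) (?A h3) (?A f4) (s h1) (s h2) (s h3) (s f4) q1 q2 q3 x t"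
      unfolding config_D_def
    proof (intro conjI)
      show "S = ?A h1 + ?A h2 + ?A h3 + ?A f4"
        using partition_fibres dist h4 unfolding F3F(2) hF by (simp add: add_ac)
      show "near m (m * n) (p1 + g f4) (s h1 * m - 1) (?A h1)" "near m (m * n) (p2 + g f4) (s h2 * m - 1) (?A h2)"
        "near m (m * n) (p3 + g f4) (s h3 * m - 1) (?A h3)" "near m (m * n) (g f4) (s f4 * m - 1) (?A f4)"
        unfolding gp[symmetric] using nearA hh f4(1) all2 by blast+
      show "sm (int m) p1 - sm (int q1) (0, int m * t) \<in> ?N" using Q[OF hh(1)] unfolding p_eq(1) q1_def H_def .
      show "sm (int m) p2 - sm (int q2) (0, int m * t) \<in> ?N" using Q[OF hh(2)] unfolding p_eq(2) q2_def H_def .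
      show "sm (int m) p3 - sm (int q3) (0, int m * t) \<in> ?N" using Q[OF hh(3)] unfolding p_eq(3) q3_def H_def .
    qed (use all2 hh f4(1) p sfp ct flags in auto)
    have "form_2a m n S"
    proof (cases "q3 = 1")
      case True
      then show ?thesis using config_D_form_ordered[OF m n2 cfg no] by blast
    next
      case False
      then have "q2 = 1" using flags by auto
      then show ?thesis using config_D_form_ordered[OF m n2 config_D_swap[OF cfg] no] by blast
    qed
    then show ?thesis ..
  qed
qed

section \<open>Transfer to the group\<close>

text \<open>A presentation of \<open>G\<close> as Z^2 / N. The instance with n = 1 presents C_m^2
  and carries Properties C and D over to \<open>lattice_C\<close> and
  \<open>lattice_D\<close>.\<close>

locale presented = comm_group G for G :: "('a, 'b) monoid_scheme" (structure) +
  fixes pi :: "int \<times> int \<Rightarrow> 'a" and m n :: nat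
  assumes m: "m \<ge> 2" and n: "n \<ge> 1"
    and pi_closed [simp]: "pi v \<in> carrier G"
    and pi_add: "pi (u + v) = pi u \<otimes> pi v"
    and pi_kernel: "pi v = \<one> \<longleftrightarrow> v \<in> lat m (m * n)"
    and pi_surj: "g \<in> carrier G \<Longrightarrow> \<exists>v. pi v = g"
begin

abbreviation N where "N \<equiv> lat m (m * n)"

lemma pi_0 [simp]: "pi 0 = \<one>"
  using pi_kernel by simp

lemma pi_minus: "pi (- v) = inv (pi v)"
proof -
  have "pi (- v) \<otimes> pi v = \<one>" by (simp flip: pi_add)
  then show ?thesis by (intro inv_equality[symmetric]) auto
qed

lemma pi_eq_iff: "pi u = pi v \<longleftrightarrow> u - v \<in> N"
proof -
  have "pi (u - v) = pi u \<otimes> inv (pi v)" using pi_add[of u "- v"] by (simp add: pi_minus)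
  then have "u - v \<in> N \<longleftrightarrow> pi u \<otimes> inv (pi v) = \<one>" by (simp flip: pi_kernel)
  also have "\<dots> \<longleftrightarrow> pi u = pi v" using inv_solve_right[of \<one> "pi u" "pi v"] by auto
  finally show ?thesis by simp
qed

lemma pi_sm_nat: "pi (sm (int k) v) = pi v [^] k"
  by (induction k) (simp_all add: sm_simps pi_add m_comm)

lemma pi_sm: "pi (sm i v) = pi v [^] i"
proof (cases i rule: int_cases2)
  case (nonneg k)
  then show ?thesis by (simp add: pi_sm_nat int_pow_int)
next
  case (nonpos k)
  then show ?thesis by (simp add: sm_simps pi_minus pi_sm_nat int_pow_neg_int)
qed

lemma seq_sum_superset:
  assumes "set_mset S \<subseteq> A" "finite A" "A \<subseteq> carrier G"
  shows "seq_sum G S = finprod G (\<lambda>g. g [^] count S g) A"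
  unfolding seq_sum_def
proof (rule finprod_mono_neutral_cong_left)
  show "\<And>i. i \<in> A - set_mset S \<Longrightarrow> i [^] count S i = \<one>"
    by (simp add: not_in_iff)
qed (use assms in auto)

lemma seq_sum_add_mset:
  assumes "set_mset S \<subseteq> carrier G" "g \<in> carrier G"
  shows "seq_sum G (add_mset g S) = g \<otimes> seq_sum G S"
proof -
  let ?A = "insert g (set_mset S)"
  have A: "finite ?A" "?A \<subseteq> carrier G" using assms by auto
  have "seq_sum G (add_mset g S) = finprod G (\<lambda>x. x [^] count (add_mset g S) x) ?A"
    by (rule seq_sum_superset) (use A in auto)
  also have "\<dots> = finprod G (\<lambda>x. (if g = x then x else \<one>) \<otimes> x [^] count S x) ?A"
    by (rule finprod_cong) (use A in \<open>auto simp: m_comm simp_implies_def\<close>)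
  also have "\<dots> = finprod G (\<lambda>x. if g = x then x else \<one>) ?A \<otimes> finprod G (\<lambda>x. x [^] count S x) ?A"
    by (rule finprod_multf) (use A in auto)
  also have "finprod G (\<lambda>x. if g = x then x else \<one>) ?A = g"
    by (rule finprod_singleton) (use A in auto)
  also have "finprod G (\<lambda>x. x [^] count S x) ?A = seq_sum G S"
    by (rule seq_sum_superset[symmetric]) (use A in auto)
  finally show ?thesis .
qed

lemma seq_sum_image: "seq_sum G (image_mset pi X) = pi (\<Sum>\<^sub># X)"
proof (induction X)
  case empty
  then show ?case by (simp add: seq_sum_def)
next
  case (add x X)
  have "seq_sum G (add_mset (pi x) (image_mset pi X)) = pi x \<otimes> seq_sum G (image_mset pi X)"
    by (rule seq_sum_add_mset) auto
  then show ?case using add by (simp add: pi_add)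
qed

lemma zero_sum_image: "zero_sum G (image_mset pi X) \<longleftrightarrow> \<Sum>\<^sub># X \<in> N"
  by (simp add: zero_sum_def seq_sum_image pi_kernel)

lemma seq_over_lift:
  assumes "seq_over G S"
  obtains X where "image_mset pi X = S"
proof -
  have "\<forall>g\<in>#S. \<exists>v. pi v = g" using assms pi_surj by (auto simp: seq_over_def)
  then obtain v where "\<forall>g\<in>#S. pi (v g) = g" by metis
  then have "image_mset pi (image_mset v S) = S"
    by (simp add: multiset.map_comp comp_def) (metis (mono_tags, lifting) image_mset_cong multiset.map_ident)
  then show thesis by (rule that)
qed

lemma seq_over_image [simp]: "seq_over G (image_mset pi X)"
  by (auto simp: seq_over_def)

lemma mn_pos: "m * n \<ge> 2"
  using m n by (metis dual_order.trans mult.right_neutral mult_le_mono2)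

lemma group_exp_eq: "group_exp G = m * n"
  unfolding group_exp_def
proof (rule Least_equality)
  have "x [^] (m * n) = \<one>" if x: "x \<in> carrier G" for x
  proof -
    obtain v where v: "pi v = x" using pi_surj[OF x] by blast
    have "pi (sm (int (m * n)) v) = \<one>" unfolding pi_kernel by (rule lat_multiple_exp)
    then show ?thesis unfolding pi_sm_nat v .
  qed
  moreover have "0 < m * n" using mn_pos by linarith
  ultimately show "0 < m * n \<and> (\<forall>x\<in>carrier G. x [^] (m * n) = \<one>)" by blast
next
  fix k :: nat assume k: "0 < k \<and> (\<forall>x\<in>carrier G. x [^] k = \<one>)"
  then have "pi (sm (int k) (0, 1)) = \<one>" by (simp add: pi_sm_nat)
  then have "int (m * n) dvd int k" by (simp add: pi_kernel lat_def sm_def)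
  then have "m * n dvd k" by (simp only: int_dvd_int_iff)
  then show "m * n \<le> k" using k by (intro dvd_imp_le) auto
qed

lemma has_short_image:
  "has_short_zero_sum G (image_mset pi X) \<longleftrightarrow> (\<exists>T. T \<subseteq># X \<and> zs_short N (m * n) T)"
proof
  assume "has_short_zero_sum G (image_mset pi X)"
  then obtain T where T: "T \<subseteq># image_mset pi X" "size T \<in> {1..m * n}" "zero_sum G T"
    unfolding has_short_zero_sum_def group_exp_eq by blast
  obtain T' where "T' \<subseteq># X" "image_mset pi T' = T" using T(1) by (rule submset_image_msetE)
  then show "\<exists>T. T \<subseteq># X \<and> zs_short N (m * n) T"
    using T(2,3) zero_sum_image by (intro exI[of _ T']) (auto simp: zs_short_def)
next
  assume "\<exists>T. T \<subseteq># X \<and> zs_short N (m * n) T"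
  then obtain T where "T \<subseteq># X" "size T \<in> {1..m * n}" "\<Sum>\<^sub># T \<in> N" by (auto simp: zs_short_def)
  then show "has_short_zero_sum G (image_mset pi X)"
    unfolding has_short_zero_sum_def group_exp_eq
    by (intro exI[of _ "image_mset pi T"]) (simp add: zero_sum_image image_mset_subseteq_mono)
qed

lemma has_exp_image:
  "has_exp_zero_sum G (image_mset pi X) \<longleftrightarrow> (\<exists>T. T \<subseteq># X \<and> zs_len N (m * n) T)"
proof
  assume "has_exp_zero_sum G (image_mset pi X)"
  then obtain T where T: "T \<subseteq># image_mset pi X" "size T = m * n" "zero_sum G T"
    unfolding has_exp_zero_sum_def group_exp_eq by blast
  obtain T' where "T' \<subseteq># X" "image_mset pi T' = T" using T(1) by (rule submset_image_msetE)
  then show "\<exists>T. T \<subseteq># X \<and> zs_len N (m * n) T"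
    using T(2,3) zero_sum_image by (intro exI[of _ T']) (auto simp: zs_len_def)
next
  assume "\<exists>T. T \<subseteq># X \<and> zs_len N (m * n) T"
  then obtain T where "T \<subseteq># X" "size T = m * n" "\<Sum>\<^sub># T \<in> N" by (auto simp: zs_len_def)
  then show "has_exp_zero_sum G (image_mset pi X)"
    unfolding has_exp_zero_sum_def group_exp_eq
    by (intro exI[of _ "image_mset pi T"]) (simp add: zero_sum_image image_mset_subseteq_mono)
qed

lemma sm_mem_reduce: "sm i u + sm j v \<in> N \<longleftrightarrow> pi u [^] i \<otimes> pi v [^] j = \<one>"
  by (simp add: pi_add pi_sm flip: pi_kernel)

lemma card_carrier: "card (carrier G) = m * (m * n)" and finite_carrier: "finite (carrier G)"
proof -
  have inj: "inj_on pi ({0..<int m} \<times> {0..<int (m * n)})"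
  proof (rule inj_onI, clarify)
    fix a b a' b' assume r: "a \<in> {0..<int m}" "b \<in> {0..<int (m * n)}" "a' \<in> {0..<int m}" "b' \<in> {0..<int (m * n)}"
      and "pi (a, b) = pi (a', b')"
    then have "int m dvd a - a'" "int (m * n) dvd b - b'" by (simp_all add: pi_eq_iff lat_def)
    then have "a mod int m = a' mod int m" "b mod int (m * n) = b' mod int (m * n)"
      by (simp_all only: mod_eq_dvd_iff)
    then show "a = a' \<and> b = b'" using r by (simp del: of_nat_mult)
  qed
  have im: "pi ` ({0..<int m} \<times> {0..<int (m * n)}) = carrier G"
  proof (intro subset_antisym subsetI)
    fix g assume "g \<in> carrier G"
    then obtain v where v: "pi v = g" using pi_surj by blast
    let ?w = "(fst v mod int m, snd v mod int (m * n))"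
    have "pi ?w = pi v" by (simp add: pi_eq_iff lat_def mod_eq_dvd_iff[symmetric])
    moreover have "0 < int (m * n)" using mn_pos by linarith
    then have "?w \<in> {0..<int m} \<times> {0..<int (m * n)}" using m by (simp del: of_nat_mult)
    ultimately show "g \<in> pi ` ({0..<int m} \<times> {0..<int (m * n)})" using v by (metis imageI)
  qed auto
  have "card (carrier G) = card ({0..<int m} \<times> {0..<int (m * n)})"
    unfolding im[symmetric] by (rule card_image[OF inj])
  then show "card (carrier G) = m * (m * n)" by (simp add: card_cartesian_product nat_mult_distrib)
  show "finite (carrier G)" unfolding im[symmetric] by simp
qed

lemma generate_pair_range:
  assumes "generating_set G {pi u, pi v}"
  obtains i j where "w - (sm i u + sm j v) \<in> N"
proof -
  have "\<exists>i j. g = pi (sm i u + sm j v)" if "g \<in> generate G {pi u, pi v}" for g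
    using that
  proof induction
    case one
    show ?case by (rule exI[of _ 0], rule exI[of _ 0]) (simp add: sm_simps)
  next
    case (incl h)
    have "pi u = pi (sm 1 u + sm 0 v)" "pi v = pi (sm 0 u + sm 1 v)" by (simp_all add: sm_simps)
    then show ?case using incl by blast
  next
    case (inv h)
    have "inv (pi u) = pi (sm (- 1) u + sm 0 v)" "inv (pi v) = pi (sm 0 u + sm (- 1) v)"
      by (simp_all add: sm_simps pi_minus)
    then show ?case using inv by blast
  next
    case (eng h1 h2)
    then obtain i j i' j' where "h1 = pi (sm i u + sm j v)" "h2 = pi (sm i' u + sm j' v)" by blast
    then have "h1 \<otimes> h2 = pi (sm (i + i') u + sm (j + j') v)" by (simp add: sm_simps add_ac flip: pi_add)
    then show ?case by blast
  qed
  moreover have "pi w \<in> generate G {pi u, pi v}" using assms by (simp add: generating_set_def)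
  ultimately obtain i j where "pi w = pi (sm i u + sm j v)" by blast
  then show thesis using that pi_eq_iff by blast
qed

lemma ord_eq_iff: "ord (pi v) = m * n \<longleftrightarrow> (\<forall>j. sm j v \<in> N \<longrightarrow> int (m * n) dvd j)"
proof -
  have 1: "sm j v \<in> N \<longleftrightarrow> int (ord (pi v)) dvd j" for j
    using int_pow_eq_id[of "pi v" j] by (simp flip: pi_kernel pi_sm)
  have "int (ord (pi v)) dvd int (m * n)" unfolding 1[symmetric] by (rule lat_multiple_exp)
  then have "ord (pi v) dvd m * n" by (simp only: int_dvd_int_iff)
  then show ?thesis unfolding 1 by (metis dvd_antisym dvd_refl int_dvd_int_iff)
qed

text \<open>Let a0 be the order of u modulo the subgroup generated by v. Every element is a u + b v
  for unique a < a0 and b < m n, so a0 m n is the group order m^2 n, and a0 = m.\<close>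

lemma rank2_pair_of_generating:
  assumes gen: "generating_set G {pi u, pi v}" and ord: "ord (pi v) = m * n"
  shows "rank2_pair m (m * n) u v"
proof -
  have ov: "\<And>j. sm j v \<in> N \<Longrightarrow> int (m * n) dvd j" using ord ord_eq_iff by blast
  define R where "R i \<longleftrightarrow> (\<exists>j. sm i u + sm j v \<in> N)" for i
  have Rsub: "R (a * i + b * i')" if Ri: "R i" "R i'" for a b i i'
  proof -
    obtain j j' where "sm i u + sm j v \<in> N" "sm i' u + sm j' v \<in> N" using Ri R_def by blast
    then have "sm a (sm i u + sm j v) + sm b (sm i' u + sm j' v) \<in> N" by (rule lat_add[OF lat_sm lat_sm])
    then have "sm (a * i + b * i') u + sm (a * j + b * j') v \<in> N"
      by (rule lat_eqI) (simp add: sm_simps algebra_simps)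
    then show ?thesis unfolding R_def by blast
  qed
  define a0 where "a0 = (LEAST a. a > 0 \<and> R (int a))"
  have R_mn: "R (int (m * n))"
    unfolding R_def by (rule exI[of _ 0]) (use lat_multiple_exp[of m n u] in \<open>simp add: sm_simps\<close>)
  have a0: "a0 > 0" "R (int a0)"
  proof -
    have "m * n > 0 \<and> R (int (m * n))" using mn_pos R_mn by (intro conjI) linarith+
    then have "a0 > 0 \<and> R (int a0)"
      unfolding a0_def by (rule LeastI[of "\<lambda>a. a > 0 \<and> R (int a)"])
    note this[THEN conjunct1] this[THEN conjunct2]
    then show "a0 > 0" "R (int a0)" .
  qed
  have a0_dvd: "int a0 dvd i" if Ri: "R i" for i
  proof -
    have "R (1 * i + (- (i div int a0)) * int a0)" by (rule Rsub[OF Ri a0(2)])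
    then have Rm: "R (i mod int a0)" by (simp add: minus_div_mult_eq_mod[symmetric])
    have "i mod int a0 = 0"
    proof (rule ccontr)
      assume ne: "i mod int a0 \<noteq> 0"
      define r where "r = nat (i mod int a0)"
      have r: "int r = i mod int a0" using a0(1) by (simp add: r_def)
      have "r > 0" using r ne by (cases r) auto
      moreover have "int r < int a0" unfolding r using a0(1) by simp
      moreover have "R (int r)" unfolding r by (rule Rm)
      ultimately show False using not_less_Least[of r "\<lambda>a. a > 0 \<and> R (int a)"] unfolding a0_def by auto
    qed
    then show ?thesis by (simp add: dvd_eq_mod_eq_0)
  qed
  let ?I = "{0..<int a0} \<times> {0..<int (m * n)}"
  let ?f = "\<lambda>(a, b). pi (sm a u + sm b v)"
  have inj: "inj_on ?f ?I"
  proof (rule inj_onI, clarify)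
    fix a b a' b' assume r: "a \<in> {0..<int a0}" "b \<in> {0..<int (m * n)}" "a' \<in> {0..<int a0}" "b' \<in> {0..<int (m * n)}"
      and "pi (sm a u + sm b v) = pi (sm a' u + sm b' v)"
    then have d: "sm (a - a') u + sm (b - b') v \<in> N" by (simp add: pi_eq_iff sm_simps algebra_simps)
    then have "int a0 dvd a - a'" using a0_dvd R_def by blast
    then have "a mod int a0 = a' mod int a0" by (simp add: mod_eq_dvd_iff)
    then have aa: "a = a'" using r by simp
    then have "int (m * n) dvd b - b'" using d ov by (simp add: sm_simps(7))
    then have "b mod int (m * n) = b' mod int (m * n)" by (simp only: mod_eq_dvd_iff)
    then show "a = a' \<and> b = b'" using r aa by (simp del: of_nat_mult)
  qed
  have im: "?f ` ?I = carrier G"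
  proof (intro subset_antisym subsetI)
    fix g assume "g \<in> carrier G"
    then obtain w where w: "pi w = g" using pi_surj by blast
    obtain i j where ij: "w - (sm i u + sm j v) \<in> N" using gen by (rule generate_pair_range)
    obtain j0 where j0: "sm (int a0) u + sm j0 v \<in> N" using a0(2) unfolding R_def by blast
    define a where "a = i mod int a0"
    define b1 where "b1 = j - (i div int a0) * j0"
    define b where "b = b1 mod int (m * n)"
    have b1: "b1 = b + (b1 div int (m * n)) * int (m * n)" unfolding b_def by (rule mod_div_mult_eq[symmetric])
    have i: "i = a + (i div int a0) * int a0" by (simp add: a_def)
    have "(w - (sm i u + sm j v)) + sm (i div int a0) (sm (int a0) u + sm j0 v)
        + sm (b1 div int (m * n)) (sm (int (m * n)) v) \<in> N"
      by (rule lat_add[OF lat_add[OF ij lat_sm[OF j0]] lat_sm[OF lat_multiple_exp]])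
    moreover have "(w - (sm i u + sm j v)) + sm (i div int a0) (sm (int a0) u + sm j0 v)
        + sm (b1 div int (m * n)) (sm (int (m * n)) v) = w - (sm a u + sm b v)"
    proof -
      have "w - (sm i u + sm j v) + sm (i div int a0) (sm (int a0) u + sm j0 v)
        + sm (b1 div int (m * n)) (sm (int (m * n)) v) =
        w - (sm (i - (i div int a0) * int a0) u + sm (b1 - (b1 div int (m * n)) * int (m * n)) v)"
        by (simp add: b1_def sm_simps algebra_simps del: of_nat_mult)
      also have "i - (i div int a0) * int a0 = a" using i by linarith
      also have "b1 - (b1 div int (m * n)) * int (m * n) = b" using b1 by linarith
      finally show ?thesis .
    qed
    ultimately have "pi w = pi (sm a u + sm b v)" by (simp only: pi_eq_iff)
    moreover have "0 < int (m * n)" using mn_pos by linarith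
    then have "a \<in> {0..<int a0}" "b \<in> {0..<int (m * n)}"
      using a0(1) by (simp_all add: a_def b_def del: of_nat_mult)
    ultimately show "g \<in> ?f ` ?I" using w by (intro image_eqI[of _ _ "(a, b)"]) auto
  qed auto
  have "card (carrier G) = card ?I" unfolding im[symmetric] by (rule card_image[OF inj])
  also have "\<dots> = a0 * (m * n)" by (simp add: card_cartesian_product nat_mult_distrib)
  finally have "m * (m * n) = a0 * (m * n)" unfolding card_carrier .
  then have "a0 = m" using mn_pos by (metis mult_right_cancel not_numeral_le_zero)
  then have "int m dvd i" if "sm i u + sm j v \<in> N" for i j using a0_dvd[of i] that R_def by blast
  then show ?thesis unfolding rank2_pair_def using ov by blast
qed

text \<open>The combinations a u + b v with a < m and b < m n are distinct, and the group has just
  that many elements.\<close>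

lemma generating_of_rank2_pair:
  assumes "rank2_pair m (m * n) u v"
  shows "generating_set G {pi u, pi v}" "ord (pi v) = m * n" "pi u \<noteq> pi v" "pi u \<noteq> \<one>" "pi v \<noteq> \<one>"
proof -
  have R: "\<And>i j. sm i u + sm j v \<in> N \<Longrightarrow> int m dvd i" "\<And>j. sm j v \<in> N \<Longrightarrow> int (m * n) dvd j"
    using assms unfolding rank2_pair_def by blast+
  show "ord (pi v) = m * n" using R(2) ord_eq_iff by blast
  let ?I = "{0..<int m} \<times> {0..<int (m * n)}"
  let ?f = "\<lambda>(a, b). pi (sm a u + sm b v)"
  have inj: "inj_on ?f ?I"
  proof (rule inj_onI, clarify)
    fix a b a' b' assume r: "a \<in> {0..<int m}" "b \<in> {0..<int (m * n)}" "a' \<in> {0..<int m}" "b' \<in> {0..<int (m * n)}"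
      and "pi (sm a u + sm b v) = pi (sm a' u + sm b' v)"
    then have d: "sm (a - a') u + sm (b - b') v \<in> N" by (simp add: pi_eq_iff sm_simps algebra_simps)
    then have "int m dvd a - a'" using R(1) by blast
    then have "a mod int m = a' mod int m" by (simp add: mod_eq_dvd_iff)
    then have aa: "a = a'" using r by simp
    then have "int (m * n) dvd b - b'" using d R(2) by (simp add: sm_simps(7))
    then have "b mod int (m * n) = b' mod int (m * n)" by (simp only: mod_eq_dvd_iff)
    then show "a = a' \<and> b = b'" using r aa by (simp del: of_nat_mult)
  qed
  have sub: "?f ` ?I \<subseteq> carrier G" by auto
  have "card (?f ` ?I) = card ?I" using inj by (rule card_image)
  also have "\<dots> = m * (m * n)" by (simp add: card_cartesian_product nat_mult_distrib)
  finally have im: "?f ` ?I = carrier G" using sub card_carrier finite_carrier by (intro card_subset_eq) auto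
  have sg: "subgroup (generate G {pi u, pi v}) G" by (rule generate_is_subgroup) auto
  have inc: "pi u \<in> generate G {pi u, pi v}" "pi v \<in> generate G {pi u, pi v}" by (auto intro: generate.incl)
  have pw: "pi (sm i w) \<in> generate G {pi u, pi v}" if "pi w \<in> generate G {pi u, pi v}" for i w
    unfolding pi_sm using subgroup_int_pow_closed[OF sg that] .
  have "carrier G \<subseteq> generate G {pi u, pi v}"
    unfolding im[symmetric] using pw[OF inc(1)] pw[OF inc(2)] by (auto simp: pi_add intro: generate.eng)
  moreover have "generate G {pi u, pi v} \<subseteq> carrier G" using sg by (rule subgroup.subset)
  ultimately have "generate G {pi u, pi v} = carrier G" by (rule subset_antisym[rotated])
  then show "generating_set G {pi u, pi v}" by (simp add: generating_set_def)
  have n1: "\<not> int m dvd 1" using m by (simp add: zdvd1_eq)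
  have n1': "\<not> int (m * n) dvd 1"
  proof
    assume "int (m * n) dvd 1"
    then have "int (m * n) \<le> 1" by (rule zdvd_imp_le) simp
    then show False using mn_pos by linarith
  qed
  show "pi u \<noteq> pi v"
  proof
    assume "pi u = pi v"
    then have "sm 1 u + sm (- 1) v \<in> N" by (simp add: pi_eq_iff sm_simps)
    then show False using R(1) n1 by blast
  qed
  show "pi u \<noteq> \<one>"
  proof
    assume "pi u = \<one>"
    then have "sm 1 u + sm 0 v \<in> N" by (simp add: pi_kernel sm_simps)
    then show False using R(1) n1 by blast
  qed
  show "pi v \<noteq> \<one>"
  proof
    assume "pi v = \<one>"
    then have "sm 1 v \<in> N" by (simp add: pi_kernel sm_simps)
    then show False using R(2) n1' by blast
  qed
qed

lemma finprod_pair: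
  assumes "x \<in> carrier G" "y \<in> carrier G" "x \<noteq> y"
  shows "finprod G (\<lambda>e. e [^] (k e :: int)) {x, y} = x [^] k x \<otimes> y [^] k y"
  using assms by simp

lemma basis_rank2:
  assumes basis: "basis_of G {pi u, pi v}" and ord: "ord (pi v) = m * n"
    and ij: "sm i u + sm j v \<in> N"
  shows "int m dvd i \<and> int (m * n) dvd j"
proof -
  have r2: "rank2_pair m (m * n) u v"
    using rank2_pair_of_generating basis ord by (simp add: basis_of_def)
  \<comment> \<open>Coefficients in \<open>independent_in\<close> are indexed by elements, so two
    separate exponents require two distinct elements.\<close>
  note ne = generating_of_rank2_pair(3)[OF r2]
  have "pi u [^] i \<otimes> pi v [^] j = \<one>" using ij by (simp add: sm_mem_reduce)
  then have one: "finprod G (\<lambda>e. e [^] (if e = pi u then i else j)) {pi u, pi v} = \<one>"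
    using finprod_pair[OF _ _ ne, of "\<lambda>e. if e = pi u then i else j"] ne by simp
  have ind: "\<forall>k :: 'a \<Rightarrow> int. finprod G (\<lambda>e. e [^] k e) {pi u, pi v} = \<one> \<longrightarrow>
      (\<forall>e\<in>{pi u, pi v}. e [^] k e = \<one>)"
    using basis unfolding basis_of_def independent_in_def by (elim conjE)
  have "\<forall>e\<in>{pi u, pi v}. e [^] (if e = pi u then i else j) = \<one>"
    by (rule mp[OF spec[OF ind, of "\<lambda>e. if e = pi u then i else j"] one])
  then have "pi v [^] j = \<one>" using ne by auto
  then have "sm j v \<in> N" by (simp flip: pi_kernel pi_sm)
  then show ?thesis using r2 ij unfolding rank2_pair_def by blast
qed

text \<open>In any relation the exponent of u is a multiple of m, so its term vanishes, and with it
  the other.\<close>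

lemma basis_of_rank2_pair:
  assumes r2: "rank2_pair m (m * n) u v" and mu: "sm (int m) u \<in> N"
  shows "basis_of G {pi u, pi v}"
proof -
  note g = generating_of_rank2_pair[OF r2]
  have "\<forall>e\<in>{pi u, pi v}. e [^] k e = \<one>"
    if k: "finprod G (\<lambda>e. e [^] (k e :: int)) {pi u, pi v} = \<one>" for k
  proof -
    have 1: "pi u [^] k (pi u) \<otimes> pi v [^] k (pi v) = \<one>" using k finprod_pair[OF _ _ g(3)] by simp
    then have "sm (k (pi u)) u + sm (k (pi v)) v \<in> N" by (simp add: sm_mem_reduce)
    then have "int m dvd k (pi u)" using r2 unfolding rank2_pair_def by blast
    then obtain c where c: "k (pi u) = int m * c" by (rule dvdE)
    have "sm c (sm (int m) u) \<in> N" by (rule lat_sm[OF mu])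
    then have "sm (k (pi u)) u \<in> N" by (simp add: c sm_simps mult.commute)
    then have "pi u [^] k (pi u) = \<one>" by (simp flip: pi_kernel pi_sm)
    then show ?thesis using 1 by auto
  qed
  then show ?thesis using g unfolding basis_of_def independent_in_def by auto
qed

end

section \<open>The listed sequences contain no forbidden zero-sum\<close>

lemma sub_replicate:
  assumes "T \<subseteq># replicate_mset k x"
  shows "T = replicate_mset (size T) x" "size T \<le> k"
proof -
  have "y = x" if "y \<in># T" for y using mset_subset_eqD[OF assms that] by (metis in_replicate_mset)
  then show "T = replicate_mset (size T) x" using image_mset_const_on[of T "\<lambda>y. y" x] by simp
  show "size T \<le> k" using size_mset_mono[OF assms] by simp
qed

lemma sub_replicate3:
  assumes "T \<subseteq># replicate_mset k1 x1 + replicate_mset k2 x2 + replicate_mset k3 x3"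
  obtains a b c where "a \<le> k1" "b \<le> k2" "c \<le> k3" "size T = a + b + c"
    "\<Sum>\<^sub># T = sm (int a) x1 + sm (int b) x2 + sm (int c) x3"
proof -
  obtain T12 T3 where T: "T12 \<subseteq># replicate_mset k1 x1 + replicate_mset k2 x2" "T3 \<subseteq># replicate_mset k3 x3" "T = T12 + T3"
    using assms by (rule submset_plusE)
  obtain T1 T2 where T': "T1 \<subseteq># replicate_mset k1 x1" "T2 \<subseteq># replicate_mset k2 x2" "T12 = T1 + T2"
    using T(1) by (rule submset_plusE)
  have s: "\<Sum>\<^sub># U = sm (int (size U)) x" if "U \<subseteq># replicate_mset k x" for U k x
    using sub_replicate(1)[OF that] sum_mset_replicate by metis
  show thesis
    by (rule that[of "size T1" "size T2" "size T3"])
      (use s[OF T'(1)] s[OF T'(2)] s[OF T(2)] sub_replicate(2)[OF T'(1)] sub_replicate(2)[OF T'(2)]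
        sub_replicate(2)[OF T(2)] T(3) T'(3) in simp_all)
qed

text \<open>With a also z is a multiple of m. Hence z \<le> (t - 1) m and a \<le> (n - t) m, which
  add up to less than m n.\<close>

lemma two_fibres_nat:
  fixes m n t z a :: nat
  assumes "m > 0" "z + a = m * n" "m dvd a" "z < t * m" "a < (n + 1 - t) * m" "t \<in> {1..n}"
  shows False
proof -
  obtain a' where a': "a = m * a'" using assms(3) by (rule dvdE)
  have z': "z = m * (n - a')" using assms(2) a' by (simp add: diff_mult_distrib2)
  have "n - a' < t" using assms(1,4) z' by (simp add: mult.commute)
  moreover have "a' < n + 1 - t" using assms(1,5) a' by (simp add: mult.commute)
  ultimately show False using assms(6) by auto
qed

text \<open>Lifts of \<open>seq_1a\<close> and its companions to Z^2, where the absence of zero-sums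
  is arithmetic of multiplicities.\<close>

definition lat_1a where
  "lat_1a m n u v x s = replicate_mset (m - 1) u + replicate_mset (s * m - 1) v +
     replicate_mset ((n + 1 - s) * m - 1) (sm (- x) u + v)"

definition lat_1b where
  "lat_1b m n u v = replicate_mset (m - 1) u + replicate_mset (m * n - 1) v + replicate_mset (m - 1) (- u + v)"

definition lat_2a where
  "lat_2a m n u v x s t g = replicate_mset (t * m - 1) g + replicate_mset ((n + 1 - t) * m - 1) (u + g) +
     replicate_mset (s * m - 1) (v + g) + replicate_mset ((n + 1 - s) * m - 1) (sm (- x) u + v + g)"

definition lat_2b where
  "lat_2b m n u v g = replicate_mset (m * n - 1) g + replicate_mset (m - 1) (u + g) +
     replicate_mset (m * n - 1) (v + g) + replicate_mset (m - 1) (- u + v + g)"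

lemma mult_split: "s \<in> {1..n} \<Longrightarrow> s * m + (n + 1 - s) * m = m * n + m" "s \<in> {1..n} \<Longrightarrow> m \<le> s * m"
    "s \<in> {1..n} \<Longrightarrow> m \<le> (n + 1 - s) * m" for s n m :: nat
proof -
  assume s: "s \<in> {1..n}"
  have "s * m + (n + 1 - s) * m = (s + (n + 1 - s)) * m" by (simp only: add_mult_distrib)
  also have "s + (n + 1 - s) = n + 1" using s by auto
  finally show "s * m + (n + 1 - s) * m = m * n + m" by (simp add: mult.commute)
  show "m \<le> s * m" using s by auto
  have "1 * m \<le> (n + 1 - s) * m" using s by (intro mult_right_mono) auto
  then show "m \<le> (n + 1 - s) * m" by simp
qed

lemma size_lat_1a: "m \<ge> 2 \<Longrightarrow> s \<in> {1..n} \<Longrightarrow> size (lat_1a m n u v x s) = m * n + 2 * m - 3"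
  using mult_split[of s n m] by (simp add: lat_1a_def)

lemma size_lat_1b: "m \<ge> 2 \<Longrightarrow> n \<ge> 1 \<Longrightarrow> size (lat_1b m n u v) = m * n + 2 * m - 3"
  using mult_le_mono2[of 1 n m] by (simp add: lat_1b_def)

lemma size_lat_2a:
  "m \<ge> 2 \<Longrightarrow> s \<in> {1..n} \<Longrightarrow> t \<in> {1..n} \<Longrightarrow> size (lat_2a m n u v x s t g) = 2 * (m * n) + 2 * m - 4"
  unfolding lat_2a_def size_union size_replicate_mset
  using mult_split[of s n m] mult_split[of t n m] by linarith

lemma size_lat_2b: "m \<ge> 2 \<Longrightarrow> n \<ge> 1 \<Longrightarrow> size (lat_2b m n u v g) = 2 * (m * n) + 2 * m - 4"
  unfolding lat_2b_def size_union size_replicate_mset using mult_le_mono2[of 1 n m] by linarith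

lemma zero_or_full:
  assumes "int (m * n) dvd int b + int c" "b + c < 2 * (m * n)"
  shows "b + c = 0 \<or> b + c = m * n"
proof -
  have "int (m * n) dvd int (b + c)" using assms(1) by simp
  then have "m * n dvd b + c" by (simp only: int_dvd_int_iff)
  then obtain e where e: "b + c = (m * n) * e" by (rule dvdE)
  then have "(m * n) * e < (m * n) * 2" using assms(2) by simp
  then have "e < 2" by (metis mult_less_cancel1)
  then have "e = 0 \<or> e = 1" by auto
  then show ?thesis using e by auto
qed

lemma fibre_bound: "m > 0 \<Longrightarrow> s \<in> {1..n} \<Longrightarrow> b < s * m \<Longrightarrow> c < (n + 1 - s) * m \<Longrightarrow> b + c < 2 * (m * n)"
  for m n s b c :: nat
proof -
  assume a: "m > 0" "s \<in> {1..n}" "b < s * m" "c < (n + 1 - s) * m"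
  then have "b + c < m * n + m" using mult_split(1)[of s n m] by linarith
  moreover have "m * 1 \<le> m * n" using a by (intro mult_le_mono2) auto
  ultimately show ?thesis by linarith
qed

text \<open>The coefficient of v forces b + c to be 0 or m n. In the first case m divides a < m. In
  the second a = 0, so m divides x c and hence c, against \<open>two_fibres_nat\<close>.\<close>

lemma free_1a:
  assumes m: "m \<ge> 2" and R: "\<And>i j. sm i u + sm j v \<in> lat m (m * n) \<Longrightarrow> int m dvd i \<and> int (m * n) dvd j"
    and x: "coprime x (int m)" and s: "s \<in> {1..n}"
  shows "\<nexists>T. T \<subseteq># lat_1a m n u v x s \<and> zs_short (lat m (m * n)) (m * n) T"
proof
  assume "\<exists>T. T \<subseteq># lat_1a m n u v x s \<and> zs_short (lat m (m * n)) (m * n) T"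
  then obtain T where T: "T \<subseteq># lat_1a m n u v x s" "size T \<in> {1..m * n}" "\<Sum>\<^sub># T \<in> lat m (m * n)"
    by (auto simp: zs_short_def)
  obtain a b c where abc: "a \<le> m - 1" "b \<le> s * m - 1" "c \<le> (n + 1 - s) * m - 1" "size T = a + b + c"
    "\<Sum>\<^sub># T = sm (int a) u + sm (int b) v + sm (int c) (sm (- x) u + v)"
    using T(1) unfolding lat_1a_def by (rule sub_replicate3)
  have "sm (int a - x * int c) u + sm (int b + int c) v \<in> lat m (m * n)"
    using T(3) unfolding abc(5) by (rule lat_eqI) (simp add: sm_simps algebra_simps)
  then have d: "int m dvd int a - x * int c" "int (m * n) dvd int b + int c" using R by blast+
  have lt: "b < s * m" "c < (n + 1 - s) * m" using abc(2,3) mult_split[OF s, of m] m by linarith+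
  from zero_or_full[OF d(2) fibre_bound[OF _ s lt]] m consider "b + c = 0" | "b + c = m * n" by auto
  then show False
  proof cases
    case 1
    then have "m dvd a" using d(1) by simp
    then have "a = 0" using abc(1) m by (auto dest: dvd_imp_le)
    then show False using 1 abc(4) T(2) by simp
  next
    case 2
    then have "a = 0" using abc(4) T(2) by simp
    then have "int m dvd x * int c" using d(1) by simp
    then have "m dvd c" using x by (metis coprime_commute coprime_dvd_mult_right_iff int_dvd_int_iff)
    then show False using two_fibres_nat[of m b c n s] 2 lt s m by simp
  qed
qed

lemma eq_of_dvd_diff:
  assumes "int m dvd int a - int c" "a < m" "c < m"
  shows "a = c"
proof -
  have "int a mod int m = int c mod int m" using assms(1) by (simp add: mod_eq_dvd_iff)
  then show ?thesis using assms(2,3) by simp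
qed

text \<open>The multiplicities of u and -u + v agree modulo m and are below m, so they are equal and
  the contributions of u cancel exactly. This is why a generating pair suffices for (1b).\<close>

lemma free_1b:
  assumes m: "m \<ge> 2" and n: "n \<ge> 1" and R: "rank2_pair m (m * n) u v"
  shows "\<nexists>T. T \<subseteq># lat_1b m n u v \<and> zs_short (lat m (m * n)) (m * n) T"
proof
  assume "\<exists>T. T \<subseteq># lat_1b m n u v \<and> zs_short (lat m (m * n)) (m * n) T"
  then obtain T where T: "T \<subseteq># lat_1b m n u v" "size T \<in> {1..m * n}" "\<Sum>\<^sub># T \<in> lat m (m * n)"
    by (auto simp: zs_short_def)
  obtain a b c where abc: "a \<le> m - 1" "b \<le> m * n - 1" "c \<le> m - 1" "size T = a + b + c"
    "\<Sum>\<^sub># T = sm (int a) u + sm (int b) v + sm (int c) (- u + v)"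
    using T(1) unfolding lat_1b_def by (rule sub_replicate3)
  have mn: "m * 1 \<le> m * n" using n by (intro mult_le_mono2)
  have z: "sm (int a - int c) u + sm (int b + int c) v \<in> lat m (m * n)"
    using T(3) unfolding abc(5) by (rule lat_eqI) (simp add: sm_simps algebra_simps)
  then have "int m dvd int a - int c" using R unfolding rank2_pair_def by blast
  then have ac: "a = c" using abc(1,3) m by (intro eq_of_dvd_diff) auto
  then have "sm (int b + int c) v \<in> lat m (m * n)" using z by (simp add: sm_simps(7))
  then have d: "int (m * n) dvd int b + int c" using R unfolding rank2_pair_def by blast
  have "b + c < 2 * (m * n)" using abc(2,3) mn m by linarith
  from zero_or_full[OF d this] show False using ac abc T(2) m mn by auto
qed

lemma sub_replicate4:
  assumes "T \<subseteq># replicate_mset k0 g + replicate_mset k1 (x1 + g) + replicate_mset k2 (x2 + g) + replicate_mset k3 (x3 + g)"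
    and "size T = l" "sm (int l) g \<in> L" "\<Sum>\<^sub># T \<in> L" and L: "L = lat m k"
  obtains z a b c where "z \<le> k0" "a \<le> k1" "b \<le> k2" "c \<le> k3" "l = z + a + b + c"
    "sm (int a) x1 + sm (int b) x2 + sm (int c) x3 \<in> L"
proof -
  have "T \<subseteq># replicate_mset k0 g + (replicate_mset k1 (x1 + g) + replicate_mset k2 (x2 + g) + replicate_mset k3 (x3 + g))"
    using assms(1) by (simp only: add.assoc)
  then obtain T0 T' where T: "T0 \<subseteq># replicate_mset k0 g"
    "T' \<subseteq># replicate_mset k1 (x1 + g) + replicate_mset k2 (x2 + g) + replicate_mset k3 (x3 + g)" "T = T0 + T'"
    by (rule submset_plusE)
  obtain a b c where abc: "a \<le> k1" "b \<le> k2" "c \<le> k3" "size T' = a + b + c"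
    "\<Sum>\<^sub># T' = sm (int a) (x1 + g) + sm (int b) (x2 + g) + sm (int c) (x3 + g)"
    using T(2) by (rule sub_replicate3)
  have T0: "\<Sum>\<^sub># T0 = sm (int (size T0)) g" using sub_replicate(1)[OF T(1)] sum_mset_replicate by metis
  have l: "l = size T0 + a + b + c" using assms(2) T(3) abc(4) by simp
  have "\<Sum>\<^sub># T - sm (int l) g \<in> lat m k" using assms(3,4) L lat_diff by blast
  then have "sm (int a) x1 + sm (int b) x2 + sm (int c) x3 \<in> lat m k"
    by (rule lat_eqI) (simp add: T(3) T0 abc(5) l sm_simps algebra_simps)
  then show thesis using that[of "size T0" a b c] sub_replicate(2)[OF T(1)] abc(1-3) l L by blast
qed

text \<open>As for (1a), except that b + c = 0 leaves a sequence in the first two fibres;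
  \<open>two_fibres_nat\<close> then applies to these with t.\<close>

lemma free_2a:
  assumes m: "m \<ge> 2" and R: "\<And>i j. sm i u + sm j v \<in> lat m (m * n) \<Longrightarrow> int m dvd i \<and> int (m * n) dvd j"
    and x: "coprime x (int m)" and s: "s \<in> {1..n}" and t: "t \<in> {1..n}"
  shows "\<nexists>T. T \<subseteq># lat_2a m n u v x s t g \<and> zs_len (lat m (m * n)) (m * n) T"
proof
  assume "\<exists>T. T \<subseteq># lat_2a m n u v x s t g \<and> zs_len (lat m (m * n)) (m * n) T"
  then obtain T where T: "T \<subseteq># lat_2a m n u v x s t g" "size T = m * n" "\<Sum>\<^sub># T \<in> lat m (m * n)"
    by (auto simp: zs_len_def)
  obtain z a b c where abc: "z \<le> t * m - 1" "a \<le> (n + 1 - t) * m - 1" "b \<le> s * m - 1" "c \<le> (n + 1 - s) * m - 1"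
    "m * n = z + a + b + c" "sm (int a) u + sm (int b) v + sm (int c) (sm (- x) u + v) \<in> lat m (m * n)"
    by (rule sub_replicate4[OF T(1)[unfolded lat_2a_def] T(2) lat_multiple_exp T(3) refl])
  have "sm (int a - x * int c) u + sm (int b + int c) v \<in> lat m (m * n)"
    by (rule lat_eqI[OF abc(6)]) (simp add: sm_simps algebra_simps)
  then have d: "int m dvd int a - x * int c" "int (m * n) dvd int b + int c" using R by blast+
  have lt: "b < s * m" "c < (n + 1 - s) * m" "z < t * m" "a < (n + 1 - t) * m"
    using abc(1-4) mult_split[OF s, of m] mult_split[OF t, of m] m by linarith+
  from zero_or_full[OF d(2) fibre_bound[OF _ s lt(1,2)]] m consider "b + c = 0" | "b + c = m * n" by auto
  then show False
  proof cases
    case 1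
    then have "m dvd a" using d(1) by simp
    then show False using two_fibres_nat[of m z a n t] 1 lt t m abc(5) by simp
  next
    case 2
    then have "a = 0" using abc(5) by simp
    then have "int m dvd x * int c" using d(1) by simp
    then have "m dvd c" using x by (metis coprime_commute coprime_dvd_mult_right_iff int_dvd_int_iff)
    then show False using two_fibres_nat[of m b c n s] 2 lt s m by simp
  qed
qed

lemma free_2b:
  assumes m: "m \<ge> 2" and n: "n \<ge> 1" and R: "rank2_pair m (m * n) u v"
  shows "\<nexists>T. T \<subseteq># lat_2b m n u v g \<and> zs_len (lat m (m * n)) (m * n) T"
proof
  assume "\<exists>T. T \<subseteq># lat_2b m n u v g \<and> zs_len (lat m (m * n)) (m * n) T"
  then obtain T where T: "T \<subseteq># lat_2b m n u v g" "size T = m * n" "\<Sum>\<^sub># T \<in> lat m (m * n)"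
    by (auto simp: zs_len_def)
  obtain z a b c where abc: "z \<le> m * n - 1" "a \<le> m - 1" "b \<le> m * n - 1" "c \<le> m - 1" "m * n = z + a + b + c"
    "sm (int a) u + sm (int b) v + sm (int c) (- u + v) \<in> lat m (m * n)"
    by (rule sub_replicate4[OF T(1)[unfolded lat_2b_def] T(2) lat_multiple_exp T(3) refl])
  have mn: "m * 1 \<le> m * n" using n by (intro mult_le_mono2)
  have z: "sm (int a - int c) u + sm (int b + int c) v \<in> lat m (m * n)"
    by (rule lat_eqI[OF abc(6)]) (simp add: sm_simps algebra_simps)
  then have "int m dvd int a - int c" using R unfolding rank2_pair_def by blast
  then have ac: "a = c" using abc(2,4) m by (intro eq_of_dvd_diff) auto
  then have "sm (int b + int c) v \<in> lat m (m * n)" using z by (simp add: sm_simps(7))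
  then have d: "int (m * n) dvd int b + int c" using R unfolding rank2_pair_def by blast
  have "b + c < 2 * (m * n)" using abc(3,4) mn m by linarith
  from zero_or_full[OF d this] show False using ac abc(1-5) m mn by auto
qed

section \<open>Constants, properties and extremal sequences in the group\<close>

context presented
begin

lemma image_near: "near m (m * n) g l A \<Longrightarrow> image_mset pi A = replicate_mset l (pi g)"
  unfolding near_def using image_mset_const_on[of A pi "pi g"] pi_eq_iff by auto

lemma image_lat_1a: "image_mset pi (lat_1a m n u v x s) = seq_1a G m n (pi u) (pi v) x s"
  by (simp add: lat_1a_def seq_1a_def pi_add pi_sm)

lemma image_lat_1b: "image_mset pi (lat_1b m n u v) = seq_1b G m n (pi u) (pi v)"
  by (simp add: lat_1b_def seq_1b_def pi_add pi_minus del: uminus_add_conv_diff)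

lemma image_lat_2a: "image_mset pi (lat_2a m n u v x s t g) = seq_2a G m n (pi u) (pi v) x s t (pi g)"
  by (simp add: lat_2a_def seq_2a_def pi_add pi_sm)

lemma image_lat_2b: "image_mset pi (lat_2b m n u v g) = seq_2b G m n (pi u) (pi v) (pi g)"
  by (simp add: lat_2b_def seq_2b_def pi_add pi_minus del: uminus_add_conv_diff)

lemma standard_basis: "sm i (1, 0) + sm j (0, 1) \<in> N \<Longrightarrow> int m dvd i \<and> int (m * n) dvd j"
  by (simp add: lat_def sm_def)

text \<open>The lower bound is witnessed by (1a) on the standard basis with x = s = 1.\<close>

lemma eta_const_eq: "eta_const G = m * n + 2 * m - 2"
  unfolding eta_const_def
proof (rule Least_equality)
  show "1 \<le> m * n + 2 * m - 2 \<and> (\<forall>S. seq_over G S \<and> m * n + 2 * m - 2 \<le> size S \<longrightarrow> has_short_zero_sum G S)"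
  proof (intro conjI allI impI)
    show "1 \<le> m * n + 2 * m - 2" using m mn_pos by linarith
    fix S assume S: "seq_over G S \<and> m * n + 2 * m - 2 \<le> size S"
    then obtain X where X: "image_mset pi X = S" using seq_over_lift by blast
    then have "size X \<ge> m * n + 2 * m - 2" using S by auto
    moreover have "forces (zs_short N (m * n)) (m * n + 2 * m - 2)" by (rule eta_rank2) (use m n in auto)
    ultimately show "has_short_zero_sum G S" using forcesD has_short_image X by blast
  qed
next
  fix l assume l: "1 \<le> l \<and> (\<forall>S. seq_over G S \<and> l \<le> size S \<longrightarrow> has_short_zero_sum G S)"
  let ?X = "lat_1a m n (1, 0) (0, 1) 1 1"
  have "\<nexists>T. T \<subseteq># ?X \<and> zs_short N (m * n) T"
    by (rule free_1a[OF m standard_basis]) (use n in auto)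
  then have "\<not> has_short_zero_sum G (image_mset pi ?X)" by (simp add: has_short_image)
  moreover have "size (image_mset pi ?X) = m * n + 2 * m - 3" using size_lat_1a[of m 1 n] m n by simp
  ultimately have "\<not> l \<le> m * n + 2 * m - 3" using l seq_over_image by metis
  then show "m * n + 2 * m - 2 \<le> l" by linarith
qed

lemma s_const_eq: "s_const G = 2 * (m * n) + 2 * m - 3"
  unfolding s_const_def
proof (rule Least_equality)
  show "1 \<le> 2 * (m * n) + 2 * m - 3 \<and> (\<forall>S. seq_over G S \<and> 2 * (m * n) + 2 * m - 3 \<le> size S \<longrightarrow> has_exp_zero_sum G S)"
  proof (intro conjI allI impI)
    show "1 \<le> 2 * (m * n) + 2 * m - 3" using m mn_pos by linarith
    fix S assume S: "seq_over G S \<and> 2 * (m * n) + 2 * m - 3 \<le> size S"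
    then obtain X where X: "image_mset pi X = S" using seq_over_lift by blast
    then have "size X \<ge> 2 * (m * n) + 2 * m - 3" using S by auto
    moreover have "forces (zs_len N (m * n)) (2 * (m * n) + 2 * m - 3)" by (rule s_rank2) (use m n in auto)
    ultimately show "has_exp_zero_sum G S" using forcesD has_exp_image X by blast
  qed
next
  fix l assume l: "1 \<le> l \<and> (\<forall>S. seq_over G S \<and> l \<le> size S \<longrightarrow> has_exp_zero_sum G S)"
  let ?X = "lat_2a m n (1, 0) (0, 1) 1 1 1 0"
  have "\<nexists>T. T \<subseteq># ?X \<and> zs_len N (m * n) T"
    by (rule free_2a[OF m standard_basis]) (use n in auto)
  then have "\<not> has_exp_zero_sum G (image_mset pi ?X)" by (simp add: has_exp_image)
  moreover have "size (image_mset pi ?X) = 2 * (m * n) + 2 * m - 4" using size_lat_2a[of m 1 n 1] m n by simp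
  ultimately have "\<not> l \<le> 2 * (m * n) + 2 * m - 4" using l seq_over_image by metis
  then show "2 * (m * n) + 2 * m - 3 \<le> l" by linarith
qed

lemma image_repeat_mset: "image_mset f (repeat_mset k T) = repeat_mset k (image_mset f T)"
  by (induction k) (simp_all add: repeat_mset_Suc)

text \<open>For n = 1 the kernel of \<open>pi\<close> is \<open>lat m m\<close>. Through
  \<open>r\<close> the sequence of group elements supplied by Property C or D becomes the multiset
  of residues required by \<open>lattice_C\<close> or \<open>lattice_D\<close>.\<close>

lemma res_factor:
  assumes "n = 1"
  obtains r where "\<And>x. res m x = r (pi x)"
proof -
  have "res m x = res m (SOME v. pi v = pi x)" for x
  proof -
    have "pi (SOME v. pi v = pi x) = pi x" by (rule someI[of _ x]) simp
    then have "x - (SOME v. pi v = pi x) \<in> N" by (simp only: pi_eq_iff[symmetric])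
    then show ?thesis using assms by (simp add: res_eq_iff)
  qed
  then show thesis using that[of "\<lambda>g. res m (SOME v. pi v = g)"] by blast
qed

lemma lattice_C_of_property:
  assumes n1: "n = 1" and C: "property_C G"
  shows "lattice_C m"
  unfolding lattice_C_def
proof (intro allI impI)
  fix X assume X: "size X = 3 * (m - 1)" "\<nexists>B. B \<subseteq># X \<and> zs_short (lat m m) m B"
  have "size (image_mset pi X) = eta_const G - 1" using X(1) m n1 by (simp add: eta_const_eq)
  moreover have "\<not> has_short_zero_sum G (image_mset pi X)" using X(2) n1 by (simp add: has_short_image)
  ultimately have "\<exists>T. seq_over G T \<and> image_mset pi X = repeat_mset (group_exp G - 1) T"
    using mp[OF spec[OF C[unfolded property_C_def], of "image_mset pi X"]] seq_over_image[of X] by blast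
  then obtain T where "image_mset pi X = repeat_mset (group_exp G - 1) T" by (elim exE conjE)
  then have T: "image_mset pi X = repeat_mset (m - 1) T" by (simp only: group_exp_eq n1 mult_1_right)
  obtain r where r: "\<And>x. res m x = r (pi x)" using res_factor[OF n1] by blast
  have "image_mset (res m) X = image_mset r (image_mset pi X)" by (simp add: multiset.map_comp comp_def flip: r)
  then have "image_mset (res m) X = repeat_mset (m - 1) (image_mset r T)" unfolding T image_repeat_mset .
  then show "\<exists>T. image_mset (res m) X = repeat_mset (m - 1) T" by blast
qed

lemma lattice_D_of_property:
  assumes n1: "n = 1" and D: "property_D G"
  shows "lattice_D m"
  unfolding lattice_D_def
proof (intro allI impI)
  fix X assume X: "size X = 4 * (m - 1)" "\<nexists>B. B \<subseteq># X \<and> zs_len (lat m m) m B"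
  have "size (image_mset pi X) = s_const G - 1" using X(1) m n1 by (simp add: s_const_eq)
  moreover have "\<not> has_exp_zero_sum G (image_mset pi X)" using X(2) n1 by (simp add: has_exp_image)
  ultimately have "\<exists>T. seq_over G T \<and> image_mset pi X = repeat_mset (group_exp G - 1) T"
    using mp[OF spec[OF D[unfolded property_D_def], of "image_mset pi X"]] seq_over_image[of X] by blast
  then obtain T where "image_mset pi X = repeat_mset (group_exp G - 1) T" by (elim exE conjE)
  then have T: "image_mset pi X = repeat_mset (m - 1) T" by (simp only: group_exp_eq n1 mult_1_right)
  obtain r where r: "\<And>x. res m x = r (pi x)" using res_factor[OF n1] by blast
  have "image_mset (res m) X = image_mset r (image_mset pi X)" by (simp add: multiset.map_comp comp_def flip: r)
  then have "image_mset (res m) X = repeat_mset (m - 1) (image_mset r T)" unfolding T image_repeat_mset .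
  then show "\<exists>T. image_mset (res m) X = repeat_mset (m - 1) T" by blast
qed

lemma eta_const_diff: "eta_const G - 1 = m * n + 2 * m - 3"
  unfolding eta_const_eq by simp

lemma s_const_diff: "s_const G - 1 = 2 * (m * n) + 2 * m - 4"
  unfolding s_const_eq by simp

lemma generating_pair_lift:
  assumes "generating_set G {g1, g2}"
  obtains u v where "pi u = g1" "pi v = g2"
proof -
  have "g1 \<in> carrier G" "g2 \<in> carrier G" using assms by (simp_all add: generating_set_def)
  then obtain u v where "pi u = g1" "pi v = g2" using pi_surj by blast
  then show thesis by (rule that)
qed

lemma seq_1a_correct:
  assumes B: "basis_of G {e1, e2}" and o: "ord e2 = m * n" and x: "gcd x (int m) = 1" and s: "s \<in> {1..n}"
  shows "seq_over G (seq_1a G m n e1 e2 x s)" "size (seq_1a G m n e1 e2 x s) = eta_const G - 1"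
    "\<not> has_short_zero_sum G (seq_1a G m n e1 e2 x s)"
proof -
  have "generating_set G {e1, e2}" using B by (simp add: basis_of_def)
  then obtain u v where uv: "pi u = e1" "pi v = e2" by (rule generating_pair_lift)
  have seq: "seq_1a G m n e1 e2 x s = image_mset pi (lat_1a m n u v x s)"
    using uv by (simp add: image_lat_1a)
  have R: "int m dvd i \<and> int (m * n) dvd j" if ij: "sm i u + sm j v \<in> N" for i j
    by (rule basis_rank2[OF _ _ ij]) (use B o uv in simp_all)
  show "seq_over G (seq_1a G m n e1 e2 x s)" unfolding seq by (rule seq_over_image)
  show "size (seq_1a G m n e1 e2 x s) = eta_const G - 1"
    unfolding seq size_image_mset eta_const_diff by (rule size_lat_1a[OF m s])
  show "\<not> has_short_zero_sum G (seq_1a G m n e1 e2 x s)"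
    unfolding seq has_short_image by (rule free_1a[OF m R gcd_eq_1_imp_coprime[OF x] s])
qed

lemma seq_1b_correct:
  assumes B: "generating_set G {g1, g2}" and o: "ord g2 = m * n"
  shows "seq_over G (seq_1b G m n g1 g2)" "size (seq_1b G m n g1 g2) = eta_const G - 1"
    "\<not> has_short_zero_sum G (seq_1b G m n g1 g2)"
proof -
  obtain u v where uv: "pi u = g1" "pi v = g2" using B by (rule generating_pair_lift)
  have seq: "seq_1b G m n g1 g2 = image_mset pi (lat_1b m n u v)"
    using uv by (simp add: image_lat_1b)
  have R: "rank2_pair m (m * n) u v" by (rule rank2_pair_of_generating) (use B o uv in simp_all)
  show "seq_over G (seq_1b G m n g1 g2)" unfolding seq by (rule seq_over_image)
  show "size (seq_1b G m n g1 g2) = eta_const G - 1"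
    unfolding seq size_image_mset eta_const_diff by (rule size_lat_1b[OF m n])
  show "\<not> has_short_zero_sum G (seq_1b G m n g1 g2)"
    unfolding seq has_short_image by (rule free_1b[OF m n R])
qed

lemma seq_2a_correct:
  assumes B: "basis_of G {e1, e2}" and o: "ord e2 = m * n" and x: "gcd x (int m) = 1" and s: "s \<in> {1..n}"
    and t: "t \<in> {1..n}" and g: "g \<in> carrier G"
  shows "seq_over G (seq_2a G m n e1 e2 x s t g)" "size (seq_2a G m n e1 e2 x s t g) = s_const G - 1"
    "\<not> has_exp_zero_sum G (seq_2a G m n e1 e2 x s t g)"
proof -
  have "generating_set G {e1, e2}" using B by (simp add: basis_of_def)
  then obtain u v where uv: "pi u = e1" "pi v = e2" by (rule generating_pair_lift)
  obtain w where w: "pi w = g" using pi_surj[OF g] by blast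
  have seq: "seq_2a G m n e1 e2 x s t g = image_mset pi (lat_2a m n u v x s t w)"
    using uv w by (simp add: image_lat_2a)
  have R: "int m dvd i \<and> int (m * n) dvd j" if ij: "sm i u + sm j v \<in> N" for i j
    by (rule basis_rank2[OF _ _ ij]) (use B o uv in simp_all)
  show "seq_over G (seq_2a G m n e1 e2 x s t g)" unfolding seq by (rule seq_over_image)
  show "size (seq_2a G m n e1 e2 x s t g) = s_const G - 1"
    unfolding seq size_image_mset s_const_diff by (rule size_lat_2a[OF m s t])
  show "\<not> has_exp_zero_sum G (seq_2a G m n e1 e2 x s t g)"
    unfolding seq has_exp_image by (rule free_2a[OF m R gcd_eq_1_imp_coprime[OF x] s t])
qed

lemma seq_2b_correct:
  assumes B: "generating_set G {g1, g2}" and o: "ord g2 = m * n" and g: "g \<in> carrier G"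
  shows "seq_over G (seq_2b G m n g1 g2 g)" "size (seq_2b G m n g1 g2 g) = s_const G - 1"
    "\<not> has_exp_zero_sum G (seq_2b G m n g1 g2 g)"
proof -
  obtain u v where uv: "pi u = g1" "pi v = g2" using B by (rule generating_pair_lift)
  obtain w where w: "pi w = g" using pi_surj[OF g] by blast
  have seq: "seq_2b G m n g1 g2 g = image_mset pi (lat_2b m n u v w)"
    using uv w by (simp add: image_lat_2b)
  have R: "rank2_pair m (m * n) u v" by (rule rank2_pair_of_generating) (use B o uv in simp_all)
  show "seq_over G (seq_2b G m n g1 g2 g)" unfolding seq by (rule seq_over_image)
  show "size (seq_2b G m n g1 g2 g) = s_const G - 1"
    unfolding seq size_image_mset s_const_diff by (rule size_lat_2b[OF m n])
  show "\<not> has_exp_zero_sum G (seq_2b G m n g1 g2 g)"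
    unfolding seq has_exp_image by (rule free_2b[OF m n R])
qed

lemma inverse_short:
  assumes C: "lattice_C m" and S: "seq_over G S" and sz: "size S = eta_const G - 1"
    and no: "\<not> has_short_zero_sum G S"
  shows "(\<exists>e1 e2 x s. basis_of G {e1, e2} \<and> ord e2 = m * n \<and> gcd x (int m) = 1 \<and> s \<in> {1..n} \<and>
      S = seq_1a G m n e1 e2 x s) \<or>
    (\<exists>g1 g2. generating_set G {g1, g2} \<and> ord g2 = m * n \<and> S = seq_1b G m n g1 g2)"
proof -
  obtain X where X: "image_mset pi X = S" using S by (rule seq_over_lift)
  have "size X = m * n + 2 * m - 3" using sz unfolding X[symmetric] size_image_mset eta_const_diff .
  moreover have "\<nexists>T. T \<subseteq># X \<and> zs_short N (m * n) T" using no unfolding X[symmetric] has_short_image .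
  ultimately have "form_1a m n X \<or> form_1b m n X" by (rule inverse_eta[OF m n C])
  then show ?thesis
  proof
    assume "form_1a m n X"
    then obtain e1 e2 x s A1 A2 A3 where *: "X = A1 + A2 + A3" "s \<in> {1..n}" "coprime x (int m)"
      "rank2_pair m (m * n) e1 e2" "sm (int m) e1 \<in> N" "near m (m * n) e1 (m - 1) A1"
      "near m (m * n) e2 (s * m - 1) A2" "near m (m * n) (sm (- x) e1 + e2) ((n + 1 - s) * m - 1) A3"
      unfolding form_1a_def by (elim exE conjE)
    have "S = seq_1a G m n (pi e1) (pi e2) x s"
      unfolding X[symmetric] *(1) seq_1a_def image_mset_union image_near[OF *(6)] image_near[OF *(7)]
        image_near[OF *(8)] pi_add pi_sm ..
    then show ?thesis
      using basis_of_rank2_pair[OF *(4,5)] generating_of_rank2_pair(2)[OF *(4)] *(2,3)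
      by (intro disjI1 exI conjI) (auto simp: coprime_iff_gcd_eq_1)
  next
    assume "form_1b m n X"
    then obtain g1 g2 A1 A2 A3 where *: "X = A1 + A2 + A3" "rank2_pair m (m * n) g1 g2"
      "near m (m * n) g1 (m - 1) A1" "near m (m * n) g2 (m * n - 1) A2" "near m (m * n) (- g1 + g2) (m - 1) A3"
      unfolding form_1b_def by (elim exE conjE)
    have "S = seq_1b G m n (pi g1) (pi g2)"
      unfolding X[symmetric] *(1) seq_1b_def image_mset_union image_near[OF *(3)] image_near[OF *(4)]
        image_near[OF *(5)] pi_add pi_minus ..
    then show ?thesis
      using generating_of_rank2_pair(1,2)[OF *(2)] by (intro disjI2 exI conjI)
  qed
qed

lemma inverse_exp:
  assumes D: "lattice_D m" and S: "seq_over G S" and sz: "size S = s_const G - 1"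
    and no: "\<not> has_exp_zero_sum G S"
  shows "(\<exists>e1 e2 x s t g. basis_of G {e1, e2} \<and> ord e2 = m * n \<and> gcd x (int m) = 1 \<and> s \<in> {1..n} \<and>
      t \<in> {1..n} \<and> g \<in> carrier G \<and> S = seq_2a G m n e1 e2 x s t g) \<or>
    (\<exists>g1 g2 g. generating_set G {g1, g2} \<and> ord g2 = m * n \<and> g \<in> carrier G \<and> S = seq_2b G m n g1 g2 g)"
proof -
  obtain X where X: "image_mset pi X = S" using S by (rule seq_over_lift)
  have "size X = 2 * (m * n) + 2 * m - 4" using sz unfolding X[symmetric] size_image_mset s_const_diff .
  moreover have "\<nexists>T. T \<subseteq># X \<and> zs_len N (m * n) T" using no unfolding X[symmetric] has_exp_image .
  ultimately have "form_2a m n X \<or> form_2b m n X" by (rule inverse_s[OF m n D])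
  then show ?thesis
  proof
    assume "form_2a m n X"
    then obtain g e1 e2 x s t A0 A1 A2 A3 where *: "X = A0 + A1 + A2 + A3" "s \<in> {1..n}" "t \<in> {1..n}"
      "coprime x (int m)" "rank2_pair m (m * n) e1 e2" "sm (int m) e1 \<in> N"
      "near m (m * n) g (t * m - 1) A0" "near m (m * n) (e1 + g) ((n + 1 - t) * m - 1) A1"
      "near m (m * n) (e2 + g) (s * m - 1) A2" "near m (m * n) (sm (- x) e1 + e2 + g) ((n + 1 - s) * m - 1) A3"
      unfolding form_2a_def by (elim exE conjE)
    have "S = seq_2a G m n (pi e1) (pi e2) x s t (pi g)"
      unfolding X[symmetric] *(1) seq_2a_def image_mset_union image_near[OF *(7)] image_near[OF *(8)]
        image_near[OF *(9)] image_near[OF *(10)] pi_add pi_sm ..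
    then show ?thesis
      using basis_of_rank2_pair[OF *(5,6)] generating_of_rank2_pair(2)[OF *(5)] *(2,3,4)
      by (intro disjI1 exI conjI) (auto simp: coprime_iff_gcd_eq_1)
  next
    assume "form_2b m n X"
    then obtain g g1 g2 A0 A1 A2 A3 where *: "X = A0 + A1 + A2 + A3" "rank2_pair m (m * n) g1 g2"
      "near m (m * n) g (m * n - 1) A0" "near m (m * n) (g1 + g) (m - 1) A1"
      "near m (m * n) (g2 + g) (m * n - 1) A2" "near m (m * n) (- g1 + g2 + g) (m - 1) A3"
      unfolding form_2b_def by (elim exE conjE)
    have "S = seq_2b G m n (pi g1) (pi g2) (pi g)"
      unfolding X[symmetric] *(1) seq_2b_def image_mset_union image_near[OF *(3)] image_near[OF *(4)]
        image_near[OF *(5)] image_near[OF *(6)] pi_add pi_minus ..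
    then show ?thesis
      using generating_of_rank2_pair(1,2)[OF *(2)] pi_closed[of g] by (intro disjI2 exI conjI)
  qed
qed

end

text \<open>Reduction of the two coordinates modulo m and m n, followed by the inverse of the given
  isomorphism.\<close>

lemma presentation_exists:
  fixes G :: "('a, 'b) monoid_scheme"
  assumes G: "comm_group G" and m: "m \<ge> 2" and n: "n \<ge> 1"
    and iso: "G \<cong> integer_mod_group m \<times>\<times> integer_mod_group (m * n)"
  shows "\<exists>pi. presented G pi m n"
proof -
  interpret comm_group G by (rule G)
  let ?Z = "integer_mod_group m \<times>\<times> integer_mod_group (m * n)"
  interpret Z: group ?Z by (intro DirProd_group) auto
  obtain h where "h \<in> iso G ?Z" using iso unfolding is_iso_def by blast
  then have "inv_into (carrier G) h \<in> iso ?Z G" by (rule iso_set_sym)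
  then obtain f where f: "f \<in> hom ?Z G" "bij_betw f (carrier ?Z) (carrier G)" unfolding iso_def by blast
  have mn: "int (m * n) > 0" "int m > 0" using m n by auto
  define pi where "pi v = f (fst v mod int m, snd v mod int (m * n))" for v :: "int \<times> int"
  have inZ: "(fst v mod int m, snd v mod int (m * n)) \<in> carrier ?Z" for v
    using mn m n by (simp add: carrier_integer_mod_group del: of_nat_mult)
  have one: "f (0, 0) = \<one>\<^bsub>G\<^esub>" using hom_one[OF f(1) Z.is_group is_group] by simp
  have "presented G pi m n"
  proof
    show "pi v \<in> carrier G" for v unfolding pi_def using hom_in_carrier[OF f(1) inZ] .
    show "pi (u + v) = pi u \<otimes>\<^bsub>G\<^esub> pi v" for u v
    proof -
      have "pi u \<otimes>\<^bsub>G\<^esub> pi v = f ((fst u mod int m, snd u mod int (m * n)) \<otimes>\<^bsub>?Z\<^esub> (fst v mod int m, snd v mod int (m * n)))"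
        unfolding pi_def by (rule hom_mult[OF f(1) inZ inZ, symmetric])
      also have "\<dots> = pi (u + v)" unfolding pi_def by (simp add: mod_add_eq del: of_nat_mult)
      finally show ?thesis by simp
    qed
    show "pi v = \<one>\<^bsub>G\<^esub> \<longleftrightarrow> v \<in> lat m (m * n)" for v
    proof -
      have "(0, 0) \<in> carrier ?Z" using Z.one_closed by simp
      then have "pi v = f (0, 0) \<longleftrightarrow> (fst v mod int m, snd v mod int (m * n)) = (0, 0)"
        unfolding pi_def using f(2) inZ by (intro inj_on_eq_iff[of f "carrier ?Z"]) (auto simp: bij_betw_def)
      then show ?thesis unfolding one by (simp add: lat_def dvd_eq_mod_eq_0 del: of_nat_mult)
    qed
    show "\<exists>v. pi v = g" if "g \<in> carrier G" for g
    proof -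
      have "g \<in> f ` carrier ?Z" using f(2) that by (simp only: bij_betw_def)
      then obtain z where z: "z \<in> carrier ?Z" "f z = g" by blast
      then have "pi z = g" using mn m n unfolding pi_def
        by (auto simp: carrier_integer_mod_group simp del: of_nat_mult)
      then show ?thesis by blast
    qed
  qed (use m n in auto)
  then show ?thesis by blast
qed

lemma integer_mod_square: "m \<ge> 2 \<Longrightarrow> \<exists>pi. presented (integer_mod_group m \<times>\<times> integer_mod_group m) pi m 1"
proof (rule presentation_exists)
  let ?Q = "integer_mod_group m \<times>\<times> integer_mod_group m"
  interpret Q: group ?Q by (intro DirProd_group) auto
  show "comm_group ?Q"
  proof (rule Q.group_comm_groupI)
    show "p \<otimes>\<^bsub>?Q\<^esub> q = q \<otimes>\<^bsub>?Q\<^esub> p" for p q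
      by (cases p; cases q) (simp add: add.commute)
  qed
  show "?Q \<cong> integer_mod_group m \<times>\<times> integer_mod_group (m * 1)"
    unfolding mult_1_right by (rule iso_refl)
qed auto

theorem theorem3p1:
  fixes G :: "('a, 'b) monoid_scheme" and m n :: nat
  assumes "comm_group G" and "finite (carrier G)"
    and "m \<ge> 2" and "n \<ge> 1"
    and "G \<cong> integer_mod_group m \<times>\<times> integer_mod_group (m * n)"
  shows
    "(\<forall>e1 e2 x s.
        basis_of G {e1, e2} \<and> group.ord G e2 = m * n \<and> gcd x (int m) = 1 \<and> s \<in> {1..n} \<longrightarrow>
        seq_over G (seq_1a G m n e1 e2 x s) \<and>
        size (seq_1a G m n e1 e2 x s) = eta_const G - 1 \<and>
        \<not> has_short_zero_sum G (seq_1a G m n e1 e2 x s))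
   \<and> (\<forall>g1 g2.
        generating_set G {g1, g2} \<and> group.ord G g2 = m * n \<longrightarrow>
        seq_over G (seq_1b G m n g1 g2) \<and>
        size (seq_1b G m n g1 g2) = eta_const G - 1 \<and>
        \<not> has_short_zero_sum G (seq_1b G m n g1 g2))
   \<and> (property_C (integer_mod_group m \<times>\<times> integer_mod_group m) \<longrightarrow>
        (\<forall>S. seq_over G S \<and> size S = eta_const G - 1 \<and> \<not> has_short_zero_sum G S \<longrightarrow>
           (\<exists>e1 e2 x s. basis_of G {e1, e2} \<and> group.ord G e2 = m * n \<and>
              gcd x (int m) = 1 \<and> s \<in> {1..n} \<and> S = seq_1a G m n e1 e2 x s) \<or>
           (\<exists>g1 g2. generating_set G {g1, g2} \<and> group.ord G g2 = m * n \<and>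
              S = seq_1b G m n g1 g2)))
   \<and> (\<forall>e1 e2 x s t g.
        basis_of G {e1, e2} \<and> group.ord G e2 = m * n \<and> gcd x (int m) = 1 \<and>
        s \<in> {1..n} \<and> t \<in> {1..n} \<and> g \<in> carrier G \<longrightarrow>
        seq_over G (seq_2a G m n e1 e2 x s t g) \<and>
        size (seq_2a G m n e1 e2 x s t g) = s_const G - 1 \<and>
        \<not> has_exp_zero_sum G (seq_2a G m n e1 e2 x s t g))
   \<and> (\<forall>g1 g2 g.
        generating_set G {g1, g2} \<and> group.ord G g2 = m * n \<and> g \<in> carrier G \<longrightarrow>
        seq_over G (seq_2b G m n g1 g2 g) \<and>
        size (seq_2b G m n g1 g2 g) = s_const G - 1 \<and>
        \<not> has_exp_zero_sum G (seq_2b G m n g1 g2 g))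
   \<and> (property_D (integer_mod_group m \<times>\<times> integer_mod_group m) \<longrightarrow>
        (\<forall>S. seq_over G S \<and> size S = s_const G - 1 \<and> \<not> has_exp_zero_sum G S \<longrightarrow>
           (\<exists>e1 e2 x s t g. basis_of G {e1, e2} \<and> group.ord G e2 = m * n \<and>
              gcd x (int m) = 1 \<and> s \<in> {1..n} \<and> t \<in> {1..n} \<and> g \<in> carrier G \<and>
              S = seq_2a G m n e1 e2 x s t g) \<or>
           (\<exists>g1 g2 g. generating_set G {g1, g2} \<and> group.ord G g2 = m * n \<and> g \<in> carrier G \<and>
              S = seq_2b G m n g1 g2 g)))"
proof -
  obtain pi where "presented G pi m n" using presentation_exists[OF assms(1,3,4,5)] by blast
  then interpret presented G pi m n .
  obtain piQ where "presented (integer_mod_group m \<times>\<times> integer_mod_group m) piQ m 1"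
    using integer_mod_square[OF assms(3)] by blast
  then interpret Q: presented "integer_mod_group m \<times>\<times> integer_mod_group m" piQ m 1 .
  note clauses = seq_1a_correct seq_1b_correct inverse_short[OF Q.lattice_C_of_property[OF refl]]
    seq_2a_correct seq_2b_correct inverse_exp[OF Q.lattice_D_of_property[OF refl]]
  show ?thesis
    by (intro conjI allI impI; (elim conjE)?; (rule clauses; assumption))
qed

end
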